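(* Let $(J,\rho)\in\mathcal J_G$ and, for $\nu\in X({}^\natural J/J)$, let $({}^\natural J,{}^\natural\rho\otimes\nu)$ be the pair defined in the context. We have an isomorphism of $\mathbb C$-algebras $$\mathcal H(G,\rho)\simeq\bigoplus_{\nu\in X({}^\natural J/J)}\mathcal H(G,{}^\natural\rho\otimes\nu).$$
   Context: Setting: $F$ is a non-archimedean local field, $\mathbf G$ a connected reductive $F$-group with center $\mathbf Z$, $G=\mathbf G(F)$, $Z=\mathbf Z(F)$. Representations are smooth and complex; $\mathrm{ind}$ is compact induction. For a group $H$, $X(H)=\mathrm{Hom}(H,\mathbb C^\times)$; for a normal subgroup $H'$, $X(H/H')$ is identified with the characters of $H$ trivial on $H'$. For $g\in G$: $H^g=gHg^{-1}$ and $\sigma^g(x)=\sigma(g^{-1}xg)$. ${}^0G$ is the intersection of the kernels of all unramified characters $g\mapsto|\chi(g)|_F^s$ of $G$ ($\chi$ an $F$-rational character of $\mathbf G$, $s\in\mathbb C$). Fix an open normal subgroup ${}^\flat G$ of $G$, contained in ${}^0G$ with finite index and containing the commutator subgroup of $G$. $\Omega(G)$ is the set of open compact subgroups of $G$; $\Omega(G/Z)$ the set of open subgroups of $G$ containing $Z$ and compact modulo $Z$. For a representation $\sigma$ of $H\subset G$, $\mathcal I_G(\sigma)=\{g\in G:\mathrm{Hom}_{H\cap H^g}(\sigma,\sigma^g)\neq0\}$. $\mathcal J_G$ is the set of pairs $(J,\rho)$, $J\in\Omega(G)$, $\rho\in\mathrm{Irr}(J)$, such that there exist $\tilde J\in\Omega(G/Z)$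 with $J=\tilde J\cap{}^\flat G$ and $\tilde\rho\in\mathrm{Irr}(\tilde J)$ containing $\rho$ with $\mathcal I_G(\tilde\rho)=\tilde J$ (equivalently $\pi:=\mathrm{ind}_{\tilde J}^G\tilde\rho$ is irreducible, hence supercuspidal). For each $(J,\rho)\in\mathcal J_G$ such a $(\tilde J,\tilde\rho)$ is fixed. For $(J,\rho)\in\mathcal J_G$: ${}^0J=\tilde J\cap{}^0G$; ${}^0\rho\in\mathrm{Irr}({}^0J)$ is a fixed representation contained in $\tilde\rho$ and containing $\rho$; ${}^\sharp J=\bigcap\ker\chi$ over $\chi\in X({}^0J/J)$ with ${}^0\rho\otimes\chi\simeq{}^0\rho$; ${}^\sharp\rho$ is the unique irreducible representation of ${}^\sharp J$ occurring in ${}^0\rho|_{{}^\sharp J}$ with ${}^\sharp\rho|_J=\rho$; ${}^\dagger({}^\flat G)=\bigcap\ker\chi$ over $\chi\in X(G/{}^\flat G)$ with $\pi\otimes\chi\simeq\pi$; ${}^\natural J={}^\dagger({}^\flat G)\cap{}^0J\subset{}^\sharp J$; ${}^\natural\rho={}^\sharp\rho|_{{}^\natural J}$ (irreducible). For a representation $\tau$ of a compact open $H$, $\mathcal H(G,\tau)=\mathrm{End}_G(\mathrm{ind}_H^G\tau)$. *)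

theory Defs
  imports
    "HOL-Analysis.Analysis"
    "HOL-Algebra.Algebra"
    "HOL-Algebra.Algebraic_Closure_Type"
    "HOL-Library.Function_Algebras"
begin

unbundle no fps_syntax

section \<open>Non-archimedean local fields\<close>

definition residue_field :: "('f::field \<Rightarrow> real) \<Rightarrow> 'f set set" where
  "residue_field absF =
     {x. absF x \<le> 1} // {(x, y). absF x \<le> 1 \<and> absF y \<le> 1 \<and> absF (x - y) < 1}"

text \<open>The field is the whole type; \<open>absF\<close> is its normalized absolute value, i.e. a uniformizer
  has absolute value \<open>1/q\<close> with \<open>q\<close> the cardinality of the residue field.\<close>

locale nonarch_local_field =
  fixes absF :: "'f::field \<Rightarrow> real"
  assumes nonneg: "0 \<le> absF x"
    and eq_0_iff: "absF x = 0 \<longleftrightarrow> x = 0"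
    and mult: "absF (x * y) = absF x * absF y"
    and ultrametric: "absF (x + y) \<le> max (absF x) (absF y)"
    and complete: "Metric_space.mcomplete UNIV (\<lambda>x y. absF (x - y))"
    and finite_residue_field: "finite (residue_field absF)"
    and uniformizer: "\<exists>w. absF w = 1 / real (card (residue_field absF))"
    and discrete: "x \<noteq> 0 \<Longrightarrow> \<exists>k::int. absF x = real (card (residue_field absF)) powi k"


section \<open>Linear algebraic groups\<close>

definition general_linear :: "('k::field ^ 'n ^ 'n) monoid" where
  "general_linear = \<lparr>carrier = {A. det A \<noteq> 0}, mult = (**), one = mat 1\<rparr>"

text \<open>Regular functions on \<open>GL\<^sub>n\<close> with coefficients in the subfield \<open>C\<close>, i.e. the functions given
  by elements of \<open>C[x\<^sub>i\<^sub>j, 1/det]\<close>. Only their values on invertible matrices matter.\<close>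

inductive_set regular_functions :: "'k::field set \<Rightarrow> ('k ^ 'n ^ 'n \<Rightarrow> 'k) set"
  for C :: "'k set" where
  const: "c \<in> C \<Longrightarrow> (\<lambda>A. c) \<in> regular_functions C"
| entry: "(\<lambda>A. A $ i $ j) \<in> regular_functions C"
| inverse_det: "(\<lambda>A. inverse (det A)) \<in> regular_functions C"
| add: "f \<in> regular_functions C \<Longrightarrow> g \<in> regular_functions C \<Longrightarrow>
    (\<lambda>A. f A + g A) \<in> regular_functions C"
| mult: "f \<in> regular_functions C \<Longrightarrow> g \<in> regular_functions C \<Longrightarrow>
    (\<lambda>A. f A * g A) \<in> regular_functions C"

definition zariski :: "('k::field ^ 'n ^ 'n) topology" where
  "zariski = topology_generated_by
     {{A. det A \<noteq> 0 \<and> f A \<noteq> 0} | f. f \<in> regular_functions UNIV}"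

text \<open>A Zariski closed subset of \<open>GL\<^sub>n\<close> over the algebraic closure is defined over \<open>F\<close> if its
  vanishing ideal is generated by regular functions with coefficients in \<open>F\<close>; as those vanishing
  on the subset form an ideal of \<open>F[x\<^sub>i\<^sub>j, 1/det]\<close>, generation is the same as linear
  spanning over the algebraic closure.\<close>

definition defined_over_base :: "('f::field alg_closure ^ 'n ^ 'n) set \<Rightarrow> bool" where
  "defined_over_base V \<longleftrightarrow>
     (\<forall>f \<in> regular_functions UNIV. (\<forall>A\<in>V. f A = 0) \<longrightarrow>
        (\<exists>S c. finite S \<and> S \<subseteq> regular_functions (range to_ac) \<and>
               (\<forall>g\<in>S. \<forall>A\<in>V. g A = 0) \<and>
               (\<forall>A. det A \<noteq> 0 \<longrightarrow> f A = (\<Sum>g\<in>S. c g * g A))))"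

text \<open>Powers are written via iteration because \<open>^\<close> on the type of square matrices is entrywise.\<close>

definition unipotent_matrix :: "'k::field ^ 'n ^ 'n \<Rightarrow> bool" where
  "unipotent_matrix A \<longleftrightarrow> (\<exists>m::nat. ((\<lambda>B. (A - mat 1) ** B) ^^ m) (mat 1) = 0)"

text \<open>A connected reductive group over the field \<open>'f\<close>, given by its points over an algebraic closure
  in some closed embedding into \<open>GL\<^sub>n\<close> over \<open>'f\<close>. The last condition says that the
  unipotent radical is trivial.\<close>

definition connected_reductive_group :: "('f::field alg_closure ^ 'n ^ 'n) set \<Rightarrow> bool" where
  "connected_reductive_group GG \<longleftrightarrow>
     subgroup GG general_linear \<and> closedin zariski GG \<and> defined_over_base GG \<and>
     connectedin zariski GG \<and>
     (\<forall>U. U \<lhd> (general_linear\<lparr>carrier := GG\<rparr>) \<and> closedin zariski U \<and> connectedin zariski U \<and>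
          (\<forall>A\<in>U. unipotent_matrix A) \<longrightarrow> U = {mat 1})"

definition base_change :: "'f::field ^ 'n ^ 'n \<Rightarrow> 'f alg_closure ^ 'n ^ 'n" where
  "base_change A = (\<chi> i j. to_ac (A $ i $ j))"

definition rational_points ::
    "('f::field alg_closure ^ 'n ^ 'n) set \<Rightarrow> ('f ^ 'n ^ 'n) monoid" where
  "rational_points GG = general_linear\<lparr>carrier := {A. base_change A \<in> GG}\<rparr>"

definition rational_center :: "('f::field alg_closure ^ 'n ^ 'n) set \<Rightarrow> ('f ^ 'n ^ 'n) set" where
  "rational_center GG =
     {A. base_change A \<in> GG \<and> (\<forall>B\<in>GG. base_change A ** B = B ** base_change A)}"

definition matrix_dist ::
    "('f::field \<Rightarrow> real) \<Rightarrow> 'f ^ 'n ^ 'n \<Rightarrow> 'f ^ 'n ^ 'n \<Rightarrow> real" where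
  "matrix_dist absF A B = Max (range (\<lambda>(i, j). absF (A $ i $ j - B $ i $ j)))"

definition rational_topology ::
    "('f::field \<Rightarrow> real) \<Rightarrow> ('f alg_closure ^ 'n ^ 'n) set \<Rightarrow> ('f ^ 'n ^ 'n) topology" where
  "rational_topology absF GG =
     subtopology (Metric_space.mtopology UNIV (matrix_dist absF)) (carrier (rational_points GG))"

definition rational_characters ::
    "('f::field alg_closure ^ 'n ^ 'n) set \<Rightarrow> ('f alg_closure ^ 'n ^ 'n \<Rightarrow> 'f alg_closure) set" where
  "rational_characters GG =
     {\<xi> \<in> regular_functions (range to_ac).
        \<xi> (mat 1) = 1 \<and> (\<forall>A\<in>GG. \<forall>B\<in>GG. \<xi> (A ** B) = \<xi> A * \<xi> B)}"

text \<open>A rational character takes values in \<open>F\<close> on rational points, so that the inverse of the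
  embedding \<open>to_ac\<close> may be applied to them.\<close>

definition unramified_character ::
    "('f::field \<Rightarrow> real) \<Rightarrow> ('f alg_closure ^ 'n ^ 'n \<Rightarrow> 'f alg_closure) \<Rightarrow> complex \<Rightarrow>
     'f ^ 'n ^ 'n \<Rightarrow> complex" where
  "unramified_character absF \<xi> s g =
     complex_of_real (absF (the_inv_into UNIV to_ac (\<xi> (base_change g)))) powr s"

definition unramified_kernel ::
    "('f::field \<Rightarrow> real) \<Rightarrow> ('f alg_closure ^ 'n ^ 'n) set \<Rightarrow> ('f ^ 'n ^ 'n) set" where
  "unramified_kernel absF GG =
     {g \<in> carrier (rational_points GG).
        \<forall>\<xi> \<in> rational_characters GG. \<forall>s. unramified_character absF \<xi> s g = 1}"


section \<open>Subgroups of a topological group\<close>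

definition coset_topology :: "('g, 'm) monoid_scheme \<Rightarrow> 'g topology \<Rightarrow> 'g set \<Rightarrow> 'g set topology" where
  "coset_topology G T H = topology (\<lambda>\<U>. \<U> \<subseteq> rcosets\<^bsub>G\<^esub> H \<and> openin T (\<Union>\<U>))"

lemma (in group) openin_coset_topology:
  assumes "subgroup H G"
  shows "openin (coset_topology G T H) \<U> \<longleftrightarrow> \<U> \<subseteq> rcosets H \<and> openin T (\<Union>\<U>)"
proof -
  have inter: "\<Union>(A \<inter> B) = \<Union>A \<inter> \<Union>B"
    if "A \<subseteq> rcosets H" "B \<subseteq> rcosets H" for A B
  proof (intro equalityI subsetI)
    fix x
    assume "x \<in> \<Union>A \<inter> \<Union>B"
    then obtain S R where SR: "S \<in> A" "R \<in> B" "x \<in> S" "x \<in> R"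
      by auto
    then have "S = R"
      using pairwiseD[OF rcos_disjoint[OF assms], of S R] that
      unfolding disjnt_def by blast
    then show "x \<in> \<Union>(A \<inter> B)"
      using SR by auto
  qed auto
  have "istopology (\<lambda>\<U>. \<U> \<subseteq> rcosets H \<and> openin T (\<Union>\<U>))"
    unfolding istopology_def
  proof (rule conjI; intro allI impI)
    fix A B
    assume "A \<subseteq> rcosets H \<and> openin T (\<Union>A)" "B \<subseteq> rcosets H \<and> openin T (\<Union>B)"
    then show "A \<inter> B \<subseteq> rcosets H \<and> openin T (\<Union>(A \<inter> B))"
      using inter[of A B] by (metis openin_Int le_infI1)
  next
    fix \<K>
    assume *: "\<forall>K\<in>\<K>. K \<subseteq> rcosets H \<and> openin T (\<Union>K)"
    have "openin T (\<Union>(\<Union> ` \<K>))"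
      using * by (intro openin_Union) blast
    moreover have "\<Union>(\<Union> ` \<K>) = \<Union>(\<Union>\<K>)"
      by blast
    ultimately show "\<Union>\<K> \<subseteq> rcosets H \<and> openin T (\<Union>(\<Union>\<K>))"
      using * by (metis Sup_least)
  qed
  then show ?thesis
    by (simp add: coset_topology_def)
qed

definition compact_modulo :: "('g, 'm) monoid_scheme \<Rightarrow> 'g topology \<Rightarrow> 'g set \<Rightarrow> 'g set \<Rightarrow> bool" where
  "compact_modulo G T H S \<longleftrightarrow> compactin (coset_topology G T H) ((\<lambda>x. H #>\<^bsub>G\<^esub> x) ` S)"

definition open_compact_subgroups :: "('g, 'm) monoid_scheme \<Rightarrow> 'g topology \<Rightarrow> 'g set set" where
  "open_compact_subgroups G T = {H. subgroup H G \<and> openin T H \<and> compactin T H}"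

definition open_compact_mod_subgroups ::
    "('g, 'm) monoid_scheme \<Rightarrow> 'g topology \<Rightarrow> 'g set \<Rightarrow> 'g set set" where
  "open_compact_mod_subgroups G T Z =
     {H. subgroup H G \<and> openin T H \<and> Z \<subseteq> H \<and> compact_modulo G T Z H}"

definition conj_subgroup :: "('g, 'm) monoid_scheme \<Rightarrow> 'g set \<Rightarrow> 'g \<Rightarrow> 'g set" where
  "conj_subgroup G H g = (\<lambda>h. g \<otimes>\<^bsub>G\<^esub> h \<otimes>\<^bsub>G\<^esub> inv\<^bsub>G\<^esub> g) ` H"

definition complex_units :: "complex monoid" where
  "complex_units = \<lparr>carrier = UNIV - {0}, mult = (*), one = 1\<rparr>"

text \<open>The characters of \<open>H\<close> trivial on \<open>H'\<close>. Extensionality makes each of them a single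
  function, which matters because this set serves as the index set of a direct sum.\<close>

definition characters_mod :: "('g, 'm) monoid_scheme \<Rightarrow> 'g set \<Rightarrow> 'g set \<Rightarrow> ('g \<Rightarrow> complex) set" where
  "characters_mod G H H' =
     {\<eta> \<in> extensional H. \<eta> \<in> hom (G\<lparr>carrier := H\<rparr>) complex_units \<and> (\<forall>x\<in>H'. \<eta> x = 1)}"


section \<open>Smooth complex representations\<close>

class complex_vector_space = ab_group_add +
  fixes scaleC :: "complex \<Rightarrow> 'a \<Rightarrow> 'a"  (infixr "*\<^sub>C" 75)
  assumes scaleC_add_right: "a *\<^sub>C (x + y) = a *\<^sub>C x + a *\<^sub>C y"
    and scaleC_add_left: "(a + b) *\<^sub>C x = a *\<^sub>C x + b *\<^sub>C x"
    and scaleC_scaleC: "a *\<^sub>C b *\<^sub>C x = (a * b) *\<^sub>C x"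
    and scaleC_one: "1 *\<^sub>C x = x"

interpretation cvs: vector_space "scaleC :: complex \<Rightarrow> 'a \<Rightarrow> 'a::complex_vector_space"
  by unfold_locales (simp_all add: scaleC_add_right scaleC_add_left scaleC_scaleC scaleC_one)

instantiation "fun" :: (type, complex_vector_space) complex_vector_space
begin

definition "c *\<^sub>C f = (\<lambda>x. c *\<^sub>C f x)"

instance
  by standard (auto simp: scaleC_fun_def fun_eq_iff scaleC_add_right scaleC_add_left
      scaleC_scaleC scaleC_one)

end

text \<open>The group being represented is not part of the record, so that restricting a
  representation to a subgroup does not change the record.\<close>

record ('g, 'v) repn =
  vspace :: "'v set"
  act :: "'g \<Rightarrow> 'v \<Rightarrow> 'v"

definition smooth_rep ::
    "('g, 'm) monoid_scheme \<Rightarrow> 'g topology \<Rightarrow> 'g set \<Rightarrow> ('g, 'v::complex_vector_space) repn \<Rightarrow> bool" where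
  "smooth_rep G T H \<tau> \<longleftrightarrow>
     cvs.subspace (vspace \<tau>) \<and>
     (\<forall>h\<in>H. \<forall>v\<in>vspace \<tau>. act \<tau> h v \<in> vspace \<tau>) \<and>
     (\<forall>h\<in>H. \<forall>v\<in>vspace \<tau>. \<forall>w\<in>vspace \<tau>. act \<tau> h (v + w) = act \<tau> h v + act \<tau> h w) \<and>
     (\<forall>h\<in>H. \<forall>c. \<forall>v\<in>vspace \<tau>. act \<tau> h (c *\<^sub>C v) = c *\<^sub>C act \<tau> h v) \<and>
     (\<forall>v\<in>vspace \<tau>. act \<tau> \<one>\<^bsub>G\<^esub> v = v) \<and>
     (\<forall>h\<in>H. \<forall>k\<in>H. \<forall>v\<in>vspace \<tau>. act \<tau> (h \<otimes>\<^bsub>G\<^esub> k) v = act \<tau> h (act \<tau> k v)) \<and>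
     (\<forall>v\<in>vspace \<tau>. openin (subtopology T H) {h \<in> H. act \<tau> h v = v})"

definition Irr ::
    "('g, 'm) monoid_scheme \<Rightarrow> 'g topology \<Rightarrow> 'g set \<Rightarrow> ('g, 'v::complex_vector_space) repn set" where
  "Irr G T H =
     {\<tau>. smooth_rep G T H \<tau> \<and> vspace \<tau> \<noteq> {0} \<and>
         (\<forall>W. cvs.subspace W \<and> W \<subseteq> vspace \<tau> \<and> (\<forall>h\<in>H. \<forall>w\<in>W. act \<tau> h w \<in> W) \<longrightarrow>
              W = {0} \<or> W = vspace \<tau>)}"

text \<open>\<open>Hom\<^sub>H(\<sigma>, \<tau>)\<close>. An intertwiner is extended by zero outside the space of \<open>\<sigma>\<close>, so that it is
  determined by its values there and pointwise sums and composites are again of this form.\<close>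

definition intertwiners ::
    "'g set \<Rightarrow> ('g, 'v::complex_vector_space) repn \<Rightarrow> ('g, 'w::complex_vector_space) repn \<Rightarrow> ('v \<Rightarrow> 'w) set" where
  "intertwiners H \<sigma> \<tau> =
     {f. (\<forall>v. v \<notin> vspace \<sigma> \<longrightarrow> f v = 0) \<and>
         (\<forall>v\<in>vspace \<sigma>. f v \<in> vspace \<tau>) \<and>
         (\<forall>v\<in>vspace \<sigma>. \<forall>w\<in>vspace \<sigma>. f (v + w) = f v + f w) \<and>
         (\<forall>c. \<forall>v\<in>vspace \<sigma>. f (c *\<^sub>C v) = c *\<^sub>C f v) \<and>
         (\<forall>h\<in>H. \<forall>v\<in>vspace \<sigma>. f (act \<sigma> h v) = act \<tau> h (f v))}"

definition rep_iso ::
    "'g set \<Rightarrow> ('g, 'v::complex_vector_space) repn \<Rightarrow> ('g, 'w::complex_vector_space) repn \<Rightarrow> bool" where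
  "rep_iso H \<sigma> \<tau> \<longleftrightarrow> (\<exists>f \<in> intertwiners H \<sigma> \<tau>. bij_betw f (vspace \<sigma>) (vspace \<tau>))"

definition occurs_in ::
    "'g set \<Rightarrow> ('g, 'v::complex_vector_space) repn \<Rightarrow> ('g, 'w::complex_vector_space) repn \<Rightarrow> bool" where
  "occurs_in H \<sigma> \<tau> \<longleftrightarrow> (\<exists>f \<in> intertwiners H \<sigma> \<tau>. inj_on f (vspace \<sigma>))"

definition twist :: "('g, 'v::complex_vector_space) repn \<Rightarrow> ('g \<Rightarrow> complex) \<Rightarrow> ('g, 'v) repn" where
  "twist \<tau> \<eta> = \<lparr>vspace = vspace \<tau>, act = (\<lambda>h v. \<eta> h *\<^sub>C act \<tau> h v)\<rparr>"

definition conj_rep ::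
    "('g, 'm) monoid_scheme \<Rightarrow> ('g, 'v::complex_vector_space) repn \<Rightarrow> 'g \<Rightarrow> ('g, 'v) repn" where
  "conj_rep G \<sigma> g =
     \<lparr>vspace = vspace \<sigma>, act = (\<lambda>x. act \<sigma> (inv\<^bsub>G\<^esub> g \<otimes>\<^bsub>G\<^esub> x \<otimes>\<^bsub>G\<^esub> g))\<rparr>"

definition intertwining_set ::
    "('g, 'm) monoid_scheme \<Rightarrow> 'g set \<Rightarrow> ('g, 'v::complex_vector_space) repn \<Rightarrow> 'g set" where
  "intertwining_set G H \<sigma> =
     {g \<in> carrier G. intertwiners (H \<inter> conj_subgroup G H g) \<sigma> (conj_rep G \<sigma> g) \<noteq> {0}}"

definition compact_induction ::
    "('g, 'm) monoid_scheme \<Rightarrow> 'g topology \<Rightarrow> 'g set \<Rightarrow> ('g, 'v::complex_vector_space) repn \<Rightarrow>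
     ('g, 'g \<Rightarrow> 'v) repn" where
  "compact_induction G T H \<tau> =
     \<lparr>vspace = {f. (\<forall>x. x \<notin> carrier G \<longrightarrow> f x = 0) \<and>
                  (\<forall>x\<in>carrier G. f x \<in> vspace \<tau>) \<and>
                  (\<forall>h\<in>H. \<forall>x\<in>carrier G. f (h \<otimes>\<^bsub>G\<^esub> x) = act \<tau> h (f x)) \<and>
                  (\<exists>K. subgroup K G \<and> openin T K \<and>
                       (\<forall>x\<in>carrier G. \<forall>k\<in>K. f (x \<otimes>\<^bsub>G\<^esub> k) = f x)) \<and>
                  compact_modulo G T H {x \<in> carrier G. f x \<noteq> 0}},
      act = (\<lambda>g f x. if x \<in> carrier G then f (x \<otimes>\<^bsub>G\<^esub> g) else 0)\<rparr>"


section \<open>Complex algebras\<close>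

text \<open>The library's locale \<open>algebra\<close> only covers commutative algebras, but its record type
  of rings with scalar multiplication is used here for noncommutative ones.\<close>

definition end_algebra ::
    "'g set \<Rightarrow> ('g, 'v::complex_vector_space) repn \<Rightarrow> (complex, 'v \<Rightarrow> 'v) module" where
  "end_algebra H \<tau> =
     \<lparr>carrier = intertwiners H \<tau> \<tau>, mult = (\<circ>), one = (\<lambda>v. if v \<in> vspace \<tau> then v else 0),
      ring.zero = 0, add = (+), smult = (*\<^sub>C)\<rparr>"

definition hecke_algebra ::
    "('g, 'm) monoid_scheme \<Rightarrow> 'g topology \<Rightarrow> 'g set \<Rightarrow> ('g, 'v::complex_vector_space) repn \<Rightarrow>
     (complex, ('g \<Rightarrow> 'v) \<Rightarrow> 'g \<Rightarrow> 'v) module" where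
  "hecke_algebra G T H \<tau> = end_algebra (carrier G) (compact_induction G T H \<tau>)"

text \<open>Componentwise operations on finitely supported families. The unit below lies in the carrier
  only for a finite index set (up to zero algebras), the case in which the sum is a unital algebra.\<close>

definition direct_sum_algebra ::
    "'i set \<Rightarrow> ('i \<Rightarrow> (complex, 'a) module) \<Rightarrow> (complex, 'i \<Rightarrow> 'a) module" where
  "direct_sum_algebra I A =
     \<lparr>carrier = {x \<in> (\<Pi>\<^sub>E i\<in>I. carrier (A i)). finite {i \<in> I. x i \<noteq> \<zero>\<^bsub>A i\<^esub>}},
      mult = (\<lambda>x y. \<lambda>i\<in>I. x i \<otimes>\<^bsub>A i\<^esub> y i),
      one = (\<lambda>i\<in>I. \<one>\<^bsub>A i\<^esub>),
      ring.zero = (\<lambda>i\<in>I. \<zero>\<^bsub>A i\<^esub>),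
      add = (\<lambda>x y. \<lambda>i\<in>I. x i \<oplus>\<^bsub>A i\<^esub> y i),
      smult = (\<lambda>c x. \<lambda>i\<in>I. c \<odot>\<^bsub>A i\<^esub> x i)\<rparr>"

definition algebra_isomorphic :: "(complex, 'a) module \<Rightarrow> (complex, 'b) module \<Rightarrow> bool" where
  "algebra_isomorphic A B \<longleftrightarrow>
     (\<exists>\<phi> \<in> ring_iso A B. \<forall>c. \<forall>x\<in>carrier A. \<phi> (c \<odot>\<^bsub>A\<^esub> x) = c \<odot>\<^bsub>B\<^esub> \<phi> x)"


section \<open>The types under consideration\<close>

text \<open>In the following, \<open>G0\<close> and \<open>Gb\<close> stand for \<open>\<^sup>0G\<close> and for the fixed subgroup of it (with a flat),
  \<open>Jt\<close> and \<open>\<rho>t\<close> for \<open>J\<close> and \<open>\<rho>\<close> with a tilde, and \<open>J0\<close> and \<open>\<rho>0\<close> for \<open>\<^sup>0J\<close> and \<open>\<^sup>0\<rho>\<close>.\<close>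

definition flat_subgroup ::
    "('g, 'm) monoid_scheme \<Rightarrow> 'g topology \<Rightarrow> 'g set \<Rightarrow> 'g set \<Rightarrow> bool" where
  "flat_subgroup G T G0 Gb \<longleftrightarrow>
     Gb \<lhd> G \<and> openin T Gb \<and> Gb \<subseteq> G0 \<and> finite (rcosets\<^bsub>G\<lparr>carrier := G0\<rparr>\<^esub> Gb) \<and>
     derived G (carrier G) \<subseteq> Gb"

text \<open>\<open>(J, \<rho>)\<close> belongs to \<open>\<J>\<^sub>G\<close>, as witnessed by \<open>(Jt, \<rho>t)\<close>. The witness is explicit since
  its choice is part of the data, and since its space may have a type of its own.\<close>

definition JG_witness ::
    "('g, 'm) monoid_scheme \<Rightarrow> 'g topology \<Rightarrow> 'g set \<Rightarrow> 'g set \<Rightarrow>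
     'g set \<Rightarrow> ('g, 'v::complex_vector_space) repn \<Rightarrow>
     'g set \<Rightarrow> ('g, 'w::complex_vector_space) repn \<Rightarrow> bool" where
  "JG_witness G T Z Gb J \<rho> Jt \<rho>t \<longleftrightarrow>
     J \<in> open_compact_subgroups G T \<and> \<rho> \<in> Irr G T J \<and>
     Jt \<in> open_compact_mod_subgroups G T Z \<and> J = Jt \<inter> Gb \<and>
     \<rho>t \<in> Irr G T Jt \<and> occurs_in J \<rho> \<rho>t \<and> intertwining_set G Jt \<rho>t = Jt"

definition sharp_subgroup ::
    "('g, 'm) monoid_scheme \<Rightarrow> 'g set \<Rightarrow> 'g set \<Rightarrow> ('g, 'v::complex_vector_space) repn \<Rightarrow> 'g set" where
  "sharp_subgroup G J J0 \<rho>0 =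
     {x \<in> J0. \<forall>\<eta> \<in> characters_mod G J0 J. rep_iso J0 (twist \<rho>0 \<eta>) \<rho>0 \<longrightarrow> \<eta> x = 1}"

definition dagger_subgroup ::
    "('g, 'm) monoid_scheme \<Rightarrow> 'g set \<Rightarrow> ('g, 'v::complex_vector_space) repn \<Rightarrow> 'g set" where
  "dagger_subgroup G Gb \<pi> =
     {x \<in> carrier G. \<forall>\<eta> \<in> characters_mod G (carrier G) Gb.
        rep_iso (carrier G) (twist \<pi> \<eta>) \<pi> \<longrightarrow> \<eta> x = 1}"

end

theory Submission
  imports Defs
begin

text \<open>
  Write \<open>\<pi>\<close> for the representation compactly induced from the pair \<open>(Jt, \<rho>t)\<close>, \<open>N\<close> for the group \<open>Jn\<close>, and
  \<open>\<sigma>\<close> for the restriction of \<open>\<rho>s\<close> to \<open>N\<close>, so that \<open>\<sigma>\<close> extends \<open>\<rho>\<close>. The quotient \<open>N/J\<close> is finite and abelian,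
  as it embeds into \<open>G0/Gb\<close>. Hence inducing \<open>\<rho>\<close> from \<open>J\<close> to \<open>N\<close> gives the sum of the twists of \<open>\<sigma>\<close> by the
  characters \<open>\<nu>\<close> of \<open>N/J\<close>, and inducing on to \<open>G\<close> decomposes the representation induced from \<open>\<rho>\<close> into the
  representations \<open>P\<^sub>\<nu>\<close> induced from \<open>\<sigma> \<otimes> \<nu>\<close>. Endomorphisms of a direct sum are matrices of maps between the
  summands, so the theorem amounts to the vanishing of all maps \<open>P\<^sub>\<nu> \<rightarrow> P\<^sub>\<nu>\<^sub>'\<close> with \<open>\<nu> \<noteq> \<nu>'\<close>
  (\<open>end_algebra_decomposition\<close>, \<open>hecke_algebra_decomposition\<close>).

  A nonzero map \<open>P\<^sub>\<nu> \<rightarrow> P\<^sub>\<nu>\<^sub>'\<close> makes some \<open>g\<close> in \<open>G\<close> intertwine \<open>\<sigma> \<otimes> \<nu>\<close> with \<open>\<sigma> \<otimes> \<nu>'\<close>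
  (\<open>intertwines_if_nonzero_map\<close>). As \<open>\<sigma>\<close> is a direct summand of \<open>\<rho>t\<close> on \<open>N\<close>, this is an intertwiner
  of \<open>\<rho>t \<otimes> \<eta>\<close> with \<open>\<rho>t\<close> on \<open>N \<inter> gNg\<^sup>-\<^sup>1\<close>, where \<open>\<eta>\<close> is a character of \<open>G/Gb\<close> that extends \<open>\<nu>/\<nu>'\<close>; it exists
  because \<open>\<complex>\<^sup>\<times>\<close> is divisible (\<open>character_extend\<close>). Now \<open>N\<close> is the intersection of \<open>Jt\<close> with a normal subgroup
  \<open>M\<close> of \<open>G\<close>, with \<open>G/M\<close> abelian. So the larger group \<open>D = Jt \<inter> gJtg\<^sup>-\<^sup>1\<close> acts on the intertwiners through an abelian
  quotient; an eigenvector (\<open>intertwiner_eigenvector\<close>) is an intertwiner on all of \<open>D\<close>, at the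
  cost of multiplying \<open>\<eta>\<close> by a character \<open>\<theta>\<close> that is trivial on \<open>M\<close>. It induces a nonzero map between \<open>\<pi>\<close> and its
  twist, which is bijective as \<open>\<pi>\<close> is irreducible (\<open>ind_irreducible\<close>, \<open>twist_iso_if_intertwines\<close>).
  By definition of the subgroup with a dagger, \<open>\<eta>\<theta>\<close> is then trivial on it, and so on \<open>N\<close>, where \<open>\<theta>\<close> is
  trivial too. Hence \<open>\<nu> = \<nu>'\<close>. The same argument at \<open>g = 1\<close>, with \<open>G0\<close> in place of \<open>M\<close>, shows that \<open>N\<close> lies in \<open>Js\<close>,
  which is needed for \<open>\<rho>s\<close> to be a representation of \<open>N\<close> in the first place.

  Two facts about \<open>\<rho>t\<close> make the averaging and eigenvector arguments possible: it has a central character and finite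
  dimension. Both come from Schur's lemma in countable dimension (\<open>schur\<close>), which applies because \<open>G\<close> is separable
  (\<open>countable_cosets_rational_points\<close>).
\<close>

section \<open>Linear algebra\<close>

interpretation cvp: vector_space_pair
  "scaleC :: complex \<Rightarrow> 'a \<Rightarrow> 'a::complex_vector_space"
  "scaleC :: complex \<Rightarrow> 'b \<Rightarrow> 'b::complex_vector_space"
  by unfold_locales

abbreviation clinear :: "('a::complex_vector_space \<Rightarrow> 'b::complex_vector_space) \<Rightarrow> bool" where
  "clinear f \<equiv> Vector_Spaces.linear scaleC scaleC f"

definition linear_maps :: "'a::complex_vector_space set \<Rightarrow> 'b::complex_vector_space set \<Rightarrow> ('a \<Rightarrow> 'b) set" where
  "linear_maps V W =
     {f. (\<forall>v\<in>V. f v \<in> W) \<and> (\<forall>v\<in>V. \<forall>w\<in>V. f (v + w) = f v + f w) \<and>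
         (\<forall>c. \<forall>v\<in>V. f (c *\<^sub>C v) = c *\<^sub>C f v)}"

lemma linear_maps_extend:
  assumes V: "cvs.subspace V" and W: "cvs.subspace W" and f: "f \<in> linear_maps V W"
  obtains g where "clinear g" "range g \<subseteq> W" "\<forall>v\<in>V. g v = f v"
proof -
  obtain B where B: "B \<subseteq> V" "cvs.independent B" "V = cvs.span B"
    using cvs.maximal_independent_subset[of V] cvs.span_minimal[OF _ V] by (metis antisym_conv)
  define g where "g = cvp.construct B f"
  have g: "clinear g"
    unfolding g_def by (rule cvp.linear_construct[OF B(2)])
  interpret g: Vector_Spaces.linear scaleC scaleC g
    by (rule g)
  have "v \<in> V \<and> g v = f v" if "v \<in> V" for v
    using that unfolding B(3)
  proof (induction rule: cvs.span_induct_alt)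
    case base
    have "f (0 *\<^sub>C 0) = 0 *\<^sub>C f 0"
      using f cvs.subspace_0[OF V] unfolding linear_maps_def by blast
    then show ?case by (simp add: cvs.span_zero)
  next
    case (step c x y)
    then have xy: "x \<in> V" "c *\<^sub>C x \<in> V" "y \<in> V"
      using B V by (auto simp: cvs.subspace_scale)
    moreover have "g x = f x"
      using step(1) unfolding g_def by (rule cvp.construct_basis[OF B(2)])
    ultimately have "g (c *\<^sub>C x + y) = f (c *\<^sub>C x + y)"
      using step f by (simp add: linear_maps_def g.add g.scale)
    then show ?case
      using xy cvs.subspace_add[OF V] B(3) by auto
  qed
  moreover have "range g \<subseteq> W"
  proof -
    have "cvs.span (f ` B) \<subseteq> W"
      using B(1) f by (intro cvs.span_minimal[OF _ W]) (auto simp: linear_maps_def)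
    then show ?thesis
      unfolding g_def cvp.range_construct_eq_span[OF B(2)] .
  qed
  ultimately show ?thesis
    using g that by blast
qed

text \<open>The value \<open>p(T) v\<close> of a polynomial in the operator \<open>T\<close>, by Horner's scheme.\<close>

definition poly_op :: "('a \<Rightarrow> 'a) \<Rightarrow> complex poly \<Rightarrow> 'a::complex_vector_space \<Rightarrow> 'a" where
  "poly_op T p = fold_coeffs (\<lambda>a f v. a *\<^sub>C v + T (f v)) p (\<lambda>v. 0)"

context
  fixes T :: "'a::complex_vector_space \<Rightarrow> 'a"
  assumes T: "clinear T"
begin

interpretation T: Vector_Spaces.linear scaleC scaleC T
  by (rule T)

lemma poly_op_0 [simp]: "poly_op T 0 v = 0"
  by (simp add: poly_op_def)

lemma poly_op_pCons [simp]: "poly_op T (pCons a p) v = a *\<^sub>C v + T (poly_op T p v)"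
  by (cases "p = 0 \<and> a = 0") (auto simp: poly_op_def T.zero)

lemma poly_op_add: "poly_op T (p + q) v = poly_op T p v + poly_op T q v"
proof (induction p arbitrary: q)
  case (pCons a p)
  obtain b r where "q = pCons b r"
    by (rule pCons_cases)
  then show ?case
    by (simp add: pCons.IH T.add scaleC_add_left add_ac)
qed simp

lemma poly_op_smult: "poly_op T (Polynomial.smult c p) v = c *\<^sub>C poly_op T p v"
  by (induction p) (simp_all add: T.scale scaleC_add_right scaleC_scaleC)

lemma poly_op_mult: "poly_op T (p * q) v = poly_op T p (poly_op T q v)"
  by (induction p) (simp_all add: poly_op_add poly_op_smult)

lemma poly_op_sum: "poly_op T (\<Sum>i\<in>I. p i) v = (\<Sum>i\<in>I. poly_op T (p i) v)"
  by (induction I rule: infinite_finite_induct) (simp_all add: poly_op_add)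

lemma poly_op_in:
  assumes "cvs.subspace V" "\<And>v. v \<in> V \<Longrightarrow> T v \<in> V" "v \<in> V"
  shows "poly_op T p v \<in> V"
  by (induction p)
    (use assms in \<open>simp_all add: cvs.subspace_0 cvs.subspace_add cvs.subspace_scale\<close>)

text \<open>Over the complex numbers \<open>p\<close> splits into linear factors, so it is enough that \<open>T\<close> has no eigenvectors.\<close>

lemma poly_op_nonzero:
  assumes V: "cvs.subspace V" "\<And>v. v \<in> V \<Longrightarrow> T v \<in> V"
    and inj: "\<And>a v. v \<in> V \<Longrightarrow> T v = a *\<^sub>C v \<Longrightarrow> v = 0"
    and "p \<noteq> 0" "v \<in> V" "v \<noteq> 0"
  shows "poly_op T p v \<noteq> 0"
  using assms(4-6)
proof (induction "Polynomial.degree p" arbitrary: p v)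
  case 0
  then obtain a where "p = [:a:]"
    by (metis degree_eq_zeroE)
  then show ?case
    using 0 by (simp add: T.zero)
next
  case (Suc n)
  then have "\<not> constant (poly p)"
    by (simp add: constant_degree)
  then obtain z where "poly p z = 0"
    using fundamental_theorem_of_algebra by blast
  then obtain q where q: "p = [:-z, 1:] * q"
    by (auto simp: poly_eq_0_iff_dvd dvd_def)
  have q0: "q \<noteq> 0"
    using q Suc by auto
  then have "Polynomial.degree p = Polynomial.degree [:-z, 1:] + Polynomial.degree q"
    unfolding q by (intro degree_mult_eq) auto
  then have "n = Polynomial.degree q"
    using Suc(2) by simp
  then have nz: "poly_op T q v \<noteq> 0"
    using Suc q0 by blast
  moreover have "poly_op T q v \<in> V"
    using poly_op_in V Suc by blast
  ultimately have "T (poly_op T q v) \<noteq> z *\<^sub>C poly_op T q v"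
    using inj by blast
  then show ?case
    unfolding q poly_op_mult by (simp add: T.zero)
qed

end

text \<open>Enlarge the independent set to a basis of the span: it is equipotent to a basis chosen inside \<open>S\<close>.\<close>

lemma countable_independent:
  assumes "countable S" and "cvs.independent B" and "B \<subseteq> cvs.span S"
  shows "countable B"
proof -
  obtain C where C: "C \<subseteq> S" "cvs.independent C" "cvs.span S = cvs.span C"
    using cvs.maximal_independent_subset[of S]
    by (metis cvs.span_minimal cvs.span_mono cvs.subspace_span subset_antisym)
  obtain B' where B': "B \<subseteq> B'" "B' \<subseteq> cvs.span S" "cvs.independent B'" "cvs.span S \<subseteq> cvs.span B'"
    using cvs.maximal_independent_subset_extend[OF assms(3,2)] by blast
  have "cvs.span B' = cvs.span C"
    using B' C by (metis cvs.span_minimal cvs.subspace_span subset_antisym)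
  then obtain f where "bij_betw f B' C"
    using cvs.bij_if_span_eq_span_bases B'(3) C(2) by blast
  then have "countable B'"
    using C(1) assms(1) countable_subset by (metis bij_betw_def countable_image_inj_on)
  then show ?thesis
    using B'(1) countable_subset by blast
qed

text \<open>Suppose that \<open>T - a\<close> is bijective on \<open>V\<close> for every \<open>a\<close>. Then, for a fixed \<open>v \<noteq> 0\<close>, the vectors
  \<open>(T - a)\<^sup>-\<^sup>1 v\<close> are linearly independent, since a relation between them gives a nonzero polynomial in \<open>T\<close>
  killing \<open>v\<close>. There are uncountably many of them, too many for a space of countable dimension.\<close>

lemma exists_eigenvalue_or_not_surj:
  fixes T :: "'a::complex_vector_space \<Rightarrow> 'a"
  assumes T: "clinear T" and V: "cvs.subspace V" "V \<noteq> {0}" and TV: "\<And>v. v \<in> V \<Longrightarrow> T v \<in> V"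
    and S: "countable S" "V \<subseteq> cvs.span S"
  obtains a v where "v \<in> V" "v \<noteq> 0" "T v = a *\<^sub>C v"
  | a where "(\<lambda>v. T v - a *\<^sub>C v) ` V \<noteq> V"
proof (rule ccontr)
  assume neg: "\<not> thesis"
  then have inj: "\<And>a v. v \<in> V \<Longrightarrow> T v = a *\<^sub>C v \<Longrightarrow> v = 0"
    and surj: "\<And>a. (\<lambda>v. T v - a *\<^sub>C v) ` V = V"
    using that by blast+
  interpret T: Vector_Spaces.linear scaleC scaleC T
    by (rule T)
  obtain v0 where v0: "v0 \<in> V" "v0 \<noteq> 0"
    using V cvs.subspace_0 by blast
  define u where "u a = (SOME u. u \<in> V \<and> T u - a *\<^sub>C u = v0)" for a
  have "u a \<in> V \<and> T (u a) - a *\<^sub>C u a = v0" for a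
  proof -
    have "v0 \<in> (\<lambda>v. T v - a *\<^sub>C v) ` V"
      by (simp only: surj v0(1))
    then obtain w where "w \<in> V" "v0 = T w - a *\<^sub>C w"
      by (rule imageE)
    then have "w \<in> V \<and> T w - a *\<^sub>C w = v0"
      by simp
    then show ?thesis
      unfolding u_def by (rule someI)
  qed
  then have u: "\<And>a. u a \<in> V" "\<And>a. T (u a) - a *\<^sub>C u a = v0"
    by blast+
  have key: "c a = 0" if I: "finite I" "(\<Sum>a\<in>I. c a *\<^sub>C u a) = 0" "a \<in> I" for I c a
  proof -
    \<comment> \<open>Clearing denominators in the relation with the product \<open>P\<close> of all \<open>T - b\<close>.\<close>
    define r where "r = (\<lambda>a. \<Prod>b\<in>I - {a}. [:- b, 1:] :: complex poly)"
    define P where "P = (\<Prod>b\<in>I. [:- b, 1:] :: complex poly)"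
    have P: "poly_op T P (u a) = poly_op T (r a) v0" if "a \<in> I" for a
    proof -
      have "P = r a * [:- a, 1:]"
        unfolding P_def r_def using I(1) that by (simp add: prod.remove mult.commute)
      then have "poly_op T P (u a) = poly_op T (r a) (poly_op T [:- a, 1:] (u a))"
        by (simp only: poly_op_mult[OF T])
      also have "poly_op T [:- a, 1:] (u a) = v0"
        using u(2)[of a] T by (simp add: T.zero scaleC_one)
      finally show ?thesis .
    qed
    have lin: "poly_op T P (\<Sum>a\<in>K. c a *\<^sub>C u a) = (\<Sum>a\<in>K. c a *\<^sub>C poly_op T P (u a))" for K
    proof -
      have "poly_op T P (x + y) = poly_op T P x + poly_op T P y" for x y
        by (induction P) (simp_all add: T T.add scaleC_add_right)
      moreover have "poly_op T P (b *\<^sub>C x) = b *\<^sub>C poly_op T P x" for b x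
        by (induction P) (simp_all add: T T.scale scaleC_add_right scaleC_scaleC mult.commute)
      moreover have "poly_op T P 0 = 0"
        by (induction P) (simp_all add: T T.zero)
      ultimately show ?thesis
        by (induction K rule: infinite_finite_induct) simp_all
    qed
    have "poly_op T (\<Sum>a\<in>I. Polynomial.smult (c a) (r a)) v0 =
        (\<Sum>a\<in>I. c a *\<^sub>C poly_op T P (u a))"
      using P by (simp add: poly_op_sum[OF T] poly_op_smult[OF T])
    also have "\<dots> = poly_op T P 0"
      unfolding lin[symmetric] I(2) ..
    also have "\<dots> = 0"
      by (induction P) (simp_all add: T T.zero)
    finally have "poly_op T (\<Sum>a\<in>I. Polynomial.smult (c a) (r a)) v0 = 0" .
    moreover have "poly_op T p v0 \<noteq> 0" if "p \<noteq> 0" for p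
      by (rule poly_op_nonzero[where V = V]) (use T V(1) TV inj v0 that in auto)
    ultimately have "(\<Sum>a\<in>I. Polynomial.smult (c a) (r a)) = 0"
      by blast
    then have "0 = (\<Sum>b\<in>I. c b * poly (r b) a)"
      by (metis (no_types, lifting) poly_0 poly_smult poly_sum sum.cong)
    also have "\<dots> = (\<Sum>b\<in>{a}. c b * poly (r b) a)"
    proof (rule sum.mono_neutral_right)
      show "\<forall>b\<in>I - {a}. c b * poly (r b) a = 0"
        using I unfolding r_def by (auto simp: poly_prod)
    qed (use I in auto)
    finally have "c a = 0 \<or> poly (r a) a = 0"
      by simp
    moreover have "poly (r a) a \<noteq> 0"
      using I by (auto simp: r_def poly_prod)
    ultimately show "c a = 0" by blast
  qed
  have inju: "inj u"
  proof (rule injI)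
    fix a b assume ab: "u a = u b"
    show "a = b"
    proof (rule ccontr)
      assume ne: "a \<noteq> b"
      define c where "c = (\<lambda>x. if x = a then 1 else - 1 :: complex)"
      have "(\<Sum>x\<in>{a, b}. c x *\<^sub>C u x) = 0"
        using ne ab by (simp add: c_def scaleC_one)
      from key[OF _ this, of a] show False
        by (simp add: c_def)
    qed
  qed
  have "cvs.independent (range u)"
    unfolding cvs.independent_explicit_finite_subsets
  proof (intro allI impI ballI)
    fix A c v
    assume A: "A \<subseteq> range u" "finite A" "(\<Sum>v\<in>A. c v *\<^sub>C v) = 0" "v \<in> A"
    define I where "I = u -` A"
    have AI: "A = u ` I" "finite I"
      using A inju by (auto simp: I_def finite_vimageI)
    have "(\<Sum>a\<in>I. c (u a) *\<^sub>C u a) = (\<Sum>v\<in>A. c v *\<^sub>C v)"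
      unfolding AI(1) by (subst sum.reindex) (use inju in \<open>auto simp: inj_on_def\<close>)
    then show "c v = 0"
      using key[OF AI(2), of "\<lambda>a. c (u a)"] A AI by auto
  qed
  then have "countable (range u)"
    by (rule countable_independent[OF S(1)]) (use u S in auto)
  then have "countable (UNIV :: complex set)"
    using inju countable_image_inj_on by blast
  then show False
    using uncountable_UNIV_complex by simp
qed

text \<open>The eigenspaces of \<open>T\<close> and the images of \<open>V\<close> under \<open>T - a\<close> are invariant under \<open>A\<close>, hence trivial.\<close>

lemma schur:
  fixes V :: "'a::complex_vector_space set"
  assumes V: "cvs.subspace V" "V \<noteq> {0}" and S: "countable S" "V \<subseteq> cvs.span S"
    and A: "\<And>f. f \<in> A \<Longrightarrow> f \<in> linear_maps V V"
    and simple: "\<And>W. cvs.subspace W \<Longrightarrow> W \<subseteq> V \<Longrightarrow> \<forall>f\<in>A. \<forall>w\<in>W. f w \<in> W \<Longrightarrow> W = {0} \<or> W = V"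
    and T: "T \<in> linear_maps V V" and comm: "\<And>f v. f \<in> A \<Longrightarrow> v \<in> V \<Longrightarrow> T (f v) = f (T v)"
  obtains a where "\<forall>v\<in>V. T v = a *\<^sub>C v"
proof -
  obtain T' where T': "clinear T'" "range T' \<subseteq> V" "\<forall>v\<in>V. T' v = T v"
    by (rule linear_maps_extend[OF V(1) V(1) T])
  interpret T': Vector_Spaces.linear scaleC scaleC T'
    by (rule T')
  have T'V: "T' v \<in> V" for v
    using T'(2) by blast
  define U where "U a = (\<lambda>v. T' v - a *\<^sub>C v)" for a
  have U: "clinear (U a)" for a
    unfolding U_def
    by (unfold_locales) (simp_all add: T'.add T'.scale algebra_simps scaleC_add_right
        cvs.scale_right_diff_distrib scaleC_scaleC)
  have UV: "U a v \<in> V" if "v \<in> V" for a v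
    unfolding U_def using V(1) T'V that by (simp add: cvs.subspace_diff cvs.subspace_scale)
  have Xlin: "f v \<in> V" "f (v + w) = f v + f w" "f (c *\<^sub>C v) = c *\<^sub>C f v"
    if "f \<in> A" "v \<in> V" "w \<in> V" for f v w c
    using A[OF that(1)] that by (auto simp: linear_maps_def)
  have Xdiff: "f (v - w) = f v - f w" if "f \<in> A" "v \<in> V" "w \<in> V" for f v w
    using Xlin(2)[of f "v - w" w] that V(1) by (simp add: cvs.subspace_diff)
  have commU: "U a (f v) = f (U a v)" if "f \<in> A" "v \<in> V" for a f v
  proof -
    have av: "a *\<^sub>C v \<in> V" "T v \<in> V"
      using cvs.subspace_scale[OF V(1) that(2)] T'(3)[rule_format, OF that(2)] T'V[of v] by simp_all
    have "f (a *\<^sub>C v) = a *\<^sub>C f v"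
      by (rule Xlin(3)[OF that(1) that(2) that(2)])
    moreover have "f (T v - a *\<^sub>C v) = f (T v) - f (a *\<^sub>C v)"
      by (rule Xdiff[OF that(1) av(2) av(1)])
    moreover have "T (f v) = f (T v)"
      by (rule comm[OF that])
    moreover have "T' (f v) = T (f v)"
      by (rule T'(3)[rule_format, OF Xlin(1)[OF that(1) that(2) that(2)]])
    ultimately show ?thesis
      unfolding U_def using T'(3)[rule_format, OF that(2)] by simp
  qed
  consider (eigen) a v where "v \<in> V" "v \<noteq> 0" "T' v = a *\<^sub>C v"
    | (image) a where "U a ` V \<noteq> V"
    unfolding U_def by (rule exists_eigenvalue_or_not_surj[OF T'(1) V T'V S])
  then show ?thesis
  proof cases
    case eigen
    define W where "W = {v \<in> V. U a v = 0}"
    interpret U: Vector_Spaces.linear scaleC scaleC "U a"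
      by (rule U)
    have "cvs.subspace W"
      using V(1) unfolding W_def cvs.subspace_def by (auto simp: U.add U.scale U.zero)
    moreover have f0: "f 0 = 0" if "f \<in> A" for f
      using Xlin(3)[OF that cvs.subspace_0[OF V(1)] cvs.subspace_0[OF V(1)], of 0] by simp
    then have "\<forall>f\<in>A. \<forall>w\<in>W. f w \<in> W"
      unfolding W_def using Xlin commU by auto
    moreover have "v \<in> W"
      using eigen by (simp add: W_def U_def)
    ultimately have WV: "W = V"
      using simple[of W] eigen(2) unfolding W_def by blast
    have "T v = a *\<^sub>C v" if "v \<in> V" for v
      using T'(3)[rule_format, OF that] that[folded WV] unfolding W_def U_def by simp
    then show ?thesis
      by (intro that[of a] ballI)
  next
    case image
    interpret U: Vector_Spaces.linear scaleC scaleC "U a"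
      by (rule U)
    have "cvs.subspace (U a ` V)"
      by (rule U.subspace_image[OF V(1)])
    moreover have "U a ` V \<subseteq> V"
      using UV by blast
    moreover have "\<forall>f\<in>A. \<forall>w\<in>U a ` V. f w \<in> U a ` V"
    proof (intro ballI)
      fix f w
      assume "f \<in> A" "w \<in> U a ` V"
      then obtain v where "f \<in> A" "v \<in> V" "w = U a v"
        by blast
      then have "f w = U a (f v)" "f v \<in> V"
        using commU[of f v a] Xlin(1)[of f v v] by simp_all
      then show "f w \<in> U a ` V"
        by blast
    qed
    ultimately have UV0: "U a ` V = {0}"
      using simple image by blast
    have "T v = a *\<^sub>C v" if "v \<in> V" for v
    proof -
      have "U a v \<in> U a ` V"
        using that by (rule imageI)
      then have "U a v = 0"
        unfolding UV0 by simp
      then show ?thesis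
        using T'(3)[rule_format, OF that] unfolding U_def by simp
    qed
    then show ?thesis
      by (intro that[of a] ballI)
  qed
qed

lemma dim_less:
  fixes V W :: "'a::complex_vector_space set"
  assumes S: "finite S" "V \<subseteq> cvs.span S" and V: "cvs.subspace V" and W: "cvs.subspace W" "W \<subseteq> V" "W \<noteq> V"
  shows "cvs.dim W < cvs.dim V"
proof -
  obtain B where B: "B \<subseteq> W" "cvs.independent B" "W \<subseteq> cvs.span B" "card B = cvs.dim W"
    using cvs.basis_exists[of W] by blast
  have spB: "cvs.span B = W"
    using B W by (metis cvs.span_subspace)
  obtain v where v: "v \<in> V" "v \<notin> W"
    using W by blast
  have ins: "cvs.independent (insert v B)"
    using v B spB by (simp add: cvs.independent_insert)
  obtain C where C: "C \<subseteq> V" "cvs.independent C" "V \<subseteq> cvs.span C" "card C = cvs.dim V"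
    using cvs.basis_exists[of V] by blast
  have "finite C"
    using cvs.independent_span_bound[OF S(1) C(2)] C(1) S(2) by blast
  moreover have "insert v B \<subseteq> cvs.span C"
    using v(1) B(1) W(2) C(3) by auto
  ultimately have "finite (insert v B) \<and> card (insert v B) \<le> card C"
    by (rule cvs.independent_span_bound[OF _ ins])
  moreover have "v \<notin> B"
    using v B by blast
  ultimately show ?thesis
    using B(4) C(4) by auto
qed

text \<open>On a nonzero invariant subspace of least dimension, Schur's lemma applies to each of the operators.\<close>

lemma common_eigenvector:
  fixes V :: "'a::complex_vector_space set"
  assumes V: "cvs.subspace V" "V \<noteq> {0}" and S: "finite S" "V \<subseteq> cvs.span S"
    and A: "\<And>f. f \<in> A \<Longrightarrow> f \<in> linear_maps V V"
    and comm: "\<And>f g v. f \<in> A \<Longrightarrow> g \<in> A \<Longrightarrow> v \<in> V \<Longrightarrow> g (f v) = f (g v)"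
  obtains v where "v \<in> V" "v \<noteq> 0" "\<forall>f\<in>A. \<exists>a. f v = a *\<^sub>C v"
proof -
  define P where "P W \<longleftrightarrow> cvs.subspace W \<and> W \<subseteq> V \<and> W \<noteq> {0} \<and> (\<forall>f\<in>A. \<forall>w\<in>W. f w \<in> W)" for W
  have "P V"
    using V A by (auto simp: P_def linear_maps_def)
  then obtain W where W: "P W" "\<And>W'. P W' \<Longrightarrow> cvs.dim W \<le> cvs.dim W'"
    using ex_has_least_nat[of P V cvs.dim] by blast
  have A': "f \<in> linear_maps W W" if "f \<in> A" for f
    using A[OF that] W(1) that unfolding P_def linear_maps_def by blast
  have simple: "W' = {0} \<or> W' = W"
    if W': "cvs.subspace W'" "W' \<subseteq> W" "\<forall>f\<in>A. \<forall>w\<in>W'. f w \<in> W'" for W'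
  proof (rule ccontr)
    assume neg: "\<not> (W' = {0} \<or> W' = W)"
    then have "P W'"
      using W' W(1) unfolding P_def by blast
    moreover have "cvs.dim W' < cvs.dim W"
      by (rule dim_less[OF S(1)]) (use W(1) S(2) W' neg in \<open>auto simp: P_def\<close>)
    ultimately show False
      using W(2) by fastforce
  qed
  have W': "cvs.subspace W" "W \<subseteq> V" "W \<noteq> {0}"
    using W(1) by (simp_all add: P_def)
  obtain v where v: "v \<in> W" "v \<noteq> 0"
    using W'(3) cvs.subspace_0[OF W'(1)] by auto
  have eig: "\<exists>a. f v = a *\<^sub>C v" if f: "f \<in> A" for f
  proof (rule schur[where V = W and S = S and A = A and T = f])
    show "W \<subseteq> cvs.span S" "countable S"
      using W'(2) S by (auto simp: countable_finite)
    show "f (g v) = g (f v)" if "g \<in> A" "v \<in> W" for g v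
      using comm[OF that(1) f] W'(2) that(2) by auto
    show ?thesis if "\<forall>v\<in>W. f v = a *\<^sub>C v" for a
      using bspec[OF that v(1)] by (rule exI)
    show "g \<in> linear_maps W W" if "g \<in> A" for g
      using that by (rule A')
    show "U = {0} \<or> U = W"
      if "cvs.subspace U" "U \<subseteq> W" "\<forall>f\<in>A. \<forall>w\<in>U. f w \<in> U" for U
      using that by (rule simple)
    show "f \<in> linear_maps W W"
      using f by (rule A')
  qed (fact W')+
  have "v \<in> V"
    using v(1) W'(2) by (rule rev_subsetD)
  from that[OF this v(2)] eig show ?thesis
    by simp
qed

section \<open>Characters of abelian quotients\<close>

text \<open>The graph of a character defined on a subgroup of \<open>A\<close>. Graphs are ordered by inclusion, as
  Zorn's lemma wants; being a subgroup, such a set is single-valued as soon as it is so at the unit.\<close>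

definition partial_character :: "('g, 'm) monoid_scheme \<Rightarrow> ('g \<times> complex) set \<Rightarrow> bool" where
  "partial_character A S \<longleftrightarrow>
     S \<subseteq> carrier A \<times> (UNIV - {0}) \<and> (\<one>\<^bsub>A\<^esub>, 1) \<in> S \<and>
     (\<forall>a z b w. (a, z) \<in> S \<longrightarrow> (b, w) \<in> S \<longrightarrow> (a \<otimes>\<^bsub>A\<^esub> b, z * w) \<in> S) \<and>
     (\<forall>a z. (a, z) \<in> S \<longrightarrow> (inv\<^bsub>A\<^esub> a, inverse z) \<in> S) \<and>
     (\<forall>z. (\<one>\<^bsub>A\<^esub>, z) \<in> S \<longrightarrow> z = 1)"

lemma partial_characterD:
  assumes "partial_character A S"
  shows "(a, z) \<in> S \<Longrightarrow> a \<in> carrier A" "(a, z) \<in> S \<Longrightarrow> z \<noteq> 0" "(\<one>\<^bsub>A\<^esub>, 1) \<in> S"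
    "(a, z) \<in> S \<Longrightarrow> (b, w) \<in> S \<Longrightarrow> (a \<otimes>\<^bsub>A\<^esub> b, z * w) \<in> S"
    "(a, z) \<in> S \<Longrightarrow> (inv\<^bsub>A\<^esub> a, inverse z) \<in> S"
    "(\<one>\<^bsub>A\<^esub>, z) \<in> S \<Longrightarrow> z = 1"
  using assms unfolding partial_character_def by (fast | simp)+

context group
begin

lemma partial_character_unique:
  assumes S: "partial_character G S" and "(a, z) \<in> S" "(a, w) \<in> S"
  shows "z = w"
proof -
  have "(a \<otimes> inv a, z * inverse w) \<in> S"
    using assms by (intro partial_characterD(4,5)[OF S])
  then have "z * inverse w = 1"
    using partial_characterD(1,6)[OF S] assms(2) by simp
  then show ?thesis
    using partial_characterD(2)[OF S assms(3)] by (simp add: field_simps)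
qed

lemma partial_character_pow:
  assumes S: "partial_character G S" and az: "(a, z) \<in> S"
  shows "(a [^] (k::int), z powi k) \<in> S"
proof -
  have nat: "(a [^] (n::nat), z ^ n) \<in> S" for n
  proof (induction n)
    case (Suc n)
    then show ?case
      using partial_characterD(4)[OF S Suc az] by (simp add: mult.commute)
  qed (use partial_characterD(3)[OF S] in simp)
  show ?thesis
  proof (cases "k < 0")
    case True
    have "(inv (a [^] nat (- k)), inverse (z ^ nat (- k))) \<in> S"
      by (rule partial_characterD(5)[OF S nat])
    moreover have "z powi k = inverse (z ^ nat (- k))"
      using True unfolding power_int_def by (simp only: power_inverse) simp
    moreover have "a [^] k = inv (a [^] nat (- k))"
      using True unfolding int_pow_def2 by (simp only: if_True)
    ultimately show ?thesis
      by (simp only:)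
  next
    case False
    have "z powi k = z ^ nat k"
      using False unfolding power_int_def by (simp only: not_less if_True)
    moreover have "a [^] k = a [^] nat k"
      using False unfolding int_pow_def2 by (simp only: if_False)
    ultimately show ?thesis
      using nat[of "nat k"] by (simp only:)
  qed
qed

end

context comm_group
begin

lemma partial_character_adjoin:
  assumes S: "partial_character G S" and x: "x \<in> carrier G" and z: "z \<noteq> 0"
    and ext: "\<And>(k::int) w. (x [^] k, w) \<in> S \<Longrightarrow> w = z powi k"
  shows "\<exists>S'. partial_character G S' \<and> S \<subseteq> S' \<and> (x, z) \<in> S'"
proof -
  define S' where "S' = {(a \<otimes> x [^] k, b * z powi k) | a b k. (a, b) \<in> S \<and> k \<in> (UNIV :: int set)}"
  have S'I: "(a \<otimes> x [^] k, b * z powi k) \<in> S'" if "(a, b) \<in> S" for a b and k :: int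
    unfolding S'_def using that by blast
  have "partial_character G S'"
    unfolding partial_character_def
  proof (intro conjI allI impI)
    show "S' \<subseteq> carrier G \<times> (UNIV - {0})"
      unfolding S'_def using partial_characterD(1,2)[OF S] x z by (auto simp: power_int_eq_0_iff)
    show "(\<one>, 1) \<in> S'"
      using S'I[OF partial_characterD(3)[OF S], of 0] by simp
  next
    fix a b c d
    assume "(a, b) \<in> S'" "(c, d) \<in> S'"
    then obtain a' b' k c' d' l where
      1: "(a', b') \<in> S" "a = a' \<otimes> x [^] (k::int)" "b = b' * z powi k" and
      2: "(c', d') \<in> S" "c = c' \<otimes> x [^] (l::int)" "d = d' * z powi l"
      unfolding S'_def by auto
    have [simp]: "a' \<in> carrier G" "c' \<in> carrier G"
      using 1 2 partial_characterD(1)[OF S] by auto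
    have "a \<otimes> c = (a' \<otimes> c') \<otimes> x [^] (k + l)"
      unfolding 1 2 using x by (simp add: int_pow_mult m_ac)
    moreover have "b * d = (b' * d') * z powi (k + l)"
      unfolding 1 2 using z by (simp add: power_int_add)
    ultimately show "(a \<otimes> c, b * d) \<in> S'"
      using S'I[OF partial_characterD(4)[OF S 1(1) 2(1)], of "k + l"] by simp
  next
    fix a b
    assume "(a, b) \<in> S'"
    then obtain a' b' k where
      1: "(a', b') \<in> S" "a = a' \<otimes> x [^] (k::int)" "b = b' * z powi k"
      unfolding S'_def by auto
    have [simp]: "a' \<in> carrier G"
      using 1 partial_characterD(1)[OF S] by auto
    have "inv a = inv a' \<otimes> x [^] (- k)"
      unfolding 1 using x by (simp add: inv_mult int_pow_neg)
    moreover have "inverse b = inverse b' * z powi (- k)"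
      unfolding 1 by (simp add: power_int_minus)
    ultimately show "(inv a, inverse b) \<in> S'"
      using S'I[OF partial_characterD(5)[OF S 1(1)], of "- k"] by simp
  next
    fix b
    assume "(\<one>, b) \<in> S'"
    then obtain a' b' k where
      1: "(a', b') \<in> S" "\<one> = a' \<otimes> x [^] (k::int)" "b = b' * z powi k"
      unfolding S'_def by auto
    have [simp]: "a' \<in> carrier G"
      using 1 partial_characterD(1)[OF S] by auto
    have "inv a' = x [^] k"
      using 1(2) x by (simp add: inv_equality m_comm)
    then have "inverse b' = z powi k"
      using ext partial_characterD(5)[OF S 1(1)] by simp
    then show "b = 1"
      using 1 partial_characterD(2)[OF S 1(1)] by (metis right_inverse)
  qed
  moreover have "S \<subseteq> S'"
  proof (rule subrelI)
    fix a b
    assume ab: "(a, b) \<in> S"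
    show "(a, b) \<in> S'"
      using S'I[OF ab, of 0] partial_characterD(1)[OF S ab] by simp
  qed
  moreover have "(x, z) \<in> S'"
    using S'I[OF partial_characterD(3)[OF S], of 1] x by simp
  ultimately show ?thesis
    by (intro exI[of _ S']) simp
qed

text \<open>By Zorn's lemma it is enough to extend to one more element \<open>x\<close>. If \<open>x\<^sup>n\<close> is the least positive power
  of \<open>x\<close> in the domain, the value at \<open>x\<close> can be any \<open>n\<close>-th root of the value at \<open>x\<^sup>n\<close>; if there is no such
  power, the value is arbitrary.\<close>

lemma partial_character_extend:
  assumes R: "partial_character G R"
  obtains \<kappa> where "\<kappa> \<in> hom G complex_units" "\<forall>(a, z)\<in>R. \<kappa> a = z"
proof -
  define \<A> where "\<A> = {S. partial_character G S \<and> R \<subseteq> S}"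
  have "\<exists>M\<in>\<A>. \<forall>S\<in>\<A>. M \<subseteq> S \<longrightarrow> S = M"
  proof (rule subset_Zorn_nonempty)
    show "\<A> \<noteq> {}"
      using R unfolding \<A>_def by blast
    fix \<C>
    assume C: "\<C> \<noteq> {}" "subset.chain \<A> \<C>"
    then have mem: "partial_character G S" "R \<subseteq> S" if "S \<in> \<C>" for S
      using that unfolding subset.chain_def \<A>_def by auto
    have cmp: "S \<subseteq> S' \<or> S' \<subseteq> S" if "S \<in> \<C>" "S' \<in> \<C>" for S S'
      using C(2) that unfolding subset_chain_def by blast
    obtain S0 where S0: "S0 \<in> \<C>"
      using C by blast
    have "partial_character G (\<Union>\<C>)"
      unfolding partial_character_def
    proof (intro conjI allI impI)
      show "\<Union>\<C> \<subseteq> carrier G \<times> (UNIV - {0})"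
        using mem(1) unfolding partial_character_def by blast
      show "(\<one>, 1) \<in> \<Union>\<C>"
        using partial_characterD(3)[OF mem(1)[OF S0]] S0 by blast
    next
      fix a z b w
      assume "(a, z) \<in> \<Union>\<C>" "(b, w) \<in> \<Union>\<C>"
      then obtain S S' where S: "S \<in> \<C>" "(a, z) \<in> S" and S': "S' \<in> \<C>" "(b, w) \<in> S'"
        by blast
      show "(a \<otimes> b, z * w) \<in> \<Union>\<C>"
      proof (cases "S \<subseteq> S'")
        case True
        then show ?thesis
          using partial_characterD(4)[OF mem(1)[OF S'(1)], of a z b w] S S' by blast
      next
        case False
        then have "S' \<subseteq> S"
          using cmp S S' by blast
        then show ?thesis
          using partial_characterD(4)[OF mem(1)[OF S(1)], of a z b w] S S' by blast
      qed
    next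
      fix a z
      assume "(a, z) \<in> \<Union>\<C>"
      then show "(inv a, inverse z) \<in> \<Union>\<C>"
        using partial_characterD(5)[OF mem(1)] by blast
    next
      fix z
      assume "(\<one>, z) \<in> \<Union>\<C>"
      then show "z = 1"
        using partial_characterD(6)[OF mem(1)] by blast
    qed
    then show "\<Union>\<C> \<in> \<A>"
      unfolding \<A>_def using mem(2) S0 by blast
  qed
  then obtain S where S': "S \<in> \<A>" "\<forall>S'\<in>\<A>. S \<subseteq> S' \<longrightarrow> S' = S"
    by (rule bexE)
  then have S: "partial_character G S" "R \<subseteq> S"
    by (simp_all add: \<A>_def)
  have max: "S' = S" if "partial_character G S'" "S \<subseteq> S'" for S'
    using S' that by (auto simp: \<A>_def)
  have total: "x \<in> fst ` S" if x: "x \<in> carrier G" for x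
  proof -
    define D where "D k \<longleftrightarrow> x [^] (k::int) \<in> fst ` S" for k
    have DE: "\<exists>w. (x [^] k, w) \<in> S" if "D k" for k
      using that unfolding D_def by force
    have "\<exists>z. z \<noteq> 0 \<and> (\<forall>k w. (x [^] (k::int), w) \<in> S \<longrightarrow> w = z powi k)"
    proof (cases "\<exists>n::nat. n > 0 \<and> D (int n)")
      case True
      define n where "n = (LEAST n::nat. n > 0 \<and> D (int n))"
      have n: "n > 0" "D (int n)"
        using LeastI_ex[OF True] unfolding n_def by auto
      have least: "D (int m) \<Longrightarrow> m > 0 \<Longrightarrow> n \<le> m" for m
        unfolding n_def by (rule Least_le) simp
      obtain w where w: "(x [^] int n, w) \<in> S"
        using DE[OF n(2)] by blast
      obtain z where z: "w = z ^ n"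
        using exists_complex_root[of n w] n by auto
      have z0: "z \<noteq> 0"
        using z partial_characterD(2)[OF S(1) w] n by (cases "z = 0") simp_all
      have "u = z powi k" if u: "(x [^] k, u) \<in> S" for k u
      proof -
        define q r where "q = k div int n" and "r = k mod int n"
        have k: "k = int n * q + r"
          by (simp add: q_def r_def)
        have p: "(x [^] (int n * - q), w powi (- q)) \<in> S"
          using partial_character_pow[OF S(1) w, of "- q"] x by (simp add: int_pow_pow)
        have "(x [^] (k + int n * - q), u * w powi (- q)) \<in> S"
          using partial_characterD(4)[OF S(1) u p] unfolding int_pow_mult[OF x] .
        then have mem: "(x [^] r, u * w powi (- q)) \<in> S"
          by (simp add: k)
        have "r = 0"
        proof (rule ccontr)
          assume "r \<noteq> 0"
          moreover have "0 \<le> r" "r < int n"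
            using n by (simp_all add: r_def)
          moreover have "D (int (nat r))"
            using mem \<open>0 \<le> r\<close> unfolding D_def by force
          ultimately show False
            using least[of "nat r"] by linarith
        qed
        then have "u * w powi (- q) = 1"
          using mem partial_characterD(6)[OF S(1)] by simp
        then have "u = w powi q"
          using partial_characterD(2)[OF S(1) w]
          by (simp add: power_int_minus field_simps)
        also have "\<dots> = z powi k"
          using \<open>r = 0\<close> by (simp add: z k power_int_mult)
        finally show ?thesis .
      qed
      then show ?thesis
        using z0 by (intro exI[of _ z]) simp
    next
      case False
      have "w = 1 powi k" if w: "(x [^] k, w) \<in> S" for k :: int and w
      proof -
        have "D k" "D (- k)"
          using w partial_characterD(5)[OF S(1) w] x unfolding D_def
          by (force simp: int_pow_neg)+
        then have "k = 0"
          using False by (metis int_eq_iff nat_eq_iff neg_0_le_iff_le nle_le not_gr_zero of_nat_0 neg_equal_0_iff_equal)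
        then show ?thesis
          using w partial_characterD(6)[OF S(1)] by simp
      qed
      then show ?thesis
        by (intro exI[of _ 1]) simp
    qed
    then obtain z where z: "z \<noteq> 0" "\<forall>k w. (x [^] (k::int), w) \<in> S \<longrightarrow> w = z powi k"
      by (elim exE conjE)
    obtain S' where S': "partial_character G S'" "S \<subseteq> S'" "(x, z) \<in> S'"
      using partial_character_adjoin[OF S(1) x z(1)] z(2) by blast
    have "(x, z) \<in> S"
      using max[OF S'(1,2)] S'(3) by simp
    then show ?thesis
      by force
  qed
  define \<kappa> where "\<kappa> a = (THE z. (a, z) \<in> S)" for a
  have \<kappa>: "\<kappa> a = z" if "(a, z) \<in> S" for a z
    unfolding \<kappa>_def using that partial_character_unique[OF S(1) _ that] by (intro the_equality)
  have "(a, \<kappa> a) \<in> S" if "a \<in> carrier G" for a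
    using total[OF that] \<kappa> by force
  then have "\<kappa> \<in> hom G complex_units"
    using partial_characterD(2,4)[OF S(1)] \<kappa>
    by (intro homI) (auto simp: complex_units_def)
  then show ?thesis
    by (rule that) (use \<kappa> S(2) in blast)
qed

lemma exists_character_nontrivial:
  assumes x: "x \<in> carrier G" "x \<noteq> \<one>"
  obtains \<kappa> where "\<kappa> \<in> hom G complex_units" "\<kappa> x \<noteq> 1"
proof -
  have triv: "partial_character G {(\<one>, 1)}"
    unfolding partial_character_def by auto
  \<comment> \<open>The order is 0 for elements of infinite order; these may take any value other than 1.\<close>
  define z :: complex where "z = (if ord x = 0 then 2 else cis (2 * pi / ord x))"
  have "ord x \<noteq> 1"
    using x ord_eq_1 by blast
  have z1: "z \<noteq> 1"
  proof (cases "ord x = 0")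
    case False
    then have "1 < ord x"
      using \<open>ord x \<noteq> 1\<close> by linarith
    then show ?thesis
      using complex_root_unity_eq_1[of "ord x" 1] by (simp add: z_def cis_conv_exp mult_ac)
  qed (simp add: z_def)
  have zord: "z ^ ord x = 1"
    by (auto simp: z_def Complex.DeMoivre)
  have ext: "w = z powi k" if "(x [^] k, w) \<in> {(\<one>, 1)}" for k :: int and w
  proof -
    have "int (ord x) dvd k" "w = 1"
      using that x int_pow_eq_id by auto
    then show ?thesis
      using zord by (auto simp: dvd_def power_int_mult)
  qed
  have "z \<noteq> 0"
    by (simp add: z_def)
  then obtain S where S: "partial_character G S" "(x, z) \<in> S"
    using partial_character_adjoin[OF triv x(1) _ ext] by blast
  obtain \<kappa> where \<kappa>: "\<kappa> \<in> hom G complex_units" "\<forall>(a, z)\<in>S. \<kappa> a = z"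
    by (rule partial_character_extend[OF S(1)])
  show ?thesis
    by (rule that[OF \<kappa>(1)]) (use \<kappa>(2) S(2) z1 in auto)
qed

end

context group
begin

lemma normal_if_derived_subset:
  assumes M: "subgroup M G" and der: "derived G (carrier G) \<subseteq> M"
  shows "M \<lhd> G"
  unfolding normal_inv_iff
proof (intro conjI ballI M)
  fix x h
  assume x: "x \<in> carrier G" and h: "h \<in> M"
  have hG: "h \<in> carrier G"
    using h M subgroup.subset by blast
  have "x \<otimes> h \<otimes> inv x \<otimes> inv h \<in> derived G (carrier G)"
    unfolding derived_def by (rule generate.incl) (use x hG in blast)
  then have "x \<otimes> h \<otimes> inv x \<otimes> inv h \<otimes> h \<in> M"
    using der h M by (meson subgroup.m_closed subsetD)
  then show "x \<otimes> h \<otimes> inv x \<in> M"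
    using x hG by (simp add: m_assoc)
qed

lemma comm_group_FactGroup:
  assumes M: "M \<lhd> G" and der: "derived G (carrier G) \<subseteq> M"
  shows "comm_group (G Mod M)"
proof -
  interpret M: normal M G
    by (rule M)
  interpret Q: group "G Mod M"
    by (rule M.factorgroup_is_group)
  show ?thesis
  proof (rule Q.group_comm_groupI)
    fix a b
    assume "a \<in> carrier (G Mod M)" "b \<in> carrier (G Mod M)"
    then obtain x y where xy: "x \<in> carrier G" "y \<in> carrier G" "a = M #> x" "b = M #> y"
      by (auto simp: carrier_FactGroup)
    have "x \<otimes> y \<otimes> inv x \<otimes> inv y \<in> derived G (carrier G)"
      unfolding derived_def by (rule generate.incl) (use xy in blast)
    then have "x \<otimes> y \<otimes> inv x \<otimes> inv y \<in> M"
      using der by blast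
    then have "(x \<otimes> y \<otimes> inv x \<otimes> inv y) \<otimes> (y \<otimes> x) \<in> M #> (y \<otimes> x)"
      unfolding r_coset_def by blast
    moreover have "(x \<otimes> y \<otimes> inv x \<otimes> inv y) \<otimes> (y \<otimes> x) = x \<otimes> y"
      using xy by (simp add: m_assoc flip: m_assoc[of "inv y" y x])
    ultimately have "M #> (x \<otimes> y) = M #> (y \<otimes> x)"
      using xy M.is_subgroup repr_independence by (metis m_closed)
    then show "a \<otimes>\<^bsub>G Mod M\<^esub> b = b \<otimes>\<^bsub>G Mod M\<^esub> a"
      using xy by (simp add: M.rcos_sum)
  qed
qed

lemma characters_modD:
  assumes "\<kappa> \<in> characters_mod G H H'"
  shows "x \<in> H \<Longrightarrow> \<kappa> x \<noteq> 0" "x \<in> H \<Longrightarrow> y \<in> H \<Longrightarrow> \<kappa> (x \<otimes> y) = \<kappa> x * \<kappa> y"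
    "x \<in> H' \<Longrightarrow> \<kappa> x = 1" "\<kappa> \<in> extensional H"
  using assms unfolding characters_mod_def complex_units_def hom_def by auto

lemma characters_modI:
  assumes "\<And>x. x \<in> H \<Longrightarrow> \<kappa> x \<noteq> 0" "\<And>x y. x \<in> H \<Longrightarrow> y \<in> H \<Longrightarrow> \<kappa> (x \<otimes> y) = \<kappa> x * \<kappa> y"
    "\<And>x. x \<in> H' \<Longrightarrow> \<kappa> x = 1" "\<kappa> \<in> extensional H"
  shows "\<kappa> \<in> characters_mod G H H'"
  using assms unfolding characters_mod_def complex_units_def hom_def by auto

lemma characters_mod_inv:
  assumes \<kappa>: "\<kappa> \<in> characters_mod G H H'" and H: "subgroup H G" and x: "x \<in> H"
  shows "\<kappa> \<one> = 1" "\<kappa> (inv x) = inverse (\<kappa> x)"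
proof -
  have "\<one> \<in> H" "inv x \<in> H" "x \<in> carrier G"
    using H x by (auto simp: subgroup.one_closed subgroup.m_inv_closed subgroup.mem_carrier)
  then show one: "\<kappa> \<one> = 1"
    using characters_modD(2)[OF \<kappa>, of \<one> \<one>] characters_modD(1)[OF \<kappa>, of \<one>] by simp
  have "\<kappa> (inv x) * \<kappa> x = 1"
    using characters_modD(2)[OF \<kappa> \<open>inv x \<in> H\<close> x] one \<open>x \<in> carrier G\<close> by simp
  then show "\<kappa> (inv x) = inverse (\<kappa> x)"
    using inverse_unique[of "\<kappa> x" "\<kappa> (inv x)"] by (simp add: mult.commute)
qed

lemma character_of_FactGroup:
  assumes M: "M \<lhd> G" and \<kappa>: "\<kappa> \<in> hom (G Mod M) complex_units"
  shows "(\<lambda>g\<in>carrier G. \<kappa> (M #> g)) \<in> characters_mod G (carrier G) M"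
proof -
  interpret M: normal M G
    by (rule M)
  have mem: "M #> g \<in> carrier (G Mod M)" if "g \<in> carrier G" for g
    using that by (auto simp: carrier_FactGroup)
  have nz: "\<kappa> q \<noteq> 0" and mult: "q' \<in> carrier (G Mod M) \<Longrightarrow> \<kappa> (q <#> q') = \<kappa> q * \<kappa> q'"
    if "q \<in> carrier (G Mod M)" for q q'
    using \<kappa> that unfolding hom_def complex_units_def by auto
  have "\<kappa> M = 1"
  proof -
    have M': "M \<in> carrier (G Mod M)"
      using mem[OF one_closed] M.subset by simp
    have "M <#> M = M"
      by (rule subgroup_mult_id[OF M.is_subgroup])
    then show ?thesis
      using mult[OF M' M'] nz[OF M'] by simp
  qed
  then show ?thesis
    using nz mult mem M.subset
    by (intro characters_modI) (auto simp: M.rcos_sum[symmetric] M.rcos_const subset_iff)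
qed

text \<open>The character \<open>\<theta>\<close> defines a character on the image of \<open>D\<close> in the abelian group \<open>G/M\<close>, which extends.\<close>

lemma character_extend:
  assumes M: "M \<lhd> G" and der: "derived G (carrier G) \<subseteq> M"
    and D: "subgroup D G" and \<theta>: "\<theta> \<in> characters_mod G D (D \<inter> M)"
  obtains \<kappa> where "\<kappa> \<in> characters_mod G (carrier G) M" "\<forall>d\<in>D. \<kappa> d = \<theta> d"
proof -
  interpret M: normal M G
    by (rule M)
  interpret Q: comm_group "G Mod M"
    by (rule comm_group_FactGroup[OF M der])
  have DG: "d \<in> carrier G" if "d \<in> D" for d
    using that D subgroup.subset by blast
  define R where "R = (\<lambda>d. (M #> d, \<theta> d)) ` D"
  have R: "partial_character (G Mod M) R"
    unfolding partial_character_def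
  proof (intro conjI allI impI)
    show "R \<subseteq> carrier (G Mod M) \<times> (UNIV - {0})"
      unfolding R_def using characters_modD(1)[OF \<theta>] DG by (auto simp: carrier_FactGroup)
    show "(\<one>\<^bsub>G Mod M\<^esub>, 1) \<in> R"
      unfolding R_def
      using subgroup.one_closed[OF D] characters_mod_inv(1)[OF \<theta> D] M.subset
      by (force intro!: image_eqI[where x = \<one>])
  next
    fix a z b w
    assume "(a, z) \<in> R" "(b, w) \<in> R"
    then obtain d e where de: "d \<in> D" "e \<in> D" "a = M #> d" "z = \<theta> d" "b = M #> e" "w = \<theta> e"
      unfolding R_def by auto
    then have "(a \<otimes>\<^bsub>G Mod M\<^esub> b, z * w) = (M #> (d \<otimes> e), \<theta> (d \<otimes> e))"
      using DG characters_modD(2)[OF \<theta>] by (simp add: M.rcos_sum)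
    then show "(a \<otimes>\<^bsub>G Mod M\<^esub> b, z * w) \<in> R"
      unfolding R_def using subgroup.m_closed[OF D de(1,2)] by (intro image_eqI)
  next
    fix a z
    assume "(a, z) \<in> R"
    then obtain d where d: "d \<in> D" "a = M #> d" "z = \<theta> d"
      unfolding R_def by auto
    then have "(inv\<^bsub>G Mod M\<^esub> a, inverse z) = (M #> inv d, \<theta> (inv d))"
      using DG characters_mod_inv(2)[OF \<theta> D]
      by (simp add: M.inv_FactGroup M.rcos_inv carrier_FactGroup)
    then show "(inv\<^bsub>G Mod M\<^esub> a, inverse z) \<in> R"
      unfolding R_def using subgroup.m_inv_closed[OF D d(1)] by (intro image_eqI)
  next
    fix z
    assume "(\<one>\<^bsub>G Mod M\<^esub>, z) \<in> R"
    then obtain d where d: "d \<in> D" "M = M #> d" "z = \<theta> d"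
      unfolding R_def by auto
    then have "d \<in> M"
      using rcos_self[OF DG[OF d(1)] M.is_subgroup] by simp
    then show "z = 1"
      using characters_modD(3)[OF \<theta>] d by simp
  qed
  obtain \<kappa> where \<kappa>: "\<kappa> \<in> hom (G Mod M) complex_units" "\<forall>(a, z)\<in>R. \<kappa> a = z"
    by (rule Q.partial_character_extend[OF R])
  show ?thesis
  proof (rule that[OF character_of_FactGroup[OF M \<kappa>(1)]], intro ballI)
    fix d
    assume d: "d \<in> D"
    have "\<kappa> (M #> d) = \<theta> d"
      using \<kappa>(2) d by (auto simp: R_def)
    then show "(\<lambda>g\<in>carrier G. \<kappa> (M #> g)) d = \<theta> d"
      using DG[OF d] by simp
  qed
qed

lemma exists_character_nontrivial_mod:
  assumes M: "M \<lhd> G" and der: "derived G (carrier G) \<subseteq> M"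
    and x: "x \<in> carrier G" "x \<notin> M"
  obtains \<kappa> where "\<kappa> \<in> characters_mod G (carrier G) M" "\<kappa> x \<noteq> 1"
proof -
  interpret M: normal M G
    by (rule M)
  interpret Q: comm_group "G Mod M"
    by (rule comm_group_FactGroup[OF M der])
  have "M #> x \<in> carrier (G Mod M)" "M #> x \<noteq> \<one>\<^bsub>G Mod M\<^esub>"
    using x rcos_self[OF x(1) M.is_subgroup] by (auto simp: carrier_FactGroup)
  then obtain \<kappa> where \<kappa>: "\<kappa> \<in> hom (G Mod M) complex_units" "\<kappa> (M #> x) \<noteq> 1"
    by (rule Q.exists_character_nontrivial)
  show ?thesis
    by (rule that[OF character_of_FactGroup[OF M \<kappa>(1)]]) (use \<kappa>(2) x in simp)
qed

end

section \<open>Sums over cosets and averaging\<close>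

text \<open>A sum over the values of \<open>f\<close>, that is over the cosets when \<open>f\<close> sends an element to its coset. The
  intended \<open>q\<close> are constant on the fibers of \<open>f\<close>, so that the choice of representatives is immaterial.\<close>

definition fiber_sum :: "('a \<Rightarrow> 'c) \<Rightarrow> 'a set \<Rightarrow> ('a \<Rightarrow> 'v) \<Rightarrow> 'v::comm_monoid_add" where
  "fiber_sum f S q = (\<Sum>c\<in>f ` S. q (SOME x. x \<in> S \<and> f x = c))"

lemma fiber_sum_choice:
  assumes "c \<in> f ` S"
  shows "(SOME x. x \<in> S \<and> f x = c) \<in> S" "f (SOME x. x \<in> S \<and> f x = c) = c"
proof -
  have "\<exists>x. x \<in> S \<and> f x = c"
    using assms by auto
  then have "(SOME x. x \<in> S \<and> f x = c) \<in> S \<and> f (SOME x. x \<in> S \<and> f x = c) = c"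
    by (rule someI_ex)
  then show "(SOME x. x \<in> S \<and> f x = c) \<in> S" "f (SOME x. x \<in> S \<and> f x = c) = c"
    by blast+
qed

lemma fiber_sum_cong:
  assumes "\<And>x. x \<in> S \<Longrightarrow> q x = q' x"
  shows "fiber_sum f S q = fiber_sum f S q'"
  unfolding fiber_sum_def by (intro sum.cong refl assms fiber_sum_choice)

lemma fiber_sum_reindex:
  assumes h: "\<And>x. x \<in> S \<Longrightarrow> h x \<in> S'" and surj: "\<And>y. y \<in> S' \<Longrightarrow> \<exists>x\<in>S. f' (h x) = f' y"
    and iff: "\<And>x y. x \<in> S \<Longrightarrow> y \<in> S \<Longrightarrow> f x = f y \<longleftrightarrow> f' (h x) = f' (h y)"
    and q: "\<And>x y. x \<in> S' \<Longrightarrow> y \<in> S' \<Longrightarrow> f' x = f' y \<Longrightarrow> q x = q y"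
  shows "fiber_sum f' S' q = fiber_sum f S (\<lambda>x. q (h x))"
  unfolding fiber_sum_def
proof (rule sum.reindex_bij_witness
    [where i = "\<lambda>c. f' (h (SOME x. x \<in> S \<and> f x = c))"
       and j = "\<lambda>d. f (SOME x. x \<in> S \<and> f' (h x) = d)"])
  fix d
  assume "d \<in> f' ` S'"
  then have "\<exists>x. x \<in> S \<and> f' (h x) = d"
    using surj by blast
  then have x: "(SOME x. x \<in> S \<and> f' (h x) = d) \<in> S"
      "f' (h (SOME x. x \<in> S \<and> f' (h x) = d)) = d"
    by (metis (mono_tags, lifting) someI_ex)+
  define x where "x = (SOME x. x \<in> S \<and> f' (h x) = d)"
  have xS: "x \<in> S" "f' (h x) = d"
    using x unfolding x_def .
  then have fx: "f x \<in> f ` S"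
    by blast
  define z where "z = (SOME z. z \<in> S \<and> f z = f x)"
  have z: "z \<in> S" "f z = f x"
    unfolding z_def using fiber_sum_choice[OF fx] .
  then have hz: "f' (h z) = d"
    using iff xS by simp
  show "f' (h (SOME z. z \<in> S \<and> f z = f (SOME x. x \<in> S \<and> f' (h x) = d))) = d"
    using hz unfolding z_def x_def .
  show "f (SOME x. x \<in> S \<and> f' (h x) = d) \<in> f ` S"
    using fx unfolding x_def .
  have "q (h z) = q (SOME y. y \<in> S' \<and> f' y = d)"
    using hz fiber_sum_choice[OF \<open>d \<in> f' ` S'\<close>] h[OF z(1)] by (intro q) auto
  then show "q (h (SOME z. z \<in> S \<and> f z = f (SOME x. x \<in> S \<and> f' (h x) = d))) =
      q (SOME y. y \<in> S' \<and> f' y = d)"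
    unfolding z_def x_def .
next
  fix c
  assume c: "c \<in> f ` S"
  define x where "x = (SOME x. x \<in> S \<and> f x = c)"
  have x: "x \<in> S" "f x = c"
    unfolding x_def using fiber_sum_choice[OF c] .
  have "\<exists>y. y \<in> S \<and> f' (h y) = f' (h x)"
    using x by blast
  then have "(SOME y. y \<in> S \<and> f' (h y) = f' (h x)) \<in> S \<and>
      f' (h (SOME y. y \<in> S \<and> f' (h y) = f' (h x))) = f' (h x)"
    by (rule someI_ex)
  then have "f (SOME y. y \<in> S \<and> f' (h y) = f' (h x)) = c"
    using iff x by blast
  then show "f (SOME y. y \<in> S \<and> f' (h y) = f' (h (SOME x. x \<in> S \<and> f x = c))) = c"
    unfolding x_def .
  show "f' (h (SOME x. x \<in> S \<and> f x = c)) \<in> f' ` S'"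
    using h[OF x(1)] unfolding x_def by blast
qed

lemma fiber_sum_mono_neutral:
  assumes S: "S \<subseteq> S'" "finite (f ` S')"
    and q: "\<And>x y. x \<in> S' \<Longrightarrow> y \<in> S' \<Longrightarrow> f x = f y \<Longrightarrow> q x = q y"
    and 0: "\<And>x. x \<in> S' \<Longrightarrow> f x \<notin> f ` S \<Longrightarrow> q x = 0"
  shows "fiber_sum f S' q = fiber_sum f S q"
proof -
  have "fiber_sum f S' q = (\<Sum>c\<in>f ` S. q (SOME x. x \<in> S' \<and> f x = c))"
    unfolding fiber_sum_def
  proof (rule sum.mono_neutral_right)
    show "\<forall>c\<in>f ` S' - f ` S. q (SOME x. x \<in> S' \<and> f x = c) = 0"
    proof
      fix c
      assume c: "c \<in> f ` S' - f ` S"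
      then have "c \<in> f ` S'"
        by blast
      from fiber_sum_choice[OF this] c show "q (SOME x. x \<in> S' \<and> f x = c) = 0"
        by (intro 0) auto
    qed
  qed (use S in auto)
  also have "\<dots> = fiber_sum f S q"
    unfolding fiber_sum_def
  proof (rule sum.cong[OF refl])
    fix c
    assume c: "c \<in> f ` S"
    then have c': "c \<in> f ` S'"
      using S by blast
    show "q (SOME x. x \<in> S' \<and> f x = c) = q (SOME x. x \<in> S \<and> f x = c)"
      using fiber_sum_choice[OF c] fiber_sum_choice[OF c'] S by (intro q) auto
  qed
  finally show ?thesis .
qed

lemma fiber_sum_add: "fiber_sum f S (\<lambda>x. q x + q' x) = fiber_sum f S q + fiber_sum f S q'"
  unfolding fiber_sum_def by (rule sum.distrib)

lemma fiber_sum_scale: "fiber_sum f S (\<lambda>x. c *\<^sub>C q x) = c *\<^sub>C fiber_sum f S q"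
  unfolding fiber_sum_def by (simp add: cvs.scale_sum_right)

lemma fiber_sum_const:
  fixes a :: "'v::complex_vector_space"
  shows "fiber_sum f S (\<lambda>x. a) = of_nat (card (f ` S)) *\<^sub>C a"
proof -
  have "(\<Sum>c\<in>I. a) = of_nat (card I) *\<^sub>C a" for I :: "'c set"
    by (induction I rule: infinite_finite_induct) (simp_all add: scaleC_add_left scaleC_one add.commute)
  then show ?thesis
    unfolding fiber_sum_def .
qed

lemma linear_mapsD:
  assumes "f \<in> linear_maps V W"
  shows "v \<in> V \<Longrightarrow> f v \<in> W" "v \<in> V \<Longrightarrow> w \<in> V \<Longrightarrow> f (v + w) = f v + f w"
    "v \<in> V \<Longrightarrow> f (c *\<^sub>C v) = c *\<^sub>C f v"
  using assms by (simp_all add: linear_maps_def)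

lemma linear_mapsI:
  assumes "\<And>v. v \<in> V \<Longrightarrow> f v \<in> W" "\<And>v w. v \<in> V \<Longrightarrow> w \<in> V \<Longrightarrow> f (v + w) = f v + f w"
    "\<And>c v. v \<in> V \<Longrightarrow> f (c *\<^sub>C v) = c *\<^sub>C f v"
  shows "f \<in> linear_maps V W"
  using assms by (simp add: linear_maps_def)

lemma linear_maps_0:
  assumes "f \<in> linear_maps V W" "cvs.subspace V"
  shows "f 0 = 0"
  using linear_mapsD(3)[OF assms(1) cvs.subspace_0[OF assms(2)], of 0] by simp

lemma linear_maps_sum:
  assumes f: "f \<in> linear_maps V W" and V: "cvs.subspace V" and q: "\<And>i. i \<in> I \<Longrightarrow> q i \<in> V"
  shows "f (\<Sum>i\<in>I. q i) = (\<Sum>i\<in>I. f (q i))"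
  using q
proof (induction I rule: infinite_finite_induct)
  case (insert i I)
  have "(\<Sum>i\<in>I. q i) \<in> V"
    using insert.prems V by (intro cvs.subspace_sum) auto
  then show ?case
    using insert linear_mapsD(2)[OF f] by simp
qed (use linear_maps_0[OF f V] in simp_all)

lemma linear_maps_fiber_sum:
  assumes F: "F \<in> linear_maps V W" and V: "cvs.subspace V" and q: "\<And>x. x \<in> S \<Longrightarrow> q x \<in> V"
  shows "F (fiber_sum f S q) = fiber_sum f S (\<lambda>x. F (q x))"
  unfolding fiber_sum_def by (rule linear_maps_sum[OF F V]) (rule q, rule fiber_sum_choice(1))

lemma fiber_sum_in:
  assumes V: "cvs.subspace V" and q: "\<And>x. x \<in> S \<Longrightarrow> q x \<in> V"
  shows "fiber_sum f S q \<in> V"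
  unfolding fiber_sum_def by (rule cvs.subspace_sum[OF V]) (rule q, rule fiber_sum_choice(1))

lemma fiber_sum_apply:
  fixes q :: "'a \<Rightarrow> 'b \<Rightarrow> 'v::comm_monoid_add"
  shows "fiber_sum f S q x = fiber_sum f S (\<lambda>y. q y x)"
proof -
  have "sum p I x = (\<Sum>i\<in>I. p i x)" for I :: "'c set" and p :: "'c \<Rightarrow> 'b \<Rightarrow> 'v"
    by (induction I rule: infinite_finite_induct) simp_all
  then show ?thesis
    unfolding fiber_sum_def by (rule trans) (rule refl)
qed

lemma fiber_sum_swap:
  "(\<Sum>i\<in>I. fiber_sum f S (q i)) = fiber_sum f S (\<lambda>x. \<Sum>i\<in>I. q i x)"
  unfolding fiber_sum_def by (rule sum.swap)

lemma finite_image_coarser: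
  assumes "finite (f ` S)" "\<And>x y. x \<in> S \<Longrightarrow> y \<in> S \<Longrightarrow> f x = f y \<Longrightarrow> g x = g y"
  shows "finite (g ` S)"
proof -
  have "g ` S \<subseteq> (\<lambda>c. g (SOME x. x \<in> S \<and> f x = c)) ` f ` S"
  proof
    fix z
    assume "z \<in> g ` S"
    then obtain x where x: "x \<in> S" "z = g x"
      by blast
    then have fx: "f x \<in> f ` S"
      by blast
    have "g (SOME y. y \<in> S \<and> f y = f x) = z"
      unfolding x(2) by (rule assms(2)[OF fiber_sum_choice(1)[OF fx] x(1) fiber_sum_choice(2)[OF fx]])
    then show "z \<in> (\<lambda>c. g (SOME x. x \<in> S \<and> f x = c)) ` f ` S"
      using fx by (rule image_eqI[OF sym])
  qed
  then show ?thesis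
    using assms(1) finite_subset by blast
qed

context group
begin

definition finite_index :: "'a set \<Rightarrow> 'a set \<Rightarrow> bool" where
  "finite_index L H \<longleftrightarrow> finite ((\<lambda>x. x <# L) ` H)"

lemma l_coset_eq_iff:
  assumes L: "subgroup L G" and x: "x \<in> carrier G" and y: "y \<in> carrier G"
  shows "x <# L = y <# L \<longleftrightarrow> inv x \<otimes> y \<in> L"
proof
  assume "x <# L = y <# L"
  then have "y \<in> x <# L"
    using subgroup.one_closed[OF L] y unfolding l_coset_def by force
  then obtain l where "l \<in> L" "y = x \<otimes> l"
    unfolding l_coset_def by blast
  then show "inv x \<otimes> y \<in> L"
    using x subgroup.mem_carrier[OF L] by (simp add: m_assoc[symmetric])
next
  assume l: "inv x \<otimes> y \<in> L"
  then have "(inv x \<otimes> y) <# L = L"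
    by (simp add: coset_join3[OF _ L] subgroup.mem_carrier[OF L])
  then have "x <# L = x <# ((inv x \<otimes> y) <# L)"
    by simp
  also have "\<dots> = (x \<otimes> (inv x \<otimes> y)) <# L"
    using x y subgroup.subset[OF L] by (intro lcos_m_assoc) auto
  also have "x \<otimes> (inv x \<otimes> y) = y"
    using x y by (simp add: m_assoc[symmetric])
  finally show "x <# L = y <# L" .
qed

lemma r_coset_eq_iff:
  assumes L: "subgroup L G" and x: "x \<in> carrier G" and y: "y \<in> carrier G"
  shows "L #> x = L #> y \<longleftrightarrow> y \<otimes> inv x \<in> L"
proof
  assume "L #> x = L #> y"
  then have "y \<in> L #> x"
    using rcos_self[OF y L] by simp
  then obtain l where "l \<in> L" "y = l \<otimes> x"
    unfolding r_coset_def by blast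
  then show "y \<otimes> inv x \<in> L"
    using x subgroup.mem_carrier[OF L] by (simp add: m_assoc)
next
  assume l: "y \<otimes> inv x \<in> L"
  have "y = (y \<otimes> inv x) \<otimes> x"
    using x y by (simp add: m_assoc)
  then have "y \<in> L #> x"
    using l unfolding r_coset_def by blast
  then show "L #> x = L #> y"
    by (rule repr_independence[OF _ x L])
qed

lemma finite_index_mono:
  assumes "finite_index L H" "subgroup L G" "subgroup L' G" "L \<inter> H \<subseteq> L'" "H' \<subseteq> H" "subgroup H G"
  shows "finite_index L' H'"
proof -
  have "finite ((\<lambda>x. x <# L') ` H)"
    using assms(1) unfolding finite_index_def
  proof (rule finite_image_coarser)
    fix x y
    assume xy: "x \<in> H" "y \<in> H" "x <# L = y <# L"
    then have "x \<in> carrier G" "y \<in> carrier G"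
      by (simp_all add: subgroup.mem_carrier[OF assms(6)])
    moreover have "inv x \<otimes> y \<in> H"
      using xy assms(6) by (simp add: subgroup.m_closed subgroup.m_inv_closed)
    ultimately show "x <# L' = y <# L'"
      using xy(3) assms(4) l_coset_eq_iff[OF assms(2)] l_coset_eq_iff[OF assms(3)] by auto
  qed
  then show ?thesis
    unfolding finite_index_def by (rule finite_subset[rotated]) (use assms(5) in blast)
qed

lemma coset_sum_left_translate:
  assumes H: "subgroup H G" and L: "subgroup L G" and h: "h \<in> H"
    and q: "\<And>x y. x \<in> H \<Longrightarrow> y \<in> H \<Longrightarrow> x <# L = y <# L \<Longrightarrow> q x = q y"
  shows "fiber_sum (\<lambda>x. x <# L) H q = fiber_sum (\<lambda>x. x <# L) H (\<lambda>x. q (h \<otimes> x))"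
proof (rule fiber_sum_reindex)
  have HG: "x \<in> carrier G" if "x \<in> H" for x
    by (rule subgroup.mem_carrier[OF H that])
  show "h \<otimes> x \<in> H" if "x \<in> H" for x
    using H h that by (simp add: subgroup.m_closed)
  show "\<exists>x\<in>H. h \<otimes> x <# L = y <# L" if "y \<in> H" for y
  proof
    show "inv h \<otimes> y \<in> H"
      using H h that by (simp add: subgroup.m_closed subgroup.m_inv_closed)
    show "h \<otimes> (inv h \<otimes> y) <# L = y <# L"
      using HG[OF h] HG[OF that] by (simp add: m_assoc[symmetric])
  qed
  show "x <# L = y <# L \<longleftrightarrow> h \<otimes> x <# L = h \<otimes> y <# L" if "x \<in> H" "y \<in> H" for x y
  proof -
    have "inv (h \<otimes> x) \<otimes> (h \<otimes> y) = inv x \<otimes> y"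
      using HG[OF h] HG[OF that(1)] HG[OF that(2)]
      by (simp add: inv_mult_group m_assoc inv_solve_left')
    then show ?thesis
      using HG[OF h] HG[OF that(1)] HG[OF that(2)] by (simp add: l_coset_eq_iff[OF L])
  qed
  show "q x = q y" if "x \<in> H" "y \<in> H" "x <# L = y <# L" for x y
    using that by (rule q)
qed

end

section \<open>Linear representations\<close>

text \<open>The algebraic part of a smooth representation. It passes to restrictions, twists, conjugates and induced
  representations without reference to the topology.\<close>

definition linear_rep ::
    "('g, 'm) monoid_scheme \<Rightarrow> 'g set \<Rightarrow> ('g, 'v::complex_vector_space) repn \<Rightarrow> bool" where
  "linear_rep G H \<tau> \<longleftrightarrow>
     cvs.subspace (vspace \<tau>) \<and>
     (\<forall>h\<in>H. act \<tau> h \<in> linear_maps (vspace \<tau>) (vspace \<tau>)) \<and>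
     (\<forall>v\<in>vspace \<tau>. act \<tau> \<one>\<^bsub>G\<^esub> v = v) \<and>
     (\<forall>h\<in>H. \<forall>k\<in>H. \<forall>v\<in>vspace \<tau>. act \<tau> (h \<otimes>\<^bsub>G\<^esub> k) v = act \<tau> h (act \<tau> k v))"

lemma smooth_rep_iff:
  "smooth_rep G T H \<tau> \<longleftrightarrow> linear_rep G H \<tau> \<and>
     (\<forall>v\<in>vspace \<tau>. openin (subtopology T H) {h \<in> H. act \<tau> h v = v})"
  unfolding smooth_rep_def linear_rep_def linear_maps_def by blast

lemma linear_repD:
  assumes "linear_rep G H \<tau>"
  shows "cvs.subspace (vspace \<tau>)" "h \<in> H \<Longrightarrow> act \<tau> h \<in> linear_maps (vspace \<tau>) (vspace \<tau>)"
    "h \<in> H \<Longrightarrow> v \<in> vspace \<tau> \<Longrightarrow> act \<tau> h v \<in> vspace \<tau>"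
    "v \<in> vspace \<tau> \<Longrightarrow> act \<tau> \<one>\<^bsub>G\<^esub> v = v"
    "h \<in> H \<Longrightarrow> k \<in> H \<Longrightarrow> v \<in> vspace \<tau> \<Longrightarrow> act \<tau> (h \<otimes>\<^bsub>G\<^esub> k) v = act \<tau> h (act \<tau> k v)"
  using assms linear_mapsD(1)[of "act \<tau> h" "vspace \<tau>" "vspace \<tau>" v] by (simp_all add: linear_rep_def)

lemma linear_rep_subset: "linear_rep G H \<tau> \<Longrightarrow> K \<subseteq> H \<Longrightarrow> linear_rep G K \<tau>"
  unfolding linear_rep_def by blast

lemma intertwiners_iff:
  "f \<in> intertwiners H \<sigma> \<tau> \<longleftrightarrow> f \<in> linear_maps (vspace \<sigma>) (vspace \<tau>) \<and> (\<forall>v. v \<notin> vspace \<sigma> \<longrightarrow> f v = 0) \<and>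
     (\<forall>h\<in>H. \<forall>v\<in>vspace \<sigma>. f (act \<sigma> h v) = act \<tau> h (f v))"
  unfolding intertwiners_def linear_maps_def by blast

lemma intertwinersD:
  assumes "f \<in> intertwiners H \<sigma> \<tau>"
  shows "f \<in> linear_maps (vspace \<sigma>) (vspace \<tau>)" "v \<notin> vspace \<sigma> \<Longrightarrow> f v = 0"
    "h \<in> H \<Longrightarrow> v \<in> vspace \<sigma> \<Longrightarrow> f (act \<sigma> h v) = act \<tau> h (f v)"
    "v \<in> vspace \<sigma> \<Longrightarrow> f v \<in> vspace \<tau>"
  using assms linear_mapsD(1)[of f "vspace \<sigma>" "vspace \<tau>" v] unfolding intertwiners_iff by simp_all

lemma intertwinersI:
  assumes "f \<in> linear_maps (vspace \<sigma>) (vspace \<tau>)" "\<And>v. v \<notin> vspace \<sigma> \<Longrightarrow> f v = 0"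
    "\<And>h v. h \<in> H \<Longrightarrow> v \<in> vspace \<sigma> \<Longrightarrow> f (act \<sigma> h v) = act \<tau> h (f v)"
  shows "f \<in> intertwiners H \<sigma> \<tau>"
  using assms unfolding intertwiners_iff by simp

lemma intertwiners_subset: "K \<subseteq> H \<Longrightarrow> intertwiners H \<sigma> \<tau> \<subseteq> intertwiners K \<sigma> \<tau>"
  unfolding intertwiners_iff subset_iff by blast

lemma intertwiners_compose:
  assumes f: "f \<in> intertwiners H \<sigma> \<tau>" and g: "g \<in> intertwiners H \<tau> \<upsilon>"
    and \<tau>: "cvs.subspace (vspace \<tau>)"
  shows "g \<circ> f \<in> intertwiners H \<sigma> \<upsilon>"
proof (rule intertwinersI)
  show "g \<circ> f \<in> linear_maps (vspace \<sigma>) (vspace \<upsilon>)"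
    using linear_mapsD[OF intertwinersD(1)[OF f]] linear_mapsD[OF intertwinersD(1)[OF g]]
    by (intro linear_mapsI) simp_all
  show "(g \<circ> f) v = 0" if "v \<notin> vspace \<sigma>" for v
    using intertwinersD(2)[OF f that] linear_maps_0[OF intertwinersD(1)[OF g] \<tau>] by simp
qed (simp add: intertwinersD(3)[OF f] intertwinersD(3)[OF g] intertwinersD(4)[OF f])

lemma intertwiners_add:
  assumes f: "f \<in> intertwiners H \<sigma> \<tau>" "g \<in> intertwiners H \<sigma> \<tau>" and \<tau>: "linear_rep G H \<tau>"
  shows "f + g \<in> intertwiners H \<sigma> \<tau>"
  using linear_mapsD[OF intertwinersD(1)[OF f(1)]] linear_mapsD[OF intertwinersD(1)[OF f(2)]]
    intertwinersD(2,3)[OF f(1)] intertwinersD(2,3)[OF f(2)]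
    linear_mapsD(2)[OF linear_repD(2)[OF \<tau>]] linear_repD(1)[OF \<tau>]
  by (intro intertwinersI linear_mapsI) (simp_all add: cvs.subspace_add scaleC_add_right add_ac)

lemma intertwiners_scale:
  assumes f: "f \<in> intertwiners H \<sigma> \<tau>" and \<tau>: "linear_rep G H \<tau>"
  shows "c *\<^sub>C f \<in> intertwiners H \<sigma> \<tau>"
  using linear_mapsD[OF intertwinersD(1)[OF f]] intertwinersD(2,3)[OF f]
    linear_mapsD(3)[OF linear_repD(2)[OF \<tau>]] linear_repD(1)[OF \<tau>]
  by (intro intertwinersI linear_mapsI)
    (simp_all add: scaleC_fun_def cvs.subspace_scale scaleC_add_right scaleC_scaleC mult.commute)

lemma zero_intertwiner:
  assumes \<tau>: "linear_rep G H \<tau>"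
  shows "0 \<in> intertwiners H \<sigma> \<tau>"
  using linear_repD(1)[OF \<tau>] linear_maps_0[OF linear_repD(2)[OF \<tau>] linear_repD(1)[OF \<tau>]]
  by (intro intertwinersI linear_mapsI) (simp_all add: cvs.subspace_0)

context group
begin

lemma linear_rep_inverse:
  assumes \<tau>: "linear_rep G H \<tau>" and H: "subgroup H G" and h: "h \<in> H" and v: "v \<in> vspace \<tau>"
  shows "act \<tau> (inv h) (act \<tau> h v) = v" "act \<tau> h (act \<tau> (inv h) v) = v"
proof -
  have "inv h \<in> H" "h \<in> carrier G"
    using H h by (simp_all add: subgroup.m_inv_closed subgroup.mem_carrier)
  then show "act \<tau> (inv h) (act \<tau> h v) = v" "act \<tau> h (act \<tau> (inv h) v) = v"
    using linear_repD(4,5)[OF \<tau>] h v by (metis l_inv, metis r_inv)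
qed

lemma subgroup_stabilizer:
  assumes \<tau>: "linear_rep G H \<tau>" and H: "subgroup H G" and v: "v \<in> vspace \<tau>"
  shows "subgroup {h \<in> H. act \<tau> h v = v} G"
proof (rule subgroupI)
  show "{h \<in> H. act \<tau> h v = v} \<subseteq> carrier G"
    using H subgroup.subset by blast
  show "{h \<in> H. act \<tau> h v = v} \<noteq> {}"
    using subgroup.one_closed[OF H] linear_repD(4)[OF \<tau> v] by blast
  show "inv h \<in> {h \<in> H. act \<tau> h v = v}" if "h \<in> {h \<in> H. act \<tau> h v = v}" for h
    using that linear_rep_inverse(1)[OF \<tau> H _ v, of h] subgroup.m_inv_closed[OF H] by simp
  show "h \<otimes> k \<in> {h \<in> H. act \<tau> h v = v}"
    if "h \<in> {h \<in> H. act \<tau> h v = v}" "k \<in> {h \<in> H. act \<tau> h v = v}" for h k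
    using that linear_repD(5)[OF \<tau> _ _ v] subgroup.m_closed[OF H] by simp
qed

text \<open>Maschke's argument: average the conjugates of \<open>s\<close> over the finite set \<open>H/L\<close>. The last clause evaluates the
  average \<open>s' v\<close> under a linear map \<open>F\<close> that takes the same value on all terms; with the identity for \<open>F\<close> it yields
  retractions, and with a map to be split it yields sections.\<close>

lemma averaging:
  fixes \<sigma> :: "('a, 'd::complex_vector_space) repn" and \<tau> :: "('a, 'e::complex_vector_space) repn"
  assumes H: "subgroup H G" and L: "subgroup L G" "L \<subseteq> H" "finite_index L H"
    and \<sigma>: "linear_rep G H \<sigma>" and \<tau>: "linear_rep G H \<tau>"
    and s: "s \<in> linear_maps (vspace \<sigma>) (vspace \<tau>)"
    and equi: "\<And>l v. l \<in> L \<Longrightarrow> v \<in> vspace \<sigma> \<Longrightarrow> s (act \<sigma> l v) = act \<tau> l (s v)"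
  obtains s' where "s' \<in> intertwiners H \<sigma> \<tau>"
    "\<forall>F U v u. F \<in> linear_maps (vspace \<tau>) U \<longrightarrow> v \<in> vspace \<sigma> \<longrightarrow>
       (\<forall>x\<in>H. F (act \<tau> x (s (act \<sigma> (inv x) v))) = u) \<longrightarrow> F (s' v) = (u::'c::complex_vector_space)"
proof -
  define q where "q v x = act \<tau> x (s (act \<sigma> (inv x) v))" for v x
  define n where "n = card ((\<lambda>x. x <# L) ` H)"
  define s' where "s' v = (if v \<in> vspace \<sigma> then inverse (of_nat n) *\<^sub>C fiber_sum (\<lambda>x. x <# L) H (q v) else 0)" for v
  have n: "n \<noteq> 0"
    using L(3) subgroup.one_closed[OF H] unfolding n_def finite_index_def by auto
  have HG: "x \<in> carrier G" if "x \<in> H" for x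
    by (rule subgroup.mem_carrier[OF H that])
  have Hinv: "inv x \<in> H" if "x \<in> H" for x
    using that H by (simp add: subgroup.m_inv_closed)
  have Hmult: "x \<otimes> y \<in> H" if "x \<in> H" "y \<in> H" for x y
    using that H by (simp add: subgroup.m_closed)
  have qV: "q v x \<in> vspace \<tau>" if "v \<in> vspace \<sigma>" "x \<in> H" for v x
    unfolding q_def using that Hinv linear_repD(3)[OF \<tau>] linear_repD(3)[OF \<sigma>] linear_mapsD(1)[OF s] by simp
  have qinv: "q v x = q v y" if v: "v \<in> vspace \<sigma>" and xy: "x \<in> H" "y \<in> H" "x <# L = y <# L" for v x y
  proof -
    define l where "l = inv x \<otimes> y"
    have l: "l \<in> L" "l \<in> H"
      using xy HG L l_coset_eq_iff unfolding l_def by auto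
    have y: "y = x \<otimes> l"
      using HG xy unfolding l_def by (simp add: m_assoc[symmetric])
    have "q v y = act \<tau> x (act \<tau> l (s (act \<sigma> (inv l) (act \<sigma> (inv x) v))))"
      unfolding q_def y using xy l v Hinv HG Hmult
      by (simp add: inv_mult_group linear_repD(3,5)[OF \<tau>] linear_repD(3,5)[OF \<sigma>] linear_mapsD(1)[OF s])
    also have "act \<tau> l (s (act \<sigma> (inv l) (act \<sigma> (inv x) v))) =
        s (act \<sigma> l (act \<sigma> (inv l) (act \<sigma> (inv x) v)))"
      using xy l v Hinv by (simp add: equi linear_repD(3)[OF \<sigma>])
    also have "act \<sigma> l (act \<sigma> (inv l) (act \<sigma> (inv x) v)) = act \<sigma> (inv x) v"
      using xy l v Hinv by (simp add: linear_rep_inverse(2)[OF \<sigma> H] linear_repD(3)[OF \<sigma>])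
    finally show ?thesis
      unfolding q_def by simp
  qed
  have s'V: "s' v \<in> vspace \<tau>" if "v \<in> vspace \<sigma>" for v
    unfolding s'_def if_P[OF that]
    by (rule cvs.subspace_scale[OF linear_repD(1)[OF \<tau>] fiber_sum_in[OF linear_repD(1)[OF \<tau>] qV[OF that]]])
  show ?thesis
  proof (rule that)
    show "s' \<in> intertwiners H \<sigma> \<tau>"
    proof (rule intertwinersI)
      show "s' \<in> linear_maps (vspace \<sigma>) (vspace \<tau>)"
      proof (rule linear_mapsI)
        fix v w
        assume vw: "v \<in> vspace \<sigma>" "w \<in> vspace \<sigma>"
        have "fiber_sum (\<lambda>x. x <# L) H (q (v + w)) = fiber_sum (\<lambda>x. x <# L) H (\<lambda>x. q v x + q w x)"
        proof (rule fiber_sum_cong)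
          fix x
          assume "x \<in> H"
          then show "q (v + w) x = q v x + q w x"
            unfolding q_def using vw Hinv
            by (simp add: linear_mapsD[OF linear_repD(2)[OF \<tau>]] linear_mapsD[OF linear_repD(2)[OF \<sigma>]] linear_mapsD[OF s])
        qed
        then show "s' (v + w) = s' v + s' w"
          unfolding s'_def using vw linear_repD(1)[OF \<sigma>]
          by (simp add: fiber_sum_add cvs.subspace_add scaleC_add_right)
      next
        fix c v
        assume v: "v \<in> vspace \<sigma>"
        have "fiber_sum (\<lambda>x. x <# L) H (q (c *\<^sub>C v)) = fiber_sum (\<lambda>x. x <# L) H (\<lambda>x. c *\<^sub>C q v x)"
        proof (rule fiber_sum_cong)
          fix x
          assume "x \<in> H"
          then show "q (c *\<^sub>C v) x = c *\<^sub>C q v x"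
            unfolding q_def using v Hinv
            by (simp add: linear_mapsD[OF linear_repD(2)[OF \<tau>]] linear_mapsD[OF linear_repD(2)[OF \<sigma>]] linear_mapsD[OF s])
        qed
        then show "s' (c *\<^sub>C v) = c *\<^sub>C s' v"
          unfolding s'_def using v linear_repD(1)[OF \<sigma>]
          by (simp add: fiber_sum_scale cvs.subspace_scale scaleC_scaleC mult.commute)
      qed (rule s'V)
    next
      fix h v
      assume h: "h \<in> H" and v: "v \<in> vspace \<sigma>"
      have hv: "act \<sigma> h v \<in> vspace \<sigma>"
        using linear_repD(3)[OF \<sigma> h v] .
      have "fiber_sum (\<lambda>x. x <# L) H (q (act \<sigma> h v)) =
          fiber_sum (\<lambda>x. x <# L) H (\<lambda>x. q (act \<sigma> h v) (h \<otimes> x))"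
        by (rule coset_sum_left_translate[OF H L(1) h]) (rule qinv[OF hv])
      also have "\<dots> = fiber_sum (\<lambda>x. x <# L) H (\<lambda>x. act \<tau> h (q v x))"
      proof (rule fiber_sum_cong)
        fix x
        assume x: "x \<in> H"
        have "act \<sigma> (inv (h \<otimes> x)) (act \<sigma> h v) = act \<sigma> (inv x) v"
          using h x v hv HG Hinv
          by (simp add: inv_mult_group linear_repD(5)[OF \<sigma>] linear_rep_inverse(1)[OF \<sigma> H])
        then show "q (act \<sigma> h v) (h \<otimes> x) = act \<tau> h (q v x)"
          unfolding q_def using h x v Hinv
          by (simp add: linear_repD(5)[OF \<tau>] linear_repD(3)[OF \<sigma>] linear_mapsD(1)[OF s])
      qed
      also have "\<dots> = act \<tau> h (fiber_sum (\<lambda>x. x <# L) H (q v))"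
        using qV[OF v] by (intro linear_maps_fiber_sum[OF linear_repD(2)[OF \<tau> h] linear_repD(1)[OF \<tau>], symmetric])
      finally show "s' (act \<sigma> h v) = act \<tau> h (s' v)"
        unfolding s'_def using v hv qV[OF v]
        by (simp add: linear_mapsD(3)[OF linear_repD(2)[OF \<tau> h]] fiber_sum_in[OF linear_repD(1)[OF \<tau>]])
    qed (simp add: s'_def)
    show "\<forall>F U v u. F \<in> linear_maps (vspace \<tau>) U \<longrightarrow> v \<in> vspace \<sigma> \<longrightarrow>
       (\<forall>x\<in>H. F (act \<tau> x (s (act \<sigma> (inv x) v))) = u) \<longrightarrow> F (s' v) = (u::'c)"
    proof (intro allI impI)
      fix F :: "'e \<Rightarrow> 'c" and U v u
      assume F: "F \<in> linear_maps (vspace \<tau>) U" and v: "v \<in> vspace \<sigma>"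
        and u: "\<forall>x\<in>H. F (act \<tau> x (s (act \<sigma> (inv x) v))) = u"
      have "F (s' v) = inverse (of_nat n) *\<^sub>C F (fiber_sum (\<lambda>x. x <# L) H (q v))"
        unfolding s'_def using v qV[OF v]
        by (simp add: linear_mapsD(3)[OF F] fiber_sum_in[OF linear_repD(1)[OF \<tau>]])
      also have "F (fiber_sum (\<lambda>x. x <# L) H (q v)) = fiber_sum (\<lambda>x. x <# L) H (\<lambda>x. F (q v x))"
        by (rule linear_maps_fiber_sum[OF F linear_repD(1)[OF \<tau>] qV[OF v]])
      also have "\<dots> = fiber_sum (\<lambda>x. x <# L) H (\<lambda>x. u)"
        using u by (intro fiber_sum_cong) (simp add: q_def)
      also have "\<dots> = of_nat n *\<^sub>C u"
        unfolding n_def by (rule fiber_sum_const)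
      finally show "F (s' v) = u"
        using n by (simp add: scaleC_scaleC scaleC_one)
    qed
  qed
qed

end

section \<open>Compact induction\<close>

context group
begin

lemma mult_inv_cancel:
  assumes "x \<in> carrier G" "y \<in> carrier G"
  shows "x \<otimes> (inv x \<otimes> y) = y" "inv x \<otimes> (x \<otimes> y) = y"
  using assms by (simp_all add: m_assoc[symmetric])

lemma mem_conj_subgroup_iff:
  assumes "H \<subseteq> carrier G" "g \<in> carrier G"
  shows "x \<in> conj_subgroup G H g \<longleftrightarrow> x \<in> carrier G \<and> inv g \<otimes> x \<otimes> g \<in> H"
proof
  assume "x \<in> conj_subgroup G H g"
  then obtain h where h: "h \<in> H" "x = g \<otimes> h \<otimes> inv g"
    unfolding conj_subgroup_def by blast
  then have "h \<in> carrier G"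
    using assms by blast
  moreover have "inv g \<otimes> (g \<otimes> h \<otimes> inv g) \<otimes> g = h"
    using \<open>h \<in> carrier G\<close> assms(2) by (simp add: m_assoc inv_solve_left')
  ultimately show "x \<in> carrier G \<and> inv g \<otimes> x \<otimes> g \<in> H"
    using h assms(2) by simp
next
  assume x: "x \<in> carrier G \<and> inv g \<otimes> x \<otimes> g \<in> H"
  have "g \<otimes> (inv g \<otimes> x \<otimes> g) \<otimes> inv g = (g \<otimes> inv g) \<otimes> x \<otimes> (g \<otimes> inv g)"
    using x assms(2) by (simp only: m_assoc m_closed inv_closed)
  then have "x = g \<otimes> (inv g \<otimes> x \<otimes> g) \<otimes> inv g"
    using x assms(2) by simp
  then show "x \<in> conj_subgroup G H g"
    unfolding conj_subgroup_def using x by (rule image_eqI[OF _ conjunct2])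
qed

lemma conj_mult:
  assumes "g \<in> carrier G" "x \<in> carrier G" "y \<in> carrier G"
  shows "inv g \<otimes> (x \<otimes> y) \<otimes> g = (inv g \<otimes> x \<otimes> g) \<otimes> (inv g \<otimes> y \<otimes> g)"
proof -
  have "(inv g \<otimes> x \<otimes> g) \<otimes> (inv g \<otimes> y \<otimes> g) = inv g \<otimes> x \<otimes> (g \<otimes> inv g) \<otimes> y \<otimes> g"
    using assms by (simp only: m_assoc m_closed inv_closed)
  also have "\<dots> = inv g \<otimes> (x \<otimes> y) \<otimes> g"
    using assms by (simp add: m_assoc)
  finally show ?thesis ..
qed

lemma conj_inv:
  assumes "g \<in> carrier G" "x \<in> carrier G"
  shows "inv g \<otimes> inv x \<otimes> g = inv (inv g \<otimes> x \<otimes> g)"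
  using assms by (simp add: inv_mult_group m_assoc)

lemma subgroup_conj_subgroup:
  assumes H: "subgroup H G" and g: "g \<in> carrier G"
  shows "subgroup (conj_subgroup G H g) G"
proof -
  note mem = mem_conj_subgroup_iff[OF subgroup.subset[OF H] g]
  show ?thesis
  proof (rule subgroupI)
    show "conj_subgroup G H g \<subseteq> carrier G"
      by (simp add: subset_iff mem)
    have "\<one> \<in> conj_subgroup G H g"
      using g subgroup.one_closed[OF H] by (simp add: mem)
    then show "conj_subgroup G H g \<noteq> {}"
      by blast
    show "inv x \<in> conj_subgroup G H g" if "x \<in> conj_subgroup G H g" for x
      using that g subgroup.m_inv_closed[OF H] by (simp add: mem conj_inv)
    show "x \<otimes> y \<in> conj_subgroup G H g"
      if "x \<in> conj_subgroup G H g" "y \<in> conj_subgroup G H g" for x y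
      using that g subgroup.m_closed[OF H] by (simp add: mem conj_mult)
  qed
qed

lemma subgroup_Int: "subgroup H G \<Longrightarrow> subgroup K G \<Longrightarrow> subgroup (H \<inter> K) G"
  by (rule subgroups_Inter_pair)

end

text \<open>The function with support \<open>H\<close> and value \<open>v\<close> at the unit, which generates the induced representation as
  \<open>v\<close> varies.\<close>

definition delta :: "'g set \<Rightarrow> ('g, 'v) repn \<Rightarrow> 'v \<Rightarrow> 'g \<Rightarrow> 'v::complex_vector_space" where
  "delta H \<tau> v = (\<lambda>x. if x \<in> H then act \<tau> x v else 0)"

text \<open>Separate continuity of the multiplication makes the cosets and the conjugates of open subgroups
  open.\<close>

locale semitopological_group = group G for G (structure) +
  fixes T :: "'a topology"
  assumes topspace_eq: "topspace T = carrier G"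
    and openin_l_coset: "openin T U \<Longrightarrow> g \<in> carrier G \<Longrightarrow> openin T (g <# U)"
    and openin_r_coset: "openin T U \<Longrightarrow> g \<in> carrier G \<Longrightarrow> openin T (U #> g)"
begin

lemma openin_subgroup_mono:
  assumes L: "openin T L" "subgroup L G" "L \<subseteq> H" and H: "subgroup H G"
  shows "openin T H"
proof -
  have "H = (\<Union>h\<in>H. h <# L)"
  proof
    show "H \<subseteq> (\<Union>h\<in>H. h <# L)"
    proof
      fix h
      assume h: "h \<in> H"
      have "h \<otimes> \<one> \<in> h <# L"
        unfolding l_coset_def using subgroup.one_closed[OF L(2)] by blast
      then show "h \<in> (\<Union>h\<in>H. h <# L)"
        using h subgroup.mem_carrier[OF H h] by auto
    qed
    show "(\<Union>h\<in>H. h <# L) \<subseteq> H"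
      unfolding l_coset_def using L(3) subgroup.m_closed[OF H] by blast
  qed
  moreover have "openin T (\<Union>h\<in>H. h <# L)"
    by (rule openin_Union) (auto intro: openin_l_coset[OF L(1)] subgroup.mem_carrier[OF H])
  ultimately show ?thesis
    by (rule ssubst)
qed

lemma openin_conj_subgroup:
  assumes "openin T K" "g \<in> carrier G"
  shows "openin T (conj_subgroup G K g)"
proof -
  have "conj_subgroup G K g = (g <# K) #> inv g"
    unfolding conj_subgroup_def l_coset_def r_coset_def by auto
  then show ?thesis
    using assms by (simp add: openin_l_coset openin_r_coset)
qed

text \<open>The coset space of an open subgroup is discrete.\<close>

lemma compact_modulo_iff_finite:
  assumes H: "subgroup H G" "openin T H" and S: "S \<subseteq> carrier G"
  shows "compact_modulo G T H S \<longleftrightarrow> finite ((\<lambda>x. H #> x) ` S)"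
proof -
  have "openin (coset_topology G T H) \<U> \<longleftrightarrow> \<U> \<subseteq> rcosets H" for \<U>
  proof -
    have "openin T (\<Union>\<U>)" if "\<U> \<subseteq> rcosets H"
    proof (rule openin_Union)
      fix C
      assume "C \<in> \<U>"
      then have "C \<in> rcosets H"
        using that by (rule rev_subsetD)
      then obtain x where "x \<in> carrier G" "C = H #> x"
        by (auto simp: RCOSETS_def)
      then show "openin T C"
        using H(2) by (simp add: openin_r_coset)
    qed
    then show ?thesis
      unfolding openin_coset_topology[OF H(1)] by (intro iffI conjI) (rule conjunct1)
  qed
  then have "coset_topology G T H = discrete_topology (rcosets H)"
    unfolding topology_eq openin_discrete_topology by (rule allI)
  moreover have "(\<lambda>x. H #> x) ` S \<subseteq> rcosets H"
    using S unfolding RCOSETS_def by blast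
  ultimately show ?thesis
    unfolding compact_modulo_def by (simp add: compactin_discrete_topology)
qed

lemma ind_iff:
  assumes H: "subgroup H G" "openin T H"
  shows "\<phi> \<in> vspace (compact_induction G T H \<tau>) \<longleftrightarrow>
     (\<forall>x. x \<notin> carrier G \<longrightarrow> \<phi> x = 0) \<and> (\<forall>x\<in>carrier G. \<phi> x \<in> vspace \<tau>) \<and>
     (\<forall>h\<in>H. \<forall>x\<in>carrier G. \<phi> (h \<otimes> x) = act \<tau> h (\<phi> x)) \<and>
     (\<exists>K. subgroup K G \<and> openin T K \<and> (\<forall>x\<in>carrier G. \<forall>k\<in>K. \<phi> (x \<otimes> k) = \<phi> x)) \<and>
     finite ((\<lambda>x. H #> x) ` {x \<in> carrier G. \<phi> x \<noteq> 0})"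
  unfolding compact_induction_def by (simp add: compact_modulo_iff_finite[OF H])

lemma indD:
  assumes H: "subgroup H G" "openin T H" and \<phi>: "\<phi> \<in> vspace (compact_induction G T H \<tau>)"
  shows "x \<notin> carrier G \<Longrightarrow> \<phi> x = 0" "x \<in> carrier G \<Longrightarrow> \<phi> x \<in> vspace \<tau>"
    "h \<in> H \<Longrightarrow> x \<in> carrier G \<Longrightarrow> \<phi> (h \<otimes> x) = act \<tau> h (\<phi> x)"
    "\<exists>K. subgroup K G \<and> openin T K \<and> (\<forall>x\<in>carrier G. \<forall>k\<in>K. \<phi> (x \<otimes> k) = \<phi> x)"
    "finite ((\<lambda>x. H #> x) ` {x \<in> carrier G. \<phi> x \<noteq> 0})"
  using \<phi> unfolding ind_iff[OF H] by simp_all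

lemma ind_act_apply: "x \<in> carrier G \<Longrightarrow> act (compact_induction G T H \<tau>) g \<phi> x = \<phi> (x \<otimes> g)"
  by (simp add: compact_induction_def)

lemma ind_act_outside: "x \<notin> carrier G \<Longrightarrow> act (compact_induction G T H \<tau>) g \<phi> x = 0"
  by (simp add: compact_induction_def)

context
  fixes H :: "'a set" and \<tau> :: "('a, 'v::complex_vector_space) repn"
  assumes H: "subgroup H G" "openin T H" and \<tau>: "linear_rep G H \<tau>"
begin

abbreviation (input) "ind \<equiv> compact_induction G T H \<tau>"

lemma ind_act_in:
  assumes \<phi>: "\<phi> \<in> vspace ind" and g: "g \<in> carrier G"
  shows "act ind g \<phi> \<in> vspace ind"
  unfolding ind_iff[OF H]
proof (intro conjI allI impI ballI)
  obtain K where K: "subgroup K G" "openin T K" "\<forall>x\<in>carrier G. \<forall>k\<in>K. \<phi> (x \<otimes> k) = \<phi> x"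
    using indD(4)[OF H \<phi>] by blast
  have "act ind g \<phi> (x \<otimes> k) = act ind g \<phi> x" if x: "x \<in> carrier G" and k: "k \<in> conj_subgroup G K g" for x k
  proof -
    have kk: "k \<in> carrier G" "inv g \<otimes> k \<otimes> g \<in> K"
      using k mem_conj_subgroup_iff[OF subgroup.subset[OF K(1)] g] by simp_all
    have "x \<otimes> k \<otimes> g = (x \<otimes> g) \<otimes> (inv g \<otimes> k \<otimes> g)"
      using x g kk(1) by (simp add: m_assoc mult_inv_cancel)
    moreover have "\<phi> ((x \<otimes> g) \<otimes> (inv g \<otimes> k \<otimes> g)) = \<phi> (x \<otimes> g)"
      using K(3) kk(2) x g by simp
    ultimately show ?thesis
      using x g kk by (simp add: ind_act_apply)
  qed
  then show "\<exists>K. subgroup K G \<and> openin T K \<and>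
      (\<forall>x\<in>carrier G. \<forall>k\<in>K. act ind g \<phi> (x \<otimes> k) = act ind g \<phi> x)"
    using K(1,2) g
    by (intro exI[of _ "conj_subgroup G K g"] conjI ballI subgroup_conj_subgroup openin_conj_subgroup)
  have "(\<lambda>x. H #> x) ` {x \<in> carrier G. act ind g \<phi> x \<noteq> 0} \<subseteq>
      (\<lambda>C. C #> inv g) ` (\<lambda>x. H #> x) ` {x \<in> carrier G. \<phi> x \<noteq> 0}"
  proof
    fix C
    assume "C \<in> (\<lambda>x. H #> x) ` {x \<in> carrier G. act ind g \<phi> x \<noteq> 0}"
    then obtain x where x: "x \<in> carrier G" "\<phi> (x \<otimes> g) \<noteq> 0" "C = H #> x"
      by (auto simp: ind_act_apply)
    have "C = (H #> (x \<otimes> g)) #> inv g"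
      using x g subgroup.subset[OF H(1)] by (simp add: coset_mult_assoc m_assoc)
    then show "C \<in> (\<lambda>C. C #> inv g) ` (\<lambda>x. H #> x) ` {x \<in> carrier G. \<phi> x \<noteq> 0}"
      using x g by blast
  qed
  then show "finite ((\<lambda>x. H #> x) ` {x \<in> carrier G. act ind g \<phi> x \<noteq> 0})"
    by (rule finite_subset) (intro finite_imageI indD(5)[OF H \<phi>])
qed (use g subgroup.mem_carrier[OF H(1)] in
    \<open>simp_all add: ind_act_apply ind_act_outside indD[OF H \<phi>] m_assoc\<close>)

lemma ind_linear_rep: "linear_rep G (carrier G) ind"
  unfolding linear_rep_def
proof (intro conjI ballI)
  note \<tau>0 = linear_maps_0[OF linear_repD(2)[OF \<tau>] linear_repD(1)[OF \<tau>]]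
  show "cvs.subspace (vspace ind)"
    unfolding cvs.subspace_def
  proof (intro conjI ballI allI)
    show "0 \<in> vspace ind"
      unfolding ind_iff[OF H] using linear_repD(1)[OF \<tau>] \<tau>0
      by (auto simp: cvs.subspace_0 intro!: exI[of _ H] H)
  next
    fix \<phi> \<psi>
    assume \<phi>: "\<phi> \<in> vspace ind" and \<psi>: "\<psi> \<in> vspace ind"
    obtain K where K: "subgroup K G" "openin T K" "\<forall>x\<in>carrier G. \<forall>k\<in>K. \<phi> (x \<otimes> k) = \<phi> x"
      using indD(4)[OF H \<phi>] by blast
    obtain K' where K': "subgroup K' G" "openin T K'" "\<forall>x\<in>carrier G. \<forall>k\<in>K'. \<psi> (x \<otimes> k) = \<psi> x"
      using indD(4)[OF H \<psi>] by blast
    have "\<exists>K. subgroup K G \<and> openin T K \<and> (\<forall>x\<in>carrier G. \<forall>k\<in>K. (\<phi> + \<psi>) (x \<otimes> k) = (\<phi> + \<psi>) x)"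
      using K K' by (intro exI[of _ "K \<inter> K'"]) (simp add: subgroup_Int openin_Int)
    moreover have "finite ((\<lambda>x. H #> x) ` {x \<in> carrier G. (\<phi> + \<psi>) x \<noteq> 0})"
    proof (rule finite_subset)
      show "(\<lambda>x. H #> x) ` {x \<in> carrier G. (\<phi> + \<psi>) x \<noteq> 0} \<subseteq>
          (\<lambda>x. H #> x) ` {x \<in> carrier G. \<phi> x \<noteq> 0} \<union> (\<lambda>x. H #> x) ` {x \<in> carrier G. \<psi> x \<noteq> 0}"
        by auto
    qed (use indD(5)[OF H \<phi>] indD(5)[OF H \<psi>] in simp)
    ultimately show "\<phi> + \<psi> \<in> vspace ind"
      unfolding ind_iff[OF H] using indD[OF H \<phi>] indD[OF H \<psi>] linear_repD(1)[OF \<tau>]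
        linear_mapsD(2)[OF linear_repD(2)[OF \<tau>]]
      by (simp add: cvs.subspace_add)
  next
    fix c \<phi>
    assume \<phi>: "\<phi> \<in> vspace ind"
    obtain K where K: "subgroup K G" "openin T K" "\<forall>x\<in>carrier G. \<forall>k\<in>K. \<phi> (x \<otimes> k) = \<phi> x"
      using indD(4)[OF H \<phi>] by blast
    have "finite ((\<lambda>x. H #> x) ` {x \<in> carrier G. (c *\<^sub>C \<phi>) x \<noteq> 0})"
      by (rule finite_subset[OF _ indD(5)[OF H \<phi>]]) (auto simp: scaleC_fun_def)
    moreover have "\<exists>K. subgroup K G \<and> openin T K \<and> (\<forall>x\<in>carrier G. \<forall>k\<in>K. (c *\<^sub>C \<phi>) (x \<otimes> k) = (c *\<^sub>C \<phi>) x)"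
      using K by (intro exI[of _ K]) (simp add: scaleC_fun_def)
    ultimately show "c *\<^sub>C \<phi> \<in> vspace ind"
      unfolding ind_iff[OF H] using indD[OF H \<phi>] linear_repD(1)[OF \<tau>]
        linear_mapsD(3)[OF linear_repD(2)[OF \<tau>]]
      by (simp add: cvs.subspace_scale scaleC_fun_def)
  qed
  show "act ind g \<in> linear_maps (vspace ind) (vspace ind)" if "g \<in> carrier G" for g
    by (rule linear_mapsI[OF ind_act_in[OF _ that]])
      (auto simp: compact_induction_def fun_eq_iff scaleC_fun_def)
  show "act ind \<one> \<phi> = \<phi>" if \<phi>: "\<phi> \<in> vspace ind" for \<phi>
    by (rule ext, case_tac "x \<in> carrier G")
      (simp_all add: ind_act_apply ind_act_outside indD(1)[OF H \<phi>])
  show "act ind (g \<otimes> h) \<phi> = act ind g (act ind h \<phi>)"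
    if "g \<in> carrier G" "h \<in> carrier G" "\<phi> \<in> vspace ind" for g h \<phi>
    using that by (auto simp: compact_induction_def fun_eq_iff m_assoc)
qed

lemma delta_in:
  assumes sm: "smooth_rep G T H \<tau>" and v: "v \<in> vspace \<tau>"
  shows "delta H \<tau> v \<in> vspace ind"
  unfolding ind_iff[OF H]
proof (intro conjI allI impI ballI)
  have HG: "x \<in> carrier G" if "x \<in> H" for x
    by (rule subgroup.mem_carrier[OF H(1) that])
  have mem: "h \<otimes> x \<in> H \<longleftrightarrow> x \<in> H" if "h \<in> H" "x \<in> carrier G" for h x
  proof
    assume "h \<otimes> x \<in> H"
    then have "inv h \<otimes> (h \<otimes> x) \<in> H"
      using that H(1) by (simp add: subgroup.m_closed subgroup.m_inv_closed)
    then show "x \<in> H"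
      using that HG by (simp add: m_assoc[symmetric])
  qed (use that H(1) in \<open>simp add: subgroup.m_closed\<close>)
  have mem': "x \<otimes> k \<in> H \<longleftrightarrow> x \<in> H" if "k \<in> H" "x \<in> carrier G" for k x
  proof
    assume "x \<otimes> k \<in> H"
    then have "(x \<otimes> k) \<otimes> inv k \<in> H"
      using that H(1) by (simp add: subgroup.m_closed subgroup.m_inv_closed)
    then show "x \<in> H"
      using that HG by (simp add: m_assoc)
  qed (use that H(1) in \<open>simp add: subgroup.m_closed\<close>)
  show "delta H \<tau> v x = 0" if "x \<notin> carrier G" for x
    using that HG by (auto simp: delta_def)
  show "delta H \<tau> v x \<in> vspace \<tau>" for x
    using v linear_repD(1,3)[OF \<tau>] by (simp add: delta_def cvs.subspace_0)
  show "delta H \<tau> v (h \<otimes> x) = act \<tau> h (delta H \<tau> v x)" if "h \<in> H" "x \<in> carrier G" for h x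
    using that v mem linear_repD(5)[OF \<tau>] linear_maps_0[OF linear_repD(2)[OF \<tau>] linear_repD(1)[OF \<tau>]]
    by (simp add: delta_def)
  define K where "K = {h \<in> H. act \<tau> h v = v}"
  have "subgroup K G"
    unfolding K_def by (rule subgroup_stabilizer[OF \<tau> H(1) v])
  moreover have "openin T K"
    using sm v H(2) unfolding smooth_rep_iff K_def by (simp add: openin_open_subtopology)
  moreover have "delta H \<tau> v (x \<otimes> k) = delta H \<tau> v x" if "x \<in> carrier G" "k \<in> K" for x k
    using that mem' v linear_repD(5)[OF \<tau>] by (simp add: delta_def K_def)
  ultimately show "\<exists>K. subgroup K G \<and> openin T K \<and> (\<forall>x\<in>carrier G. \<forall>k\<in>K. delta H \<tau> v (x \<otimes> k) = delta H \<tau> v x)"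
    by (intro exI[of _ K]) simp
  have "(\<lambda>x. H #> x) ` {x \<in> carrier G. delta H \<tau> v x \<noteq> 0} \<subseteq> {H}"
    using coset_join2[OF HG H(1)] by (auto simp: delta_def split: if_splits)
  then show "finite ((\<lambda>x. H #> x) ` {x \<in> carrier G. delta H \<tau> v x \<noteq> 0})"
    by (rule finite_subset) simp
qed

lemma delta_act:
  assumes v: "v \<in> vspace \<tau>" and h: "h \<in> H"
  shows "delta H \<tau> (act \<tau> h v) = act ind h (delta H \<tau> v)"
proof
  fix x
  have hG: "h \<in> carrier G"
    by (rule subgroup.mem_carrier[OF H(1) h])
  show "delta H \<tau> (act \<tau> h v) x = act ind h (delta H \<tau> v) x"
  proof (cases "x \<in> carrier G")
    case True
    have "x \<in> H" if "x \<otimes> h \<in> H"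
    proof -
      have "(x \<otimes> h) \<otimes> inv h \<in> H"
        using that h H(1) by (simp add: subgroup.m_closed subgroup.m_inv_closed)
      then show ?thesis
        using True hG by (simp add: m_assoc)
    qed
    then show ?thesis
      using True h v H(1) by (auto simp: delta_def ind_act_apply linear_repD(5)[OF \<tau>] subgroup.m_closed)
  next
    case False
    then have "x \<notin> H"
      using subgroup.mem_carrier[OF H(1)] by blast
    then show ?thesis
      using False by (simp add: delta_def ind_act_outside)
  qed
qed

lemma ind_support_coset:
  assumes \<phi>: "\<phi> \<in> vspace ind" and x: "x \<in> carrier G" and y: "y \<in> carrier G" and eq: "H #> x = H #> y"
  obtains h where "h \<in> H" "y = h \<otimes> x" "\<phi> y = act \<tau> h (\<phi> x)"
proof -
  have h: "y \<otimes> inv x \<in> H"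
    using eq r_coset_eq_iff[OF H(1) x y] by simp
  moreover have "y = (y \<otimes> inv x) \<otimes> x"
    using x y by (simp add: m_assoc)
  moreover have "\<phi> ((y \<otimes> inv x) \<otimes> x) = act \<tau> (y \<otimes> inv x) (\<phi> x)"
    by (rule indD(3)[OF H \<phi> h x])
  ultimately show ?thesis
    using that by simp
qed

text \<open>Frobenius reciprocity for compact induction from an open subgroup: \<open>\<phi>\<close> is the sum of the translates by
  \<open>y\<^sup>-\<^sup>1\<close> of the generators belonging to \<open>\<phi> y\<close>, over the finitely many cosets \<open>H y\<close> in its support, which
  forces the formula for \<open>F\<close>.\<close>

lemma frobenius_map:
  fixes \<Omega> :: "('a, 'u::complex_vector_space) repn"
  assumes \<Omega>: "linear_rep G (carrier G) \<Omega>" and \<Psi>: "\<Psi> \<in> intertwiners H \<tau> \<Omega>"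
  defines "F \<equiv> \<lambda>\<phi>. if \<phi> \<in> vspace ind
      then fiber_sum (\<lambda>y. H #> y) {y \<in> carrier G. \<phi> y \<noteq> 0} (\<lambda>y. act \<Omega> (inv y) (\<Psi> (\<phi> y))) else 0"
  shows "F \<in> intertwiners (carrier G) ind \<Omega>" and "v \<in> vspace \<tau> \<Longrightarrow> smooth_rep G T H \<tau> \<Longrightarrow> F (delta H \<tau> v) = \<Psi> v"
proof -
  define q where "q \<phi> y = act \<Omega> (inv y) (\<Psi> (\<phi> y))" for \<phi> y
  define S where "S \<phi> = {y \<in> carrier G. \<phi> y \<noteq> (0::'v)}" for \<phi>
  have F: "F \<phi> = fiber_sum (\<lambda>y. H #> y) (S \<phi>) (q \<phi>)" if "\<phi> \<in> vspace ind" for \<phi>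
    using that by (simp add: F_def S_def q_def[abs_def])
  have \<Psi>V: "\<Psi> u \<in> vspace \<Omega>" if "u \<in> vspace \<tau>" for u
    by (rule intertwinersD(4)[OF \<Psi> that])
  note \<Psi>lin = linear_mapsD(2,3)[OF intertwinersD(1)[OF \<Psi>]]
  note \<Omega>lin = linear_mapsD(2,3)[OF linear_repD(2)[OF \<Omega>]]
  have \<Psi>0: "\<Psi> 0 = 0"
    by (rule linear_maps_0[OF intertwinersD(1)[OF \<Psi>] linear_repD(1)[OF \<tau>]])
  have \<Omega>0: "act \<Omega> g 0 = 0" if "g \<in> carrier G" for g
    by (rule linear_maps_0[OF linear_repD(2)[OF \<Omega> that] linear_repD(1)[OF \<Omega>]])
  have qV: "q \<phi> y \<in> vspace \<Omega>" if "\<phi> \<in> vspace ind" "y \<in> carrier G" for \<phi> y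
    unfolding q_def using that \<Psi>V indD(2)[OF H that] by (simp add: linear_repD(3)[OF \<Omega>])
  have qinv: "q \<phi> x = q \<phi> y"
    if \<phi>: "\<phi> \<in> vspace ind" and xy: "x \<in> carrier G" "y \<in> carrier G" "H #> x = H #> y" for \<phi> x y
  proof -
    obtain h where h: "h \<in> H" "y = h \<otimes> x" "\<phi> y = act \<tau> h (\<phi> x)"
      by (rule ind_support_coset[OF \<phi> xy])
    have hG: "h \<in> carrier G"
      by (rule subgroup.mem_carrier[OF H(1) h(1)])
    have V: "\<phi> x \<in> vspace \<tau>" "\<Psi> (\<phi> x) \<in> vspace \<Omega>"
      using indD(2)[OF H \<phi> xy(1)] \<Psi>V by simp_all
    have "q \<phi> y = act \<Omega> (inv x \<otimes> inv h) (act \<Omega> h (\<Psi> (\<phi> x)))"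
      unfolding q_def h(3) using h(1,2) hG xy(1) V intertwinersD(3)[OF \<Psi>] by (simp add: inv_mult_group)
    also have "\<dots> = act \<Omega> (inv x) (act \<Omega> (inv h) (act \<Omega> h (\<Psi> (\<phi> x))))"
      using hG xy(1) V by (simp add: linear_repD(3,5)[OF \<Omega>])
    also have "\<dots> = q \<phi> x"
      unfolding q_def using hG V by (simp add: linear_rep_inverse(1)[OF \<Omega> subgroup_self])
    finally show ?thesis ..
  qed
  have mono: "fiber_sum (\<lambda>y. H #> y) S' (q \<phi>) = F \<phi>"
    if \<phi>: "\<phi> \<in> vspace ind" and S': "S \<phi> \<subseteq> S'" "S' \<subseteq> carrier G" "finite ((\<lambda>y. H #> y) ` S')" for \<phi> S'
    unfolding F[OF \<phi>]
  proof (rule fiber_sum_mono_neutral[OF S'(1,3)])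
    show "q \<phi> x = q \<phi> y" if "x \<in> S'" "y \<in> S'" "H #> x = H #> y" for x y
      using that S'(2) by (intro qinv[OF \<phi>]) auto
    show "q \<phi> x = 0" if x: "x \<in> S'" "H #> x \<notin> (\<lambda>y. H #> y) ` S \<phi>" for x
    proof -
      have "x \<in> carrier G" "\<phi> x = 0"
        using x S'(2) unfolding S_def by auto
      then show ?thesis
        unfolding q_def by (simp add: \<Psi>0 \<Omega>0)
    qed
  qed
  show "F \<in> intertwiners (carrier G) ind \<Omega>"
  proof (rule intertwinersI)
    show "F \<in> linear_maps (vspace ind) (vspace \<Omega>)"
    proof (rule linear_mapsI)
      fix \<phi>
      assume \<phi>: "\<phi> \<in> vspace ind"
      show "F \<phi> \<in> vspace \<Omega>"
        unfolding F[OF \<phi>] using qV[OF \<phi>] by (intro fiber_sum_in[OF linear_repD(1)[OF \<Omega>]]) (simp add: S_def)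
    next
      fix \<phi> \<psi>
      assume \<phi>: "\<phi> \<in> vspace ind" and \<psi>: "\<psi> \<in> vspace ind"
      have sum: "\<phi> + \<psi> \<in> vspace ind"
        using linear_repD(1)[OF ind_linear_rep] \<phi> \<psi> by (rule cvs.subspace_add)
      define S' where "S' = S \<phi> \<union> S \<psi>"
      have S': "S \<phi> \<subseteq> S'" "S \<psi> \<subseteq> S'" "S (\<phi> + \<psi>) \<subseteq> S'" "S' \<subseteq> carrier G"
        unfolding S'_def S_def by auto
      have fin: "finite ((\<lambda>y. H #> y) ` S')"
        using indD(5)[OF H \<phi>] indD(5)[OF H \<psi>] unfolding S'_def S_def by (simp add: image_Un)
      have "fiber_sum (\<lambda>y. H #> y) S' (q (\<phi> + \<psi>)) = fiber_sum (\<lambda>y. H #> y) S' (\<lambda>y. q \<phi> y + q \<psi> y)"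
      proof (rule fiber_sum_cong)
        fix y
        assume "y \<in> S'"
        then have y: "y \<in> carrier G"
          using S' by blast
        show "q (\<phi> + \<psi>) y = q \<phi> y + q \<psi> y"
          unfolding q_def using y indD(2)[OF H \<phi> y] indD(2)[OF H \<psi> y] \<Psi>V by (simp add: \<Psi>lin \<Omega>lin)
      qed
      then show "F (\<phi> + \<psi>) = F \<phi> + F \<psi>"
        by (simp add: fiber_sum_add mono[OF \<phi> S'(1,4) fin] mono[OF \<psi> S'(2,4) fin] mono[OF sum S'(3,4) fin])
    next
      fix c \<phi>
      assume \<phi>: "\<phi> \<in> vspace ind"
      have sc: "c *\<^sub>C \<phi> \<in> vspace ind"
        using linear_repD(1)[OF ind_linear_rep] \<phi> by (rule cvs.subspace_scale)
      have S': "S (c *\<^sub>C \<phi>) \<subseteq> S \<phi>" "S \<phi> \<subseteq> carrier G" "S \<phi> \<subseteq> S \<phi>"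
        unfolding S_def by (auto simp: scaleC_fun_def)
      have fin: "finite ((\<lambda>y. H #> y) ` S \<phi>)"
        using indD(5)[OF H \<phi>] unfolding S_def .
      have "fiber_sum (\<lambda>y. H #> y) (S \<phi>) (q (c *\<^sub>C \<phi>)) = fiber_sum (\<lambda>y. H #> y) (S \<phi>) (\<lambda>y. c *\<^sub>C q \<phi> y)"
      proof (rule fiber_sum_cong)
        fix y
        assume "y \<in> S \<phi>"
        then have y: "y \<in> carrier G"
          using S' by blast
        show "q (c *\<^sub>C \<phi>) y = c *\<^sub>C q \<phi> y"
          unfolding q_def using y indD(2)[OF H \<phi> y] \<Psi>V by (simp add: \<Psi>lin \<Omega>lin scaleC_fun_def)
      qed
      then show "F (c *\<^sub>C \<phi>) = c *\<^sub>C F \<phi>"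
        by (simp add: fiber_sum_scale mono[OF \<phi> S'(3,2) fin] mono[OF sc S'(1,2) fin])
    qed
  next
    fix g \<phi>
    assume g: "g \<in> carrier G" and \<phi>: "\<phi> \<in> vspace ind"
    have g\<phi>: "act ind g \<phi> \<in> vspace ind"
      by (rule ind_act_in[OF \<phi> g])
    have "F \<phi> = fiber_sum (\<lambda>y. H #> y) (S (act ind g \<phi>)) (\<lambda>y. q \<phi> (y \<otimes> g))"
      unfolding F[OF \<phi>]
    proof (rule fiber_sum_reindex)
      show "y \<otimes> g \<in> S \<phi>" if "y \<in> S (act ind g \<phi>)" for y
        using that g by (auto simp: S_def ind_act_apply)
      show "\<exists>x\<in>S (act ind g \<phi>). H #> (x \<otimes> g) = H #> y" if "y \<in> S \<phi>" for y
        using that g by (intro bexI[of _ "y \<otimes> inv g"]) (simp_all add: S_def ind_act_apply m_assoc)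
      show "H #> x = H #> y \<longleftrightarrow> H #> (x \<otimes> g) = H #> (y \<otimes> g)"
        if "x \<in> S (act ind g \<phi>)" "y \<in> S (act ind g \<phi>)" for x y
      proof -
        have xy: "x \<in> carrier G" "y \<in> carrier G"
          using that by (simp_all add: S_def)
        then have "(y \<otimes> g) \<otimes> inv (x \<otimes> g) = y \<otimes> inv x"
          using g by (simp add: inv_mult_group m_assoc mult_inv_cancel)
        then show ?thesis
          using xy g by (simp add: r_coset_eq_iff[OF H(1)])
      qed
      show "q \<phi> x = q \<phi> y" if "x \<in> S \<phi>" "y \<in> S \<phi>" "H #> x = H #> y" for x y
        using that by (intro qinv[OF \<phi>]) (simp_all add: S_def)
    qed
    moreover have "q \<phi> (y \<otimes> g) \<in> vspace \<Omega>" if "y \<in> S (act ind g \<phi>)" for y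
      using that g by (intro qV[OF \<phi>]) (simp add: S_def)
    ultimately have "act \<Omega> g (F \<phi>) = fiber_sum (\<lambda>y. H #> y) (S (act ind g \<phi>)) (\<lambda>y. act \<Omega> g (q \<phi> (y \<otimes> g)))"
      by (simp only: linear_maps_fiber_sum[OF linear_repD(2)[OF \<Omega> g] linear_repD(1)[OF \<Omega>]])
    also have "\<dots> = F (act ind g \<phi>)"
      unfolding F[OF g\<phi>]
    proof (rule fiber_sum_cong)
      fix y
      assume "y \<in> S (act ind g \<phi>)"
      then have y: "y \<in> carrier G"
        by (simp add: S_def)
      have V: "\<Psi> (\<phi> (y \<otimes> g)) \<in> vspace \<Omega>"
        using y g indD(2)[OF H \<phi>] \<Psi>V by simp
      have "act \<Omega> g (q \<phi> (y \<otimes> g)) = act \<Omega> (g \<otimes> inv (y \<otimes> g)) (\<Psi> (\<phi> (y \<otimes> g)))"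
        unfolding q_def using y g V by (simp add: linear_repD(5)[OF \<Omega>])
      also have "g \<otimes> inv (y \<otimes> g) = inv y"
        using y g by (simp add: inv_mult_group m_assoc[symmetric])
      finally show "act \<Omega> g (q \<phi> (y \<otimes> g)) = q (act ind g \<phi>) y"
        unfolding q_def using y by (simp add: ind_act_apply)
    qed
    finally show "F (act ind g \<phi>) = act \<Omega> g (F \<phi>)" ..
  qed (simp add: F_def)
  show "F (delta H \<tau> v) = \<Psi> v" if v: "v \<in> vspace \<tau>" and sm: "smooth_rep G T H \<tau>"
  proof -
    note d = delta_in[OF sm v]
    have S: "S (delta H \<tau> v) \<subseteq> H"
      by (auto simp: S_def delta_def split: if_splits)
    have img: "(\<lambda>y. H #> y) ` H = {H}"
      using coset_join2[OF subgroup.mem_carrier[OF H(1)] H(1)] subgroup.one_closed[OF H(1)] by force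
    have "F (delta H \<tau> v) = fiber_sum (\<lambda>y. H #> y) H (q (delta H \<tau> v))"
      by (rule mono[OF d S subgroup.subset[OF H(1)], symmetric]) (simp add: img)
    also have "\<dots> = fiber_sum (\<lambda>y. H #> y) H (\<lambda>y. \<Psi> v)"
    proof (rule fiber_sum_cong)
      fix y
      assume y: "y \<in> H"
      then show "q (delta H \<tau> v) y = \<Psi> v"
        unfolding q_def using v \<Psi>V subgroup.mem_carrier[OF H(1) y]
        by (simp add: delta_def intertwinersD(3)[OF \<Psi>] linear_rep_inverse(1)[OF \<Omega> subgroup_self])
    qed
    also have "\<dots> = \<Psi> v"
      unfolding fiber_sum_const img by (simp add: scaleC_one)
    finally show ?thesis .
  qed
qed

lemma ind_generated_by_delta:
  assumes sm: "smooth_rep G T H \<tau>"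
    and U: "cvs.subspace U" "\<And>g u. g \<in> carrier G \<Longrightarrow> u \<in> U \<Longrightarrow> act ind g u \<in> U"
    and d: "\<And>v. v \<in> vspace \<tau> \<Longrightarrow> delta H \<tau> v \<in> U" and \<phi>: "\<phi> \<in> vspace ind"
  shows "\<phi> \<in> U"
proof -
  define S where "S = {y \<in> carrier G. \<phi> y \<noteq> 0}"
  define q where "q y = act ind (inv y) (delta H \<tau> (\<phi> y))" for y
  have q: "q y x = (if H #> x = H #> y then \<phi> x else 0)" if y: "y \<in> carrier G" and x: "x \<in> carrier G" for x y
  proof -
    have "q y x = delta H \<tau> (\<phi> y) (x \<otimes> inv y)"
      using x by (simp add: q_def ind_act_apply)
    moreover have "H #> x = H #> y \<longleftrightarrow> x \<otimes> inv y \<in> H"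
      using r_coset_eq_iff[OF H(1) y x] by auto
    moreover have "act \<tau> (x \<otimes> inv y) (\<phi> y) = \<phi> x" if "x \<otimes> inv y \<in> H"
      using indD(3)[OF H \<phi> that y] x y by (simp add: m_assoc)
    ultimately show ?thesis
      by (simp add: delta_def)
  qed
  have "fiber_sum (\<lambda>y. H #> y) S q = \<phi>"
  proof
    fix x
    show "fiber_sum (\<lambda>y. H #> y) S q x = \<phi> x"
    proof (cases "x \<in> carrier G")
      case True
      have "fiber_sum (\<lambda>y. H #> y) S q x = fiber_sum (\<lambda>y. H #> y) S (\<lambda>y. if H #> x = H #> y then \<phi> x else 0)"
        unfolding fiber_sum_apply by (rule fiber_sum_cong) (simp add: S_def q True)
      also have "\<dots> = (\<Sum>C\<in>(\<lambda>y. H #> y) ` S. if H #> x = C then \<phi> x else 0)"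
        unfolding fiber_sum_def by (rule sum.cong[OF refl]) (simp only: fiber_sum_choice(2))
      also have "\<dots> = (if H #> x \<in> (\<lambda>y. H #> y) ` S then \<phi> x else 0)"
        using indD(5)[OF H \<phi>] unfolding S_def by (simp add: sum.delta)
      also have "\<dots> = \<phi> x"
        using True unfolding S_def by auto
      finally show ?thesis .
    next
      case False
      then have "fiber_sum (\<lambda>y. H #> y) S q x = fiber_sum (\<lambda>y. H #> y) S (\<lambda>y. 0)"
        unfolding fiber_sum_apply by (intro fiber_sum_cong) (simp add: q_def ind_act_outside)
      then show ?thesis
        using indD(1)[OF H \<phi> False] by (simp add: fiber_sum_def)
    qed
  qed
  moreover have "fiber_sum (\<lambda>y. H #> y) S q \<in> U"
    by (rule fiber_sum_in[OF U(1)]) (simp add: q_def S_def U(2) d indD(2)[OF H \<phi>])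
  ultimately show ?thesis
    by simp
qed

end

lemma kernel_subspace:
  assumes F: "F \<in> intertwiners (carrier G) \<sigma> \<tau>" and \<sigma>: "linear_rep G (carrier G) \<sigma>" and \<tau>: "linear_rep G (carrier G) \<tau>"
  shows "cvs.subspace {v \<in> vspace \<sigma>. F v = 0}"
    "g \<in> carrier G \<Longrightarrow> u \<in> {v \<in> vspace \<sigma>. F v = 0} \<Longrightarrow> act \<sigma> g u \<in> {v \<in> vspace \<sigma>. F v = 0}"
proof -
  note F' = linear_mapsD[OF intertwinersD(1)[OF F]] linear_maps_0[OF intertwinersD(1)[OF F] linear_repD(1)[OF \<sigma>]]
  show "cvs.subspace {v \<in> vspace \<sigma>. F v = 0}"
    using linear_repD(1)[OF \<sigma>] F' unfolding cvs.subspace_def by simp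
  show "g \<in> carrier G \<Longrightarrow> u \<in> {v \<in> vspace \<sigma>. F v = 0} \<Longrightarrow> act \<sigma> g u \<in> {v \<in> vspace \<sigma>. F v = 0}"
    using linear_maps_0[OF linear_repD(2)[OF \<tau>] linear_repD(1)[OF \<tau>]]
    by (simp add: intertwinersD(3)[OF F] linear_repD(3)[OF \<sigma>])
qed

end

section \<open>Intertwiners\<close>

context semitopological_group
begin

text \<open>The easy half of Mackey's formula: evaluation at a point \<open>x\<close> turns a map into an induced
  representation into an intertwiner at \<open>x\<^sup>-\<^sup>1\<close>.\<close>

lemma evaluation_intertwines:
  fixes \<sigma> :: "('a, 'w::complex_vector_space) repn" and \<tau> :: "('a, 'v::complex_vector_space) repn"
  assumes H: "subgroup H G" "openin T H" and \<sigma>: "linear_rep G H \<sigma>"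
    and \<Psi>: "\<Psi> \<in> intertwiners H \<sigma> (compact_induction G T H \<tau>)" and x: "x \<in> carrier G"
  shows "(\<lambda>v. if v \<in> vspace \<sigma> then \<Psi> v x else 0)
    \<in> intertwiners (H \<inter> conj_subgroup G H (inv x)) \<sigma> (conj_rep G \<tau> (inv x))"
proof (rule intertwinersI)
  note \<Psi>V = intertwinersD(4)[OF \<Psi>]
  show "(\<lambda>v. if v \<in> vspace \<sigma> then \<Psi> v x else 0) \<in> linear_maps (vspace \<sigma>) (vspace (conj_rep G \<tau> (inv x)))"
    using indD(2)[OF H \<Psi>V x] linear_repD(1)[OF \<sigma>] linear_mapsD(2,3)[OF intertwinersD(1)[OF \<Psi>]]
    by (intro linear_mapsI)
      (simp_all add: conj_rep_def cvs.subspace_add cvs.subspace_scale scaleC_fun_def)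
next
  fix n v
  assume n: "n \<in> H \<inter> conj_subgroup G H (inv x)" and v: "v \<in> vspace \<sigma>"
  note \<Psi>V = intertwinersD(4)[OF \<Psi>]
  have nH: "n \<in> H" "n \<in> carrier G" "x \<otimes> n \<otimes> inv x \<in> H"
    using n x mem_conj_subgroup_iff[OF subgroup.subset[OF H(1)], of "inv x" n] by simp_all
  have "\<Psi> (act \<sigma> n v) x = \<Psi> v (x \<otimes> n)"
    using nH x v by (simp add: intertwinersD(3)[OF \<Psi>] ind_act_apply)
  also have "x \<otimes> n = (x \<otimes> n \<otimes> inv x) \<otimes> x"
    using nH x by (simp add: m_assoc)
  also have "\<Psi> v \<dots> = act \<tau> (x \<otimes> n \<otimes> inv x) (\<Psi> v x)"
    by (rule indD(3)[OF H \<Psi>V[OF v] nH(3) x])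
  finally show "(if act \<sigma> n v \<in> vspace \<sigma> then \<Psi> (act \<sigma> n v) x else 0) =
      act (conj_rep G \<tau> (inv x)) n (if v \<in> vspace \<sigma> then \<Psi> v x else 0)"
    using v nH x linear_repD(3)[OF \<sigma>] by (simp add: conj_rep_def)
qed simp

lemma delta_intertwiner:
  assumes H: "subgroup H G" "openin T H" and \<tau>: "smooth_rep G T H \<tau>"
  shows "(\<lambda>v. if v \<in> vspace \<tau> then delta H \<tau> v else 0) \<in> intertwiners H \<tau> (compact_induction G T H \<tau>)"
proof (rule intertwinersI)
  have \<tau>l: "linear_rep G H \<tau>"
    using \<tau> by (simp add: smooth_rep_iff)
  have add: "delta H \<tau> (v + w) = delta H \<tau> v + delta H \<tau> w" if "v \<in> vspace \<tau>" "w \<in> vspace \<tau>" for v w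
    using that linear_mapsD(2)[OF linear_repD(2)[OF \<tau>l]] by (auto simp: delta_def fun_eq_iff)
  have scale: "delta H \<tau> (c *\<^sub>C v) = c *\<^sub>C delta H \<tau> v" if "v \<in> vspace \<tau>" for c v
    using that linear_mapsD(3)[OF linear_repD(2)[OF \<tau>l]] by (auto simp: delta_def fun_eq_iff scaleC_fun_def)
  show "(\<lambda>v. if v \<in> vspace \<tau> then delta H \<tau> v else 0) \<in> linear_maps (vspace \<tau>) (vspace (compact_induction G T H \<tau>))"
    using delta_in[OF H \<tau>l \<tau>] linear_repD(1)[OF \<tau>l]
    by (intro linear_mapsI) (simp_all add: add scale cvs.subspace_add cvs.subspace_scale)
  show "(if act \<tau> h v \<in> vspace \<tau> then delta H \<tau> (act \<tau> h v) else 0) =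
      act (compact_induction G T H \<tau>) h (if v \<in> vspace \<tau> then delta H \<tau> v else 0)"
    if "h \<in> H" "v \<in> vspace \<tau>" for h v
    using that linear_repD(3)[OF \<tau>l] by (simp add: delta_act[OF H \<tau>l])
qed simp

text \<open>A nonzero map does not kill every generator; evaluate the image of one at a point where it does not vanish.\<close>

lemma intertwines_if_nonzero_map:
  fixes \<tau> \<tau>' :: "('a, 'v::complex_vector_space) repn"
  assumes H: "subgroup H G" "openin T H" and \<tau>: "smooth_rep G T H \<tau>" and \<tau>': "linear_rep G H \<tau>'"
    and F: "F \<in> intertwiners (carrier G) (compact_induction G T H \<tau>) (compact_induction G T H \<tau>')"
    and nz: "F \<noteq> 0"
  obtains g A where "g \<in> carrier G" "A \<in> intertwiners (H \<inter> conj_subgroup G H g) \<tau> (conj_rep G \<tau>' g)" "A \<noteq> 0"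
proof -
  let ?I = "compact_induction G T H \<tau>" and ?I' = "compact_induction G T H \<tau>'"
  have \<tau>l: "linear_rep G H \<tau>"
    using \<tau> by (simp add: smooth_rep_iff)
  note I = ind_linear_rep[OF H \<tau>l] and I' = ind_linear_rep[OF H \<tau>']
  note d = delta_in[OF H \<tau>l \<tau>]
  have "\<exists>v\<in>vspace \<tau>. F (delta H \<tau> v) \<noteq> 0"
  proof (rule ccontr)
    assume "\<not> (\<exists>v\<in>vspace \<tau>. F (delta H \<tau> v) \<noteq> 0)"
    then have 0: "delta H \<tau> v \<in> {\<phi> \<in> vspace ?I. F \<phi> = 0}" if "v \<in> vspace \<tau>" for v
      using d that by blast
    have "F \<phi> = 0" for \<phi>
    proof (cases "\<phi> \<in> vspace ?I")
      case True
      have "\<phi> \<in> {\<phi> \<in> vspace ?I. F \<phi> = 0}"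
        by (rule ind_generated_by_delta[OF H \<tau>l \<tau> kernel_subspace[OF F I I'] 0 True])
      then show ?thesis
        by simp
    qed (rule intertwinersD(2)[OF F])
    then show False
      using nz by (simp add: fun_eq_iff)
  qed
  then obtain v where v: "v \<in> vspace \<tau>" "F (delta H \<tau> v) \<noteq> 0"
    by blast
  then obtain x where x: "F (delta H \<tau> v) x \<noteq> 0"
    by (auto simp: fun_eq_iff)
  have xG: "x \<in> carrier G"
    using x indD(1)[OF H intertwinersD(4)[OF F d[OF v(1)]]] by blast
  define \<Psi> where "\<Psi> = F \<circ> (\<lambda>v. if v \<in> vspace \<tau> then delta H \<tau> v else 0)"
  have "\<Psi> \<in> intertwiners H \<tau> ?I'"
    unfolding \<Psi>_def using delta_intertwiner[OF H \<tau>] _ linear_repD(1)[OF I]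
    by (rule intertwiners_compose)
      (use F intertwiners_subset[OF subgroup.subset[OF H(1)]] in \<open>rule subsetD[rotated]\<close>)
  from evaluation_intertwines[OF H \<tau>l this xG] show ?thesis
  proof (rule that[OF inv_closed[OF xG]])
    show "(\<lambda>v. if v \<in> vspace \<tau> then \<Psi> v x else 0) \<noteq> 0"
      using v(1) x by (auto simp: fun_eq_iff \<Psi>_def intro!: exI[of _ v])
  qed
qed

end

lemma intertwiners_subspace:
  assumes "linear_rep G H \<tau>"
  shows "cvs.subspace (intertwiners H \<sigma> \<tau>)"
  unfolding cvs.subspace_def
  by (intro conjI ballI allI zero_intertwiner[OF assms] intertwiners_add[OF _ _ assms] intertwiners_scale[OF _ assms])

context group
begin

lemma linear_rep_twist:
  assumes \<tau>: "linear_rep G H \<tau>" and H: "subgroup H G" and \<eta>: "\<eta> \<in> characters_mod G H H'"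
  shows "linear_rep G H (twist \<tau> \<eta>)"
  unfolding linear_rep_def
proof (intro conjI ballI)
  note lin = linear_mapsD[OF linear_repD(2)[OF \<tau>]]
  show "cvs.subspace (vspace (twist \<tau> \<eta>))"
    using linear_repD(1)[OF \<tau>] by (simp add: twist_def)
  show "act (twist \<tau> \<eta>) h \<in> linear_maps (vspace (twist \<tau> \<eta>)) (vspace (twist \<tau> \<eta>))" if "h \<in> H" for h
    using lin[OF that] linear_repD(1)[OF \<tau>]
    by (intro linear_mapsI) (simp_all add: twist_def cvs.subspace_scale scaleC_add_right scaleC_scaleC mult.commute)
  show "act (twist \<tau> \<eta>) \<one> v = v" if "v \<in> vspace (twist \<tau> \<eta>)" for v
    using that linear_repD(4)[OF \<tau>] characters_mod_inv(1)[OF \<eta> H subgroup.one_closed[OF H]]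
    by (simp add: twist_def scaleC_one)
  show "act (twist \<tau> \<eta>) (h \<otimes> k) v = act (twist \<tau> \<eta>) h (act (twist \<tau> \<eta>) k v)"
    if "h \<in> H" "k \<in> H" "v \<in> vspace (twist \<tau> \<eta>)" for h k v
    using that lin(3) linear_repD(3,5)[OF \<tau>] characters_modD(2)[OF \<eta>]
    by (simp add: twist_def scaleC_scaleC)
qed

lemma linear_rep_conj:
  assumes \<tau>: "linear_rep G H \<tau>" and H: "subgroup H G" and g: "g \<in> carrier G"
  shows "linear_rep G (conj_subgroup G H g) (conj_rep G \<tau> g)"
  unfolding linear_rep_def
proof (intro conjI ballI)
  note mem = mem_conj_subgroup_iff[OF subgroup.subset[OF H] g]
  show "cvs.subspace (vspace (conj_rep G \<tau> g))"
    using linear_repD(1)[OF \<tau>] by (simp add: conj_rep_def)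
  show "act (conj_rep G \<tau> g) h \<in> linear_maps (vspace (conj_rep G \<tau> g)) (vspace (conj_rep G \<tau> g))"
    if "h \<in> conj_subgroup G H g" for h
    using that linear_repD(2)[OF \<tau>] by (simp add: conj_rep_def mem)
  show "act (conj_rep G \<tau> g) \<one> v = v" if "v \<in> vspace (conj_rep G \<tau> g)" for v
    using that linear_repD(4)[OF \<tau>] g by (simp add: conj_rep_def)
  show "act (conj_rep G \<tau> g) (h \<otimes> k) v = act (conj_rep G \<tau> g) h (act (conj_rep G \<tau> g) k v)"
    if "h \<in> conj_subgroup G H g" "k \<in> conj_subgroup G H g" "v \<in> vspace (conj_rep G \<tau> g)" for h k v
    using that linear_repD(5)[OF \<tau>] g by (simp add: conj_rep_def mem conj_mult)
qed

text \<open>The group \<open>D\<close> acts on \<open>Hom\<^sub>E(\<sigma>, \<kappa>)\<close> by \<open>d B = \<kappa>(d) B \<sigma>(d)\<^sup>-\<^sup>1\<close>, and it does so through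
  \<open>D/E\<close>, which is abelian by the commutator hypothesis. As a subgroup of finite index acts by scalars, the orbit of
  \<open>A\<close> spans a finite-dimensional space, so there is a common eigenvector. Its eigenvalues form the character
  \<open>\<theta>\<close>.\<close>

lemma intertwiner_eigenvector:
  fixes \<sigma> :: "('a, 'v::complex_vector_space) repn" and \<kappa> :: "('a, 'w::complex_vector_space) repn"
  assumes D: "subgroup D G" and E: "subgroup E G" "E \<subseteq> D"
    and comm: "\<And>c d. c \<in> D \<Longrightarrow> d \<in> D \<Longrightarrow> inv (d \<otimes> c) \<otimes> (c \<otimes> d) \<in> E"
    and \<sigma>: "linear_rep G D \<sigma>" and \<kappa>: "linear_rep G D \<kappa>"
    and L: "subgroup L G" "L \<subseteq> D" "finite_index L D"
    and \<sigma>L: "\<And>l. l \<in> L \<Longrightarrow> \<exists>a. \<forall>v\<in>vspace \<sigma>. act \<sigma> l v = a *\<^sub>C v"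
    and \<kappa>L: "\<And>l. l \<in> L \<Longrightarrow> \<exists>a. \<forall>v\<in>vspace \<kappa>. act \<kappa> l v = a *\<^sub>C v"
    and A: "A \<in> intertwiners E \<sigma> \<kappa>" "A \<noteq> 0"
  obtains \<theta> B where "\<theta> \<in> characters_mod G D E" "B \<in> intertwiners D (twist \<sigma> \<theta>) \<kappa>" "B \<noteq> 0"
proof -
  define t where "t d B v = (if v \<in> vspace \<sigma> then act \<kappa> d (B (act \<sigma> (inv d) v)) else 0)" for d B v
  define \<H> where "\<H> = intertwiners E \<sigma> \<kappa>"
  have DG: "d \<in> carrier G" if "d \<in> D" for d
    by (rule subgroup.mem_carrier[OF D that])
  have Dinv: "inv d \<in> D" if "d \<in> D" for d
    by (rule subgroup.m_inv_closed[OF D that])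
  have Dm: "c \<otimes> d \<in> D" if "c \<in> D" "d \<in> D" for c d
    by (rule subgroup.m_closed[OF D that])
  have ED: "e \<in> D" if "e \<in> E" for e
    using that E(2) by blast
  note \<sigma>V = linear_repD(3)[OF \<sigma>] and \<kappa>V = linear_repD(3)[OF \<kappa>]
  note \<sigma>lin = linear_mapsD(2,3)[OF linear_repD(2)[OF \<sigma>]] and \<kappa>lin = linear_mapsD(2,3)[OF linear_repD(2)[OF \<kappa>]]
  have \<H>sub: "cvs.subspace \<H>"
    unfolding \<H>_def using linear_rep_subset[OF \<kappa> E(2)] by (rule intertwiners_subspace)
  have \<H>: "B v \<in> vspace \<kappa>" "B (v + w) = B v + B w" "B (c *\<^sub>C v) = c *\<^sub>C B v"
    if "B \<in> \<H>" "v \<in> vspace \<sigma>" "w \<in> vspace \<sigma>" for B v w c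
    using linear_mapsD[OF intertwinersD(1)[OF that(1)[unfolded \<H>_def]]] that(2,3) by simp_all
  have \<H>e: "B (act \<sigma> e v) = act \<kappa> e (B v)" if "B \<in> \<H>" "e \<in> E" "v \<in> vspace \<sigma>" for B e v
    using intertwinersD(3)[OF that(1)[unfolded \<H>_def] that(2,3)] .
  have \<H>0: "B v = 0" if "B \<in> \<H>" "v \<notin> vspace \<sigma>" for B v
    using intertwinersD(2)[OF that(1)[unfolded \<H>_def] that(2)] .
  have t\<H>: "t d B \<in> \<H>" if d: "d \<in> D" and B: "B \<in> \<H>" for d B
    unfolding \<H>_def
  proof (rule intertwinersI)
    show "t d B \<in> linear_maps (vspace \<sigma>) (vspace \<kappa>)"
      using d Dinv B linear_repD(1)[OF \<sigma>]
      by (intro linear_mapsI) (simp_all add: t_def \<sigma>V \<kappa>V \<H> \<sigma>lin \<kappa>lin cvs.subspace_add cvs.subspace_scale)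
    show "t d B v = 0" if "v \<notin> vspace \<sigma>" for v
      using that by (simp add: t_def)
    fix e v
    assume e: "e \<in> E" and v: "v \<in> vspace \<sigma>"
    define e' where "e' = inv d \<otimes> e \<otimes> d"
    have e'E: "e' \<in> E"
    proof -
      have "inv (d \<otimes> inv e) \<otimes> (inv e \<otimes> d) \<in> E"
        using comm d ED[OF e] Dinv by simp
      then have "e \<otimes> inv d \<otimes> (inv e \<otimes> d) \<in> E"
        using d DG ED[OF e] by (simp add: inv_mult_group)
      moreover have "e' = inv (inv d \<otimes> inv e \<otimes> d)"
        using d DG ED[OF e] unfolding e'_def by (simp add: inv_mult_group m_assoc)
      moreover have "inv d \<otimes> inv e \<otimes> d = inv e \<otimes> (e \<otimes> inv d \<otimes> (inv e \<otimes> d))"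
        using d DG ED[OF e] by (simp add: m_assoc mult_inv_cancel)
      ultimately show ?thesis
        using E(1) e by (simp add: subgroup.m_closed subgroup.m_inv_closed)
    qed
    have eq: "inv d \<otimes> e = e' \<otimes> inv d" "d \<otimes> e' = e \<otimes> d"
      unfolding e'_def using d DG ED[OF e] by (simp_all add: m_assoc mult_inv_cancel)
    note mem = d ED[OF e] ED[OF e'E] Dinv[OF d] e'E e v
    have "t d B (act \<sigma> e v) = act \<kappa> d (B (act \<sigma> (inv d \<otimes> e) v))"
      using mem by (simp add: t_def \<sigma>V linear_repD(5)[OF \<sigma>])
    also have "\<dots> = act \<kappa> d (act \<kappa> e' (B (act \<sigma> (inv d) v)))"
      unfolding eq using mem B by (simp add: \<sigma>V linear_repD(5)[OF \<sigma>] \<H>e)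
    also have "\<dots> = act \<kappa> (d \<otimes> e') (B (act \<sigma> (inv d) v))"
      using mem B by (simp add: \<sigma>V linear_repD(5)[OF \<kappa>] \<H>)
    also have "\<dots> = act \<kappa> e (t d B v)"
      unfolding eq using mem B by (simp add: t_def \<sigma>V linear_repD(5)[OF \<kappa>] \<H>)
    finally show "t d B (act \<sigma> e v) = act \<kappa> e (t d B v)" .
  qed
  have tlin: "t d (B + C) = t d B + t d C" "t d (c *\<^sub>C B) = c *\<^sub>C t d B"
    if "d \<in> D" "B \<in> \<H>" "C \<in> \<H>" for d B C c
    using that Dinv by (auto simp: t_def fun_eq_iff scaleC_fun_def \<H> \<sigma>V \<kappa>lin)
  have tmult: "t (c \<otimes> d) B = t c (t d B)" if "c \<in> D" "d \<in> D" "B \<in> \<H>" for c d B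
    using that Dinv DG
    by (auto simp: t_def fun_eq_iff \<H> \<sigma>V \<kappa>V inv_mult_group linear_repD(5)[OF \<kappa>] linear_repD(5)[OF \<sigma>])
  have tE: "t e B = B" if "e \<in> E" "B \<in> \<H>" for e B
  proof
    fix v
    show "t e B v = B v"
    proof (cases "v \<in> vspace \<sigma>")
      case True
      have "act \<kappa> e (B (act \<sigma> (inv e) v)) = B (act \<sigma> e (act \<sigma> (inv e) v))"
        using that True ED Dinv \<sigma>V by (simp add: \<H>e)
      then show ?thesis
        using True that(1) ED by (simp add: t_def linear_rep_inverse(2)[OF \<sigma> D])
    qed (use that in \<open>simp add: t_def \<H>0\<close>)
  qed
  have tcomm: "t c (t d B) = t d (t c B)" if "c \<in> D" "d \<in> D" "B \<in> \<H>" for c d B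
  proof -
    define e where "e = inv (d \<otimes> c) \<otimes> (c \<otimes> d)"
    have e: "e \<in> E"
      unfolding e_def by (rule comm[OF that(1,2)])
    have "c \<otimes> d = (d \<otimes> c) \<otimes> e"
      unfolding e_def using that DG by (simp add: mult_inv_cancel)
    then have "t (c \<otimes> d) B = t (d \<otimes> c) (t e B)"
      using tmult[OF Dm[OF that(2,1)] ED[OF e] that(3)] by simp
    then show ?thesis
      using that by (simp add: tE[OF e] tmult)
  qed
  have A\<H>: "A \<in> \<H>"
    using A unfolding \<H>_def by simp
  define S where "S = (\<lambda>d. t d A) ` D"
  define S0 where "S0 = (\<lambda>c. t (SOME x. x \<in> D \<and> x <# L = c) A) ` (\<lambda>x. x <# L) ` D"
  define U where "U = cvs.span S"
  have S0: "finite S0"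
    using L(3) unfolding S0_def finite_index_def by simp
  have tL: "\<exists>a. t l A = a *\<^sub>C A" if l: "l \<in> L" for l
  proof -
    obtain a where a: "\<forall>v\<in>vspace \<sigma>. act \<sigma> (inv l) v = a *\<^sub>C v"
      using \<sigma>L[OF subgroup.m_inv_closed[OF L(1) l]] by blast
    obtain b where b: "\<forall>v\<in>vspace \<kappa>. act \<kappa> l v = b *\<^sub>C v"
      using \<kappa>L[OF l] by blast
    have "t l A = (b * a) *\<^sub>C A"
    proof
      fix v
      show "t l A v = ((b * a) *\<^sub>C A) v"
        using a b \<H>[OF A\<H>, of v v] linear_repD(1)[OF \<kappa>] \<H>0[OF A\<H>, of v]
        by (cases "v \<in> vspace \<sigma>") (simp_all add: t_def scaleC_fun_def scaleC_scaleC cvs.subspace_scale)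
    qed
    then show ?thesis
      by blast
  qed
  have "S \<subseteq> cvs.span S0"
  proof
    fix B
    assume "B \<in> S"
    then obtain d where d: "d \<in> D" "B = t d A"
      unfolding S_def by blast
    define x where "x = (SOME x. x \<in> D \<and> x <# L = d <# L)"
    have x: "x \<in> D" "x <# L = d <# L"
      unfolding x_def using fiber_sum_choice[of "d <# L" "\<lambda>x. x <# L" D] d(1) by simp_all
    have l: "inv x \<otimes> d \<in> L"
      using x d(1) DG l_coset_eq_iff[OF L(1)] by simp
    then obtain a where a: "t (inv x \<otimes> d) A = a *\<^sub>C A"
      using tL by blast
    have "d = x \<otimes> (inv x \<otimes> d)"
      using x(1) d(1) DG by (simp add: mult_inv_cancel)
    then have "t d A = t x (t (inv x \<otimes> d) A)"
      using tmult[OF x(1) _ A\<H>, of "inv x \<otimes> d"] l L(2) by auto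
    then have "B = a *\<^sub>C t x A"
      unfolding d(2) a using tlin(2)[OF x(1) A\<H> A\<H>] by simp
    moreover have "t x A \<in> S0"
      unfolding S0_def x_def using d(1) by blast
    ultimately show "B \<in> cvs.span S0"
      by (simp add: cvs.span_base cvs.span_scale)
  qed
  then have US0: "U \<subseteq> cvs.span S0"
    unfolding U_def by (intro cvs.span_minimal cvs.subspace_span)
  have U\<H>: "U \<subseteq> \<H>"
    unfolding U_def by (rule cvs.span_minimal[OF _ \<H>sub]) (auto simp: S_def t\<H> A\<H>)
  have tU: "t d B \<in> U" if d: "d \<in> D" and B: "B \<in> U" for d B
  proof -
    have "cvs.subspace {B \<in> \<H>. t d B \<in> U}"
      unfolding cvs.subspace_def
    proof (intro conjI ballI allI)
      have "t d 0 = 0"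
        using tlin(2)[OF d A\<H> A\<H>, of 0] by simp
      then show "0 \<in> {B \<in> \<H>. t d B \<in> U}"
        using cvs.subspace_0[OF \<H>sub] by (simp add: U_def cvs.span_zero)
    qed (use \<H>sub d in \<open>simp_all add: U_def tlin(1) tlin(2)[OF d _ A\<H>] cvs.subspace_add cvs.subspace_scale cvs.span_add cvs.span_scale\<close>)
    moreover have "S \<subseteq> {B \<in> \<H>. t d B \<in> U}"
    proof
      fix B
      assume "B \<in> S"
      then obtain c where c: "c \<in> D" "B = t c A"
        unfolding S_def by blast
      have "t d B = t (d \<otimes> c) A"
        using c d tmult[OF d c(1) A\<H>] by simp
      then have "t d B \<in> S"
        unfolding S_def using Dm[OF d c(1)] by blast
      then show "B \<in> {B \<in> \<H>. t d B \<in> U}"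
        unfolding U_def using c t\<H>[OF c(1) A\<H>] by (simp add: cvs.span_base)
    qed
    ultimately have "U \<subseteq> {B \<in> \<H>. t d B \<in> U}"
      unfolding U_def by (rule cvs.span_minimal[rotated])
    then show ?thesis
      using B by blast
  qed
  have AU: "A \<in> U"
    using tE[OF subgroup.one_closed[OF E(1)] A\<H>] subgroup.one_closed[OF D]
    unfolding U_def S_def by (intro cvs.span_base) (rule image_eqI[OF sym])
  obtain B where B: "B \<in> U" "B \<noteq> 0" "\<forall>f\<in>t ` D. \<exists>a. f B = a *\<^sub>C B"
  proof (rule common_eigenvector[where V = U and S = S0 and A = "t ` D"])
    show "cvs.subspace U"
      unfolding U_def by (rule cvs.subspace_span)
    show "U \<noteq> {0}"
      using AU A(2) by blast
    show "f \<in> linear_maps U U" if "f \<in> t ` D" for f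
      using that tU tlin(1) tlin(2)[OF _ _ A\<H>] subsetD[OF U\<H>] by (intro linear_mapsI) auto
    show "g (f v) = f (g v)" if "f \<in> t ` D" "g \<in> t ` D" "v \<in> U" for f g v
      using that tcomm subsetD[OF U\<H>] by auto
  qed (rule S0, rule US0)
  have B\<H>: "B \<in> \<H>"
    using B(1) U\<H> by blast
  define \<theta> where "\<theta> = (\<lambda>d\<in>D. SOME a. t d B = a *\<^sub>C B)"
  have \<theta>: "t d B = \<theta> d *\<^sub>C B" if "d \<in> D" for d
  proof -
    have "\<exists>a. t d B = a *\<^sub>C B"
      using B(3) that by blast
    from someI_ex[OF this] show ?thesis
      using that by (simp add: \<theta>_def)
  qed
  have uniq: "a = b" if "a *\<^sub>C B = b *\<^sub>C B" for a b
    using that B(2) by (simp add: cvs.scale_right_imp_eq)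
  have \<theta>m: "\<theta> (c \<otimes> d) = \<theta> c * \<theta> d" if "c \<in> D" "d \<in> D" for c d
  proof (rule uniq)
    have "\<theta> (c \<otimes> d) *\<^sub>C B = t c (\<theta> d *\<^sub>C B)"
      using that by (simp add: \<theta>[symmetric] Dm tmult B\<H>)
    also have "\<dots> = (\<theta> c * \<theta> d) *\<^sub>C B"
      using that B\<H> by (simp add: tlin(2)[of c B B] \<theta> scaleC_scaleC mult.commute)
    finally show "\<theta> (c \<otimes> d) *\<^sub>C B = (\<theta> c * \<theta> d) *\<^sub>C B" .
  qed
  have \<theta>1: "\<theta> e = 1" if "e \<in> E" for e
    by (rule uniq) (use \<theta>[OF ED[OF that]] tE[OF that B\<H>] in \<open>simp add: scaleC_one\<close>)
  have "\<theta> \<in> characters_mod G D E"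
  proof (rule characters_modI)
    fix d
    assume d: "d \<in> D"
    have "\<theta> d * \<theta> (inv d) = 1"
      using \<theta>m[OF d Dinv[OF d]] \<theta>1[OF subgroup.one_closed[OF E(1)]] DG[OF d] by simp
    then show "\<theta> d \<noteq> 0"
      by auto
  qed (use \<theta>m \<theta>1 in \<open>simp_all add: \<theta>_def\<close>)
  moreover have "B \<in> intertwiners D (twist \<sigma> \<theta>) \<kappa>"
  proof (rule intertwinersI)
    show "B \<in> linear_maps (vspace (twist \<sigma> \<theta>)) (vspace \<kappa>)"
      using \<H>[OF B\<H>] by (intro linear_mapsI) (simp_all add: twist_def)
    show "B v = 0" if "v \<notin> vspace (twist \<sigma> \<theta>)" for v
      using that \<H>0[OF B\<H>] by (simp add: twist_def)
    fix d v
    assume d: "d \<in> D" and "v \<in> vspace (twist \<sigma> \<theta>)"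
    then have v: "v \<in> vspace \<sigma>"
      by (simp add: twist_def)
    have "t d B (act \<sigma> d v) = \<theta> d *\<^sub>C B (act \<sigma> d v)"
      unfolding \<theta>[OF d] by (simp add: scaleC_fun_def)
    moreover have "t d B (act \<sigma> d v) = act \<kappa> d (B v)"
      using d v by (simp add: t_def \<sigma>V linear_rep_inverse(1)[OF \<sigma> D])
    ultimately show "B (act (twist \<sigma> \<theta>) d v) = act \<kappa> d (B v)"
      using \<H>(3)[OF B\<H> \<sigma>V[OF d v] v] by (simp add: twist_def)
  qed
  ultimately show ?thesis
    using B(2) by (rule that)
qed

end

section \<open>Supercuspidal representations\<close>

context semitopological_group
begin

lemma common_open_subgroup:
  assumes "finite B" "\<And>b. b \<in> B \<Longrightarrow> \<exists>K. subgroup K G \<and> openin T K \<and> (\<forall>k\<in>K. Q b k)"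
  shows "\<exists>K. subgroup K G \<and> openin T K \<and> (\<forall>b\<in>B. \<forall>k\<in>K. Q b k)"
  using assms
proof (induction B)
  case empty
  have "openin T (carrier G)"
    using openin_topspace[of T] by (simp only: topspace_eq)
  then show ?case
    using subgroup_self by (intro exI[of _ "carrier G"]) simp
next
  case (insert b B)
  then obtain K K' where "subgroup K G" "openin T K" "\<forall>b\<in>B. \<forall>k\<in>K. Q b k"
    "subgroup K' G" "openin T K'" "\<forall>k\<in>K'. Q b k"
    by (metis insertCI)
  then show ?case
    by (intro exI[of _ "K \<inter> K'"]) (simp add: subgroup_Int openin_Int)
qed

lemma stabilizer_open:
  assumes "smooth_rep G T H \<tau>" "openin T H" "v \<in> vspace \<tau>"
  shows "openin T {h \<in> H. act \<tau> h v = v}"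
  using assms unfolding smooth_rep_iff by (simp add: openin_open_subtopology)

end

text \<open>A representation \<open>\<rho>\<close> of an open subgroup \<open>H\<close>, compact modulo the center, whose compact
  induction will be irreducible because its intertwining is as small as possible.\<close>

locale cuspidal_datum = semitopological_group G T for G (structure) and T +
  fixes Z H :: "'a set" and \<rho> :: "('a, 'v::complex_vector_space) repn"
  assumes countable_cosets: "subgroup K G \<Longrightarrow> openin T K \<Longrightarrow> countable ((\<lambda>x. x <# K) ` carrier G)"
    and Z: "subgroup Z G" "z \<in> Z \<Longrightarrow> g \<in> carrier G \<Longrightarrow> z \<otimes> g = g \<otimes> z"
    and H: "subgroup H G" "openin T H" and ZH: "Z \<subseteq> H" "compact_modulo G T Z H"
    and irreducible: "\<rho> \<in> Irr G T H" and intertwining: "intertwining_set G H \<rho> = H"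
begin

lemma HG: "h \<in> H \<Longrightarrow> h \<in> carrier G"
  by (rule subgroup.mem_carrier[OF H(1)])

lemma ZG: "z \<in> Z \<Longrightarrow> z \<in> carrier G"
  by (rule subgroup.mem_carrier[OF Z(1)])

lemma smooth: "smooth_rep G T H \<rho>"
  using irreducible by (simp add: Irr_def)

lemma rep: "linear_rep G H \<rho>"
  using smooth by (simp add: smooth_rep_iff)

abbreviation V :: "'v set" where "V \<equiv> vspace \<rho>"

lemma V_nonzero: "V \<noteq> {0}"
  using irreducible by (simp add: Irr_def)

lemma simple:
  assumes "cvs.subspace W" "W \<subseteq> V" "\<And>h w. h \<in> H \<Longrightarrow> w \<in> W \<Longrightarrow> act \<rho> h w \<in> W"
  shows "W = {0} \<or> W = V"
  using irreducible assms unfolding Irr_def by simp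

lemma subgroup_center_mult:
  assumes K: "subgroup K G"
  shows "subgroup (Z <#> K) G"
proof -
  have ZK: "z \<otimes> k = k \<otimes> z" "z \<in> carrier G" "k \<in> carrier G" if "z \<in> Z" "k \<in> K" for z k
    using that Z(2) ZG subgroup.mem_carrier[OF K] by simp_all
  show ?thesis
  proof (rule subgroupI)
    show "Z <#> K \<subseteq> carrier G"
      unfolding set_mult_def using ZK by auto
    show "Z <#> K \<noteq> {}"
      unfolding set_mult_def using subgroup.one_closed[OF Z(1)] subgroup.one_closed[OF K] by blast
  next
    fix x
    assume "x \<in> Z <#> K"
    then obtain z k where x: "z \<in> Z" "k \<in> K" "x = z \<otimes> k"
      unfolding set_mult_def by blast
    then have "inv x = inv z \<otimes> inv k" "inv z \<in> Z" "inv k \<in> K"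
      using ZK[OF x(1,2)] subgroup.m_inv_closed[OF Z(1)] subgroup.m_inv_closed[OF K]
      by (simp_all add: inv_mult_group[symmetric])
    then show "inv x \<in> Z <#> K"
      unfolding set_mult_def by blast
  next
    fix x y
    assume "x \<in> Z <#> K" "y \<in> Z <#> K"
    then obtain z k w l where x: "z \<in> Z" "k \<in> K" "x = z \<otimes> k" and y: "w \<in> Z" "l \<in> K" "y = w \<otimes> l"
      unfolding set_mult_def by blast
    have "x \<otimes> y = z \<otimes> (k \<otimes> w) \<otimes> l"
      using ZK(2,3)[OF x(1,2)] ZK(2,3)[OF y(1,2)] unfolding x(3) y(3) by (simp add: m_assoc)
    also have "k \<otimes> w = w \<otimes> k"
      using ZK(1)[OF y(1) x(2)] by simp
    also have "z \<otimes> (w \<otimes> k) \<otimes> l = (z \<otimes> w) \<otimes> (k \<otimes> l)"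
      using ZK(2,3)[OF x(1,2)] ZK(2,3)[OF y(1,2)] by (simp add: m_assoc)
    finally have "x \<otimes> y = (z \<otimes> w) \<otimes> (k \<otimes> l)" .
    moreover have "z \<otimes> w \<in> Z" "k \<otimes> l \<in> K"
      using x y subgroup.m_closed[OF Z(1)] subgroup.m_closed[OF K] by simp_all
    ultimately show "x \<otimes> y \<in> Z <#> K"
      unfolding set_mult_def by blast
  qed
qed

text \<open>The images of the sets \<open>j K\<close> in the coset space of \<open>Z\<close> are open and cover the compact image of \<open>H\<close>, so finitely
  many of them suffice.\<close>

lemma finite_index_center_mult:
  assumes K: "subgroup K G" "openin T K" "K \<subseteq> H"
  shows "finite_index (Z <#> K) H"
proof -
  have ZK: "subgroup (Z <#> K) G"
    by (rule subgroup_center_mult[OF K(1)])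
  define U where "U j = (\<lambda>x. Z #> x) ` (j <# K)" for j
  have KG: "k \<in> carrier G" if "k \<in> K" for k
    by (rule subgroup.mem_carrier[OF K(1) that])
  have jK: "x \<in> carrier G" if "x \<in> j <# K" "j \<in> H" for x j
    using that KG HG unfolding l_coset_def by auto
  have "openin (coset_topology G T Z) (U j)" if j: "j \<in> H" for j
    unfolding openin_coset_topology[OF Z(1)]
  proof
    show "U j \<subseteq> rcosets Z"
      unfolding U_def RCOSETS_def using jK[OF _ j] by blast
    have "\<Union>(U j) = (\<Union>z\<in>Z. z <# (j <# K))"
      unfolding U_def r_coset_def l_coset_def by blast
    moreover have "openin T (\<Union>z\<in>Z. z <# (j <# K))"
      by (rule openin_Union) (auto intro!: openin_l_coset[OF openin_l_coset[OF K(2) HG[OF j]] ZG])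
    ultimately show "openin T (\<Union>(U j))"
      by simp
  qed
  moreover have "(\<lambda>x. Z #> x) ` H \<subseteq> \<Union>(U ` H)"
  proof
    fix C
    assume "C \<in> (\<lambda>x. Z #> x) ` H"
    then obtain j where j: "j \<in> H" "C = Z #> j"
      by blast
    have "j \<otimes> \<one> \<in> j <# K"
      unfolding l_coset_def using subgroup.one_closed[OF K(1)] by blast
    then show "C \<in> \<Union>(U ` H)"
      unfolding U_def using j HG[OF j(1)] by auto
  qed
  ultimately obtain \<F> where \<F>: "finite \<F>" "\<F> \<subseteq> U ` H" "(\<lambda>x. Z #> x) ` H \<subseteq> \<Union>\<F>"
    using ZH(2) unfolding compact_modulo_def compactin_def by (metis (no_types, lifting) imageE)
  then obtain R where R: "R \<subseteq> H" "finite R" "\<F> = U ` R"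
    using finite_subset_image by metis
  have "(\<lambda>x. x <# (Z <#> K)) ` H \<subseteq> (\<lambda>x. x <# (Z <#> K)) ` R"
  proof
    fix C
    assume "C \<in> (\<lambda>x. x <# (Z <#> K)) ` H"
    then obtain h where h: "h \<in> H" "C = h <# (Z <#> K)"
      by blast
    then obtain j x where jx: "j \<in> R" "x \<in> j <# K" "Z #> h = Z #> x"
      using \<F>(3) R(3) unfolding U_def by blast
    then obtain k where k: "k \<in> K" "x = j \<otimes> k"
      unfolding l_coset_def by blast
    have G: "h \<in> carrier G" "j \<in> carrier G" "k \<in> carrier G" "x \<in> carrier G"
      using h(1) jx R(1) HG k KG by auto
    have z: "h \<otimes> inv x \<in> Z"
      using jx(3) G r_coset_eq_iff[OF Z(1), of x h] by simp
    have "inv j \<otimes> h = inv j \<otimes> ((h \<otimes> inv x) \<otimes> x)"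
      using G by (simp add: m_assoc)
    also have "\<dots> = inv j \<otimes> (x \<otimes> (h \<otimes> inv x))"
      using Z(2)[OF z G(4)] by simp
    also have "\<dots> = k \<otimes> (h \<otimes> inv x)"
      using G unfolding k(2) by (simp add: m_assoc mult_inv_cancel)
    also have "\<dots> = (h \<otimes> inv x) \<otimes> k"
      using Z(2)[OF z G(3)] by simp
    finally have "inv j \<otimes> h \<in> Z <#> K"
      unfolding set_mult_def using z k(1) by auto
    then have "j <# (Z <#> K) = h <# (Z <#> K)"
      using l_coset_eq_iff[OF ZK G(2,1)] by simp
    then show "C \<in> (\<lambda>x. x <# (Z <#> K)) ` R"
      using h(2) jx(1) by auto
  qed
  then show ?thesis
    unfolding finite_index_def using R(2) by (simp add: finite_subset)
qed

lemma span_orbit: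
  assumes v: "v \<in> V" "v \<noteq> 0"
  shows "V = cvs.span ((\<lambda>h. act \<rho> h v) ` H)"
proof -
  define S where "S = (\<lambda>h. act \<rho> h v) ` H"
  have SV: "cvs.span S \<subseteq> V"
    by (rule cvs.span_minimal[OF _ linear_repD(1)[OF rep]]) (auto simp: S_def linear_repD(3)[OF rep] v)
  have "act \<rho> h w \<in> cvs.span S" if h: "h \<in> H" and w: "w \<in> cvs.span S" for h w
  proof -
    note lin = linear_mapsD(2,3)[OF linear_repD(2)[OF rep h]]
    have "cvs.subspace {w \<in> V. act \<rho> h w \<in> cvs.span S}"
      unfolding cvs.subspace_def using linear_repD(1)[OF rep] lin
        linear_maps_0[OF linear_repD(2)[OF rep h] linear_repD(1)[OF rep]]
      by (simp add: cvs.subspace_0 cvs.subspace_add cvs.subspace_scale cvs.span_zero cvs.span_add cvs.span_scale)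
    moreover have "S \<subseteq> {w \<in> V. act \<rho> h w \<in> cvs.span S}"
    proof
      fix w
      assume "w \<in> S"
      then obtain k where k: "k \<in> H" "w = act \<rho> k v"
        unfolding S_def by blast
      then have "act \<rho> h w = act \<rho> (h \<otimes> k) v"
        using linear_repD(5)[OF rep h k(1) v(1)] by simp
      moreover have "h \<otimes> k \<in> H"
        by (rule subgroup.m_closed[OF H(1) h k(1)])
      ultimately have "act \<rho> h w \<in> S"
        unfolding S_def by simp
      then show "w \<in> {w \<in> V. act \<rho> h w \<in> cvs.span S}"
        using k v linear_repD(3)[OF rep] by (simp add: cvs.span_base)
    qed
    ultimately have "cvs.span S \<subseteq> {w \<in> V. act \<rho> h w \<in> cvs.span S}"
      by (rule cvs.span_minimal[rotated])
    then show ?thesis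
      using w by blast
  qed
  then have "cvs.span S = {0} \<or> cvs.span S = V"
    using SV by (intro simple) simp_all
  moreover have "v \<in> cvs.span S"
    using linear_repD(4)[OF rep v(1)] subgroup.one_closed[OF H(1)] unfolding S_def
    by (intro cvs.span_base) (rule image_eqI[OF sym])
  ultimately show ?thesis
    using v(2) unfolding S_def by auto
qed

text \<open>Schur's lemma applies since \<open>\<rho>\<close> has countable dimension: the orbit of a smooth vector is a
  quotient of a countable coset space.\<close>

lemma central_character:
  obtains \<omega> where "\<forall>z\<in>Z. \<forall>v\<in>V. act \<rho> z v = \<omega> z *\<^sub>C v"
proof -
  obtain v where v: "v \<in> V" "v \<noteq> 0"
    using V_nonzero cvs.subspace_0[OF linear_repD(1)[OF rep]] by auto
  define K where "K = {h \<in> H. act \<rho> h v = v}"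
  have K: "subgroup K G" "openin T K"
    unfolding K_def by (rule subgroup_stabilizer[OF rep H(1) v(1)], rule stabilizer_open[OF smooth H(2) v(1)])
  have orbit: "act \<rho> x v = act \<rho> y v" if xy: "x \<in> H" "y \<in> H" "x <# K = y <# K" for x y
  proof -
    have l: "inv x \<otimes> y \<in> K"
      using xy HG l_coset_eq_iff[OF K(1)] by simp
    have "y = x \<otimes> (inv x \<otimes> y)"
      using xy HG by (simp add: mult_inv_cancel)
    then have "act \<rho> y v = act \<rho> x (act \<rho> (inv x \<otimes> y) v)"
      using linear_repD(5)[OF rep xy(1) _ v(1), of "inv x \<otimes> y"] l by (simp add: K_def)
    then show ?thesis
      using l by (simp add: K_def)
  qed
  have "(\<lambda>h. act \<rho> h v) ` H \<subseteq>
      (\<lambda>C. act \<rho> (SOME x. x \<in> H \<and> x <# K = C) v) ` (\<lambda>x. x <# K) ` carrier G"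
  proof
    fix w
    assume "w \<in> (\<lambda>h. act \<rho> h v) ` H"
    then obtain h where h: "h \<in> H" "w = act \<rho> h v"
      by blast
    have c: "h <# K \<in> (\<lambda>x. x <# K) ` H"
      using h(1) by (rule imageI)
    have "act \<rho> (SOME x. x \<in> H \<and> x <# K = h <# K) v = w"
      unfolding h(2) by (rule orbit[OF fiber_sum_choice(1)[OF c] h(1) fiber_sum_choice(2)[OF c]])
    then show "w \<in> (\<lambda>C. act \<rho> (SOME x. x \<in> H \<and> x <# K = C) v) ` (\<lambda>x. x <# K) ` carrier G"
      by (rule image_eqI[where x = "h <# K", OF sym]) (intro imageI HG h(1))
  qed
  then have count: "countable ((\<lambda>h. act \<rho> h v) ` H)"
    using countable_cosets[OF K] by (meson countable_image countable_subset)
  have "\<exists>a. \<forall>v\<in>V. act \<rho> z v = a *\<^sub>C v" if z: "z \<in> Z" for z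
  proof (rule schur[where V = V and A = "act \<rho> ` H" and T = "act \<rho> z"])
    show "countable ((\<lambda>h. act \<rho> h v) ` H)"
      by (rule count)
    show "V \<subseteq> cvs.span ((\<lambda>h. act \<rho> h v) ` H)"
      using span_orbit[OF v] by simp
    show "f \<in> linear_maps V V" if "f \<in> act \<rho> ` H" for f
      using that linear_repD(2)[OF rep] by auto
    show "act \<rho> z \<in> linear_maps V V"
      using z ZH(1) linear_repD(2)[OF rep] by auto
    show "W = {0} \<or> W = V" if "cvs.subspace W" "W \<subseteq> V" "\<forall>f\<in>act \<rho> ` H. \<forall>w\<in>W. f w \<in> W" for W
      using that by (intro simple) auto
    show "act \<rho> z (f v) = f (act \<rho> z v)" if f: "f \<in> act \<rho> ` H" and v: "v \<in> V" for f v
    proof -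
      obtain h where h: "h \<in> H" "f = act \<rho> h"
        using f by blast
      have zH: "z \<in> H"
        using z ZH(1) by blast
      show ?thesis
        unfolding h(2) linear_repD(5)[OF rep zH h(1) v, symmetric] linear_repD(5)[OF rep h(1) zH v, symmetric]
        using Z(2)[OF z HG[OF h(1)]] by simp
    qed
    show "\<exists>a. \<forall>v\<in>V. act \<rho> z v = a *\<^sub>C v" if "\<forall>v\<in>V. act \<rho> z v = a *\<^sub>C v" for a
      using that by (rule exI)
  qed (rule linear_repD(1)[OF rep], rule V_nonzero)
  then have "\<forall>z\<in>Z. \<exists>a. \<forall>v\<in>V. act \<rho> z v = a *\<^sub>C v"
    by (rule ballI)
  then obtain \<omega> where "\<forall>z\<in>Z. \<forall>v\<in>V. act \<rho> z v = \<omega> z *\<^sub>C v"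
    by (rule bchoice[THEN exE])
  then show ?thesis
    by (rule that)
qed

text \<open>The vectors \<open>\<rho>(h) v\<close> span. Up to scalars they depend only on the class of \<open>h\<close> modulo \<open>ZK\<close>, where \<open>K\<close> is the
  stabilizer of \<open>v\<close>, and there are finitely many classes.\<close>

lemma finite_spanning_set:
  obtains B where "finite B" "B \<subseteq> V" "V = cvs.span B"
proof -
  obtain \<omega> where \<omega>: "\<forall>z\<in>Z. \<forall>v\<in>V. act \<rho> z v = \<omega> z *\<^sub>C v"
    by (rule central_character)
  obtain v where v: "v \<in> V" "v \<noteq> 0"
    using V_nonzero cvs.subspace_0[OF linear_repD(1)[OF rep]] by auto
  define K where "K = {h \<in> H. act \<rho> h v = v}"
  have K: "subgroup K G" "openin T K" "K \<subseteq> H"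
    unfolding K_def by (rule subgroup_stabilizer[OF rep H(1) v(1)], rule stabilizer_open[OF smooth H(2) v(1)], blast)
  note ZK = subgroup_center_mult[OF K(1)]
  define f where "f x = x <# (Z <#> K)" for x
  define B where "B = (\<lambda>C. act \<rho> (SOME x. x \<in> H \<and> f x = C) v) ` f ` H"
  have fin: "finite B"
    unfolding B_def using finite_index_center_mult[OF K] by (simp add: finite_index_def f_def[abs_def])
  have BV: "B \<subseteq> V"
    unfolding B_def using fiber_sum_choice(1)[of _ f H] v(1) linear_repD(3)[OF rep] by auto
  have "(\<lambda>h. act \<rho> h v) ` H \<subseteq> cvs.span B"
  proof
    fix w
    assume "w \<in> (\<lambda>h. act \<rho> h v) ` H"
    then obtain h where h: "h \<in> H" "w = act \<rho> h v"
      by blast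
    define x where "x = (SOME x. x \<in> H \<and> f x = f h)"
    have c: "f h \<in> f ` H"
      using h(1) by (rule imageI)
    have x: "x \<in> H" "f x = f h"
      unfolding x_def by (rule fiber_sum_choice[OF c])+
    have "inv x \<otimes> h \<in> Z <#> K"
      using x h(1) HG l_coset_eq_iff[OF ZK] unfolding f_def by simp
    then obtain z k where zk: "z \<in> Z" "k \<in> K" "inv x \<otimes> h = z \<otimes> k"
      unfolding set_mult_def by blast
    have zH: "z \<in> H" "k \<in> H"
      using zk ZH(1) K(3) by auto
    have "h = x \<otimes> (z \<otimes> k)"
      unfolding zk(3)[symmetric] using x(1) h(1) HG by (simp add: mult_inv_cancel)
    then have "w = act \<rho> x (act \<rho> z (act \<rho> k v))"
      unfolding h(2) using x(1) zH v(1) subgroup.m_closed[OF H(1)]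
      by (simp add: linear_repD(5)[OF rep])
    also have "act \<rho> k v = v"
      using zk(2) by (simp add: K_def)
    also have "act \<rho> x (act \<rho> z v) = \<omega> z *\<^sub>C act \<rho> x v"
      using \<omega> zk(1) v(1) linear_mapsD(3)[OF linear_repD(2)[OF rep x(1)] v(1)] by simp
    finally have "w = \<omega> z *\<^sub>C act \<rho> x v" .
    moreover have "act \<rho> x v \<in> B"
      unfolding B_def x_def using c by (rule imageI)
    ultimately show "w \<in> cvs.span B"
      by (simp add: cvs.span_base cvs.span_scale)
  qed
  then have "V \<subseteq> cvs.span B"
    using span_orbit[OF v] by (metis cvs.span_minimal cvs.subspace_span)
  moreover have "cvs.span B \<subseteq> V"
    using BV linear_repD(1)[OF rep] by (rule cvs.span_minimal)
  ultimately show ?thesis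
    using that[OF fin BV] by simp
qed

lemma open_subgroup_trivial:
  obtains K where "subgroup K G" "openin T K" "K \<subseteq> H" "\<forall>k\<in>K. \<forall>v\<in>V. act \<rho> k v = v"
proof -
  obtain B where B: "finite B" "B \<subseteq> V" "V = cvs.span B"
    by (rule finite_spanning_set)
  have "\<exists>K. subgroup K G \<and> openin T K \<and> (\<forall>b\<in>B. \<forall>k\<in>K. k \<in> H \<and> act \<rho> k b = b)"
  proof (rule common_open_subgroup[OF B(1)])
    fix b
    assume "b \<in> B"
    then have b: "b \<in> V"
      using B(2) by blast
    show "\<exists>K. subgroup K G \<and> openin T K \<and> (\<forall>k\<in>K. k \<in> H \<and> act \<rho> k b = b)"
      using subgroup_stabilizer[OF rep H(1) b] stabilizer_open[OF smooth H(2) b]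
      by (intro exI[of _ "{h \<in> H. act \<rho> h b = b}"]) simp
  qed
  then obtain K where K: "subgroup K G" "openin T K" "\<forall>b\<in>B. \<forall>k\<in>K. k \<in> H \<and> act \<rho> k b = b"
    by blast
  show ?thesis
  proof (rule that[of "K \<inter> H"], safe)
    show "subgroup (K \<inter> H) G" "openin T (K \<inter> H)"
      using K H by (simp_all add: subgroup_Int openin_Int)
    fix k v
    assume k: "k \<in> K" "k \<in> H" and v: "v \<in> V"
    note lin = linear_mapsD(2,3)[OF linear_repD(2)[OF rep k(2)]]
    have "cvs.subspace {v \<in> V. act \<rho> k v = v}"
      unfolding cvs.subspace_def using linear_repD(1)[OF rep] lin
        linear_maps_0[OF linear_repD(2)[OF rep k(2)] linear_repD(1)[OF rep]]
      by (simp add: cvs.subspace_0 cvs.subspace_add cvs.subspace_scale)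
    moreover have "B \<subseteq> {v \<in> V. act \<rho> k v = v}"
      using B(2) K(3) k(1) by blast
    ultimately have "V \<subseteq> {v \<in> V. act \<rho> k v = v}"
      unfolding B(3) by (rule cvs.span_minimal[rotated])
    then show "act \<rho> k v = v"
      using v by blast
  qed
qed

lemma scalar_subgroup:
  obtains L a where "subgroup L G" "finite_index L H" "L \<subseteq> H" "\<forall>l\<in>L. \<forall>v\<in>V. act \<rho> l v = a l *\<^sub>C v"
proof -
  obtain \<omega> where \<omega>: "\<forall>z\<in>Z. \<forall>v\<in>V. act \<rho> z v = \<omega> z *\<^sub>C v"
    by (rule central_character)
  obtain K where K: "subgroup K G" "openin T K" "K \<subseteq> H" "\<forall>k\<in>K. \<forall>v\<in>V. act \<rho> k v = v"
    by (rule open_subgroup_trivial)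
  have "\<exists>a. \<forall>v\<in>V. act \<rho> l v = a *\<^sub>C v" if l: "l \<in> Z <#> K" for l
  proof -
    obtain z k where zk: "z \<in> Z" "k \<in> K" "l = z \<otimes> k"
      using l unfolding set_mult_def by blast
    have zH: "z \<in> H" "k \<in> H"
      using zk ZH(1) K(3) by auto
    have "act \<rho> l v = \<omega> z *\<^sub>C v" if "v \<in> V" for v
      unfolding zk(3) using zH zk(1,2) that K(4) \<omega> by (simp add: linear_repD(5)[OF rep])
    then show ?thesis
      by (intro exI[of _ "\<omega> z"]) simp
  qed
  then have "\<forall>l\<in>Z <#> K. \<exists>a. \<forall>v\<in>V. act \<rho> l v = a *\<^sub>C v"
    by (rule ballI)
  then obtain a where a: "\<forall>l\<in>Z <#> K. \<forall>v\<in>V. act \<rho> l v = a l *\<^sub>C v"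
    by (rule bchoice[THEN exE])
  have "Z <#> K \<subseteq> H"
    unfolding set_mult_def using ZH(1) K(3) subgroup.m_closed[OF H(1)] by blast
  then show ?thesis
    by (rule that[OF subgroup_center_mult[OF K(1)] finite_index_center_mult[OF K(1-3)] _ a])
qed

text \<open>As \<open>\<rho>\<close> is scalar on a subgroup of finite index, averaging a linear retraction works for every subgroup
  \<open>N\<close> of \<open>H\<close>, compact or not.\<close>

lemma retraction:
  fixes \<sigma> :: "('a, 'w::complex_vector_space) repn"
  assumes N: "subgroup N G" "N \<subseteq> H" and \<sigma>: "linear_rep G N \<sigma>"
    and i: "i \<in> intertwiners N \<sigma> \<rho>" "inj_on i (vspace \<sigma>)"
  obtains p where "p \<in> intertwiners N \<rho> \<sigma>" "\<forall>w\<in>vspace \<sigma>. p (i w) = w"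
proof -
  obtain L a where L: "subgroup L G" "finite_index L H" "L \<subseteq> H" "\<forall>l\<in>L. \<forall>v\<in>V. act \<rho> l v = a l *\<^sub>C v"
    by (rule scalar_subgroup)
  obtain i' where i': "clinear i'" "range i' \<subseteq> V" "\<forall>w\<in>vspace \<sigma>. i' w = i w"
    by (rule linear_maps_extend[OF linear_repD(1)[OF \<sigma>] linear_repD(1)[OF rep] intertwinersD(1)[OF i(1)]])
  have "inj_on i' (vspace \<sigma>)"
    using i(2) i'(3) by (simp add: inj_on_def)
  then obtain s where s: "s ` UNIV \<subseteq> vspace \<sigma>" "clinear s" "\<forall>w\<in>vspace \<sigma>. s (i' w) = w"
    using cvp.linear_exists_left_inverse_on[OF i'(1) linear_repD(1)[OF \<sigma>]] by blast
  interpret s: Vector_Spaces.linear scaleC scaleC s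
    by (rule s(2))
  have sl: "s \<in> linear_maps V (vspace \<sigma>)"
    using s(1) by (intro linear_mapsI) (auto simp: s.add s.scale)
  have repN: "linear_rep G N \<rho>"
    using rep N(2) by (rule linear_rep_subset)
  have LN: "subgroup (L \<inter> N) G" "L \<inter> N \<subseteq> N"
    using L(1) N(1) by (simp_all add: subgroup_Int)
  have "finite_index L N"
    by (rule finite_index_mono[OF L(2) L(1) L(1) _ N(2) H(1)]) simp
  then have fin: "finite_index (L \<inter> N) N"
    by (rule finite_index_mono[OF _ L(1) LN(1) _ _ N(1)]) simp_all
  have equi: "s (act \<rho> l v) = act \<sigma> l (s v)" if l: "l \<in> L \<inter> N" and v: "v \<in> V" for l v
  proof -
    have sv: "s v \<in> vspace \<sigma>"
      using s(1) by blast
    have "i (act \<sigma> l (s v)) = a l *\<^sub>C i (s v)"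
      using l sv L(4) intertwinersD(3)[OF i(1) _ sv] intertwinersD(4)[OF i(1) sv] by simp
    also have "\<dots> = i (a l *\<^sub>C s v)"
      using linear_mapsD(3)[OF intertwinersD(1)[OF i(1)] sv] by simp
    finally have "act \<sigma> l (s v) = a l *\<^sub>C s v"
      using i(2) l sv linear_repD(3)[OF \<sigma>, of l "s v"] linear_repD(1)[OF \<sigma>]
      by (simp add: inj_on_def cvs.subspace_scale)
    then show ?thesis
      using l v L(4) by (simp add: s.scale)
  qed
  obtain p where p: "p \<in> intertwiners N \<rho> \<sigma>"
    "\<forall>F U v u. F \<in> linear_maps (vspace \<sigma>) U \<longrightarrow> v \<in> V \<longrightarrow>
       (\<forall>x\<in>N. F (act \<sigma> x (s (act \<rho> (inv x) v))) = u) \<longrightarrow> F (p v) = (u::'w)"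
    by (rule averaging[OF N(1) LN fin repN \<sigma> sl equi])
  show ?thesis
  proof (rule that[OF p(1)], intro ballI)
    fix w
    assume w: "w \<in> vspace \<sigma>"
    have "act \<sigma> x (s (act \<rho> (inv x) (i w))) = w" if x: "x \<in> N" for x
    proof -
      have ix: "inv x \<in> N"
        by (rule subgroup.m_inv_closed[OF N(1) x])
      have "act \<rho> (inv x) (i w) = i' (act \<sigma> (inv x) w)"
        using intertwinersD(3)[OF i(1) ix w] i'(3) linear_repD(3)[OF \<sigma> ix w] by simp
      then show ?thesis
        using s(3) linear_repD(3)[OF \<sigma> ix w] linear_rep_inverse(2)[OF \<sigma> N(1) x w] by simp
    qed
    moreover have "(\<lambda>u. u) \<in> linear_maps (vspace \<sigma>) (vspace \<sigma>)"
      by (rule linear_mapsI) simp_all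
    ultimately show "p (i w) = w"
      using p(2)[rule_format, of "\<lambda>u. u" "vspace \<sigma>" "i w" w] intertwinersD(4)[OF i(1) w] by simp
  qed
qed

abbreviation (input) "ind_rep \<equiv> compact_induction G T H \<rho>"

lemma linear_rep_ind: "linear_rep G (carrier G) ind_rep"
  by (rule ind_linear_rep[OF H rep])

text \<open>A nonzero invariant subspace \<open>W\<close> maps onto \<open>\<rho>\<close> by evaluation at the unit. This map has an
  \<open>H\<close>-equivariant section into \<open>W\<close>, by averaging, and its values are functions supported on \<open>H\<close>: a value
  at \<open>y\<close> outside \<open>H\<close> would intertwine \<open>\<rho>\<close> there. So \<open>W\<close> contains the generators.\<close>

theorem ind_irreducible:
  assumes W: "cvs.subspace W" "W \<subseteq> vspace ind_rep" "W \<noteq> {0}"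
    and inv: "\<And>g w. g \<in> carrier G \<Longrightarrow> w \<in> W \<Longrightarrow> act ind_rep g w \<in> W"
  shows "W = vspace ind_rep"
proof -
  define ev :: "('a \<Rightarrow> 'v) \<Rightarrow> 'v" where "ev = (\<lambda>\<phi>. \<phi> \<one>)"
  have ev: "clinear ev"
    by unfold_locales (simp_all add: ev_def scaleC_fun_def)
  interpret ev: Vector_Spaces.linear scaleC scaleC ev
    by (rule ev)
  have WI: "\<phi> \<in> vspace ind_rep" if "\<phi> \<in> W" for \<phi>
    using W(2) that by blast
  have act1: "act ind_rep g \<phi> \<one> = \<phi> g" if "g \<in> carrier G" for g \<phi>
    using that by (simp add: ind_act_apply)
  have val: "\<phi> h = act \<rho> h (\<phi> \<one>)" if "\<phi> \<in> W" "h \<in> H" for \<phi> h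
    using indD(3)[OF H WI[OF that(1)] that(2) one_closed] HG[OF that(2)] by simp
  have "ev ` W = {0} \<or> ev ` W = V"
  proof (rule simple)
    show "cvs.subspace (ev ` W)"
      by (rule ev.subspace_image[OF W(1)])
    show "ev ` W \<subseteq> V"
      unfolding ev_def using indD(2)[OF H WI one_closed] by blast
    show "act \<rho> h w \<in> ev ` W" if hw: "h \<in> H" "w \<in> ev ` W" for h w
    proof -
      obtain \<phi> where \<phi>: "\<phi> \<in> W" "w = ev \<phi>"
        using hw(2) by blast
      have "act \<rho> h w = ev (act ind_rep h \<phi>)"
        using val[OF \<phi>(1) hw(1)] HG[OF hw(1)] unfolding \<phi>(2) ev_def by (simp add: act1)
      then show ?thesis
        using inv[OF HG[OF hw(1)] \<phi>(1)] by blast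
    qed
  qed
  moreover have "ev ` W \<noteq> {0}"
  proof -
    obtain \<phi> where \<phi>: "\<phi> \<in> W" "\<phi> \<noteq> 0"
      using W(1,3) cvs.subspace_0 by blast
    then obtain x where x: "\<phi> x \<noteq> 0"
      by (auto simp: fun_eq_iff)
    have xG: "x \<in> carrier G"
      using x indD(1)[OF H WI[OF \<phi>(1)]] by blast
    have "ev (act ind_rep x \<phi>) \<noteq> 0"
      unfolding ev_def act1[OF xG] by (rule x)
    then show ?thesis
      using inv[OF xG \<phi>(1)] by blast
  qed
  ultimately have evW: "ev ` W = V"
    by blast
  obtain s where s: "s ` UNIV \<subseteq> W" "clinear s" "\<forall>v\<in>V. ev (s v) = v"
    using cvp.linear_exists_right_inverse_on[OF ev W(1)] unfolding evW by blast
  interpret s: Vector_Spaces.linear scaleC scaleC s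
    by (rule s(2))
  have sW: "s v \<in> W" for v
    using s(1) by blast
  define \<tau> where "\<tau> = \<lparr>vspace = W, act = act ind_rep\<rparr>"
  have \<tau>G: "linear_rep G (carrier G) \<tau>"
    unfolding linear_rep_def \<tau>_def using W(1) inv linear_repD(4,5)[OF linear_rep_ind] WI
      linear_mapsD(2,3)[OF linear_repD(2)[OF linear_rep_ind]]
    by (auto intro!: linear_mapsI)
  then have \<tau>: "linear_rep G H \<tau>"
    using subgroup.subset[OF H(1)] by (rule linear_rep_subset)
  obtain \<omega> where \<omega>: "\<forall>z\<in>Z. \<forall>v\<in>V. act \<rho> z v = \<omega> z *\<^sub>C v"
    by (rule central_character)
  have central: "act ind_rep z \<phi> = \<omega> z *\<^sub>C \<phi>" if z: "z \<in> Z" and \<phi>: "\<phi> \<in> W" for z \<phi>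
  proof
    fix x
    show "act ind_rep z \<phi> x = (\<omega> z *\<^sub>C \<phi>) x"
    proof (cases "x \<in> carrier G")
      case True
      have "\<phi> (z \<otimes> x) = act \<rho> z (\<phi> x)"
        using z ZH(1) True by (intro indD(3)[OF H WI[OF \<phi>]]) auto
      then show ?thesis
        using True z \<omega> indD(2)[OF H WI[OF \<phi>] True] Z(2)[OF z True]
        by (simp add: ind_act_apply scaleC_fun_def)
    next
      case False
      then show ?thesis
        using indD(1)[OF H WI[OF \<phi>] False] by (simp add: ind_act_outside scaleC_fun_def)
    qed
  qed
  obtain B where B: "finite B" "B \<subseteq> V" "V = cvs.span B"
    by (rule finite_spanning_set)
  \<comment> \<open>A subgroup fixing a finite spanning set and its image makes the linear section \<open>s\<close> equivariant under \<open>ZK\<close>.\<close>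
  have "\<exists>K. subgroup K G \<and> openin T K \<and> (\<forall>b\<in>B. \<forall>k\<in>K. \<forall>x\<in>carrier G. s b (x \<otimes> k) = s b x)"
  proof (rule common_open_subgroup[OF B(1)])
    fix b
    obtain K where "subgroup K G \<and> openin T K \<and> (\<forall>x\<in>carrier G. \<forall>k\<in>K. s b (x \<otimes> k) = s b x)"
      using indD(4)[OF H WI[OF sW]] by (rule exE)
    then show "\<exists>K. subgroup K G \<and> openin T K \<and> (\<forall>k\<in>K. \<forall>x\<in>carrier G. s b (x \<otimes> k) = s b x)"
      by (intro exI[of _ K]) simp
  qed
  then obtain K1 where K1: "subgroup K1 G \<and> openin T K1 \<and> (\<forall>b\<in>B. \<forall>k\<in>K1. \<forall>x\<in>carrier G. s b (x \<otimes> k) = s b x)"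
    by (rule exE)
  obtain K2 where K2: "subgroup K2 G" "openin T K2" "K2 \<subseteq> H" "\<forall>k\<in>K2. \<forall>v\<in>V. act \<rho> k v = v"
    by (rule open_subgroup_trivial)
  define K where "K = K1 \<inter> K2"
  have K: "subgroup K G" "openin T K" "K \<subseteq> H"
    using K1 K2 unfolding K_def by (auto simp: subgroup_Int openin_Int)
  have fixed: "act ind_rep k (s v) = s v" if k: "k \<in> K" and v: "v \<in> V" for k v
  proof -
    have kG: "k \<in> carrier G"
      by (rule subgroup.mem_carrier[OF K(1) k])
    interpret a: Vector_Spaces.linear scaleC scaleC "act ind_rep k"
      by unfold_locales (auto simp: compact_induction_def fun_eq_iff scaleC_fun_def)
    have "cvs.subspace {v. act ind_rep k (s v) = s v}"
      unfolding cvs.subspace_def by (simp add: s.add s.scale s.zero a.add a.scale a.zero)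
    moreover have "B \<subseteq> {v. act ind_rep k (s v) = s v}"
    proof
      fix b
      assume b: "b \<in> B"
      have "act ind_rep k (s b) x = s b x" for x
        using K1 k b indD(1)[OF H WI[OF sW], of x b]
        by (cases "x \<in> carrier G") (simp_all add: K_def ind_act_apply ind_act_outside)
      then show "b \<in> {v. act ind_rep k (s v) = s v}"
        by (simp add: fun_eq_iff)
    qed
    ultimately have "V \<subseteq> {v. act ind_rep k (s v) = s v}"
      unfolding B(3) by (rule cvs.span_minimal[rotated])
    then show ?thesis
      using v by blast
  qed
  have ZKH: "Z <#> K \<subseteq> H"
    unfolding set_mult_def using ZH(1) K(3) subgroup.m_closed[OF H(1)] by blast
  have equi: "s (act \<rho> l v) = act \<tau> l (s v)" if l: "l \<in> Z <#> K" and v: "v \<in> V" for l v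
  proof -
    obtain z k where zk: "z \<in> Z" "k \<in> K" "l = z \<otimes> k"
      using l unfolding set_mult_def by blast
    have zH: "z \<in> H" "k \<in> H" "z \<in> carrier G" "k \<in> carrier G"
      using zk ZH(1) K(3) HG by auto
    have "act \<rho> k v = v"
      using K2(4) zk(2) v by (simp add: K_def)
    then have "act \<rho> l v = \<omega> z *\<^sub>C v"
      unfolding zk(3) using zH zk(1) v \<omega> by (simp add: linear_repD(5)[OF rep])
    moreover have "act \<tau> l (s v) = \<omega> z *\<^sub>C s v"
      unfolding zk(3) \<tau>_def using zH zk(1,2) v WI[OF sW]
      by (simp add: linear_repD(5)[OF linear_rep_ind] fixed central sW)
    ultimately show ?thesis
      by (simp add: s.scale)
  qed
  have sl: "s \<in> linear_maps V (vspace \<tau>)"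
    using sW by (intro linear_mapsI) (auto simp: \<tau>_def s.add s.scale)
  obtain S where S: "S \<in> intertwiners H \<rho> \<tau>"
    "\<forall>F U v u. F \<in> linear_maps (vspace \<tau>) U \<longrightarrow> v \<in> V \<longrightarrow>
       (\<forall>x\<in>H. F (act \<tau> x (s (act \<rho> (inv x) v))) = u) \<longrightarrow> F (S v) = (u::'v)"
    by (rule averaging[OF H(1) subgroup_center_mult[OF K(1)] ZKH finite_index_center_mult[OF K] rep \<tau> sl equi])
  have S1: "S v \<one> = v" if v: "v \<in> V" for v
  proof -
    have "ev (act \<tau> x (s (act \<rho> (inv x) v))) = v" if x: "x \<in> H" for x
    proof -
      have ix: "act \<rho> (inv x) v \<in> V"
        by (rule linear_repD(3)[OF rep subgroup.m_inv_closed[OF H(1) x] v])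
      have "ev (act \<tau> x (s (act \<rho> (inv x) v))) = act \<rho> x (s (act \<rho> (inv x) v) \<one>)"
        unfolding ev_def \<tau>_def using val[OF sW x] by (simp add: act1[OF HG[OF x]])
      also have "s (act \<rho> (inv x) v) \<one> = act \<rho> (inv x) v"
        using s(3) ix unfolding ev_def by blast
      finally show ?thesis
        by (simp add: linear_rep_inverse(2)[OF rep H(1) x v])
    qed
    moreover have "ev \<in> linear_maps (vspace \<tau>) UNIV"
      by (rule linear_mapsI) (simp_all add: ev.add ev.scale)
    ultimately have "ev (S v) = v"
      using S(2)[rule_format, of ev UNIV v v] v by blast
    then show ?thesis
      by (simp add: ev_def)
  qed
  have SI: "S \<in> intertwiners H \<rho> ind_rep"
    using intertwinersD[OF S(1)] linear_mapsD[OF intertwinersD(1)[OF S(1)]] WI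
    by (intro intertwinersI linear_mapsI) (simp_all add: \<tau>_def)
  have S_delta: "S v = delta H \<rho> v" if v: "v \<in> V" for v
  proof
    fix y
    have SvW: "S v \<in> W"
      using intertwinersD(4)[OF S(1) v] by (simp add: \<tau>_def)
    show "S v y = delta H \<rho> v y"
    proof (cases "y \<in> H")
      case True
      then show ?thesis
        using val[OF SvW True] S1[OF v] by (simp add: delta_def)
    next
      case False
      have "S v y = 0"
      proof (cases "y \<in> carrier G")
        case True
        have "inv y \<notin> H"
        proof
          assume "inv y \<in> H"
          then have "inv (inv y) \<in> H"
            by (rule subgroup.m_inv_closed[OF H(1)])
          then show False
            using False True by simp
        qed
        then have "inv y \<notin> intertwining_set G H \<rho>"
          using intertwining by blast
        then have "intertwiners (H \<inter> conj_subgroup G H (inv y)) \<rho> (conj_rep G \<rho> (inv y)) = {0}"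
          unfolding intertwining_set_def using True by simp
        then have "(\<lambda>v. if v \<in> V then S v y else 0) = 0"
          using evaluation_intertwines[OF H rep SI True] by blast
        then show ?thesis
          using v by (simp add: fun_eq_iff) metis
      qed (rule indD(1)[OF H WI[OF SvW]])
      then show ?thesis
        using False by (simp add: delta_def)
    qed
  qed
  have "\<phi> \<in> W" if "\<phi> \<in> vspace ind_rep" for \<phi>
  proof (rule ind_generated_by_delta[OF H rep smooth W(1) inv _ that])
    fix v
    assume v: "v \<in> V"
    show "delta H \<rho> v \<in> W"
      using intertwinersD(4)[OF S(1) v] S_delta[OF v] by (simp add: \<tau>_def)
  qed
  then show ?thesis
    using W(2) by blast
qed

text \<open>Schur's lemma: the kernel is an invariant subspace of the irreducible source, and the image is one of the target,
  which has the same underlying space.\<close>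

lemma nonzero_intertwiner_bij:
  fixes \<Omega> :: "('a, 'a \<Rightarrow> 'v) repn"
  assumes rep': "linear_rep G (carrier G) \<Omega>" and sp: "vspace \<Omega> = vspace ind_rep"
    and stable: "\<And>W. cvs.subspace W \<Longrightarrow> W \<subseteq> vspace ind_rep \<Longrightarrow>
      (\<And>g w. g \<in> carrier G \<Longrightarrow> w \<in> W \<Longrightarrow> act \<Omega> g w \<in> W) \<Longrightarrow> W \<noteq> {0} \<Longrightarrow> W = vspace ind_rep"
    and F: "F \<in> intertwiners (carrier G) ind_rep \<Omega>" and nz: "F \<noteq> 0"
  shows "bij_betw F (vspace ind_rep) (vspace ind_rep)"
proof -
  note lin = linear_mapsD[OF intertwinersD(1)[OF F]] and I = linear_repD(1)[OF linear_rep_ind]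
  note F0 = linear_maps_0[OF intertwinersD(1)[OF F] I]
  obtain \<phi> where \<phi>: "F \<phi> \<noteq> 0"
    using nz by (auto simp: fun_eq_iff)
  then have \<phi>I: "\<phi> \<in> vspace ind_rep"
    using intertwinersD(2)[OF F] by blast
  let ?K = "{v \<in> vspace ind_rep. F v = 0}"
  have "?K = {0}"
  proof (rule ccontr)
    assume "?K \<noteq> {0}"
    then have "?K = vspace ind_rep"
      using ind_irreducible[OF kernel_subspace(1)[OF F linear_rep_ind rep'] _ _ kernel_subspace(2)[OF F linear_rep_ind rep']]
      by blast
    then show False
      using \<phi> \<phi>I by blast
  qed
  then have ker: "v = 0" if "v \<in> vspace ind_rep" "F v = 0" for v
    using that by blast
  have "inj_on F (vspace ind_rep)"
  proof (rule inj_onI)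
    fix v w
    assume vw: "v \<in> vspace ind_rep" "w \<in> vspace ind_rep" "F v = F w"
    have "v - w \<in> vspace ind_rep"
      using vw(1,2) by (rule cvs.subspace_diff[OF I])
    moreover from this have "F (v - w) = 0"
      using lin(2)[of "v - w" w] vw by simp
    ultimately show "v = w"
      using ker by fastforce
  qed
  moreover have "F ` vspace ind_rep = vspace ind_rep"
  proof (rule stable)
    show "cvs.subspace (F ` vspace ind_rep)"
      unfolding cvs.subspace_def
    proof (intro conjI ballI allI)
      show "0 \<in> F ` vspace ind_rep"
        using F0 cvs.subspace_0[OF I] by (rule image_eqI[OF sym])
      show "x + y \<in> F ` vspace ind_rep" if xy: "x \<in> F ` vspace ind_rep" "y \<in> F ` vspace ind_rep" for x y
      proof -
        obtain v w where vw: "v \<in> vspace ind_rep" "x = F v" "w \<in> vspace ind_rep" "y = F w"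
          using xy by blast
        then have "x + y = F (v + w)"
          by (simp add: lin(2))
        then show ?thesis
          using cvs.subspace_add[OF I vw(1,3)] by (rule image_eqI)
      qed
      show "c *\<^sub>C x \<in> F ` vspace ind_rep" if x: "x \<in> F ` vspace ind_rep" for c x
      proof -
        obtain v where v: "v \<in> vspace ind_rep" "x = F v"
          using x by blast
        then have "c *\<^sub>C x = F (c *\<^sub>C v)"
          by (simp add: lin(3))
        then show ?thesis
          using cvs.subspace_scale[OF I v(1)] by (rule image_eqI)
      qed
    qed
    show "F ` vspace ind_rep \<subseteq> vspace ind_rep"
      using lin(1) unfolding sp by blast
    show "act \<Omega> g w \<in> F ` vspace ind_rep" if gw: "g \<in> carrier G" "w \<in> F ` vspace ind_rep" for g w
    proof -
      obtain v where v: "v \<in> vspace ind_rep" "w = F v"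
        using gw(2) by blast
      then have "act \<Omega> g w = F (act ind_rep g v)"
        by (simp add: intertwinersD(3)[OF F gw(1)])
      then show ?thesis
        using linear_repD(3)[OF linear_rep_ind gw(1) v(1)] by (rule image_eqI)
    qed
    show "F ` vspace ind_rep \<noteq> {0}"
      using \<phi> \<phi>I by blast
  qed
  ultimately show ?thesis
    by (simp add: bij_betw_def)
qed

end

section \<open>Twists by characters\<close>

context group
begin

lemma character_conj:
  assumes \<eta>: "\<eta> \<in> characters_mod G (carrier G) N" and g: "g \<in> carrier G" and x: "x \<in> carrier G"
  shows "\<eta> (inv g \<otimes> x \<otimes> g) = \<eta> x"
  using characters_modD(2)[OF \<eta>] characters_mod_inv(2)[OF \<eta> subgroup_self g] characters_modD(1)[OF \<eta> g] g x
  by simp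

lemma characters_mod_mult:
  assumes "\<eta> \<in> characters_mod G H N" "\<theta> \<in> characters_mod G H N" "subgroup H G" "N \<subseteq> H"
  shows "(\<lambda>x\<in>H. \<eta> x * \<theta> x) \<in> characters_mod G H N"
  using characters_modD[OF assms(1)] characters_modD[OF assms(2)] subgroup.m_closed[OF assms(3)] assms(4)
  by (intro characters_modI) (auto simp: subset_iff)

lemma characters_mod_inverse:
  assumes "\<eta> \<in> characters_mod G H N" "subgroup H G" "N \<subseteq> H"
  shows "(\<lambda>x\<in>H. inverse (\<eta> x)) \<in> characters_mod G H N"
  using characters_modD[OF assms(1)] subgroup.m_closed[OF assms(2)] assms(3)
  by (intro characters_modI) (auto simp: subset_iff)

lemma characters_mod_subset: "N' \<subseteq> N \<Longrightarrow> characters_mod G H N \<subseteq> characters_mod G H N'"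
  unfolding characters_mod_def by blast

lemma subgroup_dagger:
  "subgroup (dagger_subgroup G N \<tau>) G"
proof (rule subgroupI)
  show "dagger_subgroup G N \<tau> \<subseteq> carrier G"
    unfolding dagger_subgroup_def by blast
  have "\<one> \<in> dagger_subgroup G N \<tau>"
    unfolding dagger_subgroup_def using characters_mod_inv(1)[OF _ subgroup_self one_closed] by blast
  then show "dagger_subgroup G N \<tau> \<noteq> {}"
    by blast
  show "inv x \<in> dagger_subgroup G N \<tau>" if "x \<in> dagger_subgroup G N \<tau>" for x
    using that unfolding dagger_subgroup_def by (simp add: characters_mod_inv(2)[OF _ subgroup_self])
  show "x \<otimes> y \<in> dagger_subgroup G N \<tau>" if "x \<in> dagger_subgroup G N \<tau>" "y \<in> dagger_subgroup G N \<tau>" for x y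
    using that unfolding dagger_subgroup_def by (auto simp: characters_modD(2))
qed

lemma subset_dagger: "N \<subseteq> carrier G \<Longrightarrow> N \<subseteq> dagger_subgroup G N \<tau>"
  unfolding dagger_subgroup_def using characters_modD(3) by blast

end

context cuspidal_datum
begin

text \<open>The intersection is an open subgroup of \<open>H\<close> that contains \<open>Z\<close>.\<close>

lemma finite_index_conj_Int:
  assumes g: "g \<in> carrier G"
  shows "finite_index (H \<inter> conj_subgroup G H g) H"
proof -
  let ?D = "H \<inter> conj_subgroup G H g"
  have D: "subgroup ?D G" "openin T ?D" "?D \<subseteq> H"
    using H g by (simp_all add: subgroup_Int subgroup_conj_subgroup openin_Int openin_conj_subgroup)
  have ZD: "Z \<subseteq> ?D"
  proof
    fix z
    assume z: "z \<in> Z"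
    have "inv g \<otimes> z \<otimes> g = z"
      using Z(2)[OF z inv_closed[OF g]] ZG[OF z] g by (simp flip: Z(2)[OF z inv_closed[OF g]] add: m_assoc)
    then show "z \<in> ?D"
      using z ZH(1) ZG[OF z] mem_conj_subgroup_iff[OF subgroup.subset[OF H(1)] g] by auto
  qed
  have "Z <#> ?D \<subseteq> ?D"
    unfolding set_mult_def using ZD subgroup.m_closed[OF D(1)] by blast
  then show ?thesis
    using finite_index_mono[OF finite_index_center_mult[OF D] subgroup_center_mult[OF D(1)] D(1) _ subset_refl H(1)]
    by blast
qed

text \<open>Send a vector \<open>v\<close> to the function with support in \<open>H g\<^sup>-\<^sup>1 H\<close> whose value at \<open>j g\<^sup>-\<^sup>1 k\<close> is
  \<open>\<eta>(k) \<rho>(j) A \<rho>(k) v\<close>. This is an \<open>H\<close>-map into the twist by \<open>\<eta>\<^sup>-\<^sup>1\<close> of the induced representation, so Frobenius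
  reciprocity makes it a nonzero \<open>G\<close>-map, which is bijective by irreducibility.\<close>

lemma twist_iso_if_intertwines:
  assumes g: "g \<in> carrier G" and Gb: "subgroup Gb G" "openin T Gb"
    and \<eta>: "\<eta> \<in> characters_mod G (carrier G) Gb"
    and A: "A \<in> intertwiners (H \<inter> conj_subgroup G H g) (twist \<rho> \<eta>) (conj_rep G \<rho> g)" "A \<noteq> 0"
  shows "rep_iso (carrier G) (twist ind_rep \<eta>) ind_rep"
proof -
  define dec where "dec y j k \<longleftrightarrow> j \<in> H \<and> k \<in> H \<and> y = j \<otimes> inv g \<otimes> k" for y j k
  define val where "val j k v = \<eta> k *\<^sub>C act \<rho> j (A (act \<rho> k v))" for j k v
  define \<Psi> where "\<Psi> v y = (if v \<in> V \<and> (\<exists>p. dec y (fst p) (snd p))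
      then val (fst (SOME p. dec y (fst p) (snd p))) (snd (SOME p. dec y (fst p) (snd p))) v else 0)" for v y
  note \<eta>D = characters_modD[OF \<eta>]
  note rV = linear_repD(3)[OF rep] and rmul = linear_repD(5)[OF rep, symmetric]
  note rlin = linear_mapsD(2,3)[OF linear_repD(2)[OF rep]]
  have Hm: "h \<otimes> k \<in> H" if "h \<in> H" "k \<in> H" for h k
    by (rule subgroup.m_closed[OF H(1) that])
  have Hi: "inv h \<in> H" if "h \<in> H" for h
    by (rule subgroup.m_inv_closed[OF H(1) that])
  have AV: "A v \<in> V" "A (v + w) = A v + A w" "A (c *\<^sub>C v) = c *\<^sub>C A v" if "v \<in> V" "w \<in> V" for v w c
    using linear_mapsD[OF intertwinersD(1)[OF A(1)]] that by (simp_all add: twist_def conj_rep_def)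
  have A0: "A v = 0" if "v \<notin> V" for v
    using intertwinersD(2)[OF A(1)] that by (simp add: twist_def)
  have Ad: "\<eta> d *\<^sub>C A (act \<rho> d u) = act \<rho> (inv g \<otimes> d \<otimes> g) (A u)"
    if "d \<in> H" "inv g \<otimes> d \<otimes> g \<in> H" "u \<in> V" for d u
  proof -
    have "d \<in> H \<inter> conj_subgroup G H g"
      using that HG mem_conj_subgroup_iff[OF subgroup.subset[OF H(1)] g] by simp
    from intertwinersD(3)[OF A(1) this, of u] that show ?thesis
      using AV(3)[OF rV[OF that(1,3)] that(3)] by (simp add: twist_def conj_rep_def)
  qed
  \<comment> \<open>Two decompositions of \<open>y\<close> differ by an element of \<open>H \<inter> gHg\<^sup>-\<^sup>1\<close>, where \<open>A\<close> is equivariant.\<close>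
  have well: "val j k v = val j' k' v" if d: "dec y j k" "dec y j' k'" and v: "v \<in> V" for y j k j' k' v
  proof -
    have mem: "j \<in> H" "k \<in> H" "j' \<in> H" "k' \<in> H" and y: "j \<otimes> inv g \<otimes> k = j' \<otimes> inv g \<otimes> k'"
      using d by (auto simp: dec_def)
    note GG = HG[OF mem(1)] HG[OF mem(2)] HG[OF mem(3)] HG[OF mem(4)]
    define d where "d = k' \<otimes> inv k"
    have dH: "d \<in> H"
      unfolding d_def using mem by (simp add: Hm Hi)
    have k': "k' = d \<otimes> k"
      unfolding d_def using GG by (simp add: m_assoc)
    have "inv j' \<otimes> (j \<otimes> inv g \<otimes> k) \<otimes> inv k \<otimes> g = inv j' \<otimes> (j' \<otimes> inv g \<otimes> k') \<otimes> inv k \<otimes> g"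
      unfolding y ..
    moreover have "inv j' \<otimes> (j \<otimes> inv g \<otimes> k) \<otimes> inv k \<otimes> g = inv j' \<otimes> j"
      using GG g by (simp add: m_assoc mult_inv_cancel)
    moreover have "inv j' \<otimes> (j' \<otimes> inv g \<otimes> k') \<otimes> inv k \<otimes> g = inv g \<otimes> d \<otimes> g"
      unfolding d_def using GG g by (simp add: m_assoc mult_inv_cancel)
    ultimately have e: "inv g \<otimes> d \<otimes> g = inv j' \<otimes> j"
      by simp
    have eH: "inv g \<otimes> d \<otimes> g \<in> H"
      unfolding e using mem by (simp add: Hm Hi)
    have u: "act \<rho> k v \<in> V"
      using rV mem v by simp
    have "val j' k' v = (\<eta> k * \<eta> d) *\<^sub>C act \<rho> j' (A (act \<rho> d (act \<rho> k v)))"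
      unfolding val_def k' using \<eta>D(2) HG[OF dH] GG dH mem v by (simp add: rmul mult.commute)
    also have "\<dots> = \<eta> k *\<^sub>C act \<rho> j' (\<eta> d *\<^sub>C A (act \<rho> d (act \<rho> k v)))"
      using mem dH u rV by (simp add: rlin AV scaleC_scaleC)
    also have "\<dots> = \<eta> k *\<^sub>C act \<rho> j' (act \<rho> (inv j' \<otimes> j) (A (act \<rho> k v)))"
      unfolding Ad[OF dH eH u] e ..
    also have "\<dots> = val j k v"
      unfolding val_def using mem u GG by (simp add: rmul Hm Hi AV mult_inv_cancel)
    finally show ?thesis ..
  qed
  have \<Psi>val: "\<Psi> v y = val j k v" if "dec y j k" "v \<in> V" for v y j k
  proof -
    have ex: "\<exists>p. dec y (fst p) (snd p)"
      using that(1) by (intro exI[of _ "(j, k)"]) simp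
    then have "dec y (fst (SOME p. dec y (fst p) (snd p))) (snd (SOME p. dec y (fst p) (snd p)))"
      by (rule someI_ex)
    from well[OF this that] show ?thesis
      using ex that(2) by (simp add: \<Psi>_def)
  qed
  have \<Psi>0: "\<Psi> v y = 0" if "\<And>j k. \<not> dec y j k" for v y
    using that by (simp add: \<Psi>_def)
  have \<Psi>out: "\<Psi> v = 0" if "v \<notin> V" for v
    using that by (simp add: \<Psi>_def fun_eq_iff)
  have decG: "y \<in> carrier G" if "dec y j k" for y j k
    using that g HG by (auto simp: dec_def)
  have dec_left: "dec (h \<otimes> y) (h \<otimes> j) k" if "dec y j k" "h \<in> H" for h y j k
    using that g HG Hm by (auto simp: dec_def m_assoc)
  have dec_right: "dec (y \<otimes> h) j (k \<otimes> h)" if "dec y j k" "h \<in> H" for h y j k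
    using that g HG Hm by (auto simp: dec_def m_assoc)
  have no_left: "\<not> dec (h \<otimes> y) j k" if "\<And>j k. \<not> dec y j k" "h \<in> H" "y \<in> carrier G" for h y j k
    using that dec_left[of "h \<otimes> y" j k "inv h"] HG Hi by (auto simp: mult_inv_cancel)
  have no_right: "\<not> dec (y \<otimes> h) j k" if "\<And>j k. \<not> dec y j k" "h \<in> H" "y \<in> carrier G" for h y j k
    using that dec_right[of "y \<otimes> h" j k "inv h"] HG Hi by (auto simp: m_assoc)
  have \<Psi>trans: "\<Psi> (act \<rho> h v) y = inverse (\<eta> h) *\<^sub>C \<Psi> v (y \<otimes> h)"
    if h: "h \<in> H" and v: "v \<in> V" and y: "y \<in> carrier G" for h v y
  proof (cases "\<exists>j k. dec y j k")
    case True
    then obtain j k where jk: "dec y j k"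
      by blast
    then have mem: "j \<in> H" "k \<in> H"
      by (simp_all add: dec_def)
    have "\<Psi> v (y \<otimes> h) = val j (k \<otimes> h) v"
      by (rule \<Psi>val[OF dec_right[OF jk h] v])
    also have "\<dots> = \<eta> h *\<^sub>C val j k (act \<rho> h v)"
      unfolding val_def using mem h v \<eta>D(2) HG by (simp add: rmul scaleC_scaleC mult.commute)
    also have "val j k (act \<rho> h v) = \<Psi> (act \<rho> h v) y"
      by (rule \<Psi>val[OF jk rV[OF h v], symmetric])
    finally show ?thesis
      using \<eta>D(1)[OF HG[OF h]] by (simp add: scaleC_scaleC scaleC_one)
  next
    case False
    then show ?thesis
      using no_right[OF _ h y] by (simp add: \<Psi>0)
  qed
  have \<Psi>I: "\<Psi> v \<in> vspace ind_rep" if v: "v \<in> V" for v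
    unfolding ind_iff[OF H]
  proof (intro conjI allI impI ballI)
    show "\<Psi> v y = 0" if "y \<notin> carrier G" for y
      using that decG by (intro \<Psi>0) blast
    show "\<Psi> v y \<in> V" if "y \<in> carrier G" for y
    proof (cases "\<exists>j k. dec y j k")
      case True
      then obtain j k where jk: "dec y j k"
        by blast
      then show ?thesis
        unfolding \<Psi>val[OF jk v] val_def using v linear_repD(1)[OF rep]
        by (simp add: dec_def rV AV cvs.subspace_scale)
    next
      case False
      then show ?thesis
        using linear_repD(1)[OF rep] by (simp add: \<Psi>0 cvs.subspace_0)
    qed
    show "\<Psi> v (h \<otimes> y) = act \<rho> h (\<Psi> v y)" if h: "h \<in> H" and y: "y \<in> carrier G" for h y
    proof (cases "\<exists>j k. dec y j k")
      case True
      then obtain j k where jk: "dec y j k"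
        by blast
      have mem: "j \<in> H" "k \<in> H"
        using jk by (simp_all add: dec_def)
      have "\<Psi> v (h \<otimes> y) = \<eta> k *\<^sub>C act \<rho> h (act \<rho> j (A (act \<rho> k v)))"
        unfolding \<Psi>val[OF dec_left[OF jk h] v] val_def using mem h v by (simp add: rmul rV AV)
      also have "\<dots> = act \<rho> h (\<Psi> v y)"
        unfolding \<Psi>val[OF jk v] val_def using mem h v by (simp add: rlin rV AV)
      finally show ?thesis .
    next
      case False
      then show ?thesis
        using no_left[OF _ h y] linear_maps_0[OF linear_repD(2)[OF rep h] linear_repD(1)[OF rep]] by (simp add: \<Psi>0)
    qed
    define K where "K = {h \<in> H. act \<rho> h v = v} \<inter> Gb"
    have "subgroup K G" "openin T K"
      unfolding K_def using subgroup_stabilizer[OF rep H(1) v] stabilizer_open[OF smooth H(2) v] Gb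
      by (simp_all add: subgroup_Int openin_Int)
    moreover have "\<Psi> v (y \<otimes> k) = \<Psi> v y" if "y \<in> carrier G" "k \<in> K" for y k
      using \<Psi>trans[of k v y] that v \<eta>D(3)[of k] by (simp add: K_def scaleC_one)
    ultimately show "\<exists>K. subgroup K G \<and> openin T K \<and> (\<forall>x\<in>carrier G. \<forall>k\<in>K. \<Psi> v (x \<otimes> k) = \<Psi> v x)"
      by (intro exI[of _ K]) simp
    define D where "D = H \<inter> conj_subgroup G H g"
    have D: "subgroup D G"
      unfolding D_def using H(1) g by (simp add: subgroup_Int subgroup_conj_subgroup)
    have "finite ((\<lambda>x. H #> (inv g \<otimes> inv x)) ` H)"
    proof (rule finite_image_coarser)
      show "finite ((\<lambda>x. x <# D) ` H)"
        using finite_index_conj_Int[OF g] unfolding D_def finite_index_def .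
      fix x y
      assume xy: "x \<in> H" "y \<in> H" "x <# D = y <# D"
      note GG = HG[OF xy(1)] HG[OF xy(2)]
      have "inv x \<otimes> y \<in> conj_subgroup G H g"
        using xy(3) l_coset_eq_iff[OF D GG] unfolding D_def by blast
      then have "inv g \<otimes> (inv x \<otimes> y) \<otimes> g \<in> H"
        using mem_conj_subgroup_iff[OF subgroup.subset[OF H(1)] g] by blast
      then have "inv (inv g \<otimes> (inv x \<otimes> y) \<otimes> g) \<in> H"
        by (rule Hi)
      then have "(inv g \<otimes> inv y) \<otimes> inv (inv g \<otimes> inv x) \<in> H"
        using GG g by (simp add: inv_mult_group m_assoc)
      then show "H #> (inv g \<otimes> inv x) = H #> (inv g \<otimes> inv y)"
        using GG g by (simp add: r_coset_eq_iff[OF H(1)])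
    qed
    moreover have "(\<lambda>x. H #> x) ` {x \<in> carrier G. \<Psi> v x \<noteq> 0} \<subseteq> (\<lambda>x. H #> (inv g \<otimes> inv x)) ` H"
    proof
      fix C
      assume "C \<in> (\<lambda>x. H #> x) ` {x \<in> carrier G. \<Psi> v x \<noteq> 0}"
      then obtain y where y: "\<Psi> v y \<noteq> 0" "C = H #> y"
        by blast
      then obtain j k where jk: "dec y j k"
        using \<Psi>0 by blast
      then have mem: "j \<in> H" "k \<in> H" "y = j \<otimes> inv g \<otimes> k"
        by (simp_all add: dec_def)
      note GG = HG[OF mem(1)] HG[OF mem(2)]
      have "y \<otimes> inv (inv g \<otimes> k) = j"
        unfolding mem(3) using GG g by (simp add: inv_mult_group m_assoc mult_inv_cancel)
      then have "H #> (inv g \<otimes> k) = H #> y"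
        using mem GG g decG[OF jk] by (simp add: r_coset_eq_iff[OF H(1)])
      then have "C = H #> (inv g \<otimes> inv (inv k))"
        using y(2) GG by simp
      then show "C \<in> (\<lambda>x. H #> (inv g \<otimes> inv x)) ` H"
        using Hi[OF mem(2)] by blast
    qed
    ultimately show "finite ((\<lambda>x. H #> x) ` {x \<in> carrier G. \<Psi> v x \<noteq> 0})"
      by (rule finite_subset[rotated])
  qed
  define \<eta>' where "\<eta>' = (\<lambda>x\<in>carrier G. inverse (\<eta> x))"
  have \<eta>': "\<eta>' \<in> characters_mod G (carrier G) Gb"
    unfolding \<eta>'_def by (rule characters_mod_inverse[OF \<eta> subgroup_self subgroup.subset[OF Gb(1)]])
  define \<Omega> where "\<Omega> = twist ind_rep \<eta>'"
  have \<Omega>sp: "vspace \<Omega> = vspace ind_rep"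
    by (simp add: \<Omega>_def twist_def)
  have \<Omega>act: "act \<Omega> x \<phi> = inverse (\<eta> x) *\<^sub>C act ind_rep x \<phi>" if "x \<in> carrier G" for x \<phi>
    using that by (simp add: \<Omega>_def twist_def \<eta>'_def)
  have \<Omega>: "linear_rep G (carrier G) \<Omega>"
    unfolding \<Omega>_def by (rule linear_rep_twist[OF linear_rep_ind subgroup_self \<eta>'])
  have \<Psi>: "\<Psi> \<in> intertwiners H \<rho> \<Omega>"
  proof (rule intertwinersI[OF linear_mapsI])
    show "\<Psi> v \<in> vspace \<Omega>" if "v \<in> V" for v
      unfolding \<Omega>sp by (rule \<Psi>I[OF that])
    have Vadd: "v + w \<in> V" "c *\<^sub>C v \<in> V" if "v \<in> V" "w \<in> V" for v w c
      using that linear_repD(1)[OF rep] by (simp_all add: cvs.subspace_add cvs.subspace_scale)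
    show "\<Psi> (v + w) = \<Psi> v + \<Psi> w" if vw: "v \<in> V" "w \<in> V" for v w
    proof
      fix y
      show "\<Psi> (v + w) y = (\<Psi> v + \<Psi> w) y"
      proof (cases "\<exists>j k. dec y j k")
        case True
        then obtain j k where jk: "dec y j k"
          by blast
        then show ?thesis
          using \<Psi>val[OF jk] vw Vadd[OF vw]
          by (simp add: val_def dec_def rlin rV AV scaleC_add_right)
      qed (simp add: \<Psi>0)
    qed
    show "\<Psi> (c *\<^sub>C v) = c *\<^sub>C \<Psi> v" if v: "v \<in> V" for c v
    proof
      fix y
      show "\<Psi> (c *\<^sub>C v) y = (c *\<^sub>C \<Psi> v) y"
      proof (cases "\<exists>j k. dec y j k")
        case True
        then obtain j k where jk: "dec y j k"
          by blast
        then have mem: "j \<in> H" "k \<in> H"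
          by (simp_all add: dec_def)
        have kv: "act \<rho> k v \<in> V" "A (act \<rho> k v) \<in> V"
          using mem v rV AV(1) by simp_all
        show ?thesis
          using \<Psi>val[OF jk] v Vadd(2)[OF v v] mem kv AV(3)[OF kv(1) kv(1)]
          by (simp add: val_def rlin(2) scaleC_scaleC scaleC_fun_def mult.commute)
      qed (simp add: \<Psi>0 scaleC_fun_def)
    qed
    show "\<Psi> v = 0" if "v \<notin> V" for v
      by (rule \<Psi>out[OF that])
    show "\<Psi> (act \<rho> h v) = act \<Omega> h (\<Psi> v)" if h: "h \<in> H" and v: "v \<in> V" for h v
    proof
      fix y
      show "\<Psi> (act \<rho> h v) y = act \<Omega> h (\<Psi> v) y"
        using \<Psi>trans[OF h v, of y] indD(1)[OF H \<Psi>I[OF rV[OF h v]], of y]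
        by (cases "y \<in> carrier G") (simp_all add: \<Omega>act[OF HG[OF h]] scaleC_fun_def ind_act_apply ind_act_outside)
    qed
  qed
  obtain F where F: "F \<in> intertwiners (carrier G) ind_rep \<Omega>" "\<forall>v\<in>V. F (delta H \<rho> v) = \<Psi> v"
    using frobenius_map[OF H rep \<Omega> \<Psi>] smooth by blast
  obtain v where v: "A v \<noteq> 0"
    using A(2) by (auto simp: fun_eq_iff)
  then have vV: "v \<in> V"
    using A0 by blast
  have one: "dec (inv g) \<one> \<one>"
    unfolding dec_def using subgroup.one_closed[OF H(1)] g by simp
  have "\<Psi> v (inv g) = A v"
    unfolding \<Psi>val[OF one vV] val_def
    using vV AV(1) characters_mod_inv(1)[OF \<eta> subgroup_self one_closed] linear_repD(4)[OF rep]
    by (simp add: scaleC_one)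
  then have "F (delta H \<rho> v) (inv g) \<noteq> 0"
    using F(2) vV v by simp
  then have "F \<noteq> 0"
    by auto
  have bij: "bij_betw F (vspace ind_rep) (vspace ind_rep)"
  proof (rule nonzero_intertwiner_bij[OF \<Omega> \<Omega>sp _ F(1) \<open>F \<noteq> 0\<close>])
    fix W
    assume W: "cvs.subspace W" "W \<subseteq> vspace ind_rep" "W \<noteq> {0}"
      and stable: "\<And>g w. g \<in> carrier G \<Longrightarrow> w \<in> W \<Longrightarrow> act \<Omega> g w \<in> W"
    show "W = vspace ind_rep"
    proof (rule ind_irreducible[OF W])
      fix x w
      assume x: "x \<in> carrier G" and w: "w \<in> W"
      have "\<eta> x *\<^sub>C act \<Omega> x w = act ind_rep x w"
        using \<eta>D(1)[OF x] by (simp add: \<Omega>act[OF x] scaleC_scaleC scaleC_one)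
      then show "act ind_rep x w \<in> W"
        using cvs.subspace_scale[OF W(1) stable[OF x w]] by metis
    qed
  qed
  have "F \<in> intertwiners (carrier G) (twist ind_rep \<eta>) ind_rep"
  proof (rule intertwinersI)
    note lin = linear_mapsD[OF intertwinersD(1)[OF F(1)]]
    show "F \<in> linear_maps (vspace (twist ind_rep \<eta>)) (vspace ind_rep)"
      using lin \<Omega>sp by (intro linear_mapsI) (simp_all add: twist_def)
    show "F \<phi> = 0" if "\<phi> \<notin> vspace (twist ind_rep \<eta>)" for \<phi>
      using that intertwinersD(2)[OF F(1)] by (simp add: twist_def)
    fix x \<phi>
    assume x: "x \<in> carrier G" and "\<phi> \<in> vspace (twist ind_rep \<eta>)"
    then have \<phi>: "\<phi> \<in> vspace ind_rep"
      by (simp add: twist_def)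
    have "F (\<eta> x *\<^sub>C act ind_rep x \<phi>) = \<eta> x *\<^sub>C act \<Omega> x (F \<phi>)"
      using lin(3)[OF linear_repD(3)[OF linear_rep_ind x \<phi>]] intertwinersD(3)[OF F(1) x \<phi>] by simp
    also have "\<dots> = act ind_rep x (F \<phi>)"
      using \<eta>D(1)[OF x] by (simp add: \<Omega>act[OF x] scaleC_scaleC scaleC_one)
    finally show "F (act (twist ind_rep \<eta>) x \<phi>) = act ind_rep x (F \<phi>)"
      by (simp add: twist_def)
  qed
  then show ?thesis
    unfolding rep_iso_def using bij by (intro bexI[of _ F]) (simp_all add: twist_def)
qed

text \<open>The quotient of \<open>D = H \<inter> gHg\<^sup>-\<^sup>1\<close> by \<open>D \<inter> M\<close> is abelian. An eigenvector for the action of \<open>D\<close> on the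
  intertwiners over \<open>D \<inter> M\<close> intertwines over \<open>D\<close> once \<open>\<eta>\<close> has been multiplied by a character that is trivial on
  \<open>M\<close>. By the isomorphism criterion the product is trivial at \<open>x\<close>, and so is the new factor.\<close>

lemma character_trivial_if_intertwines:
  assumes g: "g \<in> carrier G" and Gb: "Gb \<lhd> G" "openin T Gb" "derived G (carrier G) \<subseteq> Gb"
    and M: "M \<lhd> G" "Gb \<subseteq> M" and \<eta>: "\<eta> \<in> characters_mod G (carrier G) Gb"
    and A: "A \<in> intertwiners (H \<inter> conj_subgroup G H g \<inter> M) (twist \<rho> \<eta>) (conj_rep G \<rho> g)" "A \<noteq> 0"
    and x: "x \<in> dagger_subgroup G Gb ind_rep" "x \<in> M"
  shows "\<eta> x = 1"
proof -
  have Gb': "subgroup Gb G" and M': "subgroup M G"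
    using Gb(1) M(1) by (simp_all add: normal_imp_subgroup)
  define D where "D = H \<inter> conj_subgroup G H g"
  have conjH: "subgroup (conj_subgroup G H g) G"
    by (rule subgroup_conj_subgroup[OF H(1) g])
  have D: "subgroup D G"
    unfolding D_def by (rule subgroup_Int[OF H(1) conjH])
  have DM: "subgroup (D \<inter> M) G" "D \<inter> M \<subseteq> D"
    using D M' by (simp_all add: subgroup_Int)
  have \<eta>H: "(\<lambda>y\<in>H. \<eta> y) \<in> characters_mod G H {}"
    using characters_modD[OF \<eta>] HG subgroup.m_closed[OF H(1)] by (intro characters_modI) simp_all
  have "linear_rep G H (twist \<rho> (\<lambda>y\<in>H. \<eta> y))"
    by (rule linear_rep_twist[OF rep H(1) \<eta>H])
  then have "linear_rep G H (twist \<rho> \<eta>)"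
    unfolding linear_rep_def linear_maps_def twist_def using subgroup.m_closed[OF H(1)] subgroup.one_closed[OF H(1)]
    by simp
  then have \<sigma>: "linear_rep G D (twist \<rho> \<eta>)"
    by (rule linear_rep_subset) (simp add: D_def)
  have \<kappa>: "linear_rep G D (conj_rep G \<rho> g)"
    using linear_rep_conj[OF rep H(1) g] by (rule linear_rep_subset) (simp add: D_def)
  obtain \<omega> where \<omega>: "\<forall>z\<in>Z. \<forall>v\<in>V. act \<rho> z v = \<omega> z *\<^sub>C v"
    by (rule central_character)
  obtain K0 where K0: "subgroup K0 G" "openin T K0" "K0 \<subseteq> H" "\<forall>k\<in>K0. \<forall>v\<in>V. act \<rho> k v = v"
    by (rule open_subgroup_trivial)
  define K where "K = K0 \<inter> conj_subgroup G K0 g"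
  note memK0 = mem_conj_subgroup_iff[OF subgroup.subset[OF K0(1)] g]
  note memH = mem_conj_subgroup_iff[OF subgroup.subset[OF H(1)] g]
  have K: "subgroup K G" "openin T K" "K \<subseteq> H"
    unfolding K_def using K0 g by (auto simp: subgroup_Int subgroup_conj_subgroup openin_Int openin_conj_subgroup)
  have ZK: "l \<in> D \<and> (\<exists>a. \<forall>v\<in>V. act \<rho> l v = a *\<^sub>C v) \<and> (\<exists>a. \<forall>v\<in>V. act \<rho> (inv g \<otimes> l \<otimes> g) v = a *\<^sub>C v)"
    if l: "l \<in> Z <#> K" for l
  proof -
    obtain z k where zk: "z \<in> Z" "k \<in> K" "l = z \<otimes> k"
      using l unfolding set_mult_def by blast
    have k: "k \<in> K0" "inv g \<otimes> k \<otimes> g \<in> K0" "k \<in> H" "inv g \<otimes> k \<otimes> g \<in> H"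
      using zk(2) memK0 K0(3) unfolding K_def by auto
    have z: "z \<in> H" "z \<in> carrier G"
      using zk(1) ZH(1) ZG by auto
    have "inv g \<otimes> z = z \<otimes> inv g"
      using Z(2)[OF zk(1) inv_closed[OF g]] by simp
    then have conj: "inv g \<otimes> l \<otimes> g = z \<otimes> (inv g \<otimes> k \<otimes> g)"
      unfolding zk(3) using z HG[OF k(3)] g by (simp add: m_assoc[symmetric])
    have "l \<in> H" "inv g \<otimes> l \<otimes> g \<in> H"
      unfolding conj unfolding zk(3) using z k subgroup.m_closed[OF H(1)] by simp_all
    then have "l \<in> D"
      unfolding D_def using memH HG by simp
    moreover have "\<forall>v\<in>V. act \<rho> l v = \<omega> z *\<^sub>C v"
      unfolding zk(3) using z(1) k K0(4) \<omega> zk(1) by (simp add: linear_repD(5)[OF rep])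
    moreover have "\<forall>v\<in>V. act \<rho> (inv g \<otimes> l \<otimes> g) v = \<omega> z *\<^sub>C v"
      unfolding conj using z(1) k K0(4) \<omega> zk(1) by (simp add: linear_repD(5)[OF rep])
    ultimately show ?thesis
      by blast
  qed
  note L = subgroup_center_mult[OF K(1)]
  have LD: "Z <#> K \<subseteq> D"
    using ZK by blast
  have fin: "finite_index (Z <#> K) D"
    by (rule finite_index_mono[OF finite_index_center_mult[OF K] L L _ _ H(1)]) (simp_all add: D_def)
  have comm: "inv (d \<otimes> c) \<otimes> (c \<otimes> d) \<in> D \<inter> M" if "c \<in> D" "d \<in> D" for c d
  proof
    show "inv (d \<otimes> c) \<otimes> (c \<otimes> d) \<in> D"
      using that D by (simp add: subgroup.m_closed subgroup.m_inv_closed)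
    have cd: "c \<in> carrier G" "d \<in> carrier G"
      using that subgroup.mem_carrier[OF D] by simp_all
    have "inv c \<otimes> inv d \<otimes> inv (inv c) \<otimes> inv (inv d) \<in> derived G (carrier G)"
      unfolding derived_def by (rule generate.incl) (use cd in blast)
    moreover have "inv c \<otimes> inv d \<otimes> inv (inv c) \<otimes> inv (inv d) = inv (d \<otimes> c) \<otimes> (c \<otimes> d)"
      using cd by (simp add: inv_mult_group m_assoc)
    ultimately show "inv (d \<otimes> c) \<otimes> (c \<otimes> d) \<in> M"
      using Gb(3) M(2) by auto
  qed
  have \<sigma>L: "\<exists>a. \<forall>v\<in>vspace (twist \<rho> \<eta>). act (twist \<rho> \<eta>) l v = a *\<^sub>C v" if l: "l \<in> Z <#> K" for l
  proof -
    obtain a where "\<forall>v\<in>V. act \<rho> l v = a *\<^sub>C v"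
      using ZK[OF l] by blast
    then show ?thesis
      by (intro exI[of _ "\<eta> l * a"]) (simp add: twist_def scaleC_scaleC)
  qed
  have \<kappa>L: "\<exists>a. \<forall>v\<in>vspace (conj_rep G \<rho> g). act (conj_rep G \<rho> g) l v = a *\<^sub>C v" if l: "l \<in> Z <#> K" for l
    using ZK[OF l] by (simp add: conj_rep_def)
  have A': "A \<in> intertwiners (D \<inter> M) (twist \<rho> \<eta>) (conj_rep G \<rho> g)"
    using A(1) by (simp add: D_def)
  obtain \<theta> B where \<theta>: "\<theta> \<in> characters_mod G D (D \<inter> M)"
    and B: "B \<in> intertwiners D (twist (twist \<rho> \<eta>) \<theta>) (conj_rep G \<rho> g)" "B \<noteq> 0"
    by (rule intertwiner_eigenvector[OF D DM comm \<sigma> \<kappa> L LD fin \<sigma>L \<kappa>L A' A(2)])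
  obtain \<zeta> where \<zeta>: "\<zeta> \<in> characters_mod G (carrier G) M" "\<forall>d\<in>D. \<zeta> d = \<theta> d"
    using character_extend[OF M(1) subset_trans[OF Gb(3) M(2)] D \<theta>] by blast
  define \<eta>' where "\<eta>' = (\<lambda>x\<in>carrier G. \<eta> x * \<zeta> x)"
  have "\<zeta> \<in> characters_mod G (carrier G) Gb"
    using \<zeta>(1) characters_mod_subset[OF M(2)] by blast
  then have \<eta>': "\<eta>' \<in> characters_mod G (carrier G) Gb"
    unfolding \<eta>'_def by (rule characters_mod_mult[OF \<eta> _ subgroup_self subgroup.subset[OF Gb']])
  have "B \<in> intertwiners D (twist \<rho> \<eta>') (conj_rep G \<rho> g)"
  proof (rule intertwinersI)
    show "B \<in> linear_maps (vspace (twist \<rho> \<eta>')) (vspace (conj_rep G \<rho> g))"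
      using intertwinersD(1)[OF B(1)] by (simp add: twist_def)
    show "B v = 0" if "v \<notin> vspace (twist \<rho> \<eta>')" for v
      using intertwinersD(2)[OF B(1)] that by (simp add: twist_def)
    show "B (act (twist \<rho> \<eta>') d v) = act (conj_rep G \<rho> g) d (B v)"
      if d: "d \<in> D" and v: "v \<in> vspace (twist \<rho> \<eta>')" for d v
      using intertwinersD(3)[OF B(1) d] v \<zeta>(2) d subgroup.mem_carrier[OF D d]
      by (simp add: twist_def \<eta>'_def scaleC_scaleC mult.commute)
  qed
  then have "rep_iso (carrier G) (twist ind_rep \<eta>') ind_rep"
    unfolding D_def using twist_iso_if_intertwines[OF g Gb' Gb(2) \<eta>'] B(2) by blast
  then have "\<eta>' x = 1" and xG: "x \<in> carrier G"
    using x(1) \<eta>' unfolding dagger_subgroup_def by blast+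
  moreover have "\<zeta> x = 1"
    using characters_modD(3)[OF \<zeta>(1) x(2)] .
  ultimately show ?thesis
    by (simp add: \<eta>'_def)
qed

text \<open>Since \<open>\<sigma>\<close> splits off from \<open>\<rho>\<close> on \<open>N\<close>, an intertwiner between twists of \<open>\<sigma>\<close> gives one for \<open>\<rho>\<close>. Extending
  \<open>\<nu>\<close> and \<open>\<nu>'\<close> to \<open>G\<close> makes them invariant under conjugation by \<open>g\<close>, so only their quotient matters.\<close>

lemma characters_agree_if_intertwine:
  fixes \<sigma> :: "('a, 'w::complex_vector_space) repn"
  assumes g: "g \<in> carrier G" and Gb: "Gb \<lhd> G" "openin T Gb" "derived G (carrier G) \<subseteq> Gb"
    and M: "M \<lhd> G" "Gb \<subseteq> M" and N: "N = H \<inter> M"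
    and \<sigma>: "linear_rep G N \<sigma>" and i: "i \<in> intertwiners N \<sigma> \<rho>" "inj_on i (vspace \<sigma>)"
    and \<nu>: "\<nu> \<in> characters_mod G N (H \<inter> Gb)" "\<nu>' \<in> characters_mod G N (H \<inter> Gb)"
    and f: "f \<in> intertwiners (N \<inter> conj_subgroup G N g) (twist \<sigma> \<nu>) (conj_rep G (twist \<sigma> \<nu>') g)" "f \<noteq> 0"
    and x: "x \<in> dagger_subgroup G Gb ind_rep" "x \<in> N"
  shows "\<nu> x = \<nu>' x"
proof -
  have Gb': "subgroup Gb G" and M': "subgroup M G"
    using Gb(1) M(1) by (simp_all add: normal_imp_subgroup)
  have N': "subgroup N G" "N \<subseteq> H"
    unfolding N using H(1) M' by (simp_all add: subgroup_Int)
  have NGb: "N \<inter> Gb = H \<inter> Gb"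
    unfolding N using M(2) by blast
  obtain \<zeta> where \<zeta>: "\<zeta> \<in> characters_mod G (carrier G) Gb" "\<forall>n\<in>N. \<zeta> n = \<nu> n"
    using character_extend[OF Gb(1,3) N'(1)] \<nu>(1) unfolding NGb by blast
  obtain \<zeta>' where \<zeta>': "\<zeta>' \<in> characters_mod G (carrier G) Gb" "\<forall>n\<in>N. \<zeta>' n = \<nu>' n"
    using character_extend[OF Gb(1,3) N'(1)] \<nu>(2) unfolding NGb by blast
  define \<eta> where "\<eta> = (\<lambda>x\<in>carrier G. \<zeta> x * (\<lambda>x\<in>carrier G. inverse (\<zeta>' x)) x)"
  have \<eta>: "\<eta> \<in> characters_mod G (carrier G) Gb"
    unfolding \<eta>_def using subgroup.subset[OF Gb']
    by (intro characters_mod_mult characters_mod_inverse \<zeta>(1) \<zeta>'(1) subgroup_self)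
  have \<eta>eq: "\<eta> y = \<zeta> y * inverse (\<zeta>' y)" if "y \<in> carrier G" for y
    using that by (simp add: \<eta>_def)
  obtain p where p: "p \<in> intertwiners N \<rho> \<sigma>" "\<forall>w\<in>vspace \<sigma>. p (i w) = w"
    by (rule retraction[OF N' \<sigma> i])
  define A where "A = i \<circ> f \<circ> p"
  have fl: "f \<in> linear_maps (vspace \<sigma>) (vspace \<sigma>)"
    using intertwinersD(1)[OF f(1)] by (simp add: twist_def conj_rep_def)
  note il = linear_mapsD[OF intertwinersD(1)[OF i(1)]] and pl = linear_mapsD[OF intertwinersD(1)[OF p(1)]]
  have E: "H \<inter> conj_subgroup G H g \<inter> M = N \<inter> conj_subgroup G N g"
  proof -
    have "y \<in> M \<longleftrightarrow> inv g \<otimes> y \<otimes> g \<in> M" if "y \<in> carrier G" for y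
    proof
      show "inv g \<otimes> y \<otimes> g \<in> M" if "y \<in> M"
        using normal.inv_op_closed1[OF M(1) g that] .
      show "y \<in> M" if "inv g \<otimes> y \<otimes> g \<in> M"
      proof -
        have "g \<otimes> (inv g \<otimes> y \<otimes> g) \<otimes> inv g \<in> M"
          by (rule normal.inv_op_closed2[OF M(1) g that])
        moreover have "g \<otimes> (inv g \<otimes> y \<otimes> g) \<otimes> inv g = y"
          using g \<open>y \<in> carrier G\<close> by (simp add: m_assoc mult_inv_cancel)
        ultimately show ?thesis
          by simp
      qed
    qed
    then show ?thesis
      using mem_conj_subgroup_iff[OF subgroup.subset[OF H(1)] g] mem_conj_subgroup_iff[OF subgroup.subset[OF N'(1)] g]
      unfolding N by blast
  qed
  have "A \<in> intertwiners (N \<inter> conj_subgroup G N g) (twist \<rho> \<eta>) (conj_rep G \<rho> g)"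
  proof (rule intertwinersI)
    show "A \<in> linear_maps (vspace (twist \<rho> \<eta>)) (vspace (conj_rep G \<rho> g))"
      unfolding A_def using il pl linear_mapsD[OF fl]
      by (intro linear_mapsI) (simp_all add: twist_def conj_rep_def)
    show "A v = 0" if "v \<notin> vspace (twist \<rho> \<eta>)" for v
      using that intertwinersD(2)[OF p(1)] linear_maps_0[OF fl linear_repD(1)[OF \<sigma>]]
        linear_maps_0[OF intertwinersD(1)[OF i(1)] linear_repD(1)[OF \<sigma>]]
      by (simp add: A_def twist_def)
    fix n v
    assume n: "n \<in> N \<inter> conj_subgroup G N g" and "v \<in> vspace (twist \<rho> \<eta>)"
    then have v: "v \<in> V"
      by (simp add: twist_def)
    have nN: "n \<in> N" "inv g \<otimes> n \<otimes> g \<in> N" "n \<in> carrier G" "n \<in> H" "inv g \<otimes> n \<otimes> g \<in> carrier G"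
      using n mem_conj_subgroup_iff[OF subgroup.subset[OF N'(1)] g] N'(2) HG g by auto
    define w where "w = p v"
    have w: "w \<in> vspace \<sigma>" "act \<sigma> n w \<in> vspace \<sigma>" "f w \<in> vspace \<sigma>"
      unfolding w_def using pl(1)[OF v] linear_repD(3)[OF \<sigma> nN(1)] linear_mapsD(1)[OF fl] by simp_all
    have "\<nu> n *\<^sub>C f (act \<sigma> n w) = f (act (twist \<sigma> \<nu>) n w)"
      using linear_mapsD(3)[OF fl w(2)] by (simp add: twist_def)
    also have "\<dots> = \<nu>' (inv g \<otimes> n \<otimes> g) *\<^sub>C act \<sigma> (inv g \<otimes> n \<otimes> g) (f w)"
      using intertwinersD(3)[OF f(1) n, of w] w(1) by (simp add: twist_def conj_rep_def)
    also have "\<nu>' (inv g \<otimes> n \<otimes> g) = \<zeta>' n"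
      using \<zeta>'(2) nN(2) character_conj[OF \<zeta>'(1) g nN(3)] by auto
    finally have "\<zeta> n *\<^sub>C f (act \<sigma> n w) = \<zeta>' n *\<^sub>C act \<sigma> (inv g \<otimes> n \<otimes> g) (f w)"
      using \<zeta>(2) nN(1) by simp
    moreover have "\<zeta>' n * \<eta> n = \<zeta> n"
      using \<eta>eq[OF nN(3)] characters_modD(1)[OF \<zeta>'(1) nN(3)] by simp
    ultimately have "\<zeta>' n *\<^sub>C (\<eta> n *\<^sub>C f (act \<sigma> n w)) = \<zeta>' n *\<^sub>C act \<sigma> (inv g \<otimes> n \<otimes> g) (f w)"
      by (simp add: scaleC_scaleC)
    then have eq: "\<eta> n *\<^sub>C f (act \<sigma> n w) = act \<sigma> (inv g \<otimes> n \<otimes> g) (f w)"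
      by (rule cvs.scale_left_imp_eq[OF characters_modD(1)[OF \<zeta>'(1) nN(3)]])
    have nv: "act \<rho> n v \<in> V"
      by (rule linear_repD(3)[OF rep nN(4) v])
    have "A (\<eta> n *\<^sub>C act \<rho> n v) = i (f (p (\<eta> n *\<^sub>C act \<rho> n v)))"
      by (simp add: A_def)
    also have "\<dots> = i (f (\<eta> n *\<^sub>C act \<sigma> n w))"
      unfolding pl(3)[OF nv] intertwinersD(3)[OF p(1) nN(1) v] w_def ..
    also have "\<dots> = i (\<eta> n *\<^sub>C f (act \<sigma> n w))"
      unfolding linear_mapsD(3)[OF fl w(2)] ..
    also have "\<dots> = act \<rho> (inv g \<otimes> n \<otimes> g) (A v)"
      unfolding eq intertwinersD(3)[OF i(1) nN(2) w(3)] by (simp add: A_def w_def)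
    finally show "A (act (twist \<rho> \<eta>) n v) = act (conj_rep G \<rho> g) n (A v)"
      by (simp add: twist_def conj_rep_def)
  qed
  moreover have "A \<noteq> 0"
  proof -
    obtain w where w: "f w \<noteq> 0"
      using f(2) by (auto simp: fun_eq_iff)
    then have wV: "w \<in> vspace \<sigma>"
      using intertwinersD(2)[OF f(1)] by (auto simp: twist_def)
    have "i (f w) \<noteq> i 0"
      using i(2) w linear_mapsD(1)[OF fl wV] cvs.subspace_0[OF linear_repD(1)[OF \<sigma>]] by (auto simp: inj_on_def)
    then have "A (i w) \<noteq> 0"
      using p(2) wV linear_maps_0[OF intertwinersD(1)[OF i(1)] linear_repD(1)[OF \<sigma>]] by (simp add: A_def)
    then show ?thesis
      by (auto simp: fun_eq_iff)
  qed
  moreover have "x \<in> M" "x \<in> carrier G"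
    using x(2) N HG by auto
  ultimately have "\<eta> x = 1"
    using character_trivial_if_intertwines[OF g Gb M \<eta> _ _ x(1)] unfolding E by blast
  then have "\<zeta> x = \<zeta>' x"
    using \<eta>eq[OF \<open>x \<in> carrier G\<close>] characters_modD(1)[OF \<zeta>'(1) \<open>x \<in> carrier G\<close>] by (simp add: field_simps)
  then show ?thesis
    using \<zeta>(2) \<zeta>'(2) x(2) by simp
qed

end

section \<open>Endomorphism algebras of multiplicity-free decompositions\<close>

lemma sum_fun_apply: "sum p I x = (\<Sum>i\<in>I. p i x)"
  by (induction I rule: infinite_finite_induct) simp_all

text \<open>Without maps between different summands, an endomorphism of the sum preserves each of them, so it is the same as a
  family of endomorphisms of the summands.\<close>

lemma end_algebra_decomposition:
  fixes P :: "('g, 'v::complex_vector_space) repn" and Q :: "'i \<Rightarrow> ('g, 'w::complex_vector_space) repn"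
  assumes I: "finite I" and P: "linear_rep G H P" and Q: "\<And>i. i \<in> I \<Longrightarrow> linear_rep G H (Q i)"
    and inc: "\<And>i. i \<in> I \<Longrightarrow> inc i \<in> intertwiners H (Q i) P"
    and pr: "\<And>i. i \<in> I \<Longrightarrow> pr i \<in> intertwiners H P (Q i)"
    and pr_inc: "\<And>i v. i \<in> I \<Longrightarrow> v \<in> vspace (Q i) \<Longrightarrow> pr i (inc i v) = v"
    and total: "\<And>v. v \<in> vspace P \<Longrightarrow> (\<Sum>i\<in>I. inc i (pr i v)) = v"
    and orth: "\<And>i j f. i \<in> I \<Longrightarrow> j \<in> I \<Longrightarrow> i \<noteq> j \<Longrightarrow> f \<in> intertwiners H (Q i) (Q j) \<Longrightarrow> f = 0"
  shows "algebra_isomorphic (end_algebra H P) (direct_sum_algebra I (\<lambda>i. end_algebra H (Q i)))"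
proof -
  note Ps = linear_repD(1)[OF P] and Qs = linear_repD(1)[OF Q]
  define \<Phi> where "\<Phi> F = (\<lambda>i\<in>I. pr i \<circ> F \<circ> inc i)" for F
  have inc0: "inc i 0 = 0" and pr0: "pr i 0 = 0" if "i \<in> I" for i
    using linear_maps_0[OF intertwinersD(1)[OF inc[OF that]] Qs[OF that]]
      linear_maps_0[OF intertwinersD(1)[OF pr[OF that]] Ps] by simp_all
  have F0: "F 0 = 0" if "F \<in> intertwiners H P P" for F
    by (rule linear_maps_0[OF intertwinersD(1)[OF that] Ps])
  have comp: "pr j \<circ> F \<circ> inc i \<in> intertwiners H (Q i) (Q j)"
    if "i \<in> I" "j \<in> I" "F \<in> intertwiners H P P" for i j F
    by (rule intertwiners_compose[OF inc[OF that(1)] intertwiners_compose[OF that(3) pr[OF that(2)] Ps] Ps])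
  have cross: "pr j (F (inc i v)) = 0" if "i \<in> I" "j \<in> I" "i \<noteq> j" "F \<in> intertwiners H P P" for i j F v
    using orth[OF that(1-3) comp[OF that(1,2,4)]] by (simp add: fun_eq_iff)
  have incV: "inc i v \<in> vspace P" if "i \<in> I" "v \<in> vspace (Q i)" for i v
    by (rule intertwinersD(4)[OF inc[OF that(1)] that(2)])
  have diag: "F (inc i v) = inc i (pr i (F (inc i v)))"
    if i: "i \<in> I" and F: "F \<in> intertwiners H P P" and v: "v \<in> vspace (Q i)" for i F v
  proof -
    have "F (inc i v) = (\<Sum>j\<in>I. inc j (pr j (F (inc i v))))"
      by (rule total[symmetric, OF intertwinersD(4)[OF F incV[OF i v]]])
    also have "\<dots> = (\<Sum>j\<in>{i}. inc j (pr j (F (inc i v))))"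
    proof (rule sum.mono_neutral_right[OF I])
      show "\<forall>j\<in>I - {i}. inc j (pr j (F (inc i v))) = 0"
      proof
        fix j
        assume "j \<in> I - {i}"
        then have j: "j \<in> I" "i \<noteq> j"
          by auto
        show "inc j (pr j (F (inc i v))) = 0"
          using cross[OF i j F] inc0[OF j(1)] by simp
      qed
    qed (use i in simp)
    finally show ?thesis
      by simp
  qed
  have \<Phi>app: "\<Phi> F i v = (if v \<in> vspace (Q i) then pr i (F (inc i v)) else 0)"
    if "i \<in> I" "F \<in> intertwiners H P P" for F i v
    using that intertwinersD(2)[OF inc[OF that(1)]] F0[OF that(2)] pr0 by (auto simp: \<Phi>_def)
  have \<Phi>I: "\<Phi> F \<in> carrier (direct_sum_algebra I (\<lambda>i. end_algebra H (Q i)))" if "F \<in> intertwiners H P P" for F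
    using comp[OF _ _ that] I by (auto simp: \<Phi>_def direct_sum_algebra_def end_algebra_def)
  have expand: "F v = (\<Sum>i\<in>I. inc i (\<Phi> F i (pr i v)))" if F: "F \<in> intertwiners H P P" and v: "v \<in> vspace P" for F v
  proof -
    have prV: "pr i v \<in> vspace (Q i)" if "i \<in> I" for i
      by (rule intertwinersD(4)[OF pr[OF that] v])
    have "F v = F (\<Sum>i\<in>I. inc i (pr i v))"
      using total[OF v] by simp
    also have "\<dots> = (\<Sum>i\<in>I. F (inc i (pr i v)))"
      by (rule linear_maps_sum[OF intertwinersD(1)[OF F] Ps]) (rule incV, assumption, erule prV)
    also have "\<dots> = (\<Sum>i\<in>I. inc i (\<Phi> F i (pr i v)))"
    proof (rule sum.cong[OF refl])
      fix i
      assume i: "i \<in> I"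
      show "F (inc i (pr i v)) = inc i (\<Phi> F i (pr i v))"
        using diag[OF i F prV[OF i]] prV[OF i] by (simp add: \<Phi>app[OF i F])
    qed
    finally show ?thesis .
  qed
  have sum_closed: "F \<circ> F' \<in> intertwiners H P P" "F + F' \<in> intertwiners H P P" "c *\<^sub>C F \<in> intertwiners H P P"
    if "F \<in> intertwiners H P P" "F' \<in> intertwiners H P P" for F F' c
    using intertwiners_compose[OF that(2,1) Ps] intertwiners_add[OF that P] intertwiners_scale[OF that(1) P]
    by simp_all
  have prlin: "pr i (v + w) = pr i v + pr i w" "pr i (c *\<^sub>C v) = c *\<^sub>C pr i v"
    if "i \<in> I" "v \<in> vspace P" "w \<in> vspace P" for i v w c
    using linear_mapsD[OF intertwinersD(1)[OF pr[OF that(1)]]] that(2,3) by simp_all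
  have FV: "F (inc i v) \<in> vspace P" if "F \<in> intertwiners H P P" "i \<in> I" "v \<in> vspace (Q i)" for F i v
    by (rule intertwinersD(4)[OF that(1) incV[OF that(2,3)]])
  have hom: "\<Phi> \<in> ring_hom (end_algebra H P) (direct_sum_algebra I (\<lambda>i. end_algebra H (Q i)))"
  proof (rule ring_hom_memI)
    show "\<Phi> F \<in> carrier (direct_sum_algebra I (\<lambda>i. end_algebra H (Q i)))" if "F \<in> carrier (end_algebra H P)" for F
      using that \<Phi>I by (simp add: end_algebra_def)
  next
    fix F F'
    assume "F \<in> carrier (end_algebra H P)" "F' \<in> carrier (end_algebra H P)"
    then have F: "F \<in> intertwiners H P P" "F' \<in> intertwiners H P P"
      by (simp_all add: end_algebra_def)
    have "\<Phi> (F \<circ> F') i v = (\<Phi> F i \<circ> \<Phi> F' i) v" if i: "i \<in> I" for i v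
    proof (cases "v \<in> vspace (Q i)")
      case True
      have m: "pr i (F' (inc i v)) \<in> vspace (Q i)"
        by (rule intertwinersD(4)[OF pr[OF i] FV[OF F(2) i True]])
      have "\<Phi> (F \<circ> F') i v = pr i (F (F' (inc i v)))"
        using True by (simp add: \<Phi>app[OF i sum_closed(1)[OF F]])
      also have "\<dots> = pr i (F (inc i (pr i (F' (inc i v)))))"
        using diag[OF i F(2) True] by simp
      finally show ?thesis
        using True m by (simp add: \<Phi>app[OF i F(1)] \<Phi>app[OF i F(2)])
    next
      case False
      then show ?thesis
        using F0[OF F(1)] inc0[OF i] pr0[OF i]
        by (simp add: \<Phi>app[OF i sum_closed(1)[OF F]] \<Phi>app[OF i F(1)] \<Phi>app[OF i F(2)])
    qed
    then show "\<Phi> (F \<otimes>\<^bsub>end_algebra H P\<^esub> F') =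
        \<Phi> F \<otimes>\<^bsub>direct_sum_algebra I (\<lambda>i. end_algebra H (Q i))\<^esub> \<Phi> F'"
      by (auto simp: end_algebra_def direct_sum_algebra_def \<Phi>_def fun_eq_iff)
    have "\<Phi> (F + F') i v = (\<Phi> F i + \<Phi> F' i) v" if i: "i \<in> I" for i v
      using i by (simp add: \<Phi>app[OF i sum_closed(2)[OF F]] \<Phi>app[OF i F(1)] \<Phi>app[OF i F(2)] prlin(1) FV[OF F(1)] FV[OF F(2)])
    then show "\<Phi> (F \<oplus>\<^bsub>end_algebra H P\<^esub> F') =
        \<Phi> F \<oplus>\<^bsub>direct_sum_algebra I (\<lambda>i. end_algebra H (Q i))\<^esub> \<Phi> F'"
      by (auto simp: end_algebra_def direct_sum_algebra_def \<Phi>_def fun_eq_iff)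
  next
    have one: "(\<lambda>v. if v \<in> vspace P then v else 0) \<in> intertwiners H P P"
      using Ps linear_repD(3)[OF P]
      by (intro intertwinersI linear_mapsI) (simp_all add: cvs.subspace_add cvs.subspace_scale)
    have "\<Phi> (\<lambda>v. if v \<in> vspace P then v else 0) i v = (if v \<in> vspace (Q i) then v else 0)" if i: "i \<in> I" for i v
      using i by (simp add: \<Phi>app[OF i one] incV pr_inc)
    then show "\<Phi> \<one>\<^bsub>end_algebra H P\<^esub> = \<one>\<^bsub>direct_sum_algebra I (\<lambda>i. end_algebra H (Q i))\<^esub>"
      by (auto simp: end_algebra_def direct_sum_algebra_def \<Phi>_def fun_eq_iff)
  qed
  have inj: "inj_on \<Phi> (intertwiners H P P)"
  proof (rule inj_onI)
    fix F F'
    assume F: "F \<in> intertwiners H P P" "F' \<in> intertwiners H P P" "\<Phi> F = \<Phi> F'"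
    show "F = F'"
    proof
      fix v
      show "F v = F' v"
        using F(3) expand[OF F(1), of v] expand[OF F(2), of v] intertwinersD(2)[OF F(1), of v] intertwinersD(2)[OF F(2), of v]
        by (cases "v \<in> vspace P") simp_all
    qed
  qed
  have surj: "\<exists>F\<in>intertwiners H P P. \<Phi> F = B"
    if "B \<in> carrier (direct_sum_algebra I (\<lambda>i. end_algebra H (Q i)))" for B
  proof -
    have B: "B i \<in> intertwiners H (Q i) (Q i)" if "i \<in> I" for i
      using \<open>B \<in> _\<close> that by (auto simp: direct_sum_algebra_def end_algebra_def)
    have Bext: "B i = undefined" if "i \<notin> I" for i
      using \<open>B \<in> _\<close> that by (auto simp: direct_sum_algebra_def PiE_def extensional_def)
    have BI: "inc i \<circ> B i \<circ> pr i \<in> intertwiners H P P" if "i \<in> I" for i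
      by (rule intertwiners_compose[OF pr[OF that] intertwiners_compose[OF B[OF that] inc[OF that] Qs[OF that]] Qs[OF that]])
    define F where "F = (\<Sum>i\<in>I. inc i \<circ> B i \<circ> pr i)"
    have F: "F \<in> intertwiners H P P"
      unfolding F_def by (rule cvs.subspace_sum[OF intertwiners_subspace[OF P]]) (rule BI)
    have one: "(\<lambda>v. if v \<in> vspace P then v else 0) \<in> intertwiners H P P"
      using Ps linear_repD(3)[OF P]
      by (intro intertwinersI linear_mapsI) (simp_all add: cvs.subspace_add cvs.subspace_scale)
    have "\<Phi> F i v = B i v" if i: "i \<in> I" for i v
    proof (cases "v \<in> vspace (Q i)")
      case True
      have pj: "pr j (inc i v) = 0" if "j \<in> I" "j \<noteq> i" for j
        using cross[OF i that(1) that(2)[symmetric] one, of v] incV[OF i True] by simp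
      have B0: "B j 0 = 0" if "j \<in> I" for j
        by (rule linear_maps_0[OF intertwinersD(1)[OF B[OF that]] Qs[OF that]])
      have "F (inc i v) = (\<Sum>j\<in>I. inc j (B j (pr j (inc i v))))"
        unfolding F_def sum_fun_apply by simp
      also have "\<dots> = (\<Sum>j\<in>{i}. inc j (B j (pr j (inc i v))))"
      proof (rule sum.mono_neutral_right[OF I])
        show "\<forall>j\<in>I - {i}. inc j (B j (pr j (inc i v))) = 0"
          using pj B0 inc0 by simp
      qed (use i in simp)
      also have "\<dots> = inc i (B i v)"
        by (simp add: pr_inc[OF i True])
      finally show ?thesis
        using True intertwinersD(4)[OF B[OF i] True] by (simp add: \<Phi>app[OF i F] pr_inc[OF i])
    next
      case False
      then show ?thesis
        using intertwinersD(2)[OF B[OF i] False] by (simp add: \<Phi>app[OF i F])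
    qed
    then have "\<Phi> F = B"
      using Bext by (auto simp: \<Phi>_def fun_eq_iff)
    then show ?thesis
      using F by blast
  qed
  have "bij_betw \<Phi> (carrier (end_algebra H P)) (carrier (direct_sum_algebra I (\<lambda>i. end_algebra H (Q i))))"
    unfolding bij_betw_def
  proof
    show "inj_on \<Phi> (carrier (end_algebra H P))"
      using inj by (simp add: end_algebra_def)
    show "\<Phi> ` carrier (end_algebra H P) = carrier (direct_sum_algebra I (\<lambda>i. end_algebra H (Q i)))"
      using surj \<Phi>I by (force simp: end_algebra_def)
  qed
  moreover have "\<Phi> (c \<odot>\<^bsub>end_algebra H P\<^esub> F) = c \<odot>\<^bsub>direct_sum_algebra I (\<lambda>i. end_algebra H (Q i))\<^esub> \<Phi> F"
    if "F \<in> carrier (end_algebra H P)" for c F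
  proof -
    have F: "F \<in> intertwiners H P P"
      using that by (simp add: end_algebra_def)
    have "\<Phi> (c *\<^sub>C F) i v = (c *\<^sub>C \<Phi> F i) v" if i: "i \<in> I" for i v
      unfolding \<Phi>app[OF i sum_closed(3)[OF F F]]
      using i FV[OF F i] by (simp add: \<Phi>app[OF i F] scaleC_fun_def prlin(2)[OF i _ cvs.subspace_0[OF Ps]])
    then show ?thesis
      by (auto simp: end_algebra_def direct_sum_algebra_def \<Phi>_def fun_eq_iff)
  qed
  ultimately show ?thesis
    unfolding algebra_isomorphic_def ring_iso_def using hom by (intro bexI[of _ \<Phi>]) simp_all
qed

section \<open>Finite groups of characters\<close>

context group
begin

lemma characters_mod_pow:
  assumes "\<nu> \<in> characters_mod G N J" "subgroup N G" "x \<in> N"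
  shows "x [^] (k::nat) \<in> N" "\<nu> (x [^] k) = \<nu> x ^ k"
proof -
  have "x [^] (k::nat) \<in> N \<and> \<nu> (x [^] k) = \<nu> x ^ k"
  proof (induction k)
    case 0
    then show ?case
      using subgroup.one_closed[OF assms(2)] characters_mod_inv(1)[OF assms] by simp
  next
    case (Suc k)
    then show ?case
      using characters_modD(2)[OF assms(1) _ assms(3)] subgroup.m_closed[OF assms(2) _ assms(3)] by (simp add: mult.commute)
  qed
  then show "x [^] (k::nat) \<in> N" "\<nu> (x [^] k) = \<nu> x ^ k"
    by simp_all
qed

lemma characters_mod_coset:
  assumes \<nu>: "\<nu> \<in> characters_mod G N J" and N: "subgroup N G" and J: "subgroup J G" "J \<subseteq> N"
    and xy: "x \<in> N" "y \<in> N" "x <# J = y <# J"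
  shows "\<nu> x = \<nu> y"
proof -
  have G: "x \<in> carrier G" "y \<in> carrier G"
    using xy subgroup.mem_carrier[OF N] by simp_all
  have l: "inv x \<otimes> y \<in> J"
    using xy(3) l_coset_eq_iff[OF J(1) G] by simp
  have "\<nu> (x \<otimes> (inv x \<otimes> y)) = \<nu> x"
    using characters_modD(2)[OF \<nu> xy(1), of "inv x \<otimes> y"] characters_modD(3)[OF \<nu> l] l J(2) by auto
  then show ?thesis
    using G by (simp add: mult_inv_cancel)
qed

text \<open>A character is determined by its values on finitely many representatives of \<open>N/J\<close>. Each representative has a power
  in \<open>J\<close>, so its values are roots of unity of a fixed order.\<close>

lemma finite_characters_mod:
  assumes N: "subgroup N G" and J: "subgroup J G" "J \<subseteq> N" and fin: "finite_index J N"
  shows "finite (characters_mod G N J)"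
proof -
  let ?f = "\<lambda>x. x <# J"
  define R where "R = (\<lambda>C. SOME x. x \<in> N \<and> ?f x = C) ` ?f ` N"
  have R: "finite R" "R \<subseteq> N"
    using fin fiber_sum_choice(1)[of _ ?f N] unfolding R_def finite_index_def by auto
  have "\<exists>k. k > 0 \<and> r [^] (k::nat) \<in> J" if r: "r \<in> N" for r
  proof -
    have rG: "r \<in> carrier G"
      by (rule subgroup.mem_carrier[OF N r])
    have powN: "r [^] (k::nat) \<in> N" for k
      by (induction k) (use subgroup.one_closed[OF N] subgroup.m_closed[OF N _ r] in simp_all)
    have "range (\<lambda>k::nat. ?f (r [^] k)) \<subseteq> ?f ` N"
      using powN by blast
    then have "finite (range (\<lambda>k::nat. ?f (r [^] k)))"
      using fin finite_subset unfolding finite_index_def by blast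
    then have "\<not> inj (\<lambda>k::nat. ?f (r [^] k))"
      using finite_imageD infinite_UNIV_nat by blast
    then obtain i j :: nat where ij: "i < j" "?f (r [^] i) = ?f (r [^] j)"
      unfolding inj_def by (metis linorder_neqE_nat)
    have "inv (r [^] i) \<otimes> r [^] j \<in> J"
      using ij(2) l_coset_eq_iff[OF J(1)] rG by simp
    moreover have "r [^] j = r [^] i \<otimes> r [^] (j - i)"
      using ij(1) rG by (simp add: nat_pow_mult)
    ultimately have "r [^] (j - i) \<in> J"
      using rG by (simp add: mult_inv_cancel)
    then show ?thesis
      using ij(1) by (intro exI[of _ "j - i"]) simp
  qed
  then have "\<forall>r\<in>N. \<exists>k. k > 0 \<and> r [^] (k::nat) \<in> J"
    by (rule ballI)
  then obtain e where e: "\<forall>r\<in>N. e r > 0 \<and> r [^] (e r :: nat) \<in> J"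
    by (rule bchoice[THEN exE])
  have roots: "finite {z :: complex. z ^ k = 1}" if "k > 0" for k :: nat
  proof -
    have "Polynomial.monom 1 k - 1 \<noteq> (0 :: complex poly)"
    proof
      assume "Polynomial.monom 1 k - 1 = (0 :: complex poly)"
      then have "poly (Polynomial.monom 1 k - 1) 0 = (0 :: complex)"
        by simp
      then show False
        using that by (simp add: poly_monom power_0_left)
    qed
    then have "finite {z. poly (Polynomial.monom 1 k - 1 :: complex poly) z = 0}"
      by (rule poly_roots_finite)
    then show ?thesis
      by (simp add: poly_monom)
  qed
  have "(\<lambda>\<nu>. restrict \<nu> R) ` characters_mod G N J \<subseteq> (\<Pi>\<^sub>E r\<in>R. {z. z ^ e r = 1})"
  proof
    fix \<mu>
    assume "\<mu> \<in> (\<lambda>\<nu>. restrict \<nu> R) ` characters_mod G N J"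
    then obtain \<nu> where \<nu>: "\<nu> \<in> characters_mod G N J" "\<mu> = restrict \<nu> R"
      by blast
    have "\<nu> r ^ e r = 1" if "r \<in> R" for r
    proof -
      have r: "r \<in> N"
        using that R(2) by blast
      show ?thesis
        using characters_mod_pow(2)[OF \<nu>(1) N r, of "e r"] characters_modD(3)[OF \<nu>(1)] e r by simp
    qed
    then show "\<mu> \<in> (\<Pi>\<^sub>E r\<in>R. {z. z ^ e r = 1})"
      unfolding \<nu>(2) by simp
  qed
  moreover have "finite (\<Pi>\<^sub>E r\<in>R. {z :: complex. z ^ e r = 1})"
  proof (rule finite_PiE[OF R(1)])
    fix r
    assume "r \<in> R"
    then show "finite {z :: complex. z ^ e r = 1}"
      using e R(2) by (intro roots) auto
  qed
  ultimately have "finite ((\<lambda>\<nu>. restrict \<nu> R) ` characters_mod G N J)"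
    by (rule finite_subset)
  moreover have "inj_on (\<lambda>\<nu>. restrict \<nu> R) (characters_mod G N J)"
  proof (rule inj_onI)
    fix \<nu> \<mu>
    assume \<nu>: "\<nu> \<in> characters_mod G N J" and \<mu>: "\<mu> \<in> characters_mod G N J" and eq: "restrict \<nu> R = restrict \<mu> R"
    show "\<nu> = \<mu>"
    proof (rule extensionalityI[OF characters_modD(4)[OF \<nu>] characters_modD(4)[OF \<mu>]])
      fix n
      assume n: "n \<in> N"
      define r where "r = (SOME x. x \<in> N \<and> ?f x = ?f n)"
      have c: "?f n \<in> ?f ` N"
        using n by blast
      have r: "r \<in> N" "?f r = ?f n"
        unfolding r_def using fiber_sum_choice[OF c] by simp_all
      have "r \<in> R"
        unfolding R_def r_def using c by blast
      then have "\<nu> r = \<mu> r"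
        using eq by (metis restrict_apply')
      then show "\<nu> n = \<mu> n"
        using characters_mod_coset[OF \<nu> N J r(1) n r(2)] characters_mod_coset[OF \<mu> N J r(1) n r(2)] by simp
    qed
  qed
  ultimately show ?thesis
    by (rule finite_imageD)
qed

text \<open>Multiplication by a character that is not 1 at \<open>x\<close> permutes the summands, and it multiplies the sum by a factor other than 1.\<close>

lemma sum_characters:
  assumes N: "subgroup N G" and x: "x \<in> N" and J: "J \<subseteq> N"
    and sep: "\<exists>\<mu>\<in>characters_mod G N J. \<mu> x \<noteq> 1"
  shows "(\<Sum>\<nu>\<in>characters_mod G N J. \<nu> x) = 0"
proof -
  let ?I = "characters_mod G N J"
  obtain \<mu> where \<mu>: "\<mu> \<in> ?I" "\<mu> x \<noteq> 1"
    using sep by blast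
  note \<mu>' = characters_mod_inverse[OF \<mu>(1) N J]
  define i where "i \<nu> = (\<lambda>y\<in>N. (\<lambda>y\<in>N. inverse (\<mu> y)) y * \<nu> y)" for \<nu>
  define j where "j \<nu> = (\<lambda>y\<in>N. \<mu> y * \<nu> y)" for \<nu>
  have "(\<Sum>\<nu>\<in>?I. \<nu> x) = (\<Sum>\<nu>\<in>?I. \<mu> x * \<nu> x)"
  proof (rule sum.reindex_bij_witness[where i = j and j = i])
    fix \<nu>
    assume \<nu>: "\<nu> \<in> ?I"
    show "j (i \<nu>) = \<nu>" "i (j \<nu>) = \<nu>"
      using characters_modD(4)[OF \<nu>] characters_modD(1)[OF \<mu>(1)]
      by (auto intro!: extensionalityI[of _ N] simp: i_def j_def)
    show "i \<nu> \<in> ?I" "j \<nu> \<in> ?I"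
      unfolding i_def j_def using \<mu>(1) \<mu>' \<nu> N J by (simp_all only: characters_mod_mult)
    show "\<mu> x * i \<nu> x = \<nu> x"
      using x characters_modD(1)[OF \<mu>(1) x] by (simp add: i_def)
  qed
  also have "\<dots> = \<mu> x * (\<Sum>\<nu>\<in>?I. \<nu> x)"
    by (simp add: sum_distrib_left)
  finally have "(1 - \<mu> x) * (\<Sum>\<nu>\<in>?I. \<nu> x) = 0"
    by (simp add: algebra_simps)
  then show ?thesis
    using \<mu>(2) by simp
qed

text \<open>By orthogonality, only the trivial character contributes to the double sum of \<open>\<nu> x\<close> over characters and cosets,
  and only the trivial coset if the order of summation is exchanged.\<close>

lemma card_characters_mod:
  assumes N: "subgroup N G" and J: "subgroup J G" "J \<subseteq> N" and fin: "finite_index J N"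
    and sep: "\<And>x. x \<in> N \<Longrightarrow> x \<notin> J \<Longrightarrow> \<exists>\<mu>\<in>characters_mod G N J. \<mu> x \<noteq> 1"
  shows "card (characters_mod G N J) = card ((\<lambda>x. x <# J) ` N)"
proof -
  let ?I = "characters_mod G N J" and ?f = "\<lambda>x. x <# J"
  have finI: "finite ?I"
    by (rule finite_characters_mod[OF N J fin])
  define t where "t = (\<lambda>x\<in>N. 1 :: complex)"
  have t: "t \<in> ?I"
    unfolding t_def using J subgroup.m_closed[OF N] by (intro characters_modI) auto
  define S where "S \<nu> = (\<Sum>C\<in>?f ` N. \<nu> (SOME x. x \<in> N \<and> ?f x = C))" for \<nu> :: "'a \<Rightarrow> complex"
  have S: "S \<nu> = fiber_sum ?f N \<nu>" for \<nu>
    by (simp add: S_def fiber_sum_def)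
  have S0: "S \<nu> = 0" if \<nu>: "\<nu> \<in> ?I" "\<nu> \<noteq> t" for \<nu>
  proof -
    have "\<exists>m\<in>N. \<nu> m \<noteq> 1"
    proof (rule ccontr)
      assume "\<not> (\<exists>m\<in>N. \<nu> m \<noteq> 1)"
      then have "\<nu> = t"
        using characters_modD(4)[OF \<nu>(1)] by (intro extensionalityI[of _ N]) (auto simp: t_def)
      then show False
        using \<nu>(2) by simp
    qed
    then obtain m where m: "m \<in> N" "\<nu> m \<noteq> 1"
      by blast
    have "fiber_sum ?f N \<nu> = fiber_sum ?f N (\<lambda>x. \<nu> (m \<otimes> x))"
      by (rule coset_sum_left_translate[OF N J(1) m(1)]) (rule characters_mod_coset[OF \<nu>(1) N J])
    also have "\<dots> = fiber_sum ?f N (\<lambda>x. \<nu> m * \<nu> x)"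
      by (rule fiber_sum_cong) (rule characters_modD(2)[OF \<nu>(1) m(1)])
    also have "\<dots> = \<nu> m * fiber_sum ?f N \<nu>"
      by (simp add: fiber_sum_def sum_distrib_left)
    finally have "(1 - \<nu> m) * fiber_sum ?f N \<nu> = 0"
      by (simp add: algebra_simps)
    then show ?thesis
      using m(2) by (simp add: S)
  qed
  have "(\<Sum>\<nu>\<in>?I. S \<nu>) = (\<Sum>\<nu>\<in>{t}. S \<nu>)"
    using t S0 by (intro sum.mono_neutral_right[OF finI]) auto
  also have "\<dots> = of_nat (card (?f ` N))"
    using fiber_sum_choice(1)[of _ ?f N] by (simp add: S_def t_def)
  finally have 1: "(\<Sum>\<nu>\<in>?I. S \<nu>) = of_nat (card (?f ` N))" .
  have "(\<Sum>\<nu>\<in>?I. S \<nu>) = fiber_sum ?f N (\<lambda>x. \<Sum>\<nu>\<in>?I. \<nu> x)"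
    unfolding S by (rule fiber_sum_swap)
  also have "\<dots> = fiber_sum ?f J (\<lambda>x. \<Sum>\<nu>\<in>?I. \<nu> x)"
  proof (rule fiber_sum_mono_neutral[OF J(2)])
    show "finite (?f ` N)"
      using fin by (simp add: finite_index_def)
    show "(\<Sum>\<nu>\<in>?I. \<nu> x) = (\<Sum>\<nu>\<in>?I. \<nu> y)" if "x \<in> N" "y \<in> N" "?f x = ?f y" for x y
      using that by (intro sum.cong refl characters_mod_coset[OF _ N J])
    show "(\<Sum>\<nu>\<in>?I. \<nu> x) = 0" if x: "x \<in> N" "?f x \<notin> ?f ` J" for x
    proof (rule sum_characters[OF N x(1) J(2) sep[OF x(1)]])
      show "x \<notin> J"
        using x(2) by blast
    qed
  qed
  also have "\<dots> = fiber_sum ?f J (\<lambda>x. of_nat (card ?I))"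
  proof (rule fiber_sum_cong)
    fix x
    assume "x \<in> J"
    then have "(\<Sum>\<nu>\<in>?I. \<nu> x) = (\<Sum>\<nu>\<in>?I. 1)"
      by (intro sum.cong refl) (rule characters_modD(3))
    then show "(\<Sum>\<nu>\<in>?I. \<nu> x) = of_nat (card ?I)"
      by simp
  qed
  also have "\<dots> = (\<Sum>C\<in>{J}. of_nat (card ?I))"
  proof -
    have "?f ` J = {J}"
      using coset_join3[OF subgroup.mem_carrier[OF J(1)] J(1)] subgroup.one_closed[OF J(1)] by force
    then show ?thesis
      by (simp add: fiber_sum_def)
  qed
  finally have "(\<Sum>\<nu>\<in>?I. S \<nu>) = of_nat (card ?I)"
    by simp
  then show ?thesis
    using 1 by (metis of_nat_eq_iff)
qed

end

section \<open>Induction in stages over a finite abelian quotient\<close>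

context semitopological_group
begin

lemma smooth_twist:
  assumes \<sigma>: "smooth_rep G T N \<sigma>" and N: "subgroup N G" "openin T N" and J: "subgroup J G" "openin T J" "J \<subseteq> N"
    and \<nu>: "\<nu> \<in> characters_mod G N J"
  shows "smooth_rep G T N (twist \<sigma> \<nu>)"
  unfolding smooth_rep_iff
proof (intro conjI ballI)
  have \<sigma>l: "linear_rep G N \<sigma>"
    using \<sigma> by (simp add: smooth_rep_iff)
  show l: "linear_rep G N (twist \<sigma> \<nu>)"
    by (rule linear_rep_twist[OF \<sigma>l N(1) \<nu>])
  fix v
  assume v: "v \<in> vspace (twist \<sigma> \<nu>)"
  then have v': "v \<in> vspace \<sigma>"
    by (simp add: twist_def)
  have "{h \<in> N. act \<sigma> h v = v} \<inter> J \<subseteq> {h \<in> N. act (twist \<sigma> \<nu>) h v = v}"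
    using characters_modD(3)[OF \<nu>] by (auto simp: twist_def scaleC_one)
  moreover have "openin T ({h \<in> N. act \<sigma> h v = v} \<inter> J)"
    using stabilizer_open[OF \<sigma> N(2) v'] J(2) by (rule openin_Int)
  moreover have "subgroup ({h \<in> N. act \<sigma> h v = v} \<inter> J) G"
    using subgroup_stabilizer[OF \<sigma>l N(1) v'] J(1) by (rule subgroup_Int)
  ultimately have "openin T {h \<in> N. act (twist \<sigma> \<nu>) h v = v}"
    using openin_subgroup_mono[OF _ _ _ subgroup_stabilizer[OF l N(1) v]] by blast
  then show "openin (subtopology T N) {h \<in> N. act (twist \<sigma> \<nu>) h v = v}"
    using N(2) by (simp add: openin_open_subtopology)
qed

text \<open>As \<open>\<rho>\<close> extends to \<open>\<sigma>\<close>, inducing it to \<open>N\<close> gives \<open>\<sigma>\<close> tensored with the regular representation of \<open>N/J\<close>, the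
  sum of all twists of \<open>\<sigma>\<close>. On functions on \<open>G\<close>, the summand of \<open>\<nu>\<close> is embedded by \<open>f\<close>, and the
  projection to it averages over \<open>N/J\<close> against \<open>\<nu>\<close>; the projections add up to the identity by orthogonality of
  characters.\<close>

lemma hecke_algebra_decomposition:
  fixes \<sigma> :: "('a, 'w::complex_vector_space) repn" and \<rho> :: "('a, 'v::complex_vector_space) repn"
  assumes N: "subgroup N G" "openin T N" and J: "subgroup J G" "openin T J" "J \<subseteq> N"
    and normal: "\<And>n j. n \<in> N \<Longrightarrow> j \<in> J \<Longrightarrow> n \<otimes> j \<otimes> inv n \<in> J" and fin: "finite_index J N"
    and sep: "\<And>x. x \<in> N \<Longrightarrow> x \<notin> J \<Longrightarrow> \<exists>\<mu>\<in>characters_mod G N J. \<mu> x \<noteq> 1"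
    and \<sigma>: "linear_rep G N \<sigma>" and \<rho>: "linear_rep G J \<rho>" and iso: "rep_iso J \<sigma> \<rho>"
    and orth: "\<And>\<nu> \<nu>' F. \<nu> \<in> characters_mod G N J \<Longrightarrow> \<nu>' \<in> characters_mod G N J \<Longrightarrow> \<nu> \<noteq> \<nu>' \<Longrightarrow>
      F \<in> intertwiners (carrier G) (compact_induction G T N (twist \<sigma> \<nu>)) (compact_induction G T N (twist \<sigma> \<nu>')) \<Longrightarrow>
      F = 0"
  shows "algebra_isomorphic (hecke_algebra G T J \<rho>)
           (direct_sum_algebra (characters_mod G N J) (\<lambda>\<nu>. hecke_algebra G T N (twist \<sigma> \<nu>)))"
proof -
  let ?I = "characters_mod G N J" and ?c = "\<lambda>x. x <# J"
  define P where "P = compact_induction G T J \<rho>"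
  define Q where "Q \<nu> = compact_induction G T N (twist \<sigma> \<nu>)" for \<nu>
  have NG: "n \<in> carrier G" if "n \<in> N" for n
    by (rule subgroup.mem_carrier[OF N(1) that])
  have JN: "j \<in> N" if "j \<in> J" for j
    using that J(3) by blast
  have Ninv: "inv n \<in> N" if "n \<in> N" for n
    by (rule subgroup.m_inv_closed[OF N(1) that])
  have Nm: "m \<otimes> n \<in> N" if "m \<in> N" "n \<in> N" for m n
    by (rule subgroup.m_closed[OF N(1) that])
  note \<sigma>V = linear_repD(3)[OF \<sigma>] and \<sigma>lin = linear_mapsD(2,3)[OF linear_repD(2)[OF \<sigma>]] and \<sigma>s = linear_repD(1)[OF \<sigma>]
  have tw: "linear_rep G N (twist \<sigma> \<nu>)" if "\<nu> \<in> ?I" for \<nu>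
    by (rule linear_rep_twist[OF \<sigma> N(1) that])
  have Prep: "linear_rep G (carrier G) P"
    unfolding P_def by (rule ind_linear_rep[OF J(1,2) \<rho>])
  have Qrep: "linear_rep G (carrier G) (Q \<nu>)" if "\<nu> \<in> ?I" for \<nu>
    unfolding Q_def by (rule ind_linear_rep[OF N tw[OF that]])
  note PD = indD[OF J(1,2), of _ \<rho>, folded P_def]
  note Pact = ind_act_apply[of _ J \<rho>, folded P_def] ind_act_outside[of _ J \<rho>, folded P_def]
  have QD: "\<phi> x \<in> vspace \<sigma>" "n \<in> N \<Longrightarrow> \<phi> (n \<otimes> x) = \<nu> n *\<^sub>C act \<sigma> n (\<phi> x)"
    "\<exists>K. subgroup K G \<and> openin T K \<and> (\<forall>x\<in>carrier G. \<forall>k\<in>K. \<phi> (x \<otimes> k) = \<phi> x)"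
    "finite ((\<lambda>x. N #> x) ` {x \<in> carrier G. \<phi> x \<noteq> 0})"
    if "\<phi> \<in> vspace (Q \<nu>)" "x \<in> carrier G" for \<phi> \<nu> x n
    using indD[OF N that(1)[unfolded Q_def]] that(2) by (simp_all add: twist_def)
  have Q0: "\<phi> x = 0" if "\<phi> \<in> vspace (Q \<nu>)" "x \<notin> carrier G" for \<phi> \<nu> x
    by (rule indD(1)[OF N that(1)[unfolded Q_def] that(2)])
  note Qact = ind_act_apply[of _ N "twist \<sigma> \<nu>" for \<nu>, folded Q_def] ind_act_outside[of _ N "twist \<sigma> \<nu>" for \<nu>, folded Q_def]

  obtain f where f: "f \<in> intertwiners J \<sigma> \<rho>" "bij_betw f (vspace \<sigma>) (vspace \<rho>)"
    using iso unfolding rep_iso_def by blast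
  define f' where "f' w = (if w \<in> vspace \<rho> then the_inv_into (vspace \<sigma>) f w else 0)" for w
  note fV = intertwinersD(4)[OF f(1)] and flin = linear_mapsD(2,3)[OF intertwinersD(1)[OF f(1)]]
    and fJ = intertwinersD(3)[OF f(1)]
  have f0: "f 0 = 0"
    by (rule linear_maps_0[OF intertwinersD(1)[OF f(1)] \<sigma>s])
  have f'f: "f' (f v) = v" if "v \<in> vspace \<sigma>" for v
    unfolding f'_def if_P[OF fV[OF that]]
    using f(2) that by (intro the_inv_into_f_f) (simp_all add: bij_betw_def)
  have ff': "f (f' w) = w" "f' w \<in> vspace \<sigma>" if "w \<in> vspace \<rho>" for w
  proof -
    have "w \<in> f ` vspace \<sigma>"
      using that f(2) by (simp add: bij_betw_def)
    then obtain v where "w = f v" "v \<in> vspace \<sigma>"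
      by (rule imageE)
    then show "f (f' w) = w" "f' w \<in> vspace \<sigma>"
      using f'f by simp_all
  qed
  have f'add: "f' (v + w) = f' v + f' w" if "v \<in> vspace \<rho>" "w \<in> vspace \<rho>" for v w
  proof -
    have "f (f' v + f' w) = v + w"
      using flin(1)[OF ff'(2)[OF that(1)] ff'(2)[OF that(2)]] ff'(1)[OF that(1)] ff'(1)[OF that(2)] by simp
    then show ?thesis
      using f'f[OF cvs.subspace_add[OF \<sigma>s ff'(2)[OF that(1)] ff'(2)[OF that(2)]]] by simp
  qed
  have f'scale: "f' (c *\<^sub>C v) = c *\<^sub>C f' v" if "v \<in> vspace \<rho>" for c v
    using f'f[OF cvs.subspace_scale[OF \<sigma>s ff'(2)[OF that]], of c] flin(2)[OF ff'(2)[OF that], of c] ff'(1)[OF that]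
    by simp
  have f'J: "f' (act \<rho> j w) = act \<sigma> j (f' w)" if "j \<in> J" "w \<in> vspace \<rho>" for j w
    using f'f[OF \<sigma>V[OF JN[OF that(1)] ff'(2)[OF that(2)]]] fJ[OF that(1) ff'(2)[OF that(2)]] ff'(1)[OF that(2)]
    by simp
  have f'0: "f' 0 = 0"
    using f'f[OF cvs.subspace_0[OF \<sigma>s]] by (simp only: f0)

  have coset: "x <# J = y <# J \<longleftrightarrow> inv x \<otimes> y \<in> J" if "x \<in> N" "y \<in> N" for x y
    using l_coset_eq_iff[OF J(1)] NG that by simp
  define m where "m = card (?c ` N)"
  have m: "m \<noteq> 0" "card ?I = m"
    using fin subgroup.one_closed[OF N(1)] card_characters_mod[OF N(1) J(1,3) fin sep]
    unfolding m_def finite_index_def by auto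
  define inc where "inc \<nu> \<phi> = (if \<phi> \<in> vspace (Q \<nu>) then (\<lambda>x. f (\<phi> x)) else 0)" for \<nu> \<phi>
  define q where "q \<nu> \<phi> x n = \<nu> n *\<^sub>C act \<sigma> n (f' (\<phi> (inv n \<otimes> x)))" for \<nu> :: "'a \<Rightarrow> complex" and \<phi> x n
  define pr where "pr \<nu> \<phi> = (if \<phi> \<in> vspace P
      then (\<lambda>x. if x \<in> carrier G then inverse (of_nat m) *\<^sub>C fiber_sum ?c N (q \<nu> \<phi> x) else 0) else 0)" for \<nu> \<phi>
  have qV: "q \<nu> \<phi> x n \<in> vspace \<sigma>" if "\<phi> \<in> vspace P" "x \<in> carrier G" "n \<in> N" for \<nu> \<phi> x n
    unfolding q_def using that ff'(2) PD(2)[OF that(1)] NG \<sigma>V by (simp add: cvs.subspace_scale[OF \<sigma>s])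
  have fsV: "fiber_sum ?c N (q \<nu> \<phi> x) \<in> vspace \<sigma>" if "\<phi> \<in> vspace P" "x \<in> carrier G" for \<nu> \<phi> x
    by (rule fiber_sum_in[OF \<sigma>s qV[OF that]])
  have qinv: "q \<nu> \<phi> x n = q \<nu> \<phi> x n'"
    if \<nu>: "\<nu> \<in> ?I" and \<phi>: "\<phi> \<in> vspace P" and x: "x \<in> carrier G" and n: "n \<in> N" "n' \<in> N" "n <# J = n' <# J"
    for \<nu> \<phi> x n n'
  proof -
    define j where "j = inv n \<otimes> n'"
    have j: "j \<in> J" "inv j \<in> J"
      using n coset subgroup.m_inv_closed[OF J(1)] unfolding j_def by simp_all
    have n': "n' = n \<otimes> j"
      unfolding j_def using n NG by (simp add: mult_inv_cancel)
    have G: "n \<in> carrier G" "j \<in> carrier G"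
      using n j NG JN by simp_all
    define w where "w = f' (\<phi> (inv n \<otimes> x))"
    have wV: "\<phi> (inv n \<otimes> x) \<in> vspace \<rho>" "w \<in> vspace \<sigma>"
      unfolding w_def using PD(2)[OF \<phi>] x G ff'(2) by simp_all
    have "\<phi> (inv n' \<otimes> x) = act \<rho> (inv j) (\<phi> (inv n \<otimes> x))"
      unfolding n' using PD(3)[OF \<phi> j(2), of "inv n \<otimes> x"] x G by (simp add: inv_mult_group m_assoc)
    then have "q \<nu> \<phi> x n' = \<nu> n' *\<^sub>C act \<sigma> (n \<otimes> j) (act \<sigma> (inv j) w)"
      unfolding q_def w_def using f'J[OF j(2) wV(1)] by (simp add: n')
    also have "act \<sigma> (n \<otimes> j) (act \<sigma> (inv j) w) = act \<sigma> n w"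
      using n(1) JN[OF j(1)] JN[OF j(2)] wV(2) \<sigma>V
      by (simp add: linear_repD(5)[OF \<sigma>] linear_rep_inverse(2)[OF \<sigma> N(1)])
    also have "\<nu> n' = \<nu> n"
      using characters_mod_coset[OF \<nu> N(1) J(1,3) n] by simp
    finally show ?thesis
      by (simp add: q_def w_def)
  qed
  have inc_app: "inc \<nu> \<phi> x = f (\<phi> x)" if "\<phi> \<in> vspace (Q \<nu>)" for \<nu> \<phi> x
    using that by (simp add: inc_def)
  have pr_app: "pr \<nu> \<phi> x = inverse (of_nat m) *\<^sub>C fiber_sum ?c N (q \<nu> \<phi> x)"
    if "\<phi> \<in> vspace P" "x \<in> carrier G" for \<nu> \<phi> x
    using that by (simp add: pr_def)
  have pr_out: "pr \<nu> \<phi> x = 0" if "x \<notin> carrier G" for \<nu> \<phi> x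
    using that by (simp add: pr_def)

  have incP: "inc \<nu> \<phi> \<in> vspace P" if \<nu>: "\<nu> \<in> ?I" and \<phi>: "\<phi> \<in> vspace (Q \<nu>)" for \<nu> \<phi>
    unfolding P_def ind_iff[OF J(1,2)]
  proof (intro conjI allI impI ballI)
    show "inc \<nu> \<phi> x = 0" if "x \<notin> carrier G" for x
      using that Q0[OF \<phi>] f0 by (simp add: inc_app[OF \<phi>])
    show "inc \<nu> \<phi> x \<in> vspace \<rho>" if "x \<in> carrier G" for x
      unfolding inc_app[OF \<phi>] by (rule fV[OF QD(1)[OF \<phi> that]])
    show "inc \<nu> \<phi> (j \<otimes> x) = act \<rho> j (inc \<nu> \<phi> x)" if "j \<in> J" "x \<in> carrier G" for j x
      using QD(2)[OF \<phi> that(2) JN[OF that(1)]] fJ[OF that(1) QD(1)[OF \<phi> that(2)]] characters_modD(3)[OF \<nu> that(1)]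
      by (simp add: inc_app[OF \<phi>] scaleC_one)
    obtain K where "subgroup K G \<and> openin T K \<and> (\<forall>x\<in>carrier G. \<forall>k\<in>K. \<phi> (x \<otimes> k) = \<phi> x)"
      using QD(3)[OF \<phi> one_closed] by (rule exE)
    then show "\<exists>K. subgroup K G \<and> openin T K \<and> (\<forall>x\<in>carrier G. \<forall>k\<in>K. inc \<nu> \<phi> (x \<otimes> k) = inc \<nu> \<phi> x)"
      by (intro exI[of _ K]) (simp add: inc_app[OF \<phi>])
    let ?S = "{x \<in> carrier G. \<phi> x \<noteq> 0}"
    define rep where "rep C = (SOME x. x \<in> ?S \<and> N #> x = C)" for C
    define nrep where "nrep D = (SOME n. n \<in> N \<and> ?c n = D)" for D
    have "(\<lambda>x. J #> x) ` ?S \<subseteq> (\<lambda>(C, D). J #> (nrep D \<otimes> rep C)) ` ((\<lambda>x. N #> x) ` ?S \<times> ?c ` N)"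
    proof
      fix B
      assume "B \<in> (\<lambda>x. J #> x) ` ?S"
      then obtain x where x: "x \<in> ?S" "B = J #> x"
        by blast
      have C: "N #> x \<in> (\<lambda>x. N #> x) ` ?S"
        using x(1) by blast
      define y where "y = rep (N #> x)"
      have y: "y \<in> ?S" "N #> y = N #> x"
        unfolding y_def rep_def using fiber_sum_choice[OF C] by blast+
      have G: "x \<in> carrier G" "y \<in> carrier G"
        using x y by simp_all
      define n where "n = x \<otimes> inv y"
      have n: "n \<in> N"
        unfolding n_def using y(2) r_coset_eq_iff[OF N(1) G(2,1)] by simp
      have xn: "x = n \<otimes> y"
        unfolding n_def using G by (simp add: m_assoc)
      have D: "?c n \<in> ?c ` N"
        using n by blast
      define k where "k = nrep (?c n)"
      have k: "k \<in> N" "k <# J = n <# J"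
        unfolding k_def nrep_def using fiber_sum_choice[OF D] by blast+
      have "inv n \<otimes> k \<in> J"
        using coset[OF n k(1)] k(2) by simp
      then have "n \<otimes> (inv n \<otimes> k) \<otimes> inv n \<in> J"
        using normal n by simp
      then have "k \<otimes> inv n \<in> J"
        using n k NG by (simp add: mult_inv_cancel)
      moreover have "(k \<otimes> y) \<otimes> inv x = k \<otimes> inv n"
        unfolding xn using n k NG G by (simp add: inv_mult_group m_assoc mult_inv_cancel)
      ultimately have "J #> x = J #> (k \<otimes> y)"
        using G k NG r_coset_eq_iff[OF J(1)] by simp
      then show "B \<in> (\<lambda>(C, D). J #> (nrep D \<otimes> rep C)) ` ((\<lambda>x. N #> x) ` ?S \<times> ?c ` N)"
        unfolding x(2) k_def y_def using C D by (intro image_eqI[where x = "(N #> x, ?c n)"]) simp_all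
    qed
    moreover have "finite ((\<lambda>x. N #> x) ` ?S \<times> ?c ` N)"
      using QD(4)[OF \<phi> one_closed] fin unfolding finite_index_def by (rule finite_cartesian_product)
    ultimately have "finite ((\<lambda>x. J #> x) ` ?S)"
      by (rule finite_subset[OF _ finite_imageI])
    then show "finite ((\<lambda>x. J #> x) ` {x \<in> carrier G. inc \<nu> \<phi> x \<noteq> 0})"
      by (rule finite_subset[rotated]) (auto simp: inc_app[OF \<phi>] f0)
  qed
  have prQ: "pr \<nu> \<phi> \<in> vspace (Q \<nu>)" if \<nu>: "\<nu> \<in> ?I" and \<phi>: "\<phi> \<in> vspace P" for \<nu> \<phi>
    unfolding Q_def ind_iff[OF N]
  proof (intro conjI allI impI ballI)
    show "pr \<nu> \<phi> x = 0" if "x \<notin> carrier G" for x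
      by (rule pr_out[OF that])
    show "pr \<nu> \<phi> x \<in> vspace (twist \<sigma> \<nu>)" if "x \<in> carrier G" for x
      using fsV[OF \<phi> that] by (simp add: pr_app[OF \<phi> that] twist_def cvs.subspace_scale[OF \<sigma>s])
    show "pr \<nu> \<phi> (h \<otimes> x) = act (twist \<sigma> \<nu>) h (pr \<nu> \<phi> x)" if h: "h \<in> N" and x: "x \<in> carrier G" for h x
    proof -
      have hx: "h \<otimes> x \<in> carrier G"
        using h x NG by simp
      have "fiber_sum ?c N (q \<nu> \<phi> (h \<otimes> x)) = fiber_sum ?c N (\<lambda>n. q \<nu> \<phi> (h \<otimes> x) (h \<otimes> n))"
        by (rule coset_sum_left_translate[OF N(1) J(1) h qinv[OF \<nu> \<phi> hx]])
      also have "\<dots> = fiber_sum ?c N (\<lambda>n. \<nu> h *\<^sub>C act \<sigma> h (q \<nu> \<phi> x n))"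
      proof (rule fiber_sum_cong)
        fix n
        assume n: "n \<in> N"
        have "inv (h \<otimes> n) \<otimes> (h \<otimes> x) = inv n \<otimes> x"
          using n h x NG by (simp add: inv_mult_group m_assoc mult_inv_cancel)
        moreover have "f' (\<phi> (inv n \<otimes> x)) \<in> vspace \<sigma>"
          using n x NG PD(2)[OF \<phi>] ff'(2) by simp
        ultimately show "q \<nu> \<phi> (h \<otimes> x) (h \<otimes> n) = \<nu> h *\<^sub>C act \<sigma> h (q \<nu> \<phi> x n)"
          unfolding q_def using n h characters_modD(2)[OF \<nu>]
          by (simp add: linear_repD(5)[OF \<sigma>] \<sigma>V \<sigma>lin scaleC_scaleC)
      qed
      also have "\<dots> = \<nu> h *\<^sub>C act \<sigma> h (fiber_sum ?c N (q \<nu> \<phi> x))"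
        by (simp add: fiber_sum_scale linear_maps_fiber_sum[OF linear_repD(2)[OF \<sigma> h] \<sigma>s qV[OF \<phi> x]])
      finally show ?thesis
        using fsV[OF \<phi> x] h by (simp add: pr_app[OF \<phi>] x hx twist_def \<sigma>lin scaleC_scaleC mult.commute)
    qed
    obtain K where K: "subgroup K G \<and> openin T K \<and> (\<forall>x\<in>carrier G. \<forall>k\<in>K. \<phi> (x \<otimes> k) = \<phi> x)"
      using PD(4)[OF \<phi>] by (rule exE)
    have "pr \<nu> \<phi> (x \<otimes> k) = pr \<nu> \<phi> x" if x: "x \<in> carrier G" and k: "k \<in> K" for x k
    proof -
      have kG: "k \<in> carrier G"
        by (rule subgroup.mem_carrier[OF conjunct1[OF K] k])
      have "fiber_sum ?c N (q \<nu> \<phi> (x \<otimes> k)) = fiber_sum ?c N (q \<nu> \<phi> x)"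
      proof (rule fiber_sum_cong)
        fix n
        assume n: "n \<in> N"
        have "\<phi> ((inv n \<otimes> x) \<otimes> k) = \<phi> (inv n \<otimes> x)"
          using K k x NG[OF n] by simp
        then show "q \<nu> \<phi> (x \<otimes> k) n = q \<nu> \<phi> x n"
          using x kG NG[OF n] by (simp add: q_def m_assoc)
      qed
      then show ?thesis
        using x kG by (simp add: pr_app[OF \<phi>])
    qed
    then show "\<exists>K. subgroup K G \<and> openin T K \<and> (\<forall>x\<in>carrier G. \<forall>k\<in>K. pr \<nu> \<phi> (x \<otimes> k) = pr \<nu> \<phi> x)"
      using K by (intro exI[of _ K]) simp
    let ?S = "{x \<in> carrier G. \<phi> x \<noteq> 0}"
    have "(\<lambda>x. N #> x) ` {x \<in> carrier G. pr \<nu> \<phi> x \<noteq> 0} \<subseteq> (\<lambda>x. N #> x) ` ?S"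
    proof
      fix C
      assume "C \<in> (\<lambda>x. N #> x) ` {x \<in> carrier G. pr \<nu> \<phi> x \<noteq> 0}"
      then obtain x where x: "x \<in> carrier G" "pr \<nu> \<phi> x \<noteq> 0" "C = N #> x"
        by blast
      have "\<exists>n\<in>N. \<phi> (inv n \<otimes> x) \<noteq> 0"
      proof (rule ccontr)
        assume no: "\<not> (\<exists>n\<in>N. \<phi> (inv n \<otimes> x) \<noteq> 0)"
        have "fiber_sum ?c N (q \<nu> \<phi> x) = fiber_sum ?c N (\<lambda>n. 0)"
        proof (rule fiber_sum_cong)
          fix n
          assume n: "n \<in> N"
          show "q \<nu> \<phi> x n = 0"
            using no n f'0 linear_maps_0[OF linear_repD(2)[OF \<sigma> n] \<sigma>s] by (simp add: q_def)
        qed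
        then show False
          using x by (simp add: pr_app[OF \<phi>] fiber_sum_def)
      qed
      then obtain n where n: "n \<in> N" "\<phi> (inv n \<otimes> x) \<noteq> 0"
        by blast
      have "N #> x = N #> (inv n \<otimes> x)"
        using n(1) x(1) NG Ninv by (subst r_coset_eq_iff[OF N(1)]) (simp_all add: m_assoc)
      then show "C \<in> (\<lambda>x. N #> x) ` ?S"
        using n x NG by auto
    qed
    moreover have "finite ((\<lambda>x. N #> x) ` ?S)"
    proof (rule finite_image_coarser[OF PD(5)[OF \<phi>]])
      show "N #> x = N #> y" if "x \<in> ?S" "y \<in> ?S" "J #> x = J #> y" for x y
        using that r_coset_eq_iff[OF J(1), of x y] r_coset_eq_iff[OF N(1), of x y] JN by auto
    qed
    ultimately show "finite ((\<lambda>x. N #> x) ` {x \<in> carrier G. pr \<nu> \<phi> x \<noteq> 0})"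
      by (rule finite_subset)
  qed
  have inc: "inc \<nu> \<in> intertwiners (carrier G) (Q \<nu>) P" if \<nu>: "\<nu> \<in> ?I" for \<nu>
  proof (rule intertwinersI[OF linear_mapsI])
    note Qs = linear_repD(1)[OF Qrep[OF \<nu>]]
    show "inc \<nu> \<phi> \<in> vspace P" if "\<phi> \<in> vspace (Q \<nu>)" for \<phi>
      by (rule incP[OF \<nu> that])
    show "inc \<nu> (\<phi> + \<psi>) = inc \<nu> \<phi> + inc \<nu> \<psi>" if "\<phi> \<in> vspace (Q \<nu>)" "\<psi> \<in> vspace (Q \<nu>)" for \<phi> \<psi>
    proof
      fix x
      show "inc \<nu> (\<phi> + \<psi>) x = (inc \<nu> \<phi> + inc \<nu> \<psi>) x"
        using that cvs.subspace_add[OF Qs that] QD(1)[OF that(1), of x] QD(1)[OF that(2), of x]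
          Q0[OF that(1), of x] Q0[OF that(2), of x]
        by (cases "x \<in> carrier G") (simp_all add: inc_app flin f0)
    qed
    show "inc \<nu> (c *\<^sub>C \<phi>) = c *\<^sub>C inc \<nu> \<phi>" if "\<phi> \<in> vspace (Q \<nu>)" for c \<phi>
    proof
      fix x
      show "inc \<nu> (c *\<^sub>C \<phi>) x = (c *\<^sub>C inc \<nu> \<phi>) x"
        using that cvs.subspace_scale[OF Qs that] QD(1)[OF that, of x] Q0[OF that, of x]
        by (cases "x \<in> carrier G") (simp_all add: inc_app flin f0 scaleC_fun_def)
    qed
    show "inc \<nu> (act (Q \<nu>) g \<phi>) = act P g (inc \<nu> \<phi>)" if "g \<in> carrier G" "\<phi> \<in> vspace (Q \<nu>)" for g \<phi>
    proof
      fix x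
      show "inc \<nu> (act (Q \<nu>) g \<phi>) x = act P g (inc \<nu> \<phi>) x"
        using that linear_repD(3)[OF Qrep[OF \<nu>] that] by (cases "x \<in> carrier G") (simp_all add: inc_app Qact Pact f0)
    qed
  qed (simp add: inc_def)
  have pr: "pr \<nu> \<in> intertwiners (carrier G) P (Q \<nu>)" if \<nu>: "\<nu> \<in> ?I" for \<nu>
  proof (rule intertwinersI[OF linear_mapsI])
    note Ps = linear_repD(1)[OF Prep]
    show "pr \<nu> \<phi> \<in> vspace (Q \<nu>)" if "\<phi> \<in> vspace P" for \<phi>
      by (rule prQ[OF \<nu> that])
    show "pr \<nu> (\<phi> + \<psi>) = pr \<nu> \<phi> + pr \<nu> \<psi>" if \<phi>: "\<phi> \<in> vspace P" and \<psi>: "\<psi> \<in> vspace P" for \<phi> \<psi>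
    proof
      fix x
      have "fiber_sum ?c N (q \<nu> (\<phi> + \<psi>) x) = fiber_sum ?c N (\<lambda>n. q \<nu> \<phi> x n + q \<nu> \<psi> x n)" if x: "x \<in> carrier G"
      proof (rule fiber_sum_cong)
        fix n
        assume n: "n \<in> N"
        have "inv n \<otimes> x \<in> carrier G"
          using n x NG by simp
        then show "q \<nu> (\<phi> + \<psi>) x n = q \<nu> \<phi> x n + q \<nu> \<psi> x n"
          unfolding q_def using n PD(2)[OF \<phi>] PD(2)[OF \<psi>] ff'(2) by (simp add: f'add \<sigma>lin scaleC_add_right)
      qed
      then show "pr \<nu> (\<phi> + \<psi>) x = (pr \<nu> \<phi> + pr \<nu> \<psi>) x"
        using \<phi> \<psi> cvs.subspace_add[OF Ps \<phi> \<psi>]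
        by (cases "x \<in> carrier G") (simp_all add: pr_app pr_out fiber_sum_add scaleC_add_right)
    qed
    show "pr \<nu> (c *\<^sub>C \<phi>) = c *\<^sub>C pr \<nu> \<phi>" if \<phi>: "\<phi> \<in> vspace P" for c \<phi>
    proof
      fix x
      have "fiber_sum ?c N (q \<nu> (c *\<^sub>C \<phi>) x) = fiber_sum ?c N (\<lambda>n. c *\<^sub>C q \<nu> \<phi> x n)" if x: "x \<in> carrier G"
      proof (rule fiber_sum_cong)
        fix n
        assume n: "n \<in> N"
        have "inv n \<otimes> x \<in> carrier G"
          using n x NG by simp
        then show "q \<nu> (c *\<^sub>C \<phi>) x n = c *\<^sub>C q \<nu> \<phi> x n"
          unfolding q_def using n PD(2)[OF \<phi>] ff'(2)
          by (simp add: f'scale \<sigma>lin scaleC_scaleC scaleC_fun_def mult.commute)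
      qed
      then show "pr \<nu> (c *\<^sub>C \<phi>) x = (c *\<^sub>C pr \<nu> \<phi>) x"
        using \<phi> cvs.subspace_scale[OF Ps \<phi>]
        by (cases "x \<in> carrier G") (simp_all add: pr_app pr_out fiber_sum_scale scaleC_scaleC scaleC_fun_def mult.commute)
    qed
    show "pr \<nu> (act P g \<phi>) = act (Q \<nu>) g (pr \<nu> \<phi>)" if g: "g \<in> carrier G" and \<phi>: "\<phi> \<in> vspace P" for g \<phi>
    proof
      fix x
      have "fiber_sum ?c N (q \<nu> (act P g \<phi>) x) = fiber_sum ?c N (q \<nu> \<phi> (x \<otimes> g))" if x: "x \<in> carrier G"
        by (rule fiber_sum_cong) (use x g NG in \<open>simp add: q_def Pact m_assoc\<close>)
      then show "pr \<nu> (act P g \<phi>) x = act (Q \<nu>) g (pr \<nu> \<phi>) x"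
        using \<phi> g linear_repD(3)[OF Prep g \<phi>] by (cases "x \<in> carrier G") (simp_all add: pr_app pr_out Qact)
    qed
  qed (simp add: pr_def)
  have pr_inc: "pr \<nu> (inc \<nu> \<phi>) = \<phi>" if \<nu>: "\<nu> \<in> ?I" and \<phi>: "\<phi> \<in> vspace (Q \<nu>)" for \<nu> \<phi>
  proof
    fix x
    show "pr \<nu> (inc \<nu> \<phi>) x = \<phi> x"
    proof (cases "x \<in> carrier G")
      case True
      have "fiber_sum ?c N (q \<nu> (inc \<nu> \<phi>) x) = fiber_sum ?c N (\<lambda>n. \<phi> x)"
      proof (rule fiber_sum_cong)
        fix n
        assume n: "n \<in> N"
        have nx: "inv n \<otimes> x \<in> carrier G"
          using n NG True by simp
        have "q \<nu> (inc \<nu> \<phi>) x n = \<nu> n *\<^sub>C act \<sigma> n (\<phi> (inv n \<otimes> x))"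
          unfolding q_def inc_app[OF \<phi>] f'f[OF QD(1)[OF \<phi> nx]] ..
        also have "\<dots> = \<phi> (n \<otimes> (inv n \<otimes> x))"
          by (rule QD(2)[OF \<phi> nx n, symmetric])
        finally show "q \<nu> (inc \<nu> \<phi>) x n = \<phi> x"
          using n NG True by (simp add: mult_inv_cancel)
      qed
      then show ?thesis
        using m(1) True by (simp add: pr_app[OF incP[OF \<nu> \<phi>]] fiber_sum_const m_def[symmetric] scaleC_scaleC scaleC_one)
    qed (simp add: pr_out Q0[OF \<phi>])
  qed
  have total: "(\<Sum>\<nu>\<in>?I. inc \<nu> (pr \<nu> \<phi>)) = \<phi>" if \<phi>: "\<phi> \<in> vspace P" for \<phi>
  proof
    fix x
    show "(\<Sum>\<nu>\<in>?I. inc \<nu> (pr \<nu> \<phi>)) x = \<phi> x"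
    proof (cases "x \<in> carrier G")
      case True
      note prV = cvs.subspace_scale[OF \<sigma>s fsV[OF \<phi> True]]
      define q0 where "q0 n = (if n \<in> J then of_nat m *\<^sub>C f' (\<phi> x) else 0)" for n
      have qsum: "(\<Sum>\<nu>\<in>?I. q \<nu> \<phi> x n) = q0 n" if n: "n \<in> N" for n
      proof -
        have "(\<Sum>\<nu>\<in>?I. q \<nu> \<phi> x n) = (\<Sum>\<nu>\<in>?I. \<nu> n) *\<^sub>C act \<sigma> n (f' (\<phi> (inv n \<otimes> x)))"
          unfolding q_def by (rule cvs.scale_sum_left[symmetric])
        also have "\<dots> = q0 n"
        proof (cases "n \<in> J")
          case True
          have "(\<Sum>\<nu>\<in>?I. \<nu> n) = (\<Sum>\<nu>\<in>?I. 1)"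
            by (intro sum.cong refl) (rule characters_modD(3)[OF _ True])
          moreover have "f' (\<phi> (inv n \<otimes> x)) = act \<sigma> (inv n) (f' (\<phi> x))"
            using PD(2,3)[OF \<phi>] f'J subgroup.m_inv_closed[OF J(1) True] \<open>x \<in> carrier G\<close> by simp
          moreover have "act \<sigma> n (act \<sigma> (inv n) (f' (\<phi> x))) = f' (\<phi> x)"
            using PD(2)[OF \<phi>] ff'(2) \<open>x \<in> carrier G\<close> by (intro linear_rep_inverse(2)[OF \<sigma> N(1) n]) simp
          ultimately show ?thesis
            using True m(2) by (simp add: q0_def)
        next
          case False
          have "(\<Sum>\<nu>\<in>?I. \<nu> n) = 0"
            by (rule sum_characters[OF N(1) n J(3) sep[OF n False]])
          then show ?thesis
            using False by (simp add: q0_def)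
        qed
        finally show ?thesis .
      qed
      have "(\<Sum>\<nu>\<in>?I. inc \<nu> (pr \<nu> \<phi>)) x = (\<Sum>\<nu>\<in>?I. f (inverse (of_nat m) *\<^sub>C fiber_sum ?c N (q \<nu> \<phi> x)))"
        unfolding sum_fun_apply by (intro sum.cong refl) (simp add: inc_app prQ \<phi> pr_app[OF \<phi> True])
      also have "\<dots> = f (\<Sum>\<nu>\<in>?I. inverse (of_nat m) *\<^sub>C fiber_sum ?c N (q \<nu> \<phi> x))"
        by (rule linear_maps_sum[OF intertwinersD(1)[OF f(1)] \<sigma>s prV, symmetric])
      also have "(\<Sum>\<nu>\<in>?I. inverse (of_nat m) *\<^sub>C fiber_sum ?c N (q \<nu> \<phi> x)) =
          inverse (of_nat m) *\<^sub>C fiber_sum ?c N (\<lambda>n. \<Sum>\<nu>\<in>?I. q \<nu> \<phi> x n)"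
        by (simp add: cvs.scale_sum_right[symmetric] fiber_sum_swap)
      also have "fiber_sum ?c N (\<lambda>n. \<Sum>\<nu>\<in>?I. q \<nu> \<phi> x n) = fiber_sum ?c N q0"
        by (rule fiber_sum_cong[OF qsum])
      also have "\<dots> = fiber_sum ?c J q0"
      proof (rule fiber_sum_mono_neutral[OF J(3)])
        show "finite (?c ` N)"
          using fin by (simp add: finite_index_def)
        show "q0 n = q0 n'" if n: "n \<in> N" "n' \<in> N" "?c n = ?c n'" for n n'
        proof -
          have j: "inv n \<otimes> n' \<in> J"
            using coset n by simp
          have eq: "n \<otimes> (inv n \<otimes> n') = n'"
            using n NG by (simp add: mult_inv_cancel)
          have eq': "n' \<otimes> inv (inv n \<otimes> n') = n"
            using n NG by (simp add: inv_mult_group mult_inv_cancel)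
          have "n' \<in> J" if "n \<in> J"
            using subgroup.m_closed[OF J(1) that j] by (simp only: eq)
          moreover have "n \<in> J" if "n' \<in> J"
            using subgroup.m_closed[OF J(1) that subgroup.m_inv_closed[OF J(1) j]] by (simp only: eq')
          ultimately have "n \<in> J \<longleftrightarrow> n' \<in> J"
            by blast
          then show ?thesis
            by (simp add: q0_def)
        qed
        show "q0 n = 0" if "n \<in> N" "?c n \<notin> ?c ` J" for n
          using that by (auto simp: q0_def)
      qed
      also have "\<dots> = fiber_sum ?c J (\<lambda>n. of_nat m *\<^sub>C f' (\<phi> x))"
        by (rule fiber_sum_cong) (simp add: q0_def)
      also have "\<dots> = of_nat m *\<^sub>C f' (\<phi> x)"
      proof -
        have "?c ` J = {J}"
          using coset_join3[OF subgroup.mem_carrier[OF J(1)] J(1)] subgroup.one_closed[OF J(1)] by force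
        then show ?thesis
          by (simp add: fiber_sum_const scaleC_one)
      qed
      also have "inverse (of_nat m) *\<^sub>C of_nat m *\<^sub>C f' (\<phi> x) = f' (\<phi> x)"
        using m(1) by (simp add: scaleC_scaleC scaleC_one)
      also have "f (f' (\<phi> x)) = \<phi> x"
        by (rule ff'(1)[OF PD(2)[OF \<phi> True]])
      finally show ?thesis .
    next
      case False
      have "(\<Sum>\<nu>\<in>?I. inc \<nu> (pr \<nu> \<phi>)) x = (\<Sum>\<nu>\<in>?I. 0)"
        unfolding sum_fun_apply using False f0
        by (intro sum.cong refl) (simp add: inc_app prQ \<phi> pr_out)
      then show ?thesis
        using PD(1)[OF \<phi> False] by simp
    qed
  qed
  have "algebra_isomorphic (end_algebra (carrier G) P) (direct_sum_algebra ?I (\<lambda>\<nu>. end_algebra (carrier G) (Q \<nu>)))"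
  proof (rule end_algebra_decomposition[where G = G and inc = inc and pr = pr])
    show "finite ?I"
      by (rule finite_characters_mod[OF N(1) J(1,3) fin])
    show "linear_rep G (carrier G) P"
      by (rule Prep)
    show "linear_rep G (carrier G) (Q \<nu>)" "inc \<nu> \<in> intertwiners (carrier G) (Q \<nu>) P"
      "pr \<nu> \<in> intertwiners (carrier G) P (Q \<nu>)" if "\<nu> \<in> ?I" for \<nu>
      using Qrep[OF that] inc[OF that] pr[OF that] .
    show "pr \<nu> (inc \<nu> \<phi>) = \<phi>" if "\<nu> \<in> ?I" "\<phi> \<in> vspace (Q \<nu>)" for \<nu> \<phi>
      by (rule pr_inc[OF that])
    show "(\<Sum>\<nu>\<in>?I. inc \<nu> (pr \<nu> \<phi>)) = \<phi>" if "\<phi> \<in> vspace P" for \<phi>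
      by (rule total[OF that])
    show "F = 0" if "\<nu> \<in> ?I" "\<nu>' \<in> ?I" "\<nu> \<noteq> \<nu>'" "F \<in> intertwiners (carrier G) (Q \<nu>) (Q \<nu>')" for \<nu> \<nu>' F
      by (rule orth[OF that(1-3) that(4)[unfolded Q_def]])
  qed
  then show ?thesis
    unfolding hecke_algebra_def P_def Q_def .
qed

end

section \<open>Non-archimedean local fields are separable\<close>

context nonarch_local_field
begin

lemma abs_one: "absF 1 = 1"
  using mult[of 1 1] eq_0_iff[of 1] by simp

lemma abs_zero: "absF 0 = 0"
  by (simp add: eq_0_iff)

lemma abs_uminus: "absF (- x) = absF x"
proof -
  have "absF (- 1) * absF (- 1) = 1"
    using mult[of "- 1" "- 1"] abs_one by simp
  then have "absF (- 1) = 1"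
    using nonneg[of "- 1"] by (simp add: square_eq_1_iff)
  then show ?thesis
    using mult[of "- 1" x] by simp
qed

lemma abs_diff_commute: "absF (x - y) = absF (y - x)"
  using abs_uminus[of "x - y"] by simp

lemma abs_triangle: "absF (x + y) \<le> absF x + absF y"
  using ultrametric[of x y] nonneg[of x] nonneg[of y] by linarith

lemma abs_sum: "absF (\<Sum>i\<in>I. f i) \<le> (\<Sum>i\<in>I. absF (f i))"
proof (induction I rule: infinite_finite_induct)
  case (insert i I)
  then show ?case
    using abs_triangle[of "f i" "\<Sum>i\<in>I. f i"] by simp
qed (simp_all add: abs_zero)

lemma abs_power: "absF (x ^ n) = absF x ^ n"
  by (induction n) (simp_all add: abs_one mult)

lemma abs_divide: "y \<noteq> 0 \<Longrightarrow> absF (x / y) = absF x / absF y"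
  using mult[of "x / y" y] eq_0_iff[of y] by (simp add: field_simps)

definition residue_relation :: "('f \<times> 'f) set" where
  "residue_relation = {(x, y). absF x \<le> 1 \<and> absF y \<le> 1 \<and> absF (x - y) < 1}"

text \<open>The classes of 0 and 1 differ.\<close>

lemma residue_field_card: "card (residue_field absF) \<ge> 2"
proof -
  let ?c = "\<lambda>x. residue_relation `` {x}"
  have mem: "?c x \<in> residue_field absF" if "absF x \<le> 1" for x
    unfolding residue_field_def residue_relation_def[symmetric] using that by (intro quotientI) simp
  have "1 \<in> ?c 1" "1 \<notin> ?c 0"
    by (simp_all add: residue_relation_def abs_one abs_zero abs_uminus)
  then have "?c 1 \<noteq> ?c 0"
    by metis
  then have "card {?c 0, ?c 1} = 2"
    by simp
  moreover have "{?c 0, ?c 1} \<subseteq> residue_field absF"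
    using mem[of 0] mem[of 1] by (simp add: abs_one abs_zero)
  ultimately show ?thesis
    using card_mono[OF finite_residue_field] by metis
qed

lemma residue_representatives:
  obtains R where "finite R" "\<forall>x. absF x \<le> 1 \<longrightarrow> (\<exists>r\<in>R. absF (x - r) < 1)"
proof
  let ?s = "\<lambda>C. SOME r. r \<in> C"
  show "finite (?s ` residue_field absF)"
    using finite_residue_field by simp
  show "\<forall>x. absF x \<le> 1 \<longrightarrow> (\<exists>r\<in>?s ` residue_field absF. absF (x - r) < 1)"
  proof (intro allI impI)
    fix x
    assume x: "absF x \<le> 1"
    have "x \<in> residue_relation `` {x}"
      using x by (simp add: residue_relation_def abs_zero)
    then have "?s (residue_relation `` {x}) \<in> residue_relation `` {x}"
      by (rule someI)
    moreover have "absF (x - r) < 1" if "r \<in> residue_relation `` {x}" for r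
      using that by (simp add: residue_relation_def)
    ultimately have "absF (x - ?s (residue_relation `` {x})) < 1"
      by blast
    moreover have "residue_relation `` {x} \<in> residue_field absF"
      unfolding residue_field_def residue_relation_def[symmetric] using x by (intro quotientI) simp
    ultimately show "\<exists>r\<in>?s ` residue_field absF. absF (x - r) < 1"
      by blast
  qed
qed

text \<open>Digit expansions: successive approximation by representatives of the residue classes, scaled by powers of a
  uniformizer, gives finite nets of the ring of integers. Dividing by powers of the uniformizer covers the field.\<close>

lemma countable_dense:
  obtains D where "countable D" "\<forall>x e. e > 0 \<longrightarrow> (\<exists>a\<in>D. absF (x - a) < e)"
proof -
  define q where "q = real (card (residue_field absF))"
  have q: "q > 1"
    using residue_field_card by (simp add: q_def)
  obtain w where w: "absF w = 1 / q"
    using uniformizer unfolding q_def by blast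
  have w0: "w \<noteq> 0"
    using w q abs_zero by auto
  obtain R where R: "finite R" "\<forall>x. absF x \<le> 1 \<longrightarrow> (\<exists>r\<in>R. absF (x - r) < 1)"
    by (rule residue_representatives)
  have small: "absF y \<le> 1 / q" if "absF y < 1" for y
  proof (cases "y = 0")
    case True
    then show ?thesis
      using q by (simp add: abs_zero)
  next
    case False
    then obtain k :: int where k: "absF y = q powi k"
      using discrete unfolding q_def by blast
    have "k < 0"
    proof (rule ccontr)
      assume "\<not> k < 0"
      then have "q powi k \<ge> 1"
        using q by (simp add: power_int_def)
      then show False
        using k that by simp
    qed
    then have "q powi k \<le> q powi (- 1)"
      using q by (intro power_int_increasing) simp_all
    then show ?thesis
      using k by (simp add: power_int_minus field_simps)
  qed
  \<comment> \<open>The expansions with \<open>n\<close> digits.\<close>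
  define \<F> where "\<F> n = ((\<lambda>A. (\<lambda>(r, a). r + w * a) ` (R \<times> A)) ^^ n) {0}" for n :: nat
  have finF: "finite (\<F> n)" for n
    by (induction n) (simp_all add: \<F>_def R(1))
  have approx: "\<exists>a\<in>\<F> n. absF (x - a) \<le> (1 / q) ^ n" if "absF x \<le> 1" for x n
    using that
  proof (induction n arbitrary: x)
    case 0
    then show ?case
      by (simp add: \<F>_def)
  next
    case (Suc n)
    obtain r where r: "r \<in> R" "absF (x - r) < 1"
      using R(2) Suc.prems by blast
    define y where "y = (x - r) / w"
    have "absF y = q * absF (x - r)"
      by (simp add: y_def abs_divide[OF w0] w)
    also have "\<dots> \<le> q * (1 / q)"
      using small[OF r(2)] q by (intro mult_left_mono) simp_all
    finally have "absF y \<le> 1"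
      using q by simp
    then obtain a where a: "a \<in> \<F> n" "absF (y - a) \<le> (1 / q) ^ n"
      using Suc.IH by blast
    have "w * y = x - r"
      using w0 by (simp add: y_def)
    then have "x - (r + w * a) = w * (y - a)"
      by (simp add: right_diff_distrib)
    then have "absF (x - (r + w * a)) = (1 / q) * absF (y - a)"
      by (simp only: mult w)
    also have "\<dots> \<le> (1 / q) * (1 / q) ^ n"
      using a(2) q by (intro mult_left_mono) simp_all
    finally have "absF (x - (r + w * a)) \<le> (1 / q) ^ Suc n"
      by simp
    moreover have "r + w * a \<in> \<F> (Suc n)"
      using r(1) a(1) by (auto simp: \<F>_def)
    ultimately show ?case
      by blast
  qed
  define D where "D = (\<Union>m::nat. \<Union>n. (\<lambda>a. a / w ^ m) ` \<F> n)"
  show ?thesis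
  proof (rule that)
    show "countable D"
      unfolding D_def by (intro countable_UN countable_image countable_finite[OF finF] countableI_type)
    show "\<forall>x e. e > 0 \<longrightarrow> (\<exists>a\<in>D. absF (x - a) < e)"
    proof (intro allI impI)
      fix x and e :: real
      assume e: "e > 0"
      obtain m where m: "absF x < q ^ m"
        using real_arch_pow[OF q] by blast
      have "e / q ^ m > 0"
        using e q by simp
      then obtain n where n: "(1 / q) ^ n < e / q ^ m"
        using real_arch_pow_inv[of "e / q ^ m" "1 / q"] q by auto
      have "absF (w ^ m * x) \<le> 1"
        using m q by (simp add: mult abs_power w power_divide field_simps)
      then obtain a where a: "a \<in> \<F> n" "absF (w ^ m * x - a) \<le> (1 / q) ^ n"
        using approx by blast
      have "x - a / w ^ m = (w ^ m * x - a) / w ^ m"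
        using w0 by (simp add: field_simps)
      then have "absF (x - a / w ^ m) = absF (w ^ m * x - a) * q ^ m"
        using w0 q by (simp add: abs_divide abs_power w power_divide)
      also have "\<dots> \<le> (1 / q) ^ n * q ^ m"
        using a(2) q by (intro mult_right_mono) simp_all
      also have "\<dots> < e"
        using n q by (simp add: field_simps)
      finally show "\<exists>a\<in>D. absF (x - a) < e"
        using a(1) unfolding D_def by blast
    qed
  qed
qed

section \<open>The topology of matrix groups\<close>

lemma matrix_dist_le_iff:
  fixes A B :: "'f ^ 'n ^ 'n"
  shows "matrix_dist absF A B \<le> r \<longleftrightarrow> (\<forall>i j. absF (A $ i $ j - B $ i $ j) \<le> r)"
    "matrix_dist absF A B < r \<longleftrightarrow> (\<forall>i j. absF (A $ i $ j - B $ i $ j) < r)"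
  unfolding matrix_dist_def by (subst Max_le_iff Max_less_iff; auto)+

lemma matrix_dist_entry: "absF (A $ i $ j - B $ i $ j) \<le> matrix_dist absF A (B :: 'f ^ 'n ^ 'n)"
  using matrix_dist_le_iff(1)[of A B "matrix_dist absF A B"] by simp

lemma matrix_metric: "Metric_space UNIV (matrix_dist absF :: 'f ^ 'n ^ 'n \<Rightarrow> _)"
proof
  fix A B C :: "'f ^ 'n ^ 'n"
  show nn: "0 \<le> matrix_dist absF A B"
    using order_trans[OF nonneg matrix_dist_entry] .
  show "matrix_dist absF A B = matrix_dist absF B A"
    unfolding matrix_dist_def by (simp add: abs_diff_commute)
  show "matrix_dist absF A B = 0 \<longleftrightarrow> A = B"
  proof
    assume "matrix_dist absF A B = 0"
    then have "absF (A $ i $ j - B $ i $ j) = 0" for i j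
      using matrix_dist_entry[of A i j B] nonneg[of "A $ i $ j - B $ i $ j"] by simp
    then show "A = B"
      by (simp add: eq_0_iff vec_eq_iff)
  next
    assume "A = B"
    then have "matrix_dist absF A B \<le> 0"
      by (simp add: matrix_dist_le_iff(1) abs_zero)
    then show "matrix_dist absF A B = 0"
      using nn by simp
  qed
  show "matrix_dist absF A C \<le> matrix_dist absF A B + matrix_dist absF B C"
    unfolding matrix_dist_le_iff(1)
  proof (intro allI)
    fix i j
    have "absF (A $ i $ j - C $ i $ j) \<le> absF (A $ i $ j - B $ i $ j) + absF (B $ i $ j - C $ i $ j)"
      using abs_triangle[of "A $ i $ j - B $ i $ j" "B $ i $ j - C $ i $ j"] by simp
    then show "absF (A $ i $ j - C $ i $ j) \<le> matrix_dist absF A B + matrix_dist absF B C"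
      using matrix_dist_entry[of A i j B] matrix_dist_entry[of B i j C] by linarith
  qed
qed

lemma matrix_dist_mult:
  fixes A B g :: "'f ^ 'n ^ 'n"
  defines "c \<equiv> (\<Sum>i\<in>UNIV. \<Sum>j\<in>UNIV. absF (g $ i $ j))"
  shows "matrix_dist absF (g ** A) (g ** B) \<le> c * matrix_dist absF A B"
    "matrix_dist absF (A ** g) (B ** g) \<le> c * matrix_dist absF A B"
proof -
  have row: "(\<Sum>k\<in>UNIV. absF (g $ i $ k)) \<le> c" for i
    unfolding c_def by (rule member_le_sum) (simp_all add: sum_nonneg nonneg)
  have col: "(\<Sum>k\<in>UNIV. absF (g $ k $ j)) \<le> c" for j
    unfolding c_def by (intro sum_mono member_le_sum) (simp_all add: nonneg)
  have d0: "0 \<le> matrix_dist absF A B"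
    using order_trans[OF nonneg matrix_dist_entry] .
  show "matrix_dist absF (g ** A) (g ** B) \<le> c * matrix_dist absF A B"
    unfolding matrix_dist_le_iff(1)
  proof (intro allI)
    fix i j
    have "absF ((g ** A) $ i $ j - (g ** B) $ i $ j) = absF (\<Sum>k\<in>UNIV. g $ i $ k * (A $ k $ j - B $ k $ j))"
      by (simp add: matrix_matrix_mult_def right_diff_distrib sum_subtractf)
    also have "\<dots> \<le> (\<Sum>k\<in>UNIV. absF (g $ i $ k) * absF (A $ k $ j - B $ k $ j))"
      using abs_sum[of "\<lambda>k. g $ i $ k * (A $ k $ j - B $ k $ j)" UNIV] by (simp add: mult)
    also have "\<dots> \<le> (\<Sum>k\<in>UNIV. absF (g $ i $ k) * matrix_dist absF A B)"
      by (intro sum_mono mult_left_mono matrix_dist_entry nonneg)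
    also have "\<dots> \<le> c * matrix_dist absF A B"
      unfolding sum_distrib_right[symmetric] by (rule mult_right_mono[OF row d0])
    finally show "absF ((g ** A) $ i $ j - (g ** B) $ i $ j) \<le> c * matrix_dist absF A B" .
  qed
  show "matrix_dist absF (A ** g) (B ** g) \<le> c * matrix_dist absF A B"
    unfolding matrix_dist_le_iff(1)
  proof (intro allI)
    fix i j
    have "absF ((A ** g) $ i $ j - (B ** g) $ i $ j) = absF (\<Sum>k\<in>UNIV. (A $ i $ k - B $ i $ k) * g $ k $ j)"
      by (simp add: matrix_matrix_mult_def left_diff_distrib sum_subtractf)
    also have "\<dots> \<le> (\<Sum>k\<in>UNIV. absF (A $ i $ k - B $ i $ k) * absF (g $ k $ j))"
      using abs_sum[of "\<lambda>k. (A $ i $ k - B $ i $ k) * g $ k $ j" UNIV] by (simp add: mult)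
    also have "\<dots> \<le> (\<Sum>k\<in>UNIV. matrix_dist absF A B * absF (g $ k $ j))"
      by (intro sum_mono mult_right_mono matrix_dist_entry nonneg)
    also have "\<dots> \<le> matrix_dist absF A B * c"
      unfolding sum_distrib_left[symmetric] by (rule mult_left_mono[OF col d0])
    finally show "absF ((A ** g) $ i $ j - (B ** g) $ i $ j) \<le> c * matrix_dist absF A B"
      by (simp add: mult.commute)
  qed
qed

lemma openin_rational_topology:
  "openin (rational_topology absF GG) U \<longleftrightarrow> U \<subseteq> carrier (rational_points GG) \<and>
     (\<forall>A\<in>U. \<exists>r>0. \<forall>B\<in>carrier (rational_points GG). matrix_dist absF A B < r \<longrightarrow> B \<in> U)"
    (is "_ \<longleftrightarrow> U \<subseteq> ?C \<and> ?ball")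
proof -
  interpret d: Metric_space UNIV "matrix_dist absF :: 'f ^ 'n ^ 'n \<Rightarrow> _"
    by (rule matrix_metric)
  show ?thesis
  proof
    assume "openin (rational_topology absF GG) U"
    then obtain S where S: "openin d.mtopology S" "U = S \<inter> ?C"
      unfolding rational_topology_def openin_subtopology by blast
    show "U \<subseteq> ?C \<and> ?ball"
    proof (intro conjI ballI)
      show "U \<subseteq> ?C"
        using S(2) by blast
      fix A
      assume "A \<in> U"
      then obtain r where "r > 0" "d.mball A r \<subseteq> S"
        using S unfolding d.openin_mtopology by blast
      then show "\<exists>r>0. \<forall>B\<in>?C. matrix_dist absF A B < r \<longrightarrow> B \<in> U"
        using S(2) by (intro exI[of _ r]) auto
    qed
  next
    assume U: "U \<subseteq> ?C \<and> ?ball"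
    define S where "S = \<Union>{d.mball A r | A r. A \<in> U \<and> d.mball A r \<inter> ?C \<subseteq> U}"
    have "openin d.mtopology S"
      unfolding S_def by (rule openin_Union) auto
    moreover have "U \<subseteq> S"
    proof
      fix A
      assume A: "A \<in> U"
      then obtain r where r: "r > 0" "\<forall>B\<in>?C. matrix_dist absF A B < r \<longrightarrow> B \<in> U"
        using U by blast
      then have "d.mball A r \<inter> ?C \<subseteq> U" "A \<in> d.mball A r"
        by auto
      then show "A \<in> S"
        unfolding S_def using A by blast
    qed
    then have "U = S \<inter> ?C"
      using U unfolding S_def by blast
    ultimately show "openin (rational_topology absF GG) U"
      unfolding rational_topology_def openin_subtopology by blast
  qed
qed

end

section \<open>Rational points of a linear algebraic group\<close>

lemma group_general_linear: "group (general_linear :: ('k::field ^ 'n ^ 'n) monoid)"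
proof (rule groupI)
  fix A :: "'k ^ 'n ^ 'n"
  assume "A \<in> carrier general_linear"
  then have "invertible A"
    by (simp add: general_linear_def invertible_det_nz)
  then obtain B where B: "A ** B = mat 1" "B ** A = mat 1"
    unfolding invertible_def by blast
  have "det A * det B = 1"
    using B(1) det_mul[of A B] by simp
  then have "det B \<noteq> 0"
    by auto
  then show "\<exists>B\<in>carrier general_linear. B \<otimes>\<^bsub>general_linear\<^esub> A = \<one>\<^bsub>general_linear\<^esub>"
    using B(2) by (auto simp: general_linear_def)
qed (simp_all add: general_linear_def det_mul matrix_mul_assoc)

lemma base_change_mult: "base_change (A ** B) = base_change A ** base_change B"
  by (simp add: base_change_def matrix_matrix_mult_def vec_eq_iff to_ac_sum)

lemma base_change_one: "base_change (mat 1) = mat 1"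
  by (simp add: base_change_def mat_def vec_eq_iff)

lemma det_base_change: "det (base_change A) = to_ac (det A)"
  by (simp add: det_def base_change_def to_ac_sum to_ac_prod)

lemma base_change_eq_iff: "base_change A = base_change B \<longleftrightarrow> A = B"
  by (simp add: base_change_def vec_eq_iff)

lemma rational_points_simps:
  "carrier (rational_points GG) = {A. base_change A \<in> GG}"
  "A \<otimes>\<^bsub>rational_points GG\<^esub> B = A ** B" "\<one>\<^bsub>rational_points GG\<^esub> = mat 1"
  by (simp_all add: rational_points_def general_linear_def)

lemma group_rational_points:
  fixes GG :: "('f::field alg_closure ^ 'n ^ 'n) set"
  assumes GG: "subgroup GG general_linear"
  shows "group (rational_points GG)"
proof (rule groupI, unfold rational_points_simps)
  have GG': "A ** B \<in> GG" if "A \<in> GG" "B \<in> GG" for A B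
    using subgroup.m_closed[OF GG that] by (simp add: general_linear_def)
  show "A ** B \<in> {A. base_change A \<in> GG}" if "A \<in> {A. base_change A \<in> GG}" "B \<in> {A. base_change A \<in> GG}"
    for A B :: "'f ^ 'n ^ 'n"
    using that GG' by (simp add: base_change_mult)
  show "mat 1 \<in> {A. base_change A \<in> GG}"
    using subgroup.one_closed[OF GG] by (simp add: base_change_one general_linear_def)
  fix A :: "'f ^ 'n ^ 'n"
  assume A: "A \<in> {A. base_change A \<in> GG}"
  then have bA: "base_change A \<in> GG" "base_change A \<in> carrier general_linear"
    using subgroup.mem_carrier[OF GG] by simp_all
  then have "invertible A"
    by (simp add: general_linear_def det_base_change invertible_det_nz)
  then obtain B where B: "A ** B = mat 1" "B ** A = mat 1"
    unfolding invertible_def by blast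
  have BA: "base_change B ** base_change A = mat 1" "base_change A ** base_change B = mat 1"
    using B by (simp_all add: base_change_mult[symmetric] base_change_one)
  have "det (base_change A) * det (base_change B) = 1"
    using BA(2) det_mul[of "base_change A" "base_change B"] by simp
  then have "base_change B \<in> carrier general_linear"
    by (auto simp: general_linear_def)
  then have "inv\<^bsub>general_linear\<^esub> base_change A = base_change B"
    using BA(1) bA(2) by (intro group.inv_equality[OF group_general_linear]) (simp_all add: general_linear_def)
  then have "base_change B \<in> GG"
    using subgroup.m_inv_closed[OF GG bA(1)] by simp
  then show "\<exists>B\<in>{A. base_change A \<in> GG}. B ** A = mat 1"
    using B(2) by blast
qed (simp_all add: matrix_mul_assoc)

lemma rational_center_subgroup:
  fixes GG :: "('f::field alg_closure ^ 'n ^ 'n) set"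
  assumes GG: "subgroup GG general_linear"
  shows "subgroup (rational_center GG) (rational_points GG)"
    "z \<in> rational_center GG \<Longrightarrow> g \<in> carrier (rational_points GG) \<Longrightarrow> z ** g = g ** z"
proof -
  interpret G: group "rational_points GG"
    by (rule group_rational_points[OF GG])
  let ?Z = "rational_center GG"
  have ZC: "A \<in> carrier (rational_points GG)" if "A \<in> ?Z" for A
    using that by (simp add: rational_center_def rational_points_simps)
  have comm: "base_change A ** B = B ** base_change A" if "A \<in> ?Z" "B \<in> GG" for A B
    using that by (simp add: rational_center_def)
  show "subgroup ?Z (rational_points GG)"
  proof (rule G.subgroupI)
    show "?Z \<subseteq> carrier (rational_points GG)"
      using ZC by blast
    have "mat 1 \<in> ?Z"
      using subgroup.one_closed[OF GG] by (simp add: rational_center_def base_change_one general_linear_def)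
    then show "?Z \<noteq> {}"
      by blast
  next
    fix A
    assume A: "A \<in> ?Z"
    define A' where "A' = inv\<^bsub>rational_points GG\<^esub> A"
    have A': "A' \<in> carrier (rational_points GG)" "A' ** A = mat 1" "A ** A' = mat 1"
      using G.inv_closed[OF ZC[OF A]] G.l_inv[OF ZC[OF A]] G.r_inv[OF ZC[OF A]]
      by (simp_all add: A'_def rational_points_simps)
    have one: "base_change A' ** base_change A = mat 1" "base_change A ** base_change A' = mat 1"
      using A'(2,3) by (simp_all add: base_change_mult[symmetric] base_change_one)
    have "base_change A' ** B = B ** base_change A'" if B: "B \<in> GG" for B
    proof -
      have "base_change A' ** B = base_change A' ** (B ** (base_change A ** base_change A'))"
        by (simp add: one)
      also have "\<dots> = base_change A' ** ((B ** base_change A) ** base_change A')"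
        by (simp only: matrix_mul_assoc)
      also have "\<dots> = base_change A' ** ((base_change A ** B) ** base_change A')"
        by (simp only: comm[OF A B])
      also have "\<dots> = (base_change A' ** base_change A) ** (B ** base_change A')"
        by (simp only: matrix_mul_assoc)
      finally show ?thesis
        by (simp add: one)
    qed
    then show "inv\<^bsub>rational_points GG\<^esub> A \<in> ?Z"
      using A'(1) by (simp add: rational_center_def rational_points_simps A'_def)
  next
    fix A B
    assume A: "A \<in> ?Z" and B: "B \<in> ?Z"
    have "base_change (A ** B) ** C = C ** base_change (A ** B)" if C: "C \<in> GG" for C
      using comm[OF A C] comm[OF B C] by (metis base_change_mult matrix_mul_assoc)
    then show "A \<otimes>\<^bsub>rational_points GG\<^esub> B \<in> ?Z"
      using G.m_closed[OF ZC[OF A] ZC[OF B]] by (simp add: rational_center_def rational_points_simps)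
  qed
  show "z ** g = g ** z" if "z \<in> ?Z" "g \<in> carrier (rational_points GG)"
    using comm[OF that(1), of "base_change g"] that(2)
    by (simp add: rational_points_simps base_change_mult[symmetric] base_change_eq_iff)
qed

text \<open>Regular functions defined over the base field take rational values at rational points, so that a preimage under \<open>to_ac\<close> exists.\<close>

lemma regular_function_base_change:
  assumes "f \<in> regular_functions (range to_ac)"
  shows "f (base_change g) \<in> range to_ac"
  using assms
proof induction
  case (entry i j)
  then show ?case
    by (simp add: base_change_def)
next
  case inverse_det
  have "inverse (det (base_change g)) = to_ac (inverse (det g))"
    by (simp add: det_base_change)
  then show ?case
    by (metis rangeI)
next
  case (add f g')
  then show ?case
    by (auto simp flip: to_ac_add)
next
  case (mult f g')
  then show ?case
    by (auto simp flip: to_ac_mult)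
qed simp

lemma (in nonarch_local_field) subgroup_unramified_kernel:
  fixes GG :: "('f alg_closure ^ 'n ^ 'n) set"
  assumes GG: "subgroup GG general_linear"
  shows "subgroup (unramified_kernel absF GG) (rational_points GG)"
proof -
  interpret G: group "rational_points GG"
    by (rule group_rational_points[OF GG])
  define v :: "('f alg_closure ^ 'n ^ 'n \<Rightarrow> 'f alg_closure) \<Rightarrow> 'f ^ 'n ^ 'n \<Rightarrow> 'f"
    where "v \<xi> g = the_inv_into UNIV to_ac (\<xi> (base_change g))" for \<xi> g
  have v: "to_ac (v \<xi> g) = \<xi> (base_change g)" if "\<xi> \<in> rational_characters GG" for \<xi> g
  proof -
    have "\<xi> (base_change g) \<in> range to_ac"
      using that regular_function_base_change unfolding rational_characters_def by blast
    then show ?thesis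
      unfolding v_def by (rule f_the_inv_into_f[OF inj_to_ac])
  qed
  have vmult: "v \<xi> (g ** h) = v \<xi> g * v \<xi> h"
    if "\<xi> \<in> rational_characters GG" "base_change g \<in> GG" "base_change h \<in> GG" for \<xi> g h
  proof -
    have "to_ac (v \<xi> (g ** h)) = to_ac (v \<xi> g * v \<xi> h)"
      using that by (simp add: v base_change_mult rational_characters_def)
    then show ?thesis
      by (simp only: to_ac_eq_iff)
  qed
  have vone: "v \<xi> (mat 1) = 1" if "\<xi> \<in> rational_characters GG" for \<xi>
  proof -
    have "to_ac (v \<xi> (mat 1)) = to_ac 1"
      using that v[OF that, of "mat 1"] by (simp add: base_change_one rational_characters_def)
    then show ?thesis
      by (simp only: to_ac_eq_iff)
  qed
  \<comment> \<open>The exponent 1 already detects absolute value 1; in particular the junk value \<open>0 powr s = 0\<close> is excluded.\<close>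
  have iff: "(\<forall>s. complex_of_real r powr s = 1) \<longleftrightarrow> r = 1" for r :: real
  proof
    assume r: "\<forall>s. complex_of_real r powr s = 1"
    then have "complex_of_real r powr 1 = 1"
      by blast
    then show "r = 1"
      by (auto simp: powr_def split: if_splits)
  qed (simp add: powr_def)
  have K: "g \<in> unramified_kernel absF GG \<longleftrightarrow> base_change g \<in> GG \<and> (\<forall>\<xi>\<in>rational_characters GG. absF (v \<xi> g) = 1)" for g
    unfolding unramified_kernel_def unramified_character_def v_def[symmetric] by (simp add: iff rational_points_simps)
  show ?thesis
  proof (rule G.subgroupI)
    show "unramified_kernel absF GG \<subseteq> carrier (rational_points GG)"
      by (auto simp: K rational_points_simps)
    have "mat 1 \<in> unramified_kernel absF GG"
      using G.one_closed by (simp add: K rational_points_simps vone abs_one)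
    then show "unramified_kernel absF GG \<noteq> {}"
      by blast
  next
    fix g
    assume g: "g \<in> unramified_kernel absF GG"
    define h where "h = inv\<^bsub>rational_points GG\<^esub> g"
    have gC: "g \<in> carrier (rational_points GG)"
      using g by (simp add: K rational_points_simps)
    have h: "base_change h \<in> GG" "g ** h = mat 1"
      using G.inv_closed[OF gC] G.r_inv[OF gC] by (simp_all add: h_def rational_points_simps)
    have "absF (v \<xi> h) = 1" if "\<xi> \<in> rational_characters GG" for \<xi>
    proof -
      have "absF (v \<xi> g) * absF (v \<xi> h) = 1"
        using vmult[OF that _ h(1), of g] g h(2) vone[OF that] abs_one by (simp add: K mult[symmetric])
      then show ?thesis
        using g that by (simp add: K)
    qed
    then show "inv\<^bsub>rational_points GG\<^esub> g \<in> unramified_kernel absF GG"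
      using h(1) by (simp add: K h_def)
  next
    fix g h
    assume g: "g \<in> unramified_kernel absF GG" and h: "h \<in> unramified_kernel absF GG"
    then have "base_change (g ** h) \<in> GG"
      using G.m_closed[of g h] by (simp add: K rational_points_simps)
    then show "g \<otimes>\<^bsub>rational_points GG\<^esub> h \<in> unramified_kernel absF GG"
      using g h by (simp add: K rational_points_simps vmult mult)
  qed
qed

context nonarch_local_field
begin

lemma semitopological_group_rational_points:
  fixes GG :: "('f alg_closure ^ 'n ^ 'n) set"
  assumes GG: "subgroup GG general_linear"
  shows "semitopological_group (rational_points GG) (rational_topology absF GG)"
proof -
  interpret G: group "rational_points GG"
    by (rule group_rational_points[OF GG])
  interpret d: Metric_space UNIV "matrix_dist absF :: 'f ^ 'n ^ 'n \<Rightarrow> _"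
    by (rule matrix_metric)
  let ?C = "carrier (rational_points GG)"
  have scaled: "\<exists>r'>0. \<forall>B. matrix_dist absF A B < r' \<longrightarrow> c * matrix_dist absF A B < r"
    if "r > 0" "0 \<le> c" for A :: "'f ^ 'n ^ 'n" and r c :: real
  proof (intro exI[of _ "r / (c + 1)"] conjI allI impI)
    show "r / (c + 1) > 0"
      using that by simp
    fix B
    assume "matrix_dist absF A B < r / (c + 1)"
    then have "(c + 1) * matrix_dist absF A B < r"
      using that(2) by (simp add: field_simps)
    then show "c * matrix_dist absF A B < r"
      unfolding distrib_right using d.nonneg[of A B] by linarith
  qed
  show ?thesis
  proof
    show "topspace (rational_topology absF GG) = ?C"
      by (simp add: rational_topology_def)
  next
    fix U g
    assume U: "openin (rational_topology absF GG) U" and g: "g \<in> ?C"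
    define g' where "g' = inv\<^bsub>rational_points GG\<^esub> g"
    define c where "c = (\<Sum>i\<in>UNIV. \<Sum>j\<in>UNIV. absF (g' $ i $ j))"
    have c: "0 \<le> c"
      unfolding c_def by (intro sum_nonneg nonneg)
    have g': "g' \<in> ?C" "g' ** g = mat 1" "g ** g' = mat 1"
      using G.inv_closed[OF g] G.l_inv[OF g] G.r_inv[OF g] by (simp_all add: g'_def rational_points_simps)
    have UC: "u \<in> ?C" if "u \<in> U" for u
      using U that unfolding openin_rational_topology by blast
    have cancel: "g' ** (g ** u) = u" "g ** (g' ** u) = u" "(u ** g) ** g' = u" "(u ** g') ** g = u" for u
      using g'(2,3) by (simp_all add: matrix_mul_assoc) (simp_all flip: matrix_mul_assoc)
    have closed: "A ** B \<in> ?C" if "A \<in> ?C" "B \<in> ?C" for A B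
      using G.m_closed[OF that] by (simp add: rational_points_simps)
    show "openin (rational_topology absF GG) (g <#\<^bsub>rational_points GG\<^esub> U)"
      unfolding openin_rational_topology
    proof (intro conjI ballI)
      show "g <#\<^bsub>rational_points GG\<^esub> U \<subseteq> ?C"
        using UC g closed unfolding l_coset_def by (auto simp: rational_points_simps(2))
      fix A
      assume "A \<in> g <#\<^bsub>rational_points GG\<^esub> U"
      then obtain u where u: "u \<in> U" "A = g ** u"
        unfolding l_coset_def by (auto simp: rational_points_simps(2))
      obtain r where r: "r > 0" "\<forall>B\<in>?C. matrix_dist absF u B < r \<longrightarrow> B \<in> U"
        using U u(1) unfolding openin_rational_topology by blast
      obtain r' where r': "r' > 0" "\<forall>B. matrix_dist absF A B < r' \<longrightarrow> c * matrix_dist absF A B < r"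
        using scaled[OF r(1) c, of A] by blast
      show "\<exists>r>0. \<forall>B\<in>?C. matrix_dist absF A B < r \<longrightarrow> B \<in> g <#\<^bsub>rational_points GG\<^esub> U"
      proof (intro exI[of _ r'] conjI ballI impI r'(1))
        fix B
        assume B: "B \<in> ?C" "matrix_dist absF A B < r'"
        have "matrix_dist absF (g' ** A) (g' ** B) < r"
          using matrix_dist_mult(1)[of g' A B] r'(2) B(2) unfolding c_def by fastforce
        then have "g' ** B \<in> U"
          using r(2) closed[OF g'(1) B(1)] unfolding u(2) cancel by blast
        then have "g ** (g' ** B) \<in> g <#\<^bsub>rational_points GG\<^esub> U"
          unfolding l_coset_def by (auto simp: rational_points_simps(2))
        then show "B \<in> g <#\<^bsub>rational_points GG\<^esub> U"
          unfolding cancel .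
      qed
    qed
    show "openin (rational_topology absF GG) (U #>\<^bsub>rational_points GG\<^esub> g)"
      unfolding openin_rational_topology
    proof (intro conjI ballI)
      show "U #>\<^bsub>rational_points GG\<^esub> g \<subseteq> ?C"
        using UC g closed unfolding r_coset_def by (auto simp: rational_points_simps(2))
      fix A
      assume "A \<in> U #>\<^bsub>rational_points GG\<^esub> g"
      then obtain u where u: "u \<in> U" "A = u ** g"
        unfolding r_coset_def by (auto simp: rational_points_simps(2))
      obtain r where r: "r > 0" "\<forall>B\<in>?C. matrix_dist absF u B < r \<longrightarrow> B \<in> U"
        using U u(1) unfolding openin_rational_topology by blast
      obtain r' where r': "r' > 0" "\<forall>B. matrix_dist absF A B < r' \<longrightarrow> c * matrix_dist absF A B < r"
        using scaled[OF r(1) c, of A] by blast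
      show "\<exists>r>0. \<forall>B\<in>?C. matrix_dist absF A B < r \<longrightarrow> B \<in> U #>\<^bsub>rational_points GG\<^esub> g"
      proof (intro exI[of _ r'] conjI ballI impI r'(1))
        fix B
        assume B: "B \<in> ?C" "matrix_dist absF A B < r'"
        have "matrix_dist absF (A ** g') (B ** g') < r"
          using matrix_dist_mult(2)[of A g' B] r'(2) B(2) unfolding c_def by fastforce
        then have "B ** g' \<in> U"
          using r(2) closed[OF B(1) g'(1)] unfolding u(2) cancel by blast
        then have "(B ** g') ** g \<in> U #>\<^bsub>rational_points GG\<^esub> g"
          unfolding r_coset_def by (auto simp: rational_points_simps(2))
        then show "B \<in> U #>\<^bsub>rational_points GG\<^esub> g"
          unfolding cancel .
      qed
    qed
  qed
qed

text \<open>The cosets of \<open>K\<close> are open and disjoint. Each contains the rational points of a small ball around some matrix from a countable dense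
  set, and it is recovered from the center and the radius of the ball.\<close>

lemma countable_cosets_rational_points:
  fixes GG :: "('f alg_closure ^ 'n ^ 'n) set"
  assumes GG: "subgroup GG general_linear"
    and K: "subgroup K (rational_points GG)" "openin (rational_topology absF GG) K"
  shows "countable ((\<lambda>x. x <#\<^bsub>rational_points GG\<^esub> K) ` carrier (rational_points GG))"
proof -
  interpret G: group "rational_points GG"
    by (rule group_rational_points[OF GG])
  interpret d: Metric_space UNIV "matrix_dist absF :: 'f ^ 'n ^ 'n \<Rightarrow> _"
    by (rule matrix_metric)
  let ?C = "carrier (rational_points GG)"
  obtain D where D: "countable D" "\<forall>x e. e > 0 \<longrightarrow> (\<exists>a\<in>D. absF (x - a) < e)"
    by (rule countable_dense)
  define DM where "DM = (\<lambda>p. \<chi> i j. p (i, j)) ` (\<Pi>\<^sub>E ij\<in>(UNIV :: ('n \<times> 'n) set). D)"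
  have DM: "countable DM"
    unfolding DM_def using D(1) by (intro countable_image countable_PiE) simp_all
  have dense: "\<exists>a\<in>DM. matrix_dist absF x a < e" if "e > 0" for x :: "'f ^ 'n ^ 'n" and e
  proof -
    define p where "p ij = (SOME a. a \<in> D \<and> absF (x $ fst ij $ snd ij - a) < e)" for ij
    have p: "p ij \<in> D \<and> absF (x $ fst ij $ snd ij - p ij) < e" for ij
      unfolding p_def by (rule someI_ex) (use D(2) that in blast)
    have "(\<chi> i j. p (i, j)) \<in> DM"
      unfolding DM_def PiE_UNIV_domain using p by (intro imageI) blast
    moreover have "matrix_dist absF x (\<chi> i j. p (i, j)) < e"
      unfolding matrix_dist_le_iff(2)
    proof (intro allI)
      fix i j
      show "absF (x $ i $ j - (\<chi> i j. p (i, j)) $ i $ j) < e"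
        using p[of "(i, j)"] by simp
    qed
    ultimately show ?thesis
      by blast
  qed
  define e where "e = (\<lambda>(a, n). (SOME y. y \<in> ?C \<and> matrix_dist absF y a < 1 / real (Suc n)) <#\<^bsub>rational_points GG\<^esub> K)"
  have "(\<lambda>x. x <#\<^bsub>rational_points GG\<^esub> K) ` ?C \<subseteq> e ` (DM \<times> UNIV)"
  proof
    fix C
    assume "C \<in> (\<lambda>x. x <#\<^bsub>rational_points GG\<^esub> K) ` ?C"
    then obtain x where x: "x \<in> ?C" "C = x <#\<^bsub>rational_points GG\<^esub> K"
      by blast
    have "openin (rational_topology absF GG) C"
      unfolding x(2) by (rule semitopological_group.openin_l_coset[OF semitopological_group_rational_points[OF GG] K(2) x(1)])
    moreover have "x \<in> C"
    proof -
      have "x \<otimes>\<^bsub>rational_points GG\<^esub> \<one>\<^bsub>rational_points GG\<^esub> \<in> C"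
        unfolding x(2) l_coset_def using subgroup.one_closed[OF K(1)] by blast
      then show ?thesis
        using x(1) by simp
    qed
    ultimately obtain r where r: "r > 0" "\<forall>B\<in>?C. matrix_dist absF x B < r \<longrightarrow> B \<in> C"
      unfolding openin_rational_topology by blast
    obtain n where n: "1 / real (Suc n) < r / 2"
      using nat_approx_posE[of "r / 2"] r(1) by auto
    obtain a where a: "a \<in> DM" "matrix_dist absF x a < 1 / real (Suc n)"
      using dense[of "1 / real (Suc n)" x] by auto
    define y where "y = (SOME y. y \<in> ?C \<and> matrix_dist absF y a < 1 / real (Suc n))"
    have y: "y \<in> ?C" "matrix_dist absF y a < 1 / real (Suc n)"
      using someI[of "\<lambda>y. y \<in> ?C \<and> matrix_dist absF y a < 1 / real (Suc n)" x] x(1) a(2)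
      unfolding y_def by blast+
    have "matrix_dist absF x y \<le> matrix_dist absF x a + matrix_dist absF y a"
      using d.triangle[of x a y] d.commute[of y a] by simp
    then have "y \<in> C"
      using r(2) y a(2) n by simp
    then obtain k where k: "k \<in> K" "y = x \<otimes>\<^bsub>rational_points GG\<^esub> k"
      unfolding x(2) l_coset_def by blast
    have "inv\<^bsub>rational_points GG\<^esub> x \<otimes>\<^bsub>rational_points GG\<^esub> y = k"
      unfolding k(2) using x(1) subgroup.mem_carrier[OF K(1) k(1)] by (simp add: G.mult_inv_cancel)
    then have "C = y <#\<^bsub>rational_points GG\<^esub> K"
      unfolding x(2) using G.l_coset_eq_iff[OF K(1) x(1) y(1)] k(1) by simp
    then have "C = e (a, n)"
      by (simp add: e_def y_def)
    then show "C \<in> e ` (DM \<times> UNIV)"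
      using a(1) by blast
  qed
  moreover have "countable (e ` (DM \<times> (UNIV :: nat set)))"
    using DM by simp
  ultimately show ?thesis
    by (rule countable_subset)
qed

end

section \<open>The decomposition of the Hecke algebra\<close>

theorem corollary4p3:
  fixes absF :: "'f::field \<Rightarrow> real"
    and GG :: "('f alg_closure ^ 'n ^ 'n) set"
    and G :: "('f ^ 'n ^ 'n) monoid"
    and T :: "('f ^ 'n ^ 'n) topology"
    and Z G0 Gb J Jt J0 Js Jn :: "('f ^ 'n ^ 'n) set"
    and \<rho> :: "('f ^ 'n ^ 'n, 'v::complex_vector_space) repn"
    and \<rho>t :: "('f ^ 'n ^ 'n, 'w::complex_vector_space) repn"
    and \<rho>0 :: "('f ^ 'n ^ 'n, 'x::complex_vector_space) repn"
    and \<rho>s :: "('f ^ 'n ^ 'n, 'y::complex_vector_space) repn"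
  assumes "nonarch_local_field absF"
    and "connected_reductive_group GG"
    and G: "G = rational_points GG"
    and T: "T = rational_topology absF GG"
    and Z: "Z = rational_center GG"
    and G0: "G0 = unramified_kernel absF GG"
    and "flat_subgroup G T G0 Gb"
    and "JG_witness G T Z Gb J \<rho> Jt \<rho>t"
    and J0: "J0 = Jt \<inter> G0"
    and "\<rho>0 \<in> Irr G T J0" and "occurs_in J0 \<rho>0 \<rho>t" and "occurs_in J \<rho> \<rho>0"
    and Js: "Js = sharp_subgroup G J J0 \<rho>0"
    and "\<rho>s \<in> Irr G T Js" and "occurs_in Js \<rho>s \<rho>0" and "rep_iso J \<rho>s \<rho>"
    and Jn: "Jn = dagger_subgroup G Gb (compact_induction G T Jt \<rho>t) \<inter> J0"
  shows "algebra_isomorphic (hecke_algebra G T J \<rho>)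
           (direct_sum_algebra (characters_mod G Jn J)
              (\<lambda>\<nu>. hecke_algebra G T Jn (twist \<rho>s \<nu>)))"
proof -
  interpret F: nonarch_local_field absF
    by fact
  have GG: "subgroup GG general_linear"
    using \<open>connected_reductive_group GG\<close> by (simp add: connected_reductive_group_def)
  interpret semitopological_group G T
    unfolding G T by (rule F.semitopological_group_rational_points[OF GG])
  have flat: "Gb \<lhd> G" "openin T Gb" "Gb \<subseteq> G0" "finite (rcosets\<^bsub>G\<lparr>carrier := G0\<rparr>\<^esub> Gb)"
    "derived G (carrier G) \<subseteq> Gb"
    using \<open>flat_subgroup G T G0 Gb\<close> by (simp_all add: flat_subgroup_def)
  have J: "subgroup J G" "openin T J" "\<rho> \<in> Irr G T J" "J = Jt \<inter> Gb"
    and Jt: "subgroup Jt G" "openin T Jt" "Z \<subseteq> Jt" "compact_modulo G T Z Jt"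
      "\<rho>t \<in> Irr G T Jt" "intertwining_set G Jt \<rho>t = Jt"
    using \<open>JG_witness G T Z Gb J \<rho> Jt \<rho>t\<close>
    unfolding JG_witness_def open_compact_subgroups_def open_compact_mod_subgroups_def by blast+
  interpret cuspidal_datum G T Z Jt \<rho>t
  proof (rule cuspidal_datum.intro[OF semitopological_group_axioms], rule cuspidal_datum_axioms.intro)
    show "countable ((\<lambda>x. x <#\<^bsub>G\<^esub> K) ` carrier G)" if "subgroup K G" "openin T K" for K
      using that unfolding G T by (rule F.countable_cosets_rational_points[OF GG])
    show "subgroup Z G"
      unfolding G Z by (rule rational_center_subgroup(1)[OF GG])
    show "z \<otimes>\<^bsub>G\<^esub> g = g \<otimes>\<^bsub>G\<^esub> z" if "z \<in> Z" "g \<in> carrier G" for z g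
      using rational_center_subgroup(2)[OF GG] that unfolding G Z by (simp add: rational_points_simps(2))
  qed (fact Jt)+
  have G0': "subgroup G0 G"
    unfolding G G0 by (rule F.subgroup_unramified_kernel[OF GG])
  have Gb': "subgroup Gb G"
    by (rule normal_imp_subgroup[OF flat(1)])
  have G0n: "G0 \<lhd> G"
    by (rule normal_if_derived_subset[OF G0' subset_trans[OF flat(5,3)]])
  have J0': "subgroup J0 G"
    unfolding J0 by (rule subgroup_Int[OF Jt(1) G0'])
  have JGb: "Jt \<inter> Gb = J"
    using J(4) by simp
  have JJ0: "J \<subseteq> J0"
    using J(4) flat(3) unfolding J0 by blast
  define M where "M = dagger_subgroup G Gb ind_rep \<inter> G0"
  have M: "subgroup M G" "Gb \<subseteq> M"
    unfolding M_def
    by (rule subgroup_Int[OF subgroup_dagger G0'], rule Int_greatest[OF subset_dagger[OF subgroup.subset[OF Gb']] flat(3)])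
  have Mn: "M \<lhd> G"
    by (rule normal_if_derived_subset[OF M(1) subset_trans[OF flat(5) M(2)]])
  have JnM: "Jn = Jt \<inter> M"
    unfolding Jn J0 M_def by blast
  have Jn': "subgroup Jn G" "openin T Jn" "J \<subseteq> Jn" "Jn \<subseteq> J0" "Jn \<subseteq> Jt"
  proof -
    show sub: "subgroup Jn G"
      unfolding JnM by (rule subgroup_Int[OF Jt(1) M(1)])
    show JJn: "J \<subseteq> Jn"
      unfolding JnM J(4) using M(2) by blast
    show "openin T Jn"
      by (rule openin_subgroup_mono[OF J(2,1) JJn sub])
    show "Jn \<subseteq> J0" "Jn \<subseteq> Jt"
      unfolding Jn J0 by blast+
  qed
  have \<rho>0: "linear_rep G J0 \<rho>0"
    using \<open>\<rho>0 \<in> Irr G T J0\<close> by (simp add: Irr_def smooth_rep_iff)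
  have \<rho>s: "smooth_rep G T Js \<rho>s"
    using \<open>\<rho>s \<in> Irr G T Js\<close> by (simp add: Irr_def)
  obtain i0 where i0: "i0 \<in> intertwiners J0 \<rho>0 \<rho>t" "inj_on i0 (vspace \<rho>0)"
    using \<open>occurs_in J0 \<rho>0 \<rho>t\<close> unfolding occurs_in_def by blast
  obtain i1 where i1: "i1 \<in> intertwiners Js \<rho>s \<rho>0" "inj_on i1 (vspace \<rho>s)"
    using \<open>occurs_in Js \<rho>s \<rho>0\<close> unfolding occurs_in_def by blast
  \<comment> \<open>An isomorphism between \<open>\<rho>0 \<otimes> \<eta>\<close> and \<open>\<rho>0\<close> is an intertwiner at the unit, so \<open>\<eta>\<close> agrees with the trivial character.\<close>
  have JnJs: "Jn \<subseteq> Js"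
  proof
    fix x
    assume x: "x \<in> Jn"
    have "\<eta> x = 1" if \<eta>: "\<eta> \<in> characters_mod G J0 J" and iso: "rep_iso J0 (twist \<rho>0 \<eta>) \<rho>0" for \<eta>
    proof -
      define t where "t = (\<lambda>y\<in>J0. 1 :: complex)"
      have t: "t \<in> characters_mod G J0 J"
        unfolding t_def using JJ0 subgroup.m_closed[OF J0'] by (intro characters_modI) auto
      obtain f where f: "f \<in> intertwiners J0 (twist \<rho>0 \<eta>) \<rho>0" "bij_betw f (vspace \<rho>0) (vspace \<rho>0)"
        using iso unfolding rep_iso_def by (auto simp: twist_def)
      have "f \<noteq> 0"
      proof
        assume "f = 0"
        then have "vspace \<rho>0 \<subseteq> {0}"
          using f(2) by (auto simp: bij_betw_def)
        then show False
          using \<open>\<rho>0 \<in> Irr G T J0\<close> cvs.subspace_0[OF linear_repD(1)[OF \<rho>0]] by (auto simp: Irr_def)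
      qed
      moreover have "f \<in> intertwiners (J0 \<inter> conj_subgroup G J0 \<one>\<^bsub>G\<^esub>) (twist \<rho>0 \<eta>) (conj_rep G (twist \<rho>0 t) \<one>\<^bsub>G\<^esub>)"
      proof (rule intertwinersI)
        show "f \<in> linear_maps (vspace (twist \<rho>0 \<eta>)) (vspace (conj_rep G (twist \<rho>0 t) \<one>\<^bsub>G\<^esub>))"
          using intertwinersD(1)[OF f(1)] by (simp add: twist_def conj_rep_def)
        show "f (act (twist \<rho>0 \<eta>) h v) = act (conj_rep G (twist \<rho>0 t) \<one>\<^bsub>G\<^esub>) h (f v)"
          if "h \<in> J0 \<inter> conj_subgroup G J0 \<one>\<^bsub>G\<^esub>" "v \<in> vspace (twist \<rho>0 \<eta>)" for h v
        proof -
          have h: "h \<in> J0" "h \<in> carrier G"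
            using that(1) subgroup.mem_carrier[OF J0'] by simp_all
          show ?thesis
            using intertwinersD(3)[OF f(1) h(1) that(2)] h
            by (simp add: conj_rep_def twist_def t_def scaleC_one)
        qed
      qed (rule intertwinersD(2)[OF f(1)])
      moreover have "x \<in> dagger_subgroup G Gb ind_rep" "x \<in> J0"
        using x unfolding Jn by simp_all
      ultimately have "\<eta> x = t x"
        using characters_agree_if_intertwine[OF one_closed flat(1,2,5) G0n flat(3) J0 \<rho>0 i0] \<eta> t unfolding JGb
        by blast
      then show ?thesis
        using \<open>x \<in> J0\<close> by (simp add: t_def)
    qed
    then show "x \<in> Js"
      unfolding Js sharp_subgroup_def using x Jn'(4) by blast
  qed
  have \<rho>s': "smooth_rep G T Jn \<rho>s"
    unfolding smooth_rep_iff
  proof (intro conjI ballI)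
    show "linear_rep G Jn \<rho>s"
      using \<rho>s JnJs by (auto simp: smooth_rep_iff intro: linear_rep_subset)
    fix v
    assume "v \<in> vspace \<rho>s"
    then have "openin (subtopology T Js) {h \<in> Js. act \<rho>s h v = v}"
      using \<rho>s by (simp add: smooth_rep_iff)
    then obtain S where S: "openin T S" "{h \<in> Js. act \<rho>s h v = v} = S \<inter> Js"
      unfolding openin_subtopology by blast
    then have "{h \<in> Jn. act \<rho>s h v = v} = S \<inter> Jn"
      using JnJs by blast
    then show "openin (subtopology T Jn) {h \<in> Jn. act \<rho>s h v = v}"
      unfolding openin_subtopology using S(1) by blast
  qed
  then have \<rho>sl: "linear_rep G Jn \<rho>s"
    by (simp add: smooth_rep_iff)
  have i: "i0 \<circ> i1 \<in> intertwiners Jn \<rho>s \<rho>t" "inj_on (i0 \<circ> i1) (vspace \<rho>s)"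
  proof -
    show "i0 \<circ> i1 \<in> intertwiners Jn \<rho>s \<rho>t"
      using intertwiners_compose[OF subsetD[OF intertwiners_subset[OF JnJs] i1(1)]
          subsetD[OF intertwiners_subset[OF Jn'(4)] i0(1)] linear_repD(1)[OF \<rho>0]] .
    show "inj_on (i0 \<circ> i1) (vspace \<rho>s)"
      by (rule comp_inj_on[OF i1(2) inj_on_subset[OF i0(2)]]) (use intertwinersD(4)[OF i1(1)] in blast)
  qed
  show ?thesis
  proof (rule hecke_algebra_decomposition[OF Jn'(1,2) J(1,2) Jn'(3)])
    show "n \<otimes>\<^bsub>G\<^esub> j \<otimes>\<^bsub>G\<^esub> inv\<^bsub>G\<^esub> n \<in> J" if "n \<in> Jn" "j \<in> J" for n j
    proof -
      have n: "n \<in> Jt" "n \<in> carrier G" "j \<in> Jt" "j \<in> Gb"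
        using that Jn'(5) J(4) HG by auto
      then show ?thesis
        unfolding J(4) using normal.inv_op_closed2[OF flat(1) n(2,4)]
          subgroup.m_closed[OF Jt(1)] subgroup.m_inv_closed[OF Jt(1)] by simp
    qed
    have "finite ((\<lambda>x. Gb #>\<^bsub>G\<^esub> x) ` Jn)"
    proof (rule finite_subset[OF _ flat(4)])
      show "(\<lambda>x. Gb #>\<^bsub>G\<^esub> x) ` Jn \<subseteq> rcosets\<^bsub>G\<lparr>carrier := G0\<rparr>\<^esub> Gb"
        using Jn'(4) unfolding J0 RCOSETS_def r_coset_def by auto
    qed
    then have "finite ((\<lambda>x. x <#\<^bsub>G\<^esub> J) ` Jn)"
    proof (rule finite_image_coarser)
      fix x y
      assume xy: "x \<in> Jn" "y \<in> Jn" "Gb #>\<^bsub>G\<^esub> x = Gb #>\<^bsub>G\<^esub> y"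
      have xyJ: "x \<in> Jt" "y \<in> Jt" "x \<in> carrier G" "y \<in> carrier G"
        using xy Jn'(5) HG by auto
      have "y \<otimes>\<^bsub>G\<^esub> inv\<^bsub>G\<^esub> x \<in> Gb"
        using xy(3) r_coset_eq_iff[OF Gb' xyJ(3,4)] by simp
      then have "inv\<^bsub>G\<^esub> x \<otimes>\<^bsub>G\<^esub> (y \<otimes>\<^bsub>G\<^esub> inv\<^bsub>G\<^esub> x) \<otimes>\<^bsub>G\<^esub> x \<in> Gb"
        by (rule normal.inv_op_closed1[OF flat(1) xyJ(3)])
      then have "inv\<^bsub>G\<^esub> x \<otimes>\<^bsub>G\<^esub> y \<in> Gb"
        using xyJ by (simp add: m_assoc)
      moreover have "inv\<^bsub>G\<^esub> x \<otimes>\<^bsub>G\<^esub> y \<in> Jt"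
        using xyJ subgroup.m_closed[OF Jt(1)] subgroup.m_inv_closed[OF Jt(1)] by simp
      ultimately show "x <#\<^bsub>G\<^esub> J = y <#\<^bsub>G\<^esub> J"
        using l_coset_eq_iff[OF J(1) xyJ(3,4)] J(4) by simp
    qed
    then show "finite_index J Jn"
      by (simp add: finite_index_def)
    show "\<exists>\<mu>\<in>characters_mod G Jn J. \<mu> x \<noteq> 1" if x: "x \<in> Jn" "x \<notin> J" for x
    proof -
      have xG: "x \<in> carrier G" "x \<notin> Gb"
        using x Jn'(5) J(4) HG by auto
      obtain \<mu> where \<mu>: "\<mu> \<in> characters_mod G (carrier G) Gb" "\<mu> x \<noteq> 1"
        by (rule exists_character_nontrivial_mod[OF flat(1,5) xG])
      have "restrict \<mu> Jn \<in> characters_mod G Jn J"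
        using characters_modD[OF \<mu>(1)] subgroup.mem_carrier[OF Jn'(1)] subgroup.m_closed[OF Jn'(1)] Jn'(3) J(4)
        by (intro characters_modI) (auto simp: subset_iff)
      then show ?thesis
        using \<mu>(2) x(1) by (intro bexI[of _ "restrict \<mu> Jn"]) simp_all
    qed
    show "linear_rep G Jn \<rho>s" "linear_rep G J \<rho>" "rep_iso J \<rho>s \<rho>"
      using \<rho>sl J(3) \<open>rep_iso J \<rho>s \<rho>\<close> by (simp_all add: Irr_def smooth_rep_iff)
    fix \<nu> \<nu>' F
    assume \<nu>: "\<nu> \<in> characters_mod G Jn J" and \<nu>': "\<nu>' \<in> characters_mod G Jn J" and ne: "\<nu> \<noteq> \<nu>'"
      and F: "F \<in> intertwiners (carrier G) (compact_induction G T Jn (twist \<rho>s \<nu>)) (compact_induction G T Jn (twist \<rho>s \<nu>'))"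
    show "F = 0"
    proof (rule ccontr)
      assume nz: "F \<noteq> 0"
      obtain g A where A: "g \<in> carrier G" "A \<in> intertwiners (Jn \<inter> conj_subgroup G Jn g) (twist \<rho>s \<nu>) (conj_rep G (twist \<rho>s \<nu>') g)"
        "A \<noteq> 0"
        by (rule intertwines_if_nonzero_map[OF Jn'(1,2) smooth_twist[OF \<rho>s' Jn'(1,2) J(1,2) Jn'(3) \<nu>]
            linear_rep_twist[OF \<rho>sl Jn'(1) \<nu>'] F nz])
      have "\<nu> x = \<nu>' x" if "x \<in> Jn" for x
      proof -
        have "x \<in> dagger_subgroup G Gb ind_rep"
          using that unfolding Jn by simp
        then show ?thesis
          using characters_agree_if_intertwine[OF A(1) flat(1,2,5) Mn M(2) JnM \<rho>sl i _ _ A(2,3) _ that] \<nu> \<nu>'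
          unfolding JGb by blast
      qed
      then have "\<nu> = \<nu>'"
        using characters_modD(4)[OF \<nu>] characters_modD(4)[OF \<nu>'] by (intro extensionalityI[of _ Jn])
      then show False
        using ne by simp
    qed
  qed
qed

end
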